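(* Let $n\ge 2$ and $1<p\le+\infty$, let $E\subset \mathbb{R}^n$ be a Borel subset, and let $B\subset \mathbb{R}^n$ be a ball such that $\mathcal H^n (E)= \mathcal H^n (B)$. Then $\operatorname{fav}^p_{n-1}E\ge \operatorname{fav}^p_{n-1}B$.
   Context: $\mathcal H^k$ denotes the $k$-dimensional Hausdorff measure, normalized so that the $k$-dimensional unit cube has $\mathcal H^k$-measure $1$. For a Borel set $E\subset\mathbb{R}^n$, an integer $1\le k\le n$, and $1<p\le+\infty$, $\operatorname{fav}_k^p E\in[0,+\infty]$ denotes the $L^p$-norm of the function $V\mapsto \mathcal H^k(\pi_V(E))$ on the Grassmannian of $k$-dimensional linear subspaces $V\subset\mathbb{R}^n$, equipped with the $\mathrm{O}(n)$-invariant probability measure; here $\pi_V$ is the orthogonal projection onto $V$. (For $p=+\infty$ this is the essential supremum.) *)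

theory Defs
  imports "HOL-Probability.Probability_Measure"
begin

section \<open>Hausdorff measure\<close>

text \<open>
  The weight of a covering set is \<open>diameter ^ k\<close>, with the empty set weighing 0 also for
  \<open>k = 0\<close>. Boundedness is required explicitly because \<^const>\<open>diameter\<close> is unspecified on unbounded
  sets. The covering sets are arbitrary, and the resulting function is an outer measure defined on
  all sets.
\<close>

definition hausdorff_content :: "nat \<Rightarrow> real \<Rightarrow> 'a::metric_space set \<Rightarrow> ennreal" where
  "hausdorff_content k \<delta> A =
     (INF U \<in> {U :: nat \<Rightarrow> 'a set. (\<forall>i. bounded (U i) \<and> diameter (U i) \<le> \<delta>) \<and> A \<subseteq> (\<Union>i. U i)}.
        \<Sum>i. if U i = {} then 0 else ennreal (diameter (U i) ^ k))"

definition unnormalized_hausdorff :: "nat \<Rightarrow> 'a::metric_space set \<Rightarrow> ennreal" where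
  "unnormalized_hausdorff k A = (SUP \<delta> \<in> {0<..}. hausdorff_content k \<delta> A)"

text \<open>
  For a \<open>k\<close>-element set \<open>D\<close> of basis vectors, \<open>cbox 0 (\<Sum>D)\<close> is the \<open>k\<close>-dimensional unit
  cube spanned by \<open>D\<close>; all these cubes are isometric, so the choice of \<open>D\<close> is immaterial.
\<close>

definition unit_cube :: "nat \<Rightarrow> 'a::euclidean_space set" where
  "unit_cube k = cbox 0 (\<Sum>(SOME D. D \<subseteq> Basis \<and> card D = k))"

definition hausdorff_measure :: "nat \<Rightarrow> 'a::euclidean_space set \<Rightarrow> ennreal" where
  "hausdorff_measure k A = unnormalized_hausdorff k A / unnormalized_hausdorff k (unit_cube k :: 'a set)"


section \<open>Orthogonal projections and the Grassmannian\<close>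

definition orth_proj :: "'a::euclidean_space set \<Rightarrow> 'a \<Rightarrow> 'a" where
  "orth_proj V x = (THE y. y \<in> V \<and> (\<forall>v\<in>V. orthogonal (x - y) v))"

lemma orth_proj_unique:
  assumes V: "subspace V" and y: "y \<in> V" "\<And>v. v \<in> V \<Longrightarrow> orthogonal (x - y) v"
  shows "orth_proj V x = y"
  unfolding orth_proj_def
proof (rule the_equality)
  show "y \<in> V \<and> (\<forall>v\<in>V. orthogonal (x - y) v)" using y by blast
next
  fix z assume z: "z \<in> V \<and> (\<forall>v\<in>V. orthogonal (x - z) v)"
  have d: "z - y \<in> V" using V y z by (simp add: subspace_diff)
  have "(z - y) \<bullet> (z - y) = (x - y) \<bullet> (z - y) - (x - z) \<bullet> (z - y)"
    by (simp add: inner_diff_left)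
  also have "\<dots> = 0" using d y(2) z by (simp add: orthogonal_def)
  finally show "z = y" by simp
qed

lemma orth_proj:
  assumes V: "subspace V"
  shows "orth_proj V x \<in> V" "v \<in> V \<Longrightarrow> orthogonal (x - orth_proj V x) v"
proof -
  obtain y z where "y \<in> span V" "\<And>w. w \<in> span V \<Longrightarrow> orthogonal z w" "x = y + z"
    using orthogonal_subspace_decomp_exists[of V x] by blast
  then have y: "y \<in> V" "\<And>v. v \<in> V \<Longrightarrow> orthogonal (x - y) v"
    using V by (auto simp: span_eq_iff[THEN iffD2])
  then have "orth_proj V x = y" using V by (intro orth_proj_unique)
  with y show "orth_proj V x \<in> V" "v \<in> V \<Longrightarrow> orthogonal (x - orth_proj V x) v" by auto
qed

lemma bounded_linear_orth_proj:
  assumes V: "subspace V"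
  shows "bounded_linear (orth_proj V)"
proof -
  have "linear (orth_proj V)"
  proof (rule linearI)
    fix x y
    show "orth_proj V (x + y) = orth_proj V x + orth_proj V y"
    proof (rule orth_proj_unique[OF V])
      show "orth_proj V x + orth_proj V y \<in> V" by (intro subspace_add orth_proj(1) V)
      fix v assume "v \<in> V"
      then show "orthogonal (x + y - (orth_proj V x + orth_proj V y)) v"
        using orth_proj(2)[OF V, of v x] orth_proj(2)[OF V, of v y]
        by (simp add: orthogonal_def inner_diff_left inner_add_left)
    qed
  next
    fix c x
    show "orth_proj V (c *\<^sub>R x) = c *\<^sub>R orth_proj V x"
    proof (rule orth_proj_unique[OF V])
      show "c *\<^sub>R orth_proj V x \<in> V" by (intro subspace_scale orth_proj(1) V)
      fix v assume "v \<in> V"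
      then show "orthogonal (c *\<^sub>R x - c *\<^sub>R orth_proj V x) v"
        using orth_proj(2)[OF V, of v x]
        by (simp add: orthogonal_def inner_diff_left)
    qed
  qed
  then show ?thesis by (rule linear_conv_bounded_linear[THEN iffD1])
qed

definition grassmannian :: "nat \<Rightarrow> 'a::euclidean_space set set" where
  "grassmannian k = {V. subspace V \<and> dim V = k}"

text \<open>
  The topology of the Grassmannian is that of the operator norm distance between orthogonal
  projections; its Borel \<open>\<sigma>\<close>-algebra is therefore the pullback along
  \<open>V \<mapsto> orth_proj V\<close> of the Borel \<open>\<sigma>\<close>-algebra on bounded operators.
\<close>

definition grassmannian_borel :: "nat \<Rightarrow> 'a::euclidean_space set measure" where
  "grassmannian_borel k = vimage_algebra (grassmannian k) (\<lambda>V. Blinfun (orth_proj V)) borel"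

definition invariant_grassmannian_prob :: "nat \<Rightarrow> 'a::euclidean_space set measure \<Rightarrow> bool" where
  "invariant_grassmannian_prob k M \<longleftrightarrow>
     prob_space M \<and> space M = grassmannian k \<and> sets M = sets (grassmannian_borel k) \<and>
     (\<forall>f A. orthogonal_transformation f \<longrightarrow> A \<in> sets M \<longrightarrow>
        emeasure M ((\<lambda>V. f ` V) ` A) = emeasure M A)"

text \<open>
  For \<open>k \<le> DIM('a)\<close> there is exactly one such measure.
\<close>

definition grassmannian_measure :: "nat \<Rightarrow> 'a::euclidean_space set measure" where
  "grassmannian_measure k = (SOME M. invariant_grassmannian_prob k M)"


section \<open>The \<open>L\<^sup>p\<close> Favard functional\<close>

text \<open>Intended for exponents \<open>a > 0\<close> only.\<close>

definition ennreal_powr :: "ennreal \<Rightarrow> real \<Rightarrow> ennreal" where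
  "ennreal_powr x a = (if x = \<infinity> then \<infinity> else ennreal (enn2real x powr a))"

definition Lp_norm :: "ennreal \<Rightarrow> 'a measure \<Rightarrow> ('a \<Rightarrow> ennreal) \<Rightarrow> ennreal" where
  "Lp_norm p M f =
     (if p = \<infinity> then Inf {c. AE x in M. f x \<le> c}
      else ennreal_powr (\<integral>\<^sup>+x. ennreal_powr (f x) (enn2real p) \<partial>M) (1 / enn2real p))"

text \<open>
  For a Borel set \<open>E\<close> the projections \<open>orth_proj V ` E\<close> are analytic sets, and the integrand is
  in general only universally measurable, whence the completion.
\<close>

definition fav :: "ennreal \<Rightarrow> nat \<Rightarrow> 'a::euclidean_space set \<Rightarrow> ennreal" where
  "fav p k E =
     Lp_norm p (completion (grassmannian_measure k)) (\<lambda>V. hausdorff_measure k (orth_proj V ` E))"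

end

theory Submission
  imports Defs "HOL-Probability.Probability" "HOL-Complex_Analysis.Great_Picard"
    "HOL-Computational_Algebra.Formal_Power_Series" "HOL-Real_Asymp.Real_Asymp"
begin

text \<open>
  The sets \<open>\<pi>\<^sub>V E\<close> are measured through the slabs of height 1 over them, and since the
  \<open>L\<^sup>p\<close>-norm over a probability space dominates the mean, which for balls is the constant
  \<open>L\<^sup>p\<close>-norm itself, it suffices to bound the mean of \<open>|\<pi>\<^sub>V E|\<close> from below for compact \<open>E\<close>.

  This is a capacity estimate. Let \<open>X\<^sub>V\<close> integrate functions along the normal direction of \<open>V\<close>.
  Averaged over \<open>V\<close>, the operators \<open>X\<^sub>V\<^sup>* X\<^sub>V\<close> give the Riesz potential with kernel \<open>|x|\<^bsup>1-n\<^esup>\<close>,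
  a multiple of \<open>(-\<Delta>)\<^bsup>-1/2\<^esup>\<close>, so that Cauchy-Schwarz yields
  \<open>(\<integral>f u)\<^sup>2 \<le> \<langle>f, (-\<Delta>)\<^bsup>-1/2\<^esup> f\<rangle> \<integral>|\<pi>\<^sub>V E| dV\<close> up to constants, where the potential
  \<open>u\<close>, the average over \<open>V\<close> of the back projections of the indicators of \<open>\<pi>\<^sub>V E\<close>, is at least 1 on \<open>E\<close>.
  Truncating \<open>u\<close> to a function \<open>w\<close> and taking \<open>f = (-\<Delta>)\<^bsup>1/2\<^esup> w\<close>, one needs that the energy of \<open>w\<close> does not
  increase under symmetrization; the symmetrized function is at least 1 on the ball of the same volume as \<open>E\<close>
  and is tested against the density \<open>(r\<^sup>2 - |x|\<^sup>2)\<^bsup>-1/2\<^esup>\<close>, all of whose line integrals through that ball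
  equal \<open>\<pi>\<close>.

  To stay with bounded kernels, \<open>-\<Delta>\<close> is replaced by \<open>1 - H\<close>, where \<open>H\<close> is the heat operator at a small time, and its
  powers \<open>\<plusminus>1/2\<close> by their binomial series in \<open>H\<close>; the coefficients of \<open>(1 - X)\<^bsup>1/2\<^esup>\<close> other
  than the constant one are negative, which is why the energy decreases under polarization. A
  symmetrization is obtained as a maximizer of \<open>\<integral>v(x) exp(-|x|\<^sup>2) dx\<close> in a compact class of functions that is closed
  under polarization.
\<close>

section \<open>Gaussian kernels\<close>

text \<open>The constants \<open>C\<close> of the average over \<open>V\<close> and
  \<open>om\<close> of the coefficient asymptotics are never evaluated. The averaged operator is
  compared with (1 - H)^(-1/2) twice, from above on f and from below on the test density, and
  \<open>C * sqrt (om * \<epsilon>)\<close> cancels between the two. The comparison from above has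
  no error term, because f changes with \<epsilon>; the one from below has an error of order sqrt
  \<epsilon>, harmless since the test density is fixed. The symmetrized potential v and the test
  density \<mu> meet through the duality <v, \<mu>>^2 \<le> <v, (1 - H)^(1/2) v> <\<mu>, (1 -
  H)^(-1/2) \<mu>>. Two losses have to be repaired. The compactness argument requires a common
  bounded support, so a small level \<delta> is subtracted from the potential and the negative part
  dropped; this does not spoil the energy estimate, since 1 - (1 - H)^(1/2) is convolution with a
  nonnegative kernel of mass at most 1. Smoothing lowers the potential near the boundary of
  \<open>E\<close>, so \<open>E\<close> is first replaced by its closed neighbourhoods.\<close>

lemma nn_integral_lborel_translation:
  fixes f :: "'a::euclidean_space \<Rightarrow> ennreal"
  assumes [measurable]: "f \<in> borel_measurable borel"
  shows "(\<integral>\<^sup>+x. f (a + x) \<partial>lborel) = (\<integral>\<^sup>+x. f x \<partial>lborel)"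
proof -
  have "(\<integral>\<^sup>+x. f x \<partial>lborel) = (\<integral>\<^sup>+x. f x \<partial>distr lborel borel ((+) a))"
    by (simp add: lborel_distr_plus)
  also have "\<dots> = (\<integral>\<^sup>+x. f (a + x) \<partial>lborel)"
    by (rule nn_integral_distr) auto
  finally show ?thesis by simp
qed

lemma nn_integral_lborel_scale:
  fixes f :: "'a::euclidean_space \<Rightarrow> ennreal"
  assumes [measurable]: "f \<in> borel_measurable borel" and c: "c \<noteq> 0"
  shows "(\<integral>\<^sup>+x. f x \<partial>lborel) = ennreal (\<bar>c\<bar> ^ DIM('a)) * (\<integral>\<^sup>+x. f (c *\<^sub>R x) \<partial>lborel)"
proof -
  have "(\<integral>\<^sup>+x. f x \<partial>lborel) = (\<integral>\<^sup>+x. f x \<partial>density (distr lborel borel (\<lambda>x. 0 + c *\<^sub>R x)) (\<lambda>_. \<bar>c\<bar>^DIM('a)))"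
    using lborel_affine[OF c, of "0::'a"] by simp
  also have "\<dots> = ennreal (\<bar>c\<bar> ^ DIM('a)) * (\<integral>\<^sup>+x. f (c *\<^sub>R x) \<partial>lborel)"
    by (simp add: nn_integral_density nn_integral_distr nn_integral_cmult)
  finally show ?thesis .
qed

lemma nn_integral_lborel_reflect:
  fixes f :: "'a::euclidean_space \<Rightarrow> ennreal"
  assumes [measurable]: "f \<in> borel_measurable borel"
  shows "(\<integral>\<^sup>+x. f (a - x) \<partial>lborel) = (\<integral>\<^sup>+x. f x \<partial>lborel)"
proof -
  have "(\<integral>\<^sup>+x. f x \<partial>lborel) = (\<integral>\<^sup>+x. f (a + x) \<partial>lborel)"
    by (rule nn_integral_lborel_translation[symmetric]) simp
  also have "\<dots> = ennreal (\<bar>-1\<bar> ^ DIM('a)) * (\<integral>\<^sup>+x. f (a + (-1) *\<^sub>R x) \<partial>lborel)"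
    by (rule nn_integral_lborel_scale) auto
  finally show ?thesis by simp
qed

text \<open>The heat kernel at time \<open>t\<close>, that is the normal density with variance
  \<open>2 * t\<close> in every coordinate, so that times add under convolution. For
  \<open>t = 0\<close> division by zero makes it 0.\<close>

definition gauss :: "real \<Rightarrow> 'a::euclidean_space \<Rightarrow> real" where
  "gauss t z = exp (- (norm z)\<^sup>2 / (4 * t)) / sqrt (4 * pi * t) ^ DIM('a)"

lemma gauss_measurable' [measurable (raw)]:
  assumes [measurable]: "f \<in> borel_measurable M" "g \<in> borel_measurable M"
  shows "(\<lambda>x. gauss (f x) (g x :: 'a::euclidean_space)) \<in> borel_measurable M"
  unfolding gauss_def by measurable

lemma gauss_pos: "0 < t \<Longrightarrow> 0 < gauss t z"
  by (simp add: gauss_def)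

lemma gauss_nonneg [simp]: "0 \<le> t \<Longrightarrow> 0 \<le> gauss t z"
  by (simp add: gauss_def)

lemma gauss_minus [simp]: "gauss t (- z) = gauss t z"
  by (simp add: gauss_def)

lemma gauss_cong_norm: "norm x = norm y \<Longrightarrow> gauss t x = gauss t y" for x y :: "'a::euclidean_space"
  by (simp add: gauss_def)

lemma gauss_prod:
  assumes t: "0 < t"
  shows "gauss t (z::'a::euclidean_space) = (\<Prod>b\<in>Basis. normal_density 0 (sqrt (2 * t)) (z \<bullet> b))"
proof -
  have "(norm z)\<^sup>2 = (\<Sum>b\<in>Basis. (z \<bullet> b)\<^sup>2)"
    by (subst norm_eq_sqrt_inner, subst euclidean_inner)
       (simp add: power2_eq_square sum_nonneg)
  then have "exp (- (norm z)\<^sup>2 / (4 * t)) = (\<Prod>b\<in>Basis. exp (- (z \<bullet> b)\<^sup>2 / (4 * t)))"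
    by (simp add: exp_sum[symmetric] sum_divide_distrib sum_negf)
  then show ?thesis
    using t by (simp add: gauss_def normal_density_def prod_dividef real_sqrt_mult real_sqrt_divide power_mult_distrib
       field_simps prod.distrib)
qed

lemma nn_integral_gauss:
  assumes t: "0 < t"
  shows "(\<integral>\<^sup>+z. ennreal (gauss t (z::'a::euclidean_space)) \<partial>lborel) = 1"
proof -
  have "(\<integral>\<^sup>+r. ennreal (normal_density 0 (sqrt (2 * t)) r) \<partial>lborel) = 1"
    using t by (subst nn_integral_eq_integral) auto
  then show ?thesis
    using t by (simp add: gauss_prod prod_ennreal[symmetric]) (subst nn_integral_lborel_prod, auto)
qed

lemma nn_integral_gauss_conv:
  assumes s: "0 < s" and t: "0 < t"
  shows "(\<integral>\<^sup>+z. ennreal (gauss s (x - z) * gauss t (z - y)) \<partial>lborel) = ennreal (gauss (s + t) (x - (y::'a::euclidean_space)))"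
proof -
  let ?n = "\<lambda>t. normal_density 0 (sqrt (2 * t))"
  have 1: "(\<integral>\<^sup>+r. ennreal (?n s (a - r) * ?n t r) \<partial>lborel) = ennreal (?n (s + t) a)" for a
    using fun_cong[OF conv_normal_density_zero_mean[of "sqrt (2 * s)" "sqrt (2 * t)"], of a] s t
    by (simp add: algebra_simps)
  have "(\<integral>\<^sup>+z. ennreal (gauss s (x - z) * gauss t (z - y)) \<partial>lborel)
      = (\<integral>\<^sup>+z. ennreal (gauss s (x - (y + z)) * gauss t (y + z - y)) \<partial>lborel)"
    by (rule nn_integral_lborel_translation[symmetric]) simp
  also have "\<dots> = (\<integral>\<^sup>+z. (\<Prod>b\<in>Basis. ennreal (?n s ((x - y) \<bullet> b - z \<bullet> b) * ?n t (z \<bullet> b))) \<partial>lborel)"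
    using s t by (simp add: gauss_prod prod_ennreal prod.distrib[symmetric] inner_diff_left inner_add_left algebra_simps)
  also have "\<dots> = (\<Prod>b\<in>Basis. ennreal (?n (s + t) ((x - y) \<bullet> b)))"
    using s t by (subst nn_integral_lborel_prod) (auto simp: 1)
  also have "\<dots> = ennreal (gauss (s + t) (x - y))"
    using s t by (simp add: gauss_prod prod_ennreal)
  finally show ?thesis .
qed

section \<open>Fubini and Gaussians relative to a hyperplane\<close>

definition perp :: "'a::euclidean_space \<Rightarrow> 'a \<Rightarrow> 'a" where
  "perp v x = x - (x \<bullet> v) *\<^sub>R v"

definition slab :: "'a::euclidean_space \<Rightarrow> 'a set" where
  "slab v = {x. \<bar>x \<bullet> v\<bar> \<le> 1 / 2}"

lemma perp_measurable [measurable (raw)]: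
  assumes [measurable]: "f \<in> borel_measurable M" "g \<in> borel_measurable M"
  shows "(\<lambda>x. perp (f x) (g x :: 'a::euclidean_space)) \<in> borel_measurable M"
  unfolding perp_def by measurable

lemma slab_borel [measurable]: "slab v \<in> sets borel"
  unfolding slab_def by measurable

lemma perp_diff: "perp v (x - y) = perp v x - perp v y"
  by (simp add: perp_def inner_diff_left algebra_simps)

lemma perp_line [simp]: "norm v = 1 \<Longrightarrow> perp v (x + r *\<^sub>R v) = perp v x"
  by (simp add: perp_def inner_add_left algebra_simps dot_square_norm)

lemma norm_perp: "norm v = 1 \<Longrightarrow> (norm (perp v x))\<^sup>2 = (norm x)\<^sup>2 - (x \<bullet> v)\<^sup>2"
proof -
  assume "norm v = 1"
  then have "v \<bullet> v = 1" by (simp add: dot_square_norm)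
  then show ?thesis
    unfolding perp_def power2_norm_eq_inner
    by (simp add: inner_diff_left inner_diff_right inner_commute power2_eq_square algebra_simps)
qed

text \<open>The slab has height 1, so integrating over it a function of \<open>perp v x\<close> is
  integrating over the hyperplane orthogonal to \<open>v\<close>: this is Fubini without a measure
  on that hyperplane. After shifting by \<open>r *\<^sub>R v\<close> it only matters that the
  \<open>r\<close> with \<open>x - r *\<^sub>R v\<close> in the slab form an interval of length
  1.\<close>

lemma nn_integral_slab_fubini:
  fixes f :: "'a::euclidean_space \<Rightarrow> ennreal"
  assumes [measurable]: "f \<in> borel_measurable borel" and v: "norm v = 1"
  shows "(\<integral>\<^sup>+x. f x \<partial>lborel)
    = (\<integral>\<^sup>+x. indicator (slab v) x * (\<integral>\<^sup>+r. f (perp v x + r *\<^sub>R v) \<partial>lborel) \<partial>lborel)"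
proof -
  have 1: "(\<integral>\<^sup>+r. f (perp v x + r *\<^sub>R v) \<partial>lborel) = (\<integral>\<^sup>+r. f (x + r *\<^sub>R v) \<partial>lborel)" for x
  proof -
    have "(\<integral>\<^sup>+r. f (perp v x + r *\<^sub>R v) \<partial>lborel) = (\<integral>\<^sup>+r. f (perp v x + (x \<bullet> v + r) *\<^sub>R v) \<partial>lborel)"
      by (rule nn_integral_lborel_translation[symmetric]) simp
    then show ?thesis by (simp add: perp_def scaleR_add_left algebra_simps)
  qed
  have "(\<integral>\<^sup>+x. indicator (slab v) x * (\<integral>\<^sup>+r. f (perp v x + r *\<^sub>R v) \<partial>lborel) \<partial>lborel)
      = (\<integral>\<^sup>+x. (\<integral>\<^sup>+r. indicator (slab v) x * f (x + r *\<^sub>R v) \<partial>lborel) \<partial>lborel)"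
    by (simp add: 1 nn_integral_cmult)
  also have "\<dots> = (\<integral>\<^sup>+r. (\<integral>\<^sup>+x. indicator (slab v) x * f (x + r *\<^sub>R v) \<partial>lborel) \<partial>lborel)"
    by (rule lborel_pair.Fubini') measurable
  also have "\<dots> = (\<integral>\<^sup>+r. (\<integral>\<^sup>+x. indicator (slab v) (x - r *\<^sub>R v) * f x \<partial>lborel) \<partial>lborel)"
  proof (rule nn_integral_cong)
    fix r
    have "(\<integral>\<^sup>+x. indicator (slab v) (r *\<^sub>R v + x - r *\<^sub>R v) * f (r *\<^sub>R v + x) \<partial>lborel)
       = (\<integral>\<^sup>+x. indicator (slab v) (x - r *\<^sub>R v) * f x \<partial>lborel)"
      by (rule nn_integral_lborel_translation) measurable
    then show "(\<integral>\<^sup>+x. indicator (slab v) x * f (x + r *\<^sub>R v) \<partial>lborel)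
       = (\<integral>\<^sup>+x. indicator (slab v) (x - r *\<^sub>R v) * f x \<partial>lborel)"
      by (simp add: add.commute)
  qed
  also have "\<dots> = (\<integral>\<^sup>+x. (\<integral>\<^sup>+r. indicator (slab v) (x - r *\<^sub>R v) * f x \<partial>lborel) \<partial>lborel)"
    by (rule lborel_pair.Fubini') measurable
  also have "\<dots> = (\<integral>\<^sup>+x. f x \<partial>lborel)"
  proof (rule nn_integral_cong)
    fix x
    have *: "indicator (slab v) (x - r *\<^sub>R v) = (indicator {x \<bullet> v - 1/2 .. x \<bullet> v + 1/2} r :: ennreal)" for r
    proof -
      have "x - r *\<^sub>R v \<in> slab v \<longleftrightarrow> \<bar>x \<bullet> v - r\<bar> \<le> 1 / 2"
        using v by (simp add: slab_def inner_diff_left dot_square_norm)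
      also have "\<dots> \<longleftrightarrow> r \<in> {x \<bullet> v - 1/2 .. x \<bullet> v + 1/2}"
        by (simp only: atLeastAtMost_iff) arith
      finally show ?thesis by (simp only: indicator_def)
    qed
    have "(\<integral>\<^sup>+r. indicator (slab v) (x - r *\<^sub>R v) * f x \<partial>lborel)
       = (\<integral>\<^sup>+r. indicator {x \<bullet> v - 1/2 .. x \<bullet> v + 1/2} r \<partial>lborel) * f x"
      by (simp only: *, rule nn_integral_multc) simp
    then show "(\<integral>\<^sup>+r. indicator (slab v) (x - r *\<^sub>R v) * f x \<partial>lborel) = f x"
      by simp
  qed
  finally show ?thesis ..
qed

text \<open>For functions constant along \<open>v\<close>, every probability density in the height
  \<open>x \<bullet> v\<close> serves as well as the uniform one on the slab. With a Gaussian
  profile, integrals over hyperplanes become full Gaussian integrals, for which the identities are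
  already known.\<close>

lemma nn_integral_slab_cylinder:
  fixes F :: "'a::euclidean_space \<Rightarrow> ennreal"
  assumes [measurable]: "F \<in> borel_measurable borel" "g \<in> borel_measurable borel"
    and v: "norm v = 1" and F: "\<And>x r. F (x + r *\<^sub>R v) = F x"
    and g: "(\<integral>\<^sup>+r. g r \<partial>lborel) = 1"
  shows "(\<integral>\<^sup>+x. F x * g (x \<bullet> v) \<partial>lborel) = (\<integral>\<^sup>+x. indicator (slab v) x * F x \<partial>lborel)"
proof -
  have 1: "F (perp v x) = F x" for x
    using F[of x "- (x \<bullet> v)"] by (simp add: perp_def)
  have 2: "(perp v x + r *\<^sub>R v) \<bullet> v = r" for x r
    using v by (simp add: perp_def inner_add_left inner_diff_left dot_square_norm)
  show ?thesis
    by (subst nn_integral_slab_fubini[OF _ v], simp)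
       (simp add: F 1 2 nn_integral_cmult g)
qed

text \<open>The heat kernel of dimension n - 1, to be evaluated at projections onto a hyperplane; as
  a function on the whole space it needs no type for hyperplanes.\<close>

definition pgauss :: "real \<Rightarrow> 'a::euclidean_space \<Rightarrow> real" where
  "pgauss t y = exp (- (norm y)\<^sup>2 / (4 * t)) / sqrt (4 * pi * t) ^ (DIM('a) - 1)"

lemma pgauss_measurable [measurable (raw)]:
  assumes [measurable]: "f \<in> borel_measurable M" "g \<in> borel_measurable M"
  shows "(\<lambda>x. pgauss (f x) (g x :: 'a::euclidean_space)) \<in> borel_measurable M"
  unfolding pgauss_def by measurable

lemma pgauss_nonneg [simp]: "0 \<le> t \<Longrightarrow> 0 \<le> pgauss t z"
  by (simp add: pgauss_def)

lemma gauss_split: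
  fixes z v :: "'a::euclidean_space"
  assumes v: "norm v = 1" and t: "0 < t"
  shows "gauss t z = pgauss t (perp v z) * gauss t (z \<bullet> v)"
proof -
  have "exp (- (norm z)\<^sup>2 / (4 * t)) = exp (- (norm (perp v z))\<^sup>2 / (4 * t)) * exp (- (norm (z \<bullet> v))\<^sup>2 / (4 * t))"
    unfolding exp_add[symmetric] using t by (simp add: norm_perp[OF v] field_simps)
  moreover have "sqrt (4 * pi * t) ^ DIM('a) = sqrt (4 * pi * t) ^ (DIM('a) - 1) * sqrt (4 * pi * t) ^ DIM(real)"
    unfolding power_add[symmetric] by simp
  ultimately show ?thesis
    unfolding gauss_def pgauss_def by simp
qed

lemma nn_integral_slab_pgauss:
  fixes F :: "'a::euclidean_space \<Rightarrow> ennreal"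
  assumes [measurable]: "F \<in> borel_measurable borel"
    and v: "norm v = 1" and F: "\<And>x r. F (x + r *\<^sub>R v) = F x" and t: "0 < t"
  shows "(\<integral>\<^sup>+z. indicator (slab v) z * (F z * ennreal (pgauss t (perp v (x - z)))) \<partial>lborel)
    = (\<integral>\<^sup>+z. F z * ennreal (gauss t (x - z)) \<partial>lborel)"
proof -
  have g: "(\<integral>\<^sup>+r. ennreal (gauss t (x \<bullet> v - r)) \<partial>lborel) = 1"
    using nn_integral_lborel_reflect[of "\<lambda>r. ennreal (gauss t r)" "x \<bullet> v"] nn_integral_gauss[OF t, where 'a=real] by simp
  have "perp v (x - (y + r *\<^sub>R v)) = perp v (x - y)" for y r
    using v by (simp add: perp_diff)
  then have "(\<integral>\<^sup>+z. (F z * ennreal (pgauss t (perp v (x - z)))) * ennreal (gauss t (x \<bullet> v - z \<bullet> v)) \<partial>lborel) =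
      (\<integral>\<^sup>+z. indicator (slab v) z * (F z * ennreal (pgauss t (perp v (x - z)))) \<partial>lborel)"
    by (intro nn_integral_slab_cylinder[where g="\<lambda>r. ennreal (gauss t (x \<bullet> v - r))"] v g) (simp_all add: F)
  moreover have "(F z * ennreal (pgauss t (perp v (x - z)))) * ennreal (gauss t (x \<bullet> v - z \<bullet> v)) = F z * ennreal (gauss t (x - z))" for z
    using t by (simp add: gauss_split[OF v t, of "x - z"] ennreal_mult inner_diff_left mult.assoc)
  ultimately show ?thesis by simp
qed

text \<open>The semigroup law on the hyperplane is inherited from the one in the whole space. The
  height profile \<open>g\<close> is the product of the two missing one-dimensional Gaussians,
  normalized by their convolution \<open>c\<close> at 0; the same factor \<open>c\<close> splits off
  from the full kernel at time \<open>s + t\<close>.\<close>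

lemma nn_integral_slab_pgauss_conv:
  fixes x y v :: "'a::euclidean_space"
  assumes v: "norm v = 1" and s: "0 < s" and t: "0 < t"
  shows "(\<integral>\<^sup>+z. indicator (slab v) z * ennreal (pgauss s (perp v (x - z)) * pgauss t (perp v (z - y))) \<partial>lborel)
    = ennreal (pgauss (s + t) (perp v (x - y)))"
proof -
  define c where "c = gauss (s + t) (0::real)"
  have c: "0 < c" unfolding c_def using s t by (intro gauss_pos) simp
  define g where "g r = ennreal (gauss s (0 - r) * gauss t (r - 0) / c)" for r :: real
  have [measurable]: "g \<in> borel_measurable borel" unfolding g_def by measurable
  have g: "(\<integral>\<^sup>+r. g r \<partial>lborel) = 1"
  proof -
    have "(\<integral>\<^sup>+r. g r \<partial>lborel) = (\<integral>\<^sup>+(r::real). ennreal (gauss s (0 - r) * gauss t (r - 0)) * ennreal (1 / c) \<partial>lborel)"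
      by (rule nn_integral_cong) (use c s t in \<open>simp add: ennreal_mult[symmetric] g_def\<close>)
    also have "\<dots> = ennreal c * ennreal (1 / c)"
      using nn_integral_gauss_conv[OF s t, of 0 "0::real"] by (subst nn_integral_multc) (auto simp: c_def)
    finally show ?thesis using c by (simp add: ennreal_mult[symmetric])
  qed
  have inv: "perp v (x - (z + r *\<^sub>R v)) = perp v (x - z)" "perp v (z + r *\<^sub>R v - y) = perp v (z - y)" for z r
    using v by (simp_all add: perp_diff)
  have pv: "perp v a \<bullet> v = 0" "perp v (perp v a) = perp v a" for a
    using v by (simp_all add: perp_def inner_diff_left dot_square_norm)
  have "(\<integral>\<^sup>+z. indicator (slab v) z * ennreal (pgauss s (perp v (x - z)) * pgauss t (perp v (z - y))) \<partial>lborel)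
     = (\<integral>\<^sup>+z. ennreal (pgauss s (perp v (x - z)) * pgauss t (perp v (z - y))) * g (z \<bullet> v) \<partial>lborel)"
    by (rule nn_integral_slab_cylinder[symmetric]) (auto simp: inv g v)
  also have "\<dots> = (\<integral>\<^sup>+z. ennreal (gauss s (perp v x - z) * gauss t (z - perp v y)) * ennreal (1 / c) \<partial>lborel)"
    using c s t by (intro nn_integral_cong)
      (simp add: gauss_split[OF v] g_def ennreal_mult[symmetric] perp_diff pv inner_diff_left field_simps)
  also have "\<dots> = ennreal (gauss (s + t) (perp v x - perp v y)) * ennreal (1 / c)"
    using s t by (subst nn_integral_multc) (auto simp: nn_integral_gauss_conv)
  also have "\<dots> = ennreal (pgauss (s + t) (perp v (x - y)))"
    using s t c gauss_split[OF v, of "s + t" "perp v x - perp v y"] 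
    by (simp add: ennreal_mult[symmetric] perp_diff pv inner_diff_left c_def[symmetric])
  finally show ?thesis .
qed

section \<open>Polarization and symmetrization\<close>

lemma orthogonal_transformation_measurable:
  fixes f :: "'a::euclidean_space \<Rightarrow> 'a"
  shows "orthogonal_transformation f \<Longrightarrow> f \<in> borel_measurable borel"
  by (intro borel_measurable_continuous_onI linear_continuous_on)
    (auto simp: orthogonal_transformation_linear linear_conv_bounded_linear[symmetric])

text \<open>This is the uniqueness argument for Haar measure, with no determinant. The double
  integral of \<open>indicator ?B x * g (x + f y)\<close> is computed in both orders by translation
  invariance, and the unit ball looks the same after \<open>f\<close>; its finite positive volume is
  then cancelled.\<close>

lemma nn_integral_lborel_orthogonal:
  fixes f :: "'a::euclidean_space \<Rightarrow> 'a"
  assumes f: "orthogonal_transformation f" and [measurable]: "g \<in> borel_measurable borel"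
  shows "(\<integral>\<^sup>+x. g (f x) \<partial>lborel) = (\<integral>\<^sup>+x. g x \<partial>lborel)"
proof -
  note [measurable] = orthogonal_transformation_measurable[OF f]
  let ?B = "ball (0::'a) 1" and ?h = "inv f"
  have [measurable]: "?B \<in> sets borel" by simp
  have h: "f (?h x) = x" for x
    using orthogonal_transformation_surj[OF f] by (rule surj_f_inv_f)
  have "f (x + y) = f x + f y" "f (x - y) = f x - f y" for x y
    using orthogonal_transformation_linear[OF f] by (simp_all add: linear_add linear_diff)
  note lin = this
  have n: "norm (f x) = norm x" for x using f by (simp add: orthogonal_transformation)
  have "emeasure lborel ?B * (\<integral>\<^sup>+y. g (f y) \<partial>lborel) = (\<integral>\<^sup>+(x::'a). indicator ?B x * (\<integral>\<^sup>+y. g (f y) \<partial>lborel) \<partial>lborel)"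
    by (subst nn_integral_multc) auto
  also have "\<dots> = (\<integral>\<^sup>+x. \<integral>\<^sup>+y. indicator ?B x * g (x + f y) \<partial>lborel \<partial>lborel)"
  proof (rule nn_integral_cong)
    fix x
    have "(\<integral>\<^sup>+y. g (f y) \<partial>lborel) = (\<integral>\<^sup>+y. g (f (?h x + y)) \<partial>lborel)"
      by (rule nn_integral_lborel_translation[symmetric]) measurable
    then show "indicator ?B x * (\<integral>\<^sup>+y. g (f y) \<partial>lborel) = (\<integral>\<^sup>+y. indicator ?B x * g (x + f y) \<partial>lborel)"
      by (simp add: lin h nn_integral_cmult)
  qed
  also have "\<dots> = (\<integral>\<^sup>+y. \<integral>\<^sup>+x. indicator ?B x * g (x + f y) \<partial>lborel \<partial>lborel)"
    by (rule lborel_pair.Fubini') measurable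
  also have "\<dots> = (\<integral>\<^sup>+y. \<integral>\<^sup>+x. indicator ?B (x - f y) * g x \<partial>lborel \<partial>lborel)"
  proof (rule nn_integral_cong)
    fix y
    have "(\<integral>\<^sup>+x. indicator ?B (f y + x - f y) * g (f y + x) \<partial>lborel) = (\<integral>\<^sup>+x. indicator ?B (x - f y) * g x \<partial>lborel)"
      by (rule nn_integral_lborel_translation) measurable
    then show "(\<integral>\<^sup>+x. indicator ?B x * g (x + f y) \<partial>lborel) = (\<integral>\<^sup>+x. indicator ?B (x - f y) * g x \<partial>lborel)"
      by (simp add: add.commute)
  qed
  also have "\<dots> = (\<integral>\<^sup>+x. \<integral>\<^sup>+y. indicator ?B (x - f y) * g x \<partial>lborel \<partial>lborel)"
    by (rule lborel_pair.Fubini'[symmetric]) measurable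
  also have "\<dots> = (\<integral>\<^sup>+x. emeasure lborel ?B * g x \<partial>lborel)"
  proof (rule nn_integral_cong)
    fix x
    have "norm (x - f y) = norm (?h x - y)" for y
      using n[of "?h x - y"] by (simp add: lin h)
    then have "indicator ?B (x - f y) = (indicator ?B (?h x - y) :: ennreal)" for y
      by (simp add: indicator_def)
    moreover have "(\<integral>\<^sup>+y. indicator ?B (?h x - y) \<partial>lborel) = (\<integral>\<^sup>+y. indicator ?B y \<partial>lborel)"
      by (rule nn_integral_lborel_reflect) measurable
    ultimately show "(\<integral>\<^sup>+y. indicator ?B (x - f y) * g x \<partial>lborel) = emeasure lborel ?B * g x"
      by (simp add: nn_integral_multc)
  qed
  also have "\<dots> = emeasure lborel ?B * (\<integral>\<^sup>+x. g x \<partial>lborel)"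
    by (simp add: nn_integral_cmult)
  finally have eq: "emeasure lborel ?B * (\<integral>\<^sup>+y. g (f y) \<partial>lborel) = emeasure lborel ?B * (\<integral>\<^sup>+x. g x \<partial>lborel)" .
  have "0 < measure lborel ?B" by (rule content_ball_pos) simp
  then have "emeasure lborel ?B \<noteq> 0" unfolding measure_def enn2real_positive_iff by auto
  with eq emeasure_lborel_ball_finite[of "0::'a" 1] show ?thesis
    unfolding ennreal_mult_cancel_left by auto
qed

text \<open>For a unit vector \<open>e\<close>, the reflection in the affine hyperplane of all
  points with \<open>x \<bullet> e = d\<close>.\<close>

definition reflect :: "'a::euclidean_space \<Rightarrow> real \<Rightarrow> 'a \<Rightarrow> 'a" where
  "reflect e d x = x - (2 * (x \<bullet> e - d)) *\<^sub>R e"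

lemma reflect_inner: "norm e = 1 \<Longrightarrow> reflect e d x \<bullet> e = 2 * d - x \<bullet> e"
  by (simp add: reflect_def inner_diff_left dot_square_norm algebra_simps)

lemma reflect_reflect [simp]: "norm e = 1 \<Longrightarrow> reflect e d (reflect e d x) = x"
  using reflect_inner[of e d x] by (simp add: reflect_def[of e d "reflect e d x"]) (simp add: reflect_def algebra_simps)

text \<open>The last term is nonnegative precisely if \<open>x\<close> and \<open>y\<close> lie on
  the same closed side of the mirror or one of them lies on it. All comparisons of distances below,
  also those of a point and its image with the origin, are read off from its sign.\<close>

lemma norm_diff_reflect:
  assumes "norm e = 1"
  shows "(norm (x - reflect e d y))\<^sup>2 = (norm (x - y))\<^sup>2 + 4 * ((x \<bullet> e - d) * (y \<bullet> e - d))"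
proof -
  have e: "e \<bullet> e = 1" using assms by (simp add: dot_square_norm)
  define w where "w = x - y"
  define c where "c = 2 * (y \<bullet> e - d)"
  have "x - reflect e d y = w + c *\<^sub>R e" by (simp add: reflect_def w_def c_def)
  then have "(norm (x - reflect e d y))\<^sup>2 = (w + c *\<^sub>R e) \<bullet> (w + c *\<^sub>R e)"
    by (simp add: power2_norm_eq_inner)
  also have "\<dots> = w \<bullet> w + 2 * c * (w \<bullet> e) + c\<^sup>2"
    by (simp only: inner_add_left inner_add_right inner_scaleR_left inner_scaleR_right e inner_commute[of e w] power2_eq_square)
       (simp add: algebra_simps)
  also have "w \<bullet> w = (norm w)\<^sup>2" by (simp add: power2_norm_eq_inner)
  finally show ?thesis
    by (simp add: w_def c_def inner_diff_left power2_eq_square algebra_simps)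
qed

lemma norm_reflect_diff_swap:
  assumes e: "norm e = 1"
  shows "norm (reflect e d x - y) = norm (x - reflect e d y)"
proof (rule power2_eq_imp_eq)
  have "(norm (reflect e d x - y))\<^sup>2 = (norm (y - reflect e d x))\<^sup>2"
    by (simp only: norm_minus_commute)
  also have "\<dots> = (norm (x - reflect e d y))\<^sup>2"
    unfolding norm_diff_reflect[OF e] by (simp only: norm_minus_commute[of y x] mult.commute)
  finally show "(norm (reflect e d x - y))\<^sup>2 = (norm (x - reflect e d y))\<^sup>2" .
qed simp_all

lemma norm_reflect_diff [simp]: "norm e = 1 \<Longrightarrow> norm (reflect e d x - reflect e d y) = norm (x - y)"
  by (simp only: norm_reflect_diff_swap reflect_reflect)

lemma reflect_continuous: "continuous_on UNIV (reflect e d)"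
  unfolding reflect_def by (intro continuous_intros)

lemma reflect_measurable [measurable]: "reflect e d \<in> borel_measurable borel"
  by (rule borel_measurable_continuous_onI[OF reflect_continuous])

lemma nn_integral_lborel_reflection:
  fixes e :: "'a::euclidean_space"
  assumes e: "norm e = 1" and [measurable]: "g \<in> borel_measurable borel"
  shows "(\<integral>\<^sup>+x. g (reflect e d x) \<partial>lborel) = (\<integral>\<^sup>+x. g x \<partial>lborel)"
proof -
  have "linear (reflect e 0)"
    unfolding reflect_def by (rule linearI) (simp_all add: inner_add_left algebra_simps)
  moreover have "norm (reflect e 0 x) = norm x" for x
    using norm_reflect_diff[OF e, of 0 x 0] by (simp add: reflect_def)
  ultimately have o: "orthogonal_transformation (reflect e 0)"
    by (simp add: orthogonal_transformation)
  have "reflect e d x = (2 * d) *\<^sub>R e + reflect e 0 x" for x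
    by (simp add: reflect_def algebra_simps)
  then have "(\<integral>\<^sup>+x. g (reflect e d x) \<partial>lborel) = (\<integral>\<^sup>+x. g ((2 * d) *\<^sub>R e + reflect e 0 x) \<partial>lborel)"
    by simp
  also have "\<dots> = (\<integral>\<^sup>+x. g ((2 * d) *\<^sub>R e + x) \<partial>lborel)"
    by (rule nn_integral_lborel_orthogonal[OF o, of "\<lambda>x. g ((2 * d) *\<^sub>R e + x)"]) measurable
  also have "\<dots> = (\<integral>\<^sup>+x. g x \<partial>lborel)"
    by (rule nn_integral_lborel_translation) simp
  finally show ?thesis .
qed

text \<open>Two-point rearrangement: of the values at a point and its mirror image, the larger one
  goes to the side \<open>x \<bullet> e \<le> d\<close>. Since it is later used with
  \<open>0 \<le> d\<close>, this is the side containing the origin.\<close>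

definition polarize :: "'a::euclidean_space \<Rightarrow> real \<Rightarrow> ('a \<Rightarrow> real) \<Rightarrow> 'a \<Rightarrow> real" where
  "polarize e d v x = (if x \<bullet> e \<le> d then max (v x) (v (reflect e d x)) else min (v x) (v (reflect e d x)))"

lemma polarize_measurable [measurable (raw)]:
  assumes [measurable]: "v \<in> borel_measurable borel"
  shows "polarize e d v \<in> borel_measurable borel"
  unfolding polarize_def by measurable

text \<open>For points on one side, maxima and minima are compared with their likes. For points on
  different sides a maximum meets a minimum, which also requires the differences of \<open>v\<close>
  between \<open>x\<close> and the image of \<open>y\<close>; there reflecting one point shortens
  the distance.\<close>

lemma polarize_lipschitz:
  assumes e: "norm e = 1" and L: "\<And>x y. \<bar>v x - v y\<bar> \<le> L * norm (x - y)" and L0: "0 \<le> L"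
  shows "\<bar>polarize e d v x - polarize e d v y\<bar> \<le> L * norm (x - y)"
proof -
  let ?s = "reflect e d"
  have ss: "\<bar>v (?s x) - v (?s y)\<bar> \<le> L * norm (x - y)"
    using L[of "?s x" "?s y"] e by simp
  have s: "\<bar>v (?s x) - v y\<bar> \<le> L * norm (x - y)" "\<bar>v x - v (?s y)\<bar> \<le> L * norm (x - y)"
    if "(x \<bullet> e - d) * (y \<bullet> e - d) \<le> 0"
  proof -
    have "(norm (x - ?s y))\<^sup>2 \<le> (norm (x - y))\<^sup>2"
      unfolding norm_diff_reflect[OF e] using that by linarith
    then have "norm (x - ?s y) \<le> norm (x - y)"
      by (rule power2_le_imp_le) simp
    then have le: "L * norm (x - ?s y) \<le> L * norm (x - y)"
      using L0 by (rule mult_left_mono)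
    show "\<bar>v (?s x) - v y\<bar> \<le> L * norm (x - y)"
      using L[of "?s x" y] le unfolding norm_reflect_diff_swap[OF e] by (rule order_trans)
    show "\<bar>v x - v (?s y)\<bar> \<le> L * norm (x - y)"
      using L[of x "?s y"] le by (rule order_trans)
  qed
  note n = L[of x y] ss
  have mm: "\<bar>max a b - max c d\<bar> \<le> K" "\<bar>min a b - min c d\<bar> \<le> K" if "\<bar>a - c\<bar> \<le> K" "\<bar>b - d\<bar> \<le> K"
    for a b c d K :: real
    using that by (simp_all add: abs_le_iff max_def min_def)
  have mx: "\<bar>max a b - min c d\<bar> \<le> K" "\<bar>min a b - max c d\<bar> \<le> K"
    if "\<bar>a - c\<bar> \<le> K" "\<bar>b - d\<bar> \<le> K" "\<bar>a - d\<bar> \<le> K" "\<bar>b - c\<bar> \<le> K" for a b c d K :: real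
    using that by (simp_all add: abs_le_iff max_def min_def)
  consider "x \<bullet> e \<le> d" "y \<bullet> e \<le> d" | "\<not> x \<bullet> e \<le> d" "\<not> y \<bullet> e \<le> d"
    | "x \<bullet> e \<le> d" "\<not> y \<bullet> e \<le> d" | "\<not> x \<bullet> e \<le> d" "y \<bullet> e \<le> d" by blast
  then show ?thesis
  proof cases
    case 1 then show ?thesis unfolding polarize_def by (simp only: if_True) (rule mm(1)[OF n])
  next
    case 2 then show ?thesis unfolding polarize_def by (simp only: if_False) (rule mm(2)[OF n])
  next
    case 3 then have "(x \<bullet> e - d) * (y \<bullet> e - d) \<le> 0" by (intro mult_nonpos_nonneg) auto
    from mx(1)[OF n s(2,1)[OF this]] 3 show ?thesis unfolding polarize_def by (simp only: if_True if_False)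
  next
    case 4 then have "(x \<bullet> e - d) * (y \<bullet> e - d) \<le> 0" by (intro mult_nonneg_nonpos) auto
    from mx(2)[OF n s(2,1)[OF this]] 4 show ?thesis unfolding polarize_def by (simp only: if_True if_False)
  qed
qed

text \<open>On every pair of mirror images polarization is either the identity or the swap.
  Therefore integrals of functions of \<open>v\<close>, such as the L^2 norm and the measures of
  level sets, do not change.\<close>

lemma polarize_pair:
  assumes e: "norm e = 1"
  obtains "polarize e d v x = v x" "polarize e d v (reflect e d x) = v (reflect e d x)"
  | "polarize e d v x = v (reflect e d x)" "polarize e d v (reflect e d x) = v x"
proof -
  have mm: "max a b = a \<and> min b a = b \<or> max a b = b \<and> min b a = a" for a b :: real
    by linarith
  have r: "reflect e d x \<bullet> e = 2 * d - x \<bullet> e" "reflect e d (reflect e d x) = x"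
    using e by (simp_all add: reflect_inner)
  consider "x \<bullet> e = d" | "x \<bullet> e < d" | "x \<bullet> e > d" by linarith
  then show thesis
  proof cases
    case 1
    then have "reflect e d x = x" by (simp add: reflect_def)
    then show thesis using that(1) by (simp add: polarize_def)
  next
    case 2
    then have p: "polarize e d v x = max (v x) (v (reflect e d x))"
      "polarize e d v (reflect e d x) = min (v (reflect e d x)) (v x)"
      by (simp_all add: polarize_def r)
    show thesis using mm[of "v x" "v (reflect e d x)"] that unfolding p by fast
  next
    case 3
    then have p: "polarize e d v x = min (v x) (v (reflect e d x))"
      "polarize e d v (reflect e d x) = max (v (reflect e d x)) (v x)"
      by (simp_all add: polarize_def r)
    show thesis using mm[of "v (reflect e d x)" "v x"] that unfolding p by fast
  qed
qed

lemma nn_integral_polarize: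
  fixes e :: "'a::euclidean_space" and F :: "real \<Rightarrow> ennreal"
  assumes e: "norm e = 1" and [measurable]: "v \<in> borel_measurable borel" "F \<in> borel_measurable borel"
  shows "(\<integral>\<^sup>+x. F (polarize e d v x) \<partial>lborel) = (\<integral>\<^sup>+x. F (v x) \<partial>lborel)"
proof -
  have dbl: "2 * (\<integral>\<^sup>+x. F (u x) \<partial>lborel) = (\<integral>\<^sup>+x. F (u x) + F (u (reflect e d x)) \<partial>lborel)"
    if [measurable]: "u \<in> borel_measurable borel" for u :: "'a \<Rightarrow> real"
    by (subst nn_integral_add) (auto simp: nn_integral_lborel_reflection[OF e, of "\<lambda>x. F (u x)"] mult_2)
  have "F (polarize e d v x) + F (polarize e d v (reflect e d x)) = F (v x) + F (v (reflect e d x))" for x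
    by (rule polarize_pair[OF e, of d v x]) (auto simp: add.commute)
  then have "2 * (\<integral>\<^sup>+x. F (polarize e d v x) \<partial>lborel) = 2 * (\<integral>\<^sup>+x. F (v x) \<partial>lborel)"
    by (simp add: dbl)
  then show ?thesis
    by (simp add: ennreal_mult_cancel_left)
qed

definition radial_decreasing :: "('a::euclidean_space \<Rightarrow> real) \<Rightarrow> bool" where
  "radial_decreasing q \<longleftrightarrow> (\<forall>x y. norm x \<le> norm y \<longrightarrow> q y \<le> q x)"

lemma radial_decreasing_cong: "radial_decreasing q \<Longrightarrow> norm x = norm y \<Longrightarrow> q x = q y"
  by (simp add: radial_decreasing_def order_antisym)

text \<open>\<open>G\<close> is the contribution to the kernel form of \<open>x\<close> and
  \<open>y\<close> together with their mirror images. Polarization keeps the sum of the four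
  products, so only their distribution over the two weights matters: points on the same side are
  closer and get the larger weight, and polarization lines up the large values there.\<close>

lemma polarize_kernel_pointwise:
  fixes q v :: "'a::euclidean_space \<Rightarrow> real" and e x y :: 'a and d :: real
  assumes e: "norm e = 1" and q: "radial_decreasing q" 
  defines "G \<equiv> \<lambda>u. q (x - y) * (u x * u y + u (reflect e d x) * u (reflect e d y))
     + q (x - reflect e d y) * (u x * u (reflect e d y) + u (reflect e d x) * u y)"
  shows "G v \<le> G (polarize e d v)"
proof -
  let ?s = "reflect e d"
  have sx: "?s x \<bullet> e \<le> d \<longleftrightarrow> x \<bullet> e \<ge> d" and sy: "?s y \<bullet> e \<le> d \<longleftrightarrow> y \<bullet> e \<ge> d"
    using reflect_inner[OF e, of d x] reflect_inner[OF e, of d y] by auto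
  have lin: "A * S + B * T \<le> A * S' + B * T'" if "0 \<le> (A - B) * (S' - S)" "S' + T' = S + T"
    for A B S T S' T' :: real
  proof -
    have T: "T = S' + T' - S" using that by simp
    show ?thesis using that(1) unfolding T by (simp add: algebra_simps)
  qed
  \<comment> \<open>The rearrangement inequality for two pairs: sorting both pairs the same way can
    only move mass from the smaller weight \<open>B\<close> to the larger weight
    \<open>A\<close>.\<close>
  have key: "A * (a * b + a' * b') + B * (a * b' + a' * b) \<le> A * (max a a' * max b b' + min a a' * min b b')
      + B * (max a a' * min b b' + min a a' * max b b')" if "B \<le> A" for A B a a' b b' :: real
  proof -
    have "0 \<le> (A - B) * ((max a a' * max b b' + min a a' * min b b') - (a * b + a' * b'))"
    proof (rule mult_nonneg_nonneg)
      have "0 \<le> (a - a') * (b - b')" if "a \<ge> a' \<and> b \<ge> b' \<or> a \<le> a' \<and> b \<le> b'"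
        using that by (auto intro: mult_nonneg_nonneg mult_nonpos_nonpos)
      moreover have "(a - a') * (b - b') \<le> 0" if "a \<ge> a' \<and> b \<le> b' \<or> a \<le> a' \<and> b \<ge> b'"
        using that by (auto intro: mult_nonneg_nonpos mult_nonpos_nonneg)
      ultimately show "0 \<le> (max a a' * max b b' + min a a' * min b b') - (a * b + a' * b')"
        by (auto simp: max_def min_def algebra_simps)
    qed (use that in simp)
    moreover have "(max a a' * max b b' + min a a' * min b b') + (max a a' * min b b' + min a a' * max b b')
       = (a * b + a' * b') + (a * b' + a' * b)"
      by (cases "a \<le> a'"; cases "b \<le> b'") (simp_all add: max_def min_def)
    ultimately show ?thesis by (rule lin)
  qed
  have cmp: "q (x - y) \<le> q (x - ?s y)" if "(x \<bullet> e - d) * (y \<bullet> e - d) \<le> 0"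
  proof -
    have "(norm (x - ?s y))\<^sup>2 \<le> (norm (x - y))\<^sup>2"
      unfolding norm_diff_reflect[OF e] using that by linarith
    then have "norm (x - ?s y) \<le> norm (x - y)"
      by (rule power2_le_imp_le) simp
    then show ?thesis using q by (simp add: radial_decreasing_def)
  qed
  have cmp': "q (x - ?s y) \<le> q (x - y)" if "(x \<bullet> e - d) * (y \<bullet> e - d) \<ge> 0"
  proof -
    have "(norm (x - y))\<^sup>2 \<le> (norm (x - ?s y))\<^sup>2"
      unfolding norm_diff_reflect[OF e] using that by linarith
    then have "norm (x - y) \<le> norm (x - ?s y)"
      by (rule power2_le_imp_le) simp
    then show ?thesis using q by (simp add: radial_decreasing_def)
  qed
  define M m N k where M_def: "M = max (v x) (v (?s x))" "m = min (v x) (v (?s x))"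
    "N = max (v y) (v (?s y))" "k = min (v y) (v (?s y))"
  consider "x \<bullet> e = d \<or> y \<bullet> e = d" | "x \<bullet> e < d" "y \<bullet> e < d" | "x \<bullet> e > d" "y \<bullet> e > d"
    | "x \<bullet> e < d" "y \<bullet> e > d" | "x \<bullet> e > d" "y \<bullet> e < d" by linarith
  then show ?thesis
  proof cases
    \<comment> \<open>If one of the points lies on the mirror, the two weights agree, and only the
      sums over mirror pairs enter, which polarization preserves.\<close>
    case 1
    then have "q (x - ?s y) = q (x - y)" using cmp cmp' by force
    moreover have "(u x * u y + u (?s x) * u (?s y)) + (u x * u (?s y) + u (?s x) * u y) = (u x + u (?s x)) * (u y + u (?s y))"
      for u :: "'a \<Rightarrow> real" by (simp add: algebra_simps)
    moreover have "polarize e d v z + polarize e d v (?s z) = v z + v (?s z)" for z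
      by (rule polarize_pair[OF e, of d v z]) auto
    ultimately show ?thesis unfolding G_def by (simp flip: distrib_left)
  next
    case 2
    then have le: "q (x - ?s y) \<le> q (x - y)" by (intro cmp' mult_nonpos_nonpos) auto
    have "polarize e d v x = M" "polarize e d v (?s x) = m"
      "polarize e d v y = N" "polarize e d v (?s y) = k"
      unfolding M_def polarize_def using 2 sx sy by (simp_all add: e max.commute min.commute)
    note p = this
    show ?thesis
      using key[OF le, of "v x" "v y" "v (?s x)" "v (?s y)"] unfolding G_def p M_def[symmetric]
      by (simp only: ac_simps)
  next
    case 3
    then have le: "q (x - ?s y) \<le> q (x - y)" by (intro cmp' mult_nonneg_nonneg) auto
    have "polarize e d v x = m" "polarize e d v (?s x) = M"
      "polarize e d v y = k" "polarize e d v (?s y) = N"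
      unfolding M_def polarize_def using 3 sx sy by (simp_all add: e max.commute min.commute)
    note p = this
    show ?thesis
      using key[OF le, of "v x" "v y" "v (?s x)" "v (?s y)"] unfolding G_def p M_def[symmetric]
      by (simp only: ac_simps)
  next
    \<comment> \<open>On opposite sides the image of \<open>y\<close> is the closer point, so
      \<open>key\<close> is used with \<open>y\<close> and its image exchanged.\<close>
    case 4
    then have le: "q (x - y) \<le> q (x - ?s y)" by (intro cmp mult_nonpos_nonneg) auto
    have "polarize e d v x = M" "polarize e d v (?s x) = m"
      "polarize e d v y = k" "polarize e d v (?s y) = N"
      unfolding M_def polarize_def using 4 sx sy by (simp_all add: e max.commute min.commute)
    note p = this
    have p': "max (v (?s y)) (v y) = N" "min (v (?s y)) (v y) = k"
      unfolding M_def by (simp_all add: max.commute min.commute)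
    show ?thesis
      using key[OF le, of "v x" "v (?s y)" "v (?s x)" "v y"] unfolding G_def p p' M_def[symmetric]
      by (simp only: ac_simps)
  next
    case 5
    then have le: "q (x - y) \<le> q (x - ?s y)" by (intro cmp mult_nonneg_nonpos) auto
    have "polarize e d v x = m" "polarize e d v (?s x) = M"
      "polarize e d v y = N" "polarize e d v (?s y) = k"
      unfolding M_def polarize_def using 5 sx sy by (simp_all add: e max.commute min.commute)
    note p = this
    have p': "max (v (?s y)) (v y) = N" "min (v (?s y)) (v y) = k"
      unfolding M_def by (simp_all add: max.commute min.commute)
    show ?thesis
      using key[OF le, of "v x" "v (?s y)" "v (?s x)" "v y"] unfolding G_def p p' M_def[symmetric]
      by (simp only: ac_simps)
  qed
qed

definition kernel_form :: "('a::euclidean_space \<Rightarrow> real) \<Rightarrow> ('a \<Rightarrow> real) \<Rightarrow> ennreal" where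
  "kernel_form q v = (\<integral>\<^sup>+x. \<integral>\<^sup>+y. ennreal (q (x - y) * (v x * v y)) \<partial>lborel \<partial>lborel)"

text \<open>Reflecting the variable \<open>x\<close>, the variable \<open>y\<close>, or both, gives
  four expressions for the same form. Their sum has the integrand of
  \<open>polarize_kernel_pointwise\<close>, so the inequality already holds pointwise.\<close>

lemma kernel_form_polarize:
  fixes e :: "'a::euclidean_space"
  assumes e: "norm e = 1" and [measurable]: "v \<in> borel_measurable borel" "q \<in> borel_measurable borel"
    and q: "radial_decreasing q" and q0: "\<And>x. 0 \<le> q x" and v0: "\<And>x. 0 \<le> v x"
  shows "kernel_form q v \<le> kernel_form q (polarize e d v)"
proof -
  let ?s = "reflect e d"
  have four: "4 * kernel_form q u = (\<integral>\<^sup>+x. \<integral>\<^sup>+y. ennreal (q (x - y) * (u x * u y + u (?s x) * u (?s y))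
     + q (x - ?s y) * (u x * u (?s y) + u (?s x) * u y)) \<partial>lborel \<partial>lborel)"
    if [measurable]: "u \<in> borel_measurable borel" and u0: "\<And>x. 0 \<le> u x" for u :: "'a \<Rightarrow> real"
  proof -
    let ?I = "\<lambda>F. \<integral>\<^sup>+x. \<integral>\<^sup>+y. ennreal (F x y) \<partial>lborel \<partial>lborel"
    have k1: "kernel_form q u = ?I (\<lambda>x y. q (x - y) * (u x * u y))" by (simp add: kernel_form_def)
    have k3: "kernel_form q u = ?I (\<lambda>x y. q (x - ?s y) * (u x * u (?s y)))"
      unfolding kernel_form_def
      by (subst nn_integral_lborel_reflection[OF e, where d=d, symmetric], measurable)
    have k2: "kernel_form q u = ?I (\<lambda>x y. q (x - y) * (u (?s x) * u (?s y)))"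
    proof -
      have "kernel_form q u = ?I (\<lambda>x y. q (?s x - ?s y) * (u (?s x) * u (?s y)))"
        unfolding k3 by (subst nn_integral_lborel_reflection[OF e, where d=d, symmetric], measurable)
      moreover have "q (?s x - ?s y) = q (x - y)" for x y
        by (rule radial_decreasing_cong[OF q]) (simp add: e)
      ultimately show ?thesis by simp
    qed
    have k4: "kernel_form q u = ?I (\<lambda>x y. q (x - ?s y) * (u (?s x) * u y))"
    proof -
      have "kernel_form q u = ?I (\<lambda>x y. q (?s x - y) * (u (?s x) * u y))"
        unfolding kernel_form_def by (subst nn_integral_lborel_reflection[OF e, where d=d, symmetric], measurable)
      moreover have "q (?s x - y) = q (x - ?s y)" for x y
        by (rule radial_decreasing_cong[OF q]) (simp add: e norm_reflect_diff_swap)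
      ultimately show ?thesis by simp
    qed
    have "4 * kernel_form q u = (kernel_form q u + kernel_form q u) + (kernel_form q u + kernel_form q u)"
      by (simp flip: mult_2 mult.assoc)
    also have "\<dots> = (?I (\<lambda>x y. q (x - y) * (u x * u y)) + ?I (\<lambda>x y. q (x - y) * (u (?s x) * u (?s y))))
      + (?I (\<lambda>x y. q (x - ?s y) * (u x * u (?s y))) + ?I (\<lambda>x y. q (x - ?s y) * (u (?s x) * u y)))"
      using k1 k2 k3 k4 by simp
    also have "\<dots> = (\<integral>\<^sup>+x. \<integral>\<^sup>+y. (ennreal (q (x - y) * (u x * u y)) + ennreal (q (x - y) * (u (?s x) * u (?s y))))
      + (ennreal (q (x - ?s y) * (u x * u (?s y))) + ennreal (q (x - ?s y) * (u (?s x) * u y))) \<partial>lborel \<partial>lborel)"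
      by (simp add: nn_integral_add)
    also have "\<dots> = ?I (\<lambda>x y. q (x - y) * (u x * u y + u (?s x) * u (?s y))
     + q (x - ?s y) * (u x * u (?s y) + u (?s x) * u y))"
      using q0 u0 by (simp add: ennreal_plus[symmetric] distrib_left del: ennreal_plus)
    finally show ?thesis .
  qed
  have p0: "0 \<le> polarize e d v x" for x using v0 by (simp add: polarize_def min_def max_def)
  have "4 * kernel_form q v \<le> 4 * kernel_form q (polarize e d v)"
    unfolding four[OF \<open>v \<in> _\<close> v0] four[OF polarize_measurable[OF \<open>v \<in> _\<close>] p0]
    by (intro nn_integral_mono ennreal_leI polarize_kernel_pointwise e q)
  then show ?thesis
    by (subst (asm) ennreal_mult_le_mult_iff) auto
qed

section \<open>A compact class closed under polarization, and its radial member\<close>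

lemma ball_borel [measurable]: "ball x r \<in> sets borel" "cball x r \<in> sets borel"
  by simp_all

lemma lipschitz_imp_continuous:
  fixes v :: "'a::real_normed_vector \<Rightarrow> real"
  assumes L: "\<And>x y. \<bar>v x - v y\<bar> \<le> L * norm (x - y)"
  shows "continuous_on UNIV v"
proof -
  have "L * norm (x - y) \<le> \<bar>L\<bar> * norm (x - y)" for x y :: 'a
    by (intro mult_right_mono) auto
  then have "\<bar>L\<bar>-lipschitz_on UNIV v"
    using order_trans[OF L] by (intro lipschitz_onI) (auto simp: dist_norm)
  then show ?thesis by (rule lipschitz_on_continuous_on)
qed

lemma distr_lborel_reflect:
  assumes e: "norm (e::'a::euclidean_space) = 1"
  shows "distr lborel borel (reflect e d) = lborel"
proof (rule measure_eqI)
  fix A assume "A \<in> sets (distr lborel borel (reflect e d))"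
  then have [measurable]: "A \<in> sets borel" by simp
  have "emeasure (distr lborel borel (reflect e d)) A = (\<integral>\<^sup>+x. indicator A x \<partial>distr lborel borel (reflect e d))"
    by simp
  also have "\<dots> = (\<integral>\<^sup>+x. indicator A (reflect e d x) \<partial>lborel)"
    by (rule nn_integral_distr) auto
  also have "\<dots> = emeasure lborel A"
    by (subst nn_integral_lborel_reflection[OF e]) auto
  finally show "emeasure (distr lborel borel (reflect e d)) A = emeasure lborel A" .
qed simp

lemma integrable_lborel_bounded_support:
  fixes f :: "'a::euclidean_space \<Rightarrow> real"
  assumes "f \<in> borel_measurable borel" "\<And>x. \<bar>f x\<bar> \<le> K" "\<And>x. R < norm x \<Longrightarrow> f x = 0"
  shows "integrable lborel f"
  using assms emeasure_lborel_cball_finite[of "0::'a" R]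
  by (intro integrableI_bounded_set[where A="cball 0 R" and B=K]) (auto simp: not_le)

text \<open>The constraints are chosen to survive polarization as well as uniform limits, and they
  keep all that is needed of \<open>w\<close>: its L^2 norm, a lower bound for its kernel form and
  the size of its superlevel sets. The last constraint concerns only levels strictly below
  \<open>c\<close>, which leaves room for a uniform error.\<close>

definition polarization_class ::
  "real \<Rightarrow> real \<Rightarrow> real \<Rightarrow> ('a::euclidean_space \<Rightarrow> real) \<Rightarrow> ('a \<Rightarrow> real) \<Rightarrow> real \<Rightarrow> ennreal \<Rightarrow> ('a \<Rightarrow> real) set" where
  "polarization_class K L R q w c m = {v.
     (\<forall>x. 0 \<le> v x \<and> v x \<le> K) \<and> (\<forall>x y. \<bar>v x - v y\<bar> \<le> L * norm (x - y)) \<and> (\<forall>x. R < norm x \<longrightarrow> v x = 0) \<and>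
     kernel_form q w \<le> kernel_form q v \<and>
     (\<integral>\<^sup>+x. ennreal ((v x)\<^sup>2) \<partial>lborel) = (\<integral>\<^sup>+x. ennreal ((w x)\<^sup>2) \<partial>lborel) \<and>
     (\<forall>c'<c. m \<le> emeasure lborel {x. c' < v x})}"

lemma polarization_class_measurable:
  "v \<in> polarization_class K L R q w c m \<Longrightarrow> v \<in> borel_measurable borel"
  unfolding polarization_class_def
  by (intro borel_measurable_continuous_onI lipschitz_imp_continuous[of _ L]) auto

lemma polarize_in_class:
  assumes v: "v \<in> polarization_class K L R q w c m"
    and e: "norm e = 1" and d: "0 \<le> d" and L: "0 \<le> L"
    and q: "radial_decreasing q" "\<And>x. 0 \<le> q x" and [measurable]: "q \<in> borel_measurable borel"
  shows "polarize e d v \<in> polarization_class K L R q w c m"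
proof -
  note [measurable] = polarization_class_measurable[OF v]
  have v0: "\<And>x. 0 \<le> v x" and vK: "\<And>x. v x \<le> K" and vL: "\<And>x y. \<bar>v x - v y\<bar> \<le> L * norm (x - y)"
    and vR: "\<And>x. R < norm x \<Longrightarrow> v x = 0"
    and k: "kernel_form q w \<le> kernel_form q v"
    and s: "(\<integral>\<^sup>+x. ennreal ((v x)\<^sup>2) \<partial>lborel) = (\<integral>\<^sup>+x. ennreal ((w x)\<^sup>2) \<partial>lborel)"
    and l: "\<And>c'. c' < c \<Longrightarrow> m \<le> emeasure lborel {x. c' < v x}"
    using v unfolding polarization_class_def by auto
  \<comment> \<open>As \<open>0 \<le> d\<close>, a point on the side of the origin is reflected
    farther from the origin, so both values vanish. On the other side the minimum of 0 and a
    nonnegative value is 0.\<close>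
  have "polarize e d v x = 0" if x: "R < norm x" for x
  proof (cases "x \<bullet> e \<le> d")
    case True
    have "(norm x)\<^sup>2 \<le> (norm (0 - reflect e d x))\<^sup>2"
      unfolding norm_diff_reflect[OF e] using d True by (simp add: mult_nonneg_nonpos)
    then have "norm x \<le> norm (reflect e d x)" by (intro power2_le_imp_le[of "norm x"]) auto
    then show ?thesis using True x vR by (simp add: polarize_def)
  next
    case False
    then show ?thesis using x vR v0[of "reflect e d x"] by (simp add: polarize_def)
  qed
  moreover have "0 \<le> polarize e d v x \<and> polarize e d v x \<le> K" for x
    using v0 vK by (rule_tac polarize_pair[OF e, of d v x]) auto
  moreover have "\<bar>polarize e d v x - polarize e d v y\<bar> \<le> L * norm (x - y)" for x y
    by (rule polarize_lipschitz[OF e vL L])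
  moreover have "kernel_form q w \<le> kernel_form q (polarize e d v)"
    using k kernel_form_polarize[OF e _ _ q v0, where d=d] by (auto intro: order_trans)
  moreover have "(\<integral>\<^sup>+x. ennreal ((polarize e d v x)\<^sup>2) \<partial>lborel) = (\<integral>\<^sup>+x. ennreal ((w x)\<^sup>2) \<partial>lborel)"
    using nn_integral_polarize[OF e, of v "\<lambda>r. ennreal (r\<^sup>2)" d] s by simp
  moreover have "m \<le> emeasure lborel {x. c' < polarize e d v x}" if "c' < c" for c'
  proof -
    have "emeasure lborel {x. c' < u x} = (\<integral>\<^sup>+x. indicator {c'<..} (u x) \<partial>lborel)"
      if [measurable]: "u \<in> borel_measurable borel" for u :: "'a \<Rightarrow> real"
    proof -
      have "(\<integral>\<^sup>+x. indicator {c'<..} (u x) \<partial>lborel) = (\<integral>\<^sup>+x. indicator {x. c' < u x} x \<partial>lborel)"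
        by (intro nn_integral_cong) (simp split: split_indicator)
      then show ?thesis by simp
    qed
    then show ?thesis
      using l[OF that] nn_integral_polarize[OF e, of v "indicator {c'<..}" d] by simp
  qed
  ultimately show ?thesis unfolding polarization_class_def by auto
qed

lemma polarization_class_closed:
  fixes v :: "'a::euclidean_space \<Rightarrow> real" and u :: "nat \<Rightarrow> 'a \<Rightarrow> real"
  assumes u: "\<And>k. u k \<in> polarization_class K L R q w c m"
    and lim: "\<And>\<epsilon>. 0 < \<epsilon> \<Longrightarrow> \<exists>N. \<forall>k\<ge>N. \<forall>x. \<bar>u k x - v x\<bar> < \<epsilon>"
    and [measurable]: "q \<in> borel_measurable borel" and q0: "\<And>x. 0 \<le> q x"
    and q1: "(\<integral>\<^sup>+x. ennreal (q x) \<partial>lborel) < \<infinity>"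
  shows "v \<in> polarization_class K L R q w c m"
proof -
  note [measurable] = polarization_class_measurable[OF u]
  have u0: "\<And>k x. 0 \<le> u k x" and uK: "\<And>k x. u k x \<le> K" and uL: "\<And>k x y. \<bar>u k x - u k y\<bar> \<le> L * norm (x - y)"
    and uR: "\<And>k x. R < norm x \<Longrightarrow> u k x = 0"
    and uk: "\<And>k. kernel_form q w \<le> kernel_form q (u k)"
    and us: "\<And>k. (\<integral>\<^sup>+x. ennreal ((u k x)\<^sup>2) \<partial>lborel) = (\<integral>\<^sup>+x. ennreal ((w x)\<^sup>2) \<partial>lborel)"
    and ul: "\<And>k c'. c' < c \<Longrightarrow> m \<le> emeasure lborel {x. c' < u k x}"
    using u unfolding polarization_class_def by auto
  have pt: "(\<lambda>k. u k x) \<longlonglongrightarrow> v x" for x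
    by (rule LIMSEQ_I) (use lim in \<open>auto, blast\<close>)
  have v0: "0 \<le> v x" and vK: "v x \<le> K" for x
    using LIMSEQ_le_const[OF pt] LIMSEQ_le_const2[OF pt] u0 uK by blast+
  have K0: "0 \<le> K" using v0[of 0] vK[of 0] by simp
  have vL: "\<bar>v x - v y\<bar> \<le> L * norm (x - y)" for x y
    by (rule LIMSEQ_le_const2[OF tendsto_rabs[OF tendsto_diff[OF pt pt]]]) (use uL in blast)
  have vR: "v x = 0" if "R < norm x" for x
    using pt[of x] uR[OF that] by (simp add: LIMSEQ_const_iff)
  have [measurable]: "v \<in> borel_measurable borel"
    by (intro borel_measurable_continuous_onI lipschitz_imp_continuous[of _ L] vL)
  have sq: "(\<lambda>k. \<integral>\<^sup>+x. ennreal ((u k x)\<^sup>2) \<partial>lborel) \<longlonglongrightarrow> (\<integral>\<^sup>+x. ennreal ((v x)\<^sup>2) \<partial>lborel)"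
  proof (rule nn_integral_dominated_convergence[where w="\<lambda>x. ennreal (K\<^sup>2) * indicator (cball 0 R) x"])
    show "(\<integral>\<^sup>+(x::'a). ennreal (K\<^sup>2) * indicator (cball 0 R) x \<partial>lborel) < \<infinity>"
      using emeasure_lborel_cball_finite[of "0::'a" R]
      by (subst nn_integral_cmult_indicator) (auto simp: ennreal_mult_less_top)
    show "AE x in lborel. (\<lambda>k. ennreal ((u k x)\<^sup>2)) \<longlonglongrightarrow> ennreal ((v x)\<^sup>2)"
      by (intro AE_I2 tendsto_intros tendsto_ennrealI pt)
    show "AE x in lborel. ennreal ((u k x)\<^sup>2) \<le> ennreal (K\<^sup>2) * indicator (cball 0 R) x" for k
      using u0 uK uR by (intro AE_I2) (auto split: split_indicator intro!: ennreal_leI power_mono)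
  qed (measurable)
  have kf: "(\<lambda>k. kernel_form q (u k)) \<longlonglongrightarrow> kernel_form q v"
  proof -
    have tr: "(\<integral>\<^sup>+y. ennreal (q (x - y)) \<partial>lborel) = (\<integral>\<^sup>+y. ennreal (q y) \<partial>lborel)" for x
      using nn_integral_lborel_reflect[of "\<lambda>y. ennreal (q y)" x] by simp
    have bd: "ennreal (q (x - y) * (u k x * u k y)) \<le> ennreal (K\<^sup>2) * indicator (cball 0 R) x * ennreal (q (x - y))" for k x y
    proof (cases "norm x \<le> R")
      case True
      have "u k x * u k y \<le> K\<^sup>2"
        unfolding power2_eq_square by (intro mult_mono uK u0 K0)
      then have "q (x - y) * (u k x * u k y) \<le> q (x - y) * K\<^sup>2"
        using q0 by (rule mult_left_mono)
      then show ?thesis using True q0 by (simp add: ennreal_mult[symmetric] ennreal_leI mult.commute)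
    next
      case False then show ?thesis using uR by simp
    qed
    have inner: "(\<lambda>k. \<integral>\<^sup>+y. ennreal (q (x - y) * (u k x * u k y)) \<partial>lborel) \<longlonglongrightarrow> (\<integral>\<^sup>+y. ennreal (q (x - y) * (v x * v y)) \<partial>lborel)" for x
    proof (rule nn_integral_dominated_convergence[where w="\<lambda>y. ennreal (K\<^sup>2) * indicator (cball 0 R) x * ennreal (q (x - y))"])
      show "(\<integral>\<^sup>+y. ennreal (K\<^sup>2) * indicator (cball 0 R) x * ennreal (q (x - y)) \<partial>lborel) < \<infinity>"
        using q1 by (subst nn_integral_cmult) (auto simp: tr ennreal_mult_less_top split: split_indicator)
      show "AE y in lborel. (\<lambda>k. ennreal (q (x - y) * (u k x * u k y))) \<longlonglongrightarrow> ennreal (q (x - y) * (v x * v y))"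
        by (intro AE_I2 tendsto_intros tendsto_ennrealI pt)
      show "AE y in lborel. ennreal (q (x - y) * (u k x * u k y)) \<le> ennreal (K\<^sup>2) * indicator (cball 0 R) x * ennreal (q (x - y))" for k
        by (intro AE_I2 bd)
    qed (measurable)
    show ?thesis unfolding kernel_form_def
    proof (rule nn_integral_dominated_convergence[where w="\<lambda>x. ennreal (K\<^sup>2) * (\<integral>\<^sup>+y. ennreal (q y) \<partial>lborel) * indicator (cball 0 R) x"])
      show "(\<integral>\<^sup>+(x::'a). ennreal (K\<^sup>2) * (\<integral>\<^sup>+y. ennreal (q y) \<partial>lborel) * indicator (cball 0 R) x \<partial>lborel) < \<infinity>"
        using emeasure_lborel_cball_finite[of "0::'a" R] q1
        by (subst nn_integral_cmult_indicator) (auto simp: ennreal_mult_less_top)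
      show "AE x in lborel. (\<integral>\<^sup>+y. ennreal (q (x - y) * (u k x * u k y)) \<partial>lborel)
          \<le> ennreal (K\<^sup>2) * (\<integral>\<^sup>+y. ennreal (q y) \<partial>lborel) * indicator (cball 0 R) x" for k
      proof (rule AE_I2)
        fix x :: 'a
        have "(\<integral>\<^sup>+y. ennreal (q (x - y) * (u k x * u k y)) \<partial>lborel)
           \<le> (\<integral>\<^sup>+y. ennreal (K\<^sup>2) * indicator (cball 0 R) x * ennreal (q (x - y)) \<partial>lborel)"
          by (intro nn_integral_mono bd)
        also have "\<dots> = ennreal (K\<^sup>2) * (\<integral>\<^sup>+y. ennreal (q y) \<partial>lborel) * indicator (cball 0 R) x"
          by (subst nn_integral_cmult) (auto simp: tr mult_ac)
        finally show "(\<integral>\<^sup>+y. ennreal (q (x - y) * (u k x * u k y)) \<partial>lborel)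
          \<le> ennreal (K\<^sup>2) * (\<integral>\<^sup>+y. ennreal (q y) \<partial>lborel) * indicator (cball 0 R) x" .
      qed
    qed (use inner in \<open>auto\<close>)
  qed
  have "kernel_form q w \<le> kernel_form q v"
    by (rule LIMSEQ_le_const[OF kf]) (use uk in blast)
  moreover have "(\<integral>\<^sup>+x. ennreal ((v x)\<^sup>2) \<partial>lborel) = (\<integral>\<^sup>+x. ennreal ((w x)\<^sup>2) \<partial>lborel)"
    using sq unfolding us by (simp add: LIMSEQ_const_iff)
  moreover have "m \<le> emeasure lborel {x. c' < v x}" if c': "c' < c" for c'
  proof -
    \<comment> \<open>Half of the gap between \<open>c'\<close> and \<open>c\<close> absorbs the
      uniform distance between \<open>v\<close> and some \<open>u N\<close>.\<close>
    define \<epsilon> where "\<epsilon> = (c - c') / 2"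
    have e: "0 < \<epsilon>" "c' + \<epsilon> < c" using c' by (auto simp: \<epsilon>_def field_simps)
    obtain N where N: "\<And>x. \<bar>u N x - v x\<bar> < \<epsilon>" using lim[OF e(1)] by auto
    have "m \<le> emeasure lborel {x. c' + \<epsilon> < u N x}" by (rule ul[OF e(2)])
    also have "\<dots> \<le> emeasure lborel {x. c' < v x}"
      by (rule emeasure_mono) (use N in \<open>auto simp: abs_less_iff, smt (verit)\<close>)
    finally show ?thesis .
  qed
  ultimately show ?thesis
    unfolding polarization_class_def using v0 vK vL vR by auto
qed

text \<open>The Gaussian weight is strictly larger on the side of the origin, so moving larger
  values there raises the weighted integral unless nothing moves. Pairing mirror images writes twice
  the increase as the integral of a nonnegative continuous \<open>h\<close>; it vanishes almost
  everywhere, hence everywhere, and off the mirror the weights at a point and its image differ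
  because \<open>d \<noteq> 0\<close>.\<close>

lemma polarize_eq_if_weight_le:
  fixes v :: "'a::euclidean_space \<Rightarrow> real"
  assumes v: "v \<in> polarization_class K L R q w c m" and L: "0 \<le> L"
    and q: "radial_decreasing q" "\<And>x. 0 \<le> q x" and q': "q \<in> borel_measurable borel"
    and e: "norm e = 1" and d: "0 < d"
    and le: "(\<integral>x. polarize e d v x * exp (- (norm x)\<^sup>2) \<partial>lborel) \<le> (\<integral>x. v x * exp (- (norm x)\<^sup>2) \<partial>lborel)"
    and x: "x \<bullet> e \<noteq> d"
  shows "polarize e d v x = v x"
proof -
  let ?p = "\<lambda>x::'a. exp (- (norm x)\<^sup>2)" and ?s = "reflect e d"
  define D where "D x = polarize e d v x - v x" for x
  have pv: "polarize e d v \<in> polarization_class K L R q w c m"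
    using polarize_in_class[OF v e _ L q q'] d by simp
  have int: "integrable lborel (\<lambda>x. u x * ?p x)" if u: "u \<in> polarization_class K L R q w c m" for u
  proof (rule integrable_lborel_bounded_support[where K=K and R=R])
    show "(\<lambda>x. u x * ?p x) \<in> borel_measurable borel"
      using polarization_class_measurable[OF u] by measurable
    show "\<bar>u x * ?p x\<bar> \<le> K" for x
    proof -
      have "0 \<le> u x" "u x \<le> K" using u by (auto simp: polarization_class_def)
      then have "u x * ?p x \<le> K * 1" by (intro mult_mono) auto
      then show ?thesis using \<open>0 \<le> u x\<close> by simp
    qed
    show "u x * ?p x = 0" if "R < norm x" for x
      using u that by (auto simp: polarization_class_def)
  qed
  have Di: "integrable lborel (\<lambda>x. D x * ?p x)"
    unfolding D_def left_diff_distrib by (intro Bochner_Integration.integrable_diff int v pv)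
  have Dm[measurable]: "(\<lambda>x. D x * ?p x) \<in> borel_measurable borel"
    using borel_measurable_integrable[OF Di] by simp
  have Ds: "D (?s x) = - D x" for x
    unfolding D_def by (rule polarize_pair[OF e, of d v x]) (auto simp: e)
  have Di': "integrable lborel (\<lambda>x. D x * ?p (?s x))" and DI: "(\<integral>x. D x * ?p (?s x) \<partial>lborel) = - (\<integral>x. D x * ?p x \<partial>lborel)"
  proof -
    have "integrable (distr lborel borel ?s) (\<lambda>x. D x * ?p x)"
      using Di by (simp add: distr_lborel_reflect[OF e])
    then have "integrable lborel (\<lambda>x. D (?s x) * ?p (?s x))"
      by (subst (asm) integrable_distr_eq) auto
    then show "integrable lborel (\<lambda>x. D x * ?p (?s x))" by (simp add: Ds)
    have "(\<integral>x. D x * ?p x \<partial>lborel) = (\<integral>x. D x * ?p x \<partial>distr lborel borel ?s)"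
      by (simp add: distr_lborel_reflect[OF e])
    also have "\<dots> = (\<integral>x. D (?s x) * ?p (?s x) \<partial>lborel)"
      by (rule integral_distr) auto
    finally show "(\<integral>x. D x * ?p (?s x) \<partial>lborel) = - (\<integral>x. D x * ?p x \<partial>lborel)" by (simp add: Ds)
  qed
  define h where "h x = D x * (?p x - ?p (?s x))" for x
  have hi: "integrable lborel h"
    unfolding h_def right_diff_distrib by (intro Bochner_Integration.integrable_diff Di Di')
  have h0: "0 \<le> h x" for x
  proof (cases "x \<bullet> e \<le> d")
    case True
    have "(norm (x - 0))\<^sup>2 \<le> (norm (0 - reflect e d x))\<^sup>2"
      unfolding norm_diff_reflect[OF e] using d True by (simp add: mult_nonneg_nonpos)
    then show ?thesis unfolding h_def D_def polarize_def using True by (intro mult_nonneg_nonneg) auto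
  next
    case False
    have "(norm (0 - reflect e d x))\<^sup>2 \<le> (norm (x - 0))\<^sup>2"
      unfolding norm_diff_reflect[OF e] using d False by (simp add: mult_nonneg_nonneg)
    then show ?thesis unfolding h_def D_def polarize_def using False by (intro mult_nonpos_nonpos) auto
  qed
  have "(\<integral>x. h x \<partial>lborel) = 2 * (\<integral>x. D x * ?p x \<partial>lborel)"
    unfolding h_def right_diff_distrib using Di Di' DI by simp
  moreover have "(\<integral>x. D x * ?p x \<partial>lborel) \<le> 0"
    unfolding D_def left_diff_distrib using int[OF v] int[OF pv] le by simp
  moreover have "0 \<le> (\<integral>x. h x \<partial>lborel)" using h0 by simp
  ultimately have "(\<integral>x. h x \<partial>lborel) = 0" by linarith
  then have ae: "AE x in lborel. h x = 0"
    using integral_nonneg_eq_0_iff_AE[OF hi] h0 by simp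
  have cont: "continuous_on UNIV u" if "u \<in> polarization_class K L R q w c m" for u
    using that unfolding polarization_class_def by (intro lipschitz_imp_continuous[of _ L]) auto
  have "continuous_on UNIV h"
    unfolding h_def D_def by (intro continuous_intros cont v pv reflect_continuous)
  then have "closed {x. h x = 0}"
    using continuous_closed_vimage[of "{0}" h] by (simp add: vimage_def continuous_on_eq_continuous_at)
  moreover have "AE x in lebesgue. x \<in> {x. h x = 0}"
    using AE_completion[OF ae] by simp
  ultimately have "h x = 0" using mem_closed_if_AE_lebesgue by blast
  moreover have "?p x \<noteq> ?p (?s x)"
  proof
    assume "?p x = ?p (?s x)"
    then have "(norm (x - 0))\<^sup>2 = (norm (0 - ?s x))\<^sup>2" by simp
    then show False using x d unfolding norm_diff_reflect[OF e] by simp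
  qed
  ultimately show ?thesis by (simp add: h_def D_def)
qed

text \<open>For \<open>norm x < norm y\<close> the mirror is the perpendicular bisector of
  \<open>x\<close> and \<open>y\<close>. The origin lies strictly on the side of \<open>x\<close>,
  whence \<open>0 < d\<close>, and the reflection takes \<open>x\<close> to \<open>y\<close>, so
  being fixed forces \<open>v y \<le> v x\<close>. Equal norms follow by continuity, replacing
  \<open>y\<close> by \<open>(1 + t) *\<^sub>R y\<close>.\<close>

lemma radial_decreasing_if_polarize_eq:
  fixes v :: "'a::euclidean_space \<Rightarrow> real"
  assumes L: "\<And>x y. \<bar>v x - v y\<bar> \<le> L * norm (x - y)"
    and p: "\<And>e d x. norm e = 1 \<Longrightarrow> 0 < d \<Longrightarrow> x \<bullet> e \<noteq> d \<Longrightarrow> polarize e d v x = v x"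
  shows "radial_decreasing v"
proof -
  have lt: "v y \<le> v x" if xy: "norm x < norm y" for x y
  proof -
    define n where "n = norm (y - x)"
    have n: "0 < n" using xy by (auto simp: n_def)
    define e where "e = (1 / n) *\<^sub>R (y - x)"
    define d where "d = ((norm y)\<^sup>2 - (norm x)\<^sup>2) / (2 * n)"
    have e: "norm e = 1" using n by (simp add: e_def n_def)
    have d: "0 < d" unfolding d_def using n xy by (simp add: power_strict_mono)
    have "n * n = (norm y)\<^sup>2 + (norm x)\<^sup>2 - 2 * (x \<bullet> y)"
      unfolding n_def power2_eq_square[symmetric] power2_norm_eq_inner
      by (simp add: inner_diff_left inner_diff_right inner_commute)
    moreover have "x \<bullet> e = (x \<bullet> y - (norm x)\<^sup>2) / n"
      by (simp add: e_def inner_diff_right power2_norm_eq_inner)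
    ultimately have xe: "x \<bullet> e - d = - n / 2"
      using n by (simp add: d_def field_simps)
    have "reflect e d x = y"
      unfolding reflect_def xe using n by (simp add: e_def)
    then have "polarize e d v x = max (v x) (v y)"
      using xe n by (simp add: polarize_def)
    then show ?thesis using p[OF e d, of x] xe n by simp
  qed
  show ?thesis unfolding radial_decreasing_def
  proof (intro allI impI)
    fix x y :: 'a assume xy: "norm x \<le> norm y"
    show "v y \<le> v x"
    proof (cases "x = 0 \<or> norm x < norm y")
      case True
      then show ?thesis using lt[of x y] by (cases "y = 0") auto
    next
      case False
      then have y: "y \<noteq> 0" and eq: "norm x = norm y" using xy by auto
      show ?thesis
      proof (rule field_le_epsilon)
        fix \<epsilon> :: real assume \<epsilon>: "0 < \<epsilon>"
        define t where "t = \<epsilon> / ((\<bar>L\<bar> + 1) * norm y)"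
        have t: "0 < t" using \<epsilon> y by (simp add: t_def)
        have "norm x < norm ((1 + t) *\<^sub>R y)" using t y eq by simp
        then have "v ((1 + t) *\<^sub>R y) \<le> v x" by (rule lt)
        moreover have "\<bar>v y - v ((1 + t) *\<^sub>R y)\<bar> \<le> \<epsilon>"
        proof -
          have "y - (1 + t) *\<^sub>R y = - (t *\<^sub>R y)" by (simp add: algebra_simps)
          then have "norm (y - (1 + t) *\<^sub>R y) = t * norm y" using t by simp
          then have "\<bar>v y - v ((1 + t) *\<^sub>R y)\<bar> \<le> L * (t * norm y)" using L[of y "(1 + t) *\<^sub>R y"] by simp
          also have "\<dots> \<le> (\<bar>L\<bar> + 1) * (t * norm y)"
            using t by (intro mult_right_mono) auto
          also have "\<dots> = \<epsilon>"
          proof -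
            have "\<bar>L\<bar> + 1 \<noteq> 0" "norm y \<noteq> 0" using y by auto
            then show ?thesis unfolding t_def by (simp only: times_divide_eq_right times_divide_eq_left
               mult.left_commute[of _ \<epsilon>] nonzero_mult_div_cancel_right mult.commute[of \<epsilon>] mult.assoc[symmetric]) simp
          qed
          finally show ?thesis .
        qed
        ultimately show "v y \<le> v x + \<epsilon>" by linarith
      qed
    qed
  qed
qed

text \<open>A maximizer of \<open>F\<close> exists by Arzela-Ascoli, and since polarization stays in
  the class it cannot increase \<open>F\<close>; by \<open>polarize_eq_if_weight_le\<close> the
  maximizer is then fixed by all polarizations with \<open>0 < d\<close>. No sequence of
  polarizations has to be shown to converge.\<close>

theorem exists_symmetrization:
  fixes w q :: "'a::euclidean_space \<Rightarrow> real"
  assumes w: "\<And>x. 0 \<le> w x" "\<And>x. w x \<le> K" "\<And>x y. \<bar>w x - w y\<bar> \<le> L * norm (x - y)" "\<And>x. R < norm x \<Longrightarrow> w x = 0"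
    and L: "0 \<le> L"
    and q: "radial_decreasing q" "\<And>x. 0 \<le> q x" and [measurable]: "q \<in> borel_measurable borel"
    and q1: "(\<integral>\<^sup>+x. ennreal (q x) \<partial>lborel) < \<infinity>"
    and m: "\<And>c'. c' < c \<Longrightarrow> m \<le> emeasure lborel {x. c' < w x}"
  obtains v where "v \<in> polarization_class K L R q w c m" "radial_decreasing v"
proof -
  let ?A = "polarization_class K L R q w c m"
  define F where "F v = (\<integral>x. v x * exp (- (norm x)\<^sup>2) \<partial>lborel)" for v :: "'a \<Rightarrow> real"
  have wA: "w \<in> ?A" using w m unfolding polarization_class_def by auto
  let ?G = "\<lambda>x. K * indicator (cball 0 R) (x::'a)"
  have K0: "0 \<le> K" using w(1,2)[of 0] by simp
  have G: "integrable lborel ?G"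
    by (rule integrable_lborel_bounded_support[where K=K and R=R]) (auto simp: K0 split: split_indicator)
  have Gb: "norm (v x * exp (- (norm x)\<^sup>2)) \<le> ?G x" if "v \<in> ?A" for v x
  proof -
    have v: "0 \<le> v x" "v x \<le> K" "R < norm x \<Longrightarrow> v x = 0" using that by (auto simp: polarization_class_def)
    have "v x * exp (- (norm x)\<^sup>2) \<le> K * 1" using v by (intro mult_mono) auto
    then show ?thesis using v by (auto split: split_indicator)
  qed
  have Fb: "F v \<le> (\<integral>x. ?G x \<partial>lborel)" if "v \<in> ?A" for v
  proof -
    have "norm (F v) \<le> (\<integral>x. ?G x \<partial>lborel)"
      unfolding F_def using polarization_class_measurable[OF that] Gb[OF that]
      by (intro Bochner_Integration.integral_norm_bound_integral[OF _ G] Bochner_Integration.integrable_bound[OF G])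
        (auto intro: order_trans[OF _ abs_ge_self])
    then show ?thesis by simp
  qed
  define S where "S = Sup (F ` ?A)"
  have bdd: "bdd_above (F ` ?A)" by (intro bdd_aboveI2[of _ _ "\<integral>x. ?G x \<partial>lborel"] Fb)
  have "\<exists>v\<in>?A. S - 1 / (k + 1) < F v" for k :: nat
  proof -
    have "S - 1 / (k + 1) < S" by simp
    then show ?thesis unfolding S_def using wA bdd by (subst (asm) less_cSup_iff) auto
  qed
  then obtain u :: "nat \<Rightarrow> 'a \<Rightarrow> real"
    where u: "\<And>k. u k \<in> ?A" "\<And>k. S - 1 / real (k + 1) < F (u k)" by metis
  have ub: "\<And>k x. 0 \<le> u k x" "\<And>k x. u k x \<le> K" "\<And>k x y. \<bar>u k x - u k y\<bar> \<le> L * norm (x - y)" "\<And>k x. R < norm x \<Longrightarrow> u k x = 0"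
    using u(1) unfolding polarization_class_def by auto
  obtain g k where k: "strict_mono (k :: nat \<Rightarrow> nat)"
    and g: "\<And>\<epsilon>. 0 < \<epsilon> \<Longrightarrow> \<exists>N. \<forall>n x. n \<ge> N \<and> x \<in> cball 0 R \<longrightarrow> norm (u (k n) x - g x) < \<epsilon>"
  proof (rule Arzela_Ascoli[of "cball (0::'a) R" u K])
    show "compact (cball (0::'a) R)" by simp
    show "norm (u n x) \<le> K" for n x using ub(1,2)[of n x] by simp
    show "\<exists>d>0. \<forall>n y. y \<in> cball 0 R \<and> norm (x - y) < d \<longrightarrow> norm (u n x - u n y) < \<epsilon>" if "0 < \<epsilon>" for x \<epsilon>
    proof (intro exI[of _ "\<epsilon> / (L + 1)"] conjI allI impI)
      show "0 < \<epsilon> / (L + 1)" using that L by simp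
      fix n y assume "y \<in> cball 0 R \<and> norm (x - y) < \<epsilon> / (L + 1)"
      then have *: "norm (x - y) * (L + 1) < \<epsilon>" using L by (simp add: field_simps)
      have "\<bar>u n x - u n y\<bar> \<le> L * norm (x - y)" by (rule ub)
      also have "\<dots> \<le> norm (x - y) * (L + 1)" by (simp add: algebra_simps)
      finally show "norm (u n x - u n y) < \<epsilon>" using * by simp
    qed
  qed blast
  \<comment> \<open>Arzela-Ascoli determines the limit \<open>g\<close> on the ball only; outside,
    all members of the class are 0.\<close>
  define v where "v x = (if norm x \<le> R then g x else 0)" for x
  have lim: "\<exists>N. \<forall>n\<ge>N. \<forall>x. \<bar>u (k n) x - v x\<bar> < \<epsilon>" if \<epsilon>: "0 < \<epsilon>" for \<epsilon>
  proof -
    obtain N where N: "\<And>n x. n \<ge> N \<Longrightarrow> norm x \<le> R \<Longrightarrow> norm (u (k n) x - g x) < \<epsilon>" using g[OF \<epsilon>] by auto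
    have "\<bar>u (k n) x - v x\<bar> < \<epsilon>" if "n \<ge> N" for n x
      using N[OF that, of x] ub(4)[of x] \<epsilon> by (cases "norm x \<le> R") (auto simp: v_def)
    then show ?thesis by blast
  qed
  have vA: "v \<in> ?A"
    by (rule polarization_class_closed[where u="\<lambda>n. u (k n)"]) (use u lim q q1 in auto)
  have pt: "(\<lambda>n. u (k n) x) \<longlonglongrightarrow> v x" for x
    by (rule LIMSEQ_I) (use lim in \<open>auto, blast\<close>)
  have FS: "F v = S"
  proof (rule LIMSEQ_unique)
    show "(\<lambda>n. F (u (k n))) \<longlonglongrightarrow> F v"
      unfolding F_def
    proof (rule integral_dominated_convergence[OF _ _ G])
      show "AE x in lborel. (\<lambda>n. u (k n) x * exp (- (norm x)\<^sup>2)) \<longlonglongrightarrow> v x * exp (- (norm x)\<^sup>2)"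
        by (intro AE_I2 tendsto_intros pt)
      show "AE x in lborel. norm (u (k n) x * exp (- (norm x)\<^sup>2)) \<le> ?G x" for n
        by (intro AE_I2 Gb u)
    qed (use polarization_class_measurable[OF u(1)] polarization_class_measurable[OF vA] in auto)
    show "(\<lambda>n. F (u (k n))) \<longlonglongrightarrow> S"
    proof (rule tendsto_sandwich[OF _ _ _ tendsto_const])
      show "\<forall>\<^sub>F n in sequentially. S - 1 / (real (k n) + 1) \<le> F (u (k n))"
        using less_imp_le[OF u(2)] by (intro always_eventually allI) (simp add: add.commute)
      show "\<forall>\<^sub>F n in sequentially. F (u (k n)) \<le> S"
        unfolding S_def using u(1) bdd by (intro always_eventually allI cSUP_upper) auto
      have "(\<lambda>n. S - 1 / (real n + 1)) \<longlonglongrightarrow> S - 0"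
        using LIMSEQ_inverse_real_of_nat by (intro tendsto_intros) (simp add: inverse_eq_divide add.commute)
      from LIMSEQ_subseq_LIMSEQ[OF this k] show "(\<lambda>n. S - 1 / (real (k n) + 1)) \<longlonglongrightarrow> S"
        by (simp add: o_def)
    qed
  qed
  have "polarize e d v x = v x" if e: "norm e = 1" and d: "0 < d" and x: "x \<bullet> e \<noteq> d" for e d x
  proof (rule polarize_eq_if_weight_le[OF vA L q _ e d _ x])
    have "polarize e d v \<in> ?A"
      using polarize_in_class[OF vA e _ L q] d by simp
    then show "(\<integral>x. polarize e d v x * exp (- (norm x)\<^sup>2) \<partial>lborel) \<le> (\<integral>x. v x * exp (- (norm x)\<^sup>2) \<partial>lborel)"
      unfolding F_def[symmetric] FS unfolding S_def using bdd by (intro cSUP_upper)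
  qed simp
  moreover have "\<bar>v x - v y\<bar> \<le> L * norm (x - y)" for x y using vA unfolding polarization_class_def by auto
  ultimately have "radial_decreasing v" by (intro radial_decreasing_if_polarize_eq)
  then show thesis using that vA by blast
qed

section \<open>Heat operators and binomial series\<close>

text \<open>\<open>cbin k = binomial (2 * k) k / 4 ^ k\<close>, the coefficients of \<open>(1 - X) powr (-1/2)\<close>.\<close>
fun cbin :: "nat \<Rightarrow> real" where
  "cbin 0 = 1"
| "cbin (Suc k) = cbin k * (2 * real k + 1) / (2 * real k + 2)"

lemma cbin_pos: "0 < cbin k"
  by (induction k) auto

lemma cbin_Suc_le: "cbin (Suc k) \<le> cbin k"
  using cbin_pos[of k] by (simp add: field_simps)

lemma cbin_antimono: "i \<le> j \<Longrightarrow> cbin j \<le> cbin i"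
  by (rule lift_Suc_antimono_le[of cbin]) (rule cbin_Suc_le)

lemma cbin_le_1: "cbin k \<le> 1"
  using cbin_antimono[of 0 k] by simp

lemma cbin_gbinomial: "cbin k = (- 1) ^ k * ((- 1 / 2) gchoose k)"
proof (induction k)
  case (Suc k)
  have "(- 1 / 2) * ((- 1 / 2 :: real) gchoose k) = real k * ((- 1 / 2) gchoose k) + real (Suc k) * ((- 1 / 2) gchoose Suc k)"
    by (rule gbinomial_mult_1)
  then have "((- 1 / 2 :: real) gchoose Suc k) * (2 * real k + 2) = - ((- 1 / 2) gchoose k) * (2 * real k + 1)"
    by (simp add: algebra_simps)
  then have "((- 1 / 2 :: real) gchoose Suc k) = - ((- 1 / 2) gchoose k) * (2 * real k + 1) / (2 * real k + 2)"
    by (subst nonzero_eq_divide_eq) auto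
  then show ?case using Suc.IH by simp
qed simp

text \<open>The square of (1 - X)^(-1/2) is the geometric series. In coefficients this is
  Vandermonde with -1/2 - 1/2 = -1.\<close>

lemma cbin_convolution: "(\<Sum>j\<le>i. cbin j * cbin (i - j)) = 1"
proof -
  have "(\<Sum>j\<le>i. cbin j * cbin (i - j)) = (\<Sum>j\<le>i. (- 1) ^ i * (((- 1 / 2) gchoose j) * ((- 1 / 2) gchoose (i - j))))"
  proof (rule sum.cong[OF refl])
    fix j assume "j \<in> {..i}"
    then have "(- 1 :: real) ^ i = (- 1) ^ j * (- 1) ^ (i - j)" by (simp flip: power_add)
    then show "cbin j * cbin (i - j) = (- 1) ^ i * (((- 1 / 2) gchoose j) * ((- 1 / 2) gchoose (i - j)))"
      by (simp add: cbin_gbinomial)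
  qed
  also have "\<dots> = (- 1) ^ i * ((- 1 / 2 + - 1 / 2) gchoose i)"
    unfolding sum_distrib_left[symmetric] gbinomial_Vandermonde[symmetric] by (simp add: atMost_atLeast0)
  also have "\<dots> = 1"
    using gbinomial_minus[of "1::real" i] by (simp add: binomial_gbinomial[symmetric] power_mult_distrib[symmetric])
  finally show ?thesis .
qed

text \<open>Let A be the power series of \<open>cbin\<close>. The series with coefficient
  \<open>cbin j - cbin (Suc j)\<close> at X^(j+1) is B = 1 - (1 - X) A, and A^2 = 1 / (1 - X) gives
  A B = A - 1, which is the claim coefficient by coefficient.\<close>

lemma cbin_renewal: "cbin i = (if i = 0 then 1 else (\<Sum>j<i. (cbin j - cbin (Suc j)) * cbin (i - Suc j)))"
proof (cases i)
  case (Suc n)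
  have "(\<Sum>j<i. cbin j * cbin (i - Suc j)) = 1"
    using cbin_convolution[of n] by (simp add: Suc lessThan_Suc_atMost)
  moreover have "(\<Sum>j<i. cbin (Suc j) * cbin (i - Suc j)) = 1 - cbin i"
    using cbin_convolution[of i] by (simp add: Suc sum.atMost_Suc_shift lessThan_Suc_atMost del: sum.atMost_Suc cbin.simps(2))
  ultimately show ?thesis by (simp add: Suc left_diff_distrib sum_subtractf)
qed simp

text \<open>The constant is \<open>pi\<close> (Wallis), but its value does not matter.\<close>
lemma cbin_asymptotics:
  obtains om :: real where "0 < om" "\<And>k. om * (cbin k)\<^sup>2 * real k \<le> 1" "\<And>k. 1 \<le> om * (cbin k)\<^sup>2 * (real k + 1 / 2)"
proof -
  define X where "X k = (cbin k)\<^sup>2 * real k" for k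
  define Y where "Y k = (cbin k)\<^sup>2 * (real k + 1 / 2)" for k
  define r where "r k = (2 * real k + 1) / (2 * real k + 2)" for k
  have r: "cbin (Suc k) = cbin k * r k" for k by (simp add: r_def)
  have "X k \<le> X (Suc k)" for k
  proof -
    have "(2 * real k + 2)\<^sup>2 * real k \<le> (2 * real k + 1)\<^sup>2 * (real k + 1)"
      by (simp add: power2_eq_square algebra_simps)
    then have "real k \<le> ((2 * real k + 1) / (2 * real k + 2))\<^sup>2 * (real k + 1)"
      by (simp add: power_divide field_simps)
    then have "(cbin k)\<^sup>2 * real k \<le> (cbin k)\<^sup>2 * (((2 * real k + 1) / (2 * real k + 2))\<^sup>2 * (real k + 1))"
      by (rule mult_left_mono) simp
    then show ?thesis unfolding r_def[symmetric] X_def r by (simp only: power_mult_distrib of_nat_Suc ac_simps)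
  qed
  then have X: "X i \<le> X j" if "i \<le> j" for i j using that by (rule lift_Suc_mono_le)
  have "Y (Suc k) \<le> Y k" for k
  proof -
    have "(2 * real k + 1)\<^sup>2 * (real k + 3 / 2) \<le> (2 * real k + 2)\<^sup>2 * (real k + 1 / 2)"
      by (simp add: power2_eq_square algebra_simps)
    then have "((2 * real k + 1) / (2 * real k + 2))\<^sup>2 * (real k + 3 / 2) \<le> real k + 1 / 2"
      by (simp add: power_divide divide_le_eq mult.commute)
    then have "(cbin k)\<^sup>2 * (((2 * real k + 1) / (2 * real k + 2))\<^sup>2 * (real k + 3 / 2)) \<le> (cbin k)\<^sup>2 * (real k + 1 / 2)"
      by (rule mult_left_mono) simp
    then show ?thesis unfolding r_def[symmetric] Y_def r
      by (simp only: power_mult_distrib of_nat_Suc mult.assoc) (simp add: algebra_simps)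
  qed
  then have Y: "Y j \<le> Y i" if "i \<le> j" for i j using that by (rule lift_Suc_antimono_le)
  have XY: "X i \<le> Y j" for i j
  proof -
    have "X (max i j) \<le> Y (max i j)" by (simp add: X_def Y_def mult_left_mono)
    then show ?thesis using X[of i "max i j"] Y[of j "max i j"] by simp
  qed
  \<comment> \<open>\<open>X\<close> increases, \<open>Y\<close> decreases and \<open>X\<close>
    stays below \<open>Y\<close>, so one number separates them; \<open>om\<close> is its reciprocal.
    The summand 1/2 in \<open>Y\<close> reappears as the offset \<open>\<epsilon> / 2\<close> of the
    time in the comparison with integrals.\<close>
  define l where "l = Sup (range X)"
  have bdd: "bdd_above (range X)" using XY[of _ 0] by (intro bdd_aboveI2)
  have Xl: "X k \<le> l" and lY: "l \<le> Y k" for k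
    unfolding l_def using bdd XY by (auto intro: cSUP_upper cSUP_least)
  have l: "0 < l" using Xl[of 1] by (simp add: X_def power2_eq_square)
  show thesis
  proof (rule that[of "1 / l"])
    show "1 / l * (cbin k)\<^sup>2 * real k \<le> 1" for k using Xl[of k] l by (simp add: X_def field_simps)
    show "1 \<le> 1 / l * (cbin k)\<^sup>2 * (real k + 1 / 2)" for k using lY[of k] l by (simp add: Y_def field_simps)
  qed (use l in simp)
qed

text \<open>L^1 functions with a pointwise bound. The space is preserved by the convolutions used
  here and all pairings in it are finite, so it replaces L^2 as the domain of the operators.\<close>

definition bdd_L1 :: "('a::euclidean_space \<Rightarrow> real) set" where
  "bdd_L1 = {f. integrable lborel f \<and> (\<exists>K. \<forall>x. \<bar>f x\<bar> \<le> K)}"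

definition convol :: "('a::euclidean_space \<Rightarrow> real) \<Rightarrow> ('a \<Rightarrow> real) \<Rightarrow> 'a \<Rightarrow> real" where
  "convol q f x = (\<integral>y. q (x - y) * f y \<partial>lborel)"

definition ip :: "('a::euclidean_space \<Rightarrow> real) \<Rightarrow> ('a \<Rightarrow> real) \<Rightarrow> real" where
  "ip f g = (\<integral>x. f x * g x \<partial>lborel)"

definition even_kernel :: "('a::euclidean_space \<Rightarrow> real) set" where
  "even_kernel = {q. integrable lborel q \<and> (\<forall>x. 0 \<le> q x) \<and> (\<forall>x. q (- x) = q x)}"

lemma bdd_L1D:
  assumes "f \<in> bdd_L1"
  shows "integrable lborel f" "f \<in> borel_measurable borel" "\<exists>K>0. \<forall>x. \<bar>f x\<bar> \<le> K"
proof -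
  show i: "integrable lborel f" using assms by (auto simp: bdd_L1_def)
  show "f \<in> borel_measurable borel" using borel_measurable_integrable[OF i] by simp
  obtain K where "\<And>x. \<bar>f x\<bar> \<le> K" using assms by (auto simp: bdd_L1_def)
  then have "\<forall>x. \<bar>f x\<bar> \<le> max K 1" by (simp add: le_max_iff_disj)
  then show "\<exists>K>0. \<forall>x. \<bar>f x\<bar> \<le> K" by (intro exI[of _ "max K 1"]) auto
qed

lemma bdd_L1I: "integrable lborel f \<Longrightarrow> (\<And>x. \<bar>f x\<bar> \<le> K) \<Longrightarrow> f \<in> bdd_L1"
  by (auto simp: bdd_L1_def)

lemma bdd_L1_bounded_support:
  fixes f :: "'a::euclidean_space \<Rightarrow> real"
  assumes "f \<in> borel_measurable borel" "\<And>x. \<bar>f x\<bar> \<le> K" "\<And>x. R < norm x \<Longrightarrow> f x = 0"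
  shows "f \<in> bdd_L1"
  using integrable_lborel_bounded_support[OF assms] assms(2) by (rule bdd_L1I)

lemma bdd_L1_scale: "f \<in> bdd_L1 \<Longrightarrow> (\<lambda>x. c * f x) \<in> bdd_L1"
  using bdd_L1D[of f]
  by (auto intro!: bdd_L1I[of _ "\<bar>c\<bar> * K" for K] mult_left_mono simp: abs_mult)

lemma bdd_L1_diff:
  assumes f: "f \<in> bdd_L1" and g: "g \<in> bdd_L1" shows "(\<lambda>x. f x - g x) \<in> bdd_L1"
proof -
  obtain K1 K2 where "\<And>x. \<bar>f x\<bar> \<le> K1" "\<And>x. \<bar>g x\<bar> \<le> K2" using bdd_L1D(3)[OF f] bdd_L1D(3)[OF g] by auto
  then have "\<bar>f x - g x\<bar> \<le> K1 + K2" for x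
    by (metis abs_triangle_ineq4 add_mono order_trans)
  then show ?thesis using bdd_L1D(1)[OF f] bdd_L1D(1)[OF g] by (intro bdd_L1I[of _ "K1 + K2"]) auto
qed

lemma even_kernelD:
  assumes "q \<in> even_kernel"
  shows "integrable lborel q" "q \<in> borel_measurable borel" "0 \<le> q x" "q (x - y) = q (y - x)"
    "(\<integral>\<^sup>+x. ennreal (q x) \<partial>lborel) = ennreal (\<integral>x. q x \<partial>lborel)"
proof -
  show i: "integrable lborel q" and "0 \<le> q x" using assms by (auto simp: even_kernel_def)
  show "q \<in> borel_measurable borel" using borel_measurable_integrable[OF i] by simp
  show "q (x - y) = q (y - x)" using assms unfolding even_kernel_def by (metis (mono_tags, lifting) mem_Collect_eq minus_diff_eq)
  show "(\<integral>\<^sup>+x. ennreal (q x) \<partial>lborel) = ennreal (\<integral>x. q x \<partial>lborel)"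
    using assms by (intro nn_integral_eq_integral) (auto simp: even_kernel_def)
qed

lemma even_kernel_nn_integral:
  assumes q: "q \<in> even_kernel"
  shows "(\<integral>\<^sup>+y. ennreal (q (x - y)) \<partial>lborel) = ennreal (\<integral>x. q x \<partial>lborel)"
    "(\<integral>\<^sup>+y. ennreal (q (y - x)) \<partial>lborel) = ennreal (\<integral>x. q x \<partial>lborel)"
proof -
  note [measurable] = even_kernelD(2)[OF q]
  show 1: "(\<integral>\<^sup>+y. ennreal (q (x - y)) \<partial>lborel) = ennreal (\<integral>x. q x \<partial>lborel)"
    using nn_integral_lborel_reflect[of "\<lambda>y. ennreal (q y)" x] even_kernelD(5)[OF q] by simp
  then show "(\<integral>\<^sup>+y. ennreal (q (y - x)) \<partial>lborel) = ennreal (\<integral>x. q x \<partial>lborel)"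
    by (simp add: even_kernelD(4)[OF q, of _ x])
qed

lemma integrable_lborel_pairI:
  fixes f :: "'a::euclidean_space \<Rightarrow> 'b::euclidean_space \<Rightarrow> real"
  assumes [measurable]: "case_prod f \<in> borel_measurable (lborel \<Otimes>\<^sub>M lborel)"
    and "(\<integral>\<^sup>+x. \<integral>\<^sup>+y. ennreal \<bar>f x y\<bar> \<partial>lborel \<partial>lborel) < \<infinity>"
  shows "integrable (lborel \<Otimes>\<^sub>M lborel) (case_prod f)"
proof (rule integrableI_bounded)
  have "(\<integral>\<^sup>+z. ennreal (norm (case_prod f z)) \<partial>(lborel \<Otimes>\<^sub>M lborel)) = (\<integral>\<^sup>+x. \<integral>\<^sup>+y. ennreal \<bar>f x y\<bar> \<partial>lborel \<partial>lborel)"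
    by (subst lborel.nn_integral_fst[symmetric]) (auto simp: case_prod_unfold)
  with assms(2) show "(\<integral>\<^sup>+z. ennreal (norm (case_prod f z)) \<partial>(lborel \<Otimes>\<^sub>M lborel)) < \<infinity>" by simp
qed simp

lemma kernel_pair_integrable:
  assumes q: "q \<in> even_kernel" and f: "f \<in> bdd_L1" and g: "g \<in> borel_measurable borel" "\<And>y. \<bar>g y\<bar> \<le> K"
  shows "integrable (lborel \<Otimes>\<^sub>M lborel) (\<lambda>(x, y). q (x - y) * f y * g x)"
    "integrable (lborel \<Otimes>\<^sub>M lborel) (\<lambda>(x, y). f x * (q (x - y) * g y))"
proof -
  note [measurable] = even_kernelD(2)[OF q] bdd_L1D(2)[OF f] g(1)
  have fi: "(\<integral>\<^sup>+y. ennreal \<bar>f y\<bar> \<partial>lborel) < \<infinity>"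
    using bdd_L1D(1)[OF f] by (simp add: integrable_iff_bounded)
  have b1: "(\<integral>\<^sup>+y. \<integral>\<^sup>+x. ennreal \<bar>q (x - y) * f y * g x\<bar> \<partial>lborel \<partial>lborel) < \<infinity>"
  proof -
    have "(\<integral>\<^sup>+y. \<integral>\<^sup>+x. ennreal \<bar>q (x - y) * f y * g x\<bar> \<partial>lborel \<partial>lborel)
      \<le> (\<integral>\<^sup>+y. \<integral>\<^sup>+x. ennreal (K * \<bar>f y\<bar>) * ennreal (q (x - y)) \<partial>lborel \<partial>lborel)"
    proof (intro nn_integral_mono)
      fix x y
      have "\<bar>q (x - y) * f y * g x\<bar> \<le> q (x - y) * \<bar>f y\<bar> * K"
        unfolding abs_mult using even_kernelD(3)[OF q] g(2) by (intro mult_mono) auto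
      then show "ennreal \<bar>q (x - y) * f y * g x\<bar> \<le> ennreal (K * \<bar>f y\<bar>) * ennreal (q (x - y))"
        using even_kernelD(3)[OF q] order_trans[OF abs_ge_zero g(2)]
        by (simp add: ennreal_mult[symmetric] ennreal_leI ac_simps)
    qed
    also have "\<dots> = (\<integral>\<^sup>+y. ennreal (K * (\<integral>x. q x \<partial>lborel)) * ennreal \<bar>f y\<bar> \<partial>lborel)"
    proof (rule nn_integral_cong)
      fix y
      have "0 \<le> K" "0 \<le> (\<integral>x. q x \<partial>lborel)"
        using even_kernelD(3)[OF q] order_trans[OF abs_ge_zero g(2)] by (auto intro: integral_nonneg_AE)
      then have "ennreal (K * \<bar>f y\<bar>) * ennreal (\<integral>x. q x \<partial>lborel) = ennreal (K * (\<integral>x. q x \<partial>lborel)) * ennreal \<bar>f y\<bar>"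
        by (simp add: ennreal_mult[symmetric] ac_simps)
      then show "(\<integral>\<^sup>+x. ennreal (K * \<bar>f y\<bar>) * ennreal (q (x - y)) \<partial>lborel) = ennreal (K * (\<integral>x. q x \<partial>lborel)) * ennreal \<bar>f y\<bar>"
        by (subst nn_integral_cmult) (simp_all add: even_kernel_nn_integral(2)[OF q])
    qed
    also have "\<dots> < \<infinity>"
      using fi by (simp add: nn_integral_cmult ennreal_mult_less_top)
    finally show ?thesis .
  qed
  show "integrable (lborel \<Otimes>\<^sub>M lborel) (\<lambda>(x, y). q (x - y) * f y * g x)"
    using b1 by (intro integrable_lborel_pairI) (measurable, subst lborel_pair.Fubini', auto)
  have "(\<integral>\<^sup>+x. \<integral>\<^sup>+y. ennreal \<bar>f x * (q (x - y) * g y)\<bar> \<partial>lborel \<partial>lborel) = (\<integral>\<^sup>+y. \<integral>\<^sup>+x. ennreal \<bar>q (x - y) * f y * g x\<bar> \<partial>lborel \<partial>lborel)"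
    by (intro nn_integral_cong) (simp add: even_kernelD(4)[OF q] mult_ac)
  with b1 show "integrable (lborel \<Otimes>\<^sub>M lborel) (\<lambda>(x, y). f x * (q (x - y) * g y))"
    by (intro integrable_lborel_pairI) auto
qed

lemma convol_integrable:
  assumes q: "q \<in> even_kernel" and g: "g \<in> borel_measurable borel" "\<And>y. \<bar>g y\<bar> \<le> K"
  shows "integrable lborel (\<lambda>y. q (x - y) * g y)" "\<bar>convol q g x\<bar> \<le> K * (\<integral>x. q x \<partial>lborel)"
proof -
  note [measurable] = even_kernelD(2)[OF q] g(1)
  have qi: "integrable lborel (\<lambda>y. q (x - y))"
    using even_kernel_nn_integral(1)[OF q, of x] even_kernelD(3)[OF q]
    by (intro integrableI_bounded) auto
  have qI: "(\<integral>y. q (x - y) \<partial>lborel) = (\<integral>x. q x \<partial>lborel)"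
    using even_kernel_nn_integral(1)[OF q, of x] even_kernelD(3)[OF q]
    by (subst integral_eq_nn_integral) (auto intro!: integral_nonneg_AE)
  have b: "norm (q (x - y) * g y) \<le> K * q (x - y)" for y
    using mult_mono[OF order_refl g(2)[of y] even_kernelD(3)[OF q, of "x - y"] abs_ge_zero] even_kernelD(3)[OF q, of "x - y"]
    by (simp add: abs_mult mult.commute)
  show i: "integrable lborel (\<lambda>y. q (x - y) * g y)"
    by (rule Bochner_Integration.integrable_bound[of _ "\<lambda>y. K * q (x - y)"])
      (use qi b in \<open>auto intro: order_trans[OF _ abs_ge_self]\<close>)
  have "norm (convol q g x) \<le> (\<integral>y. K * q (x - y) \<partial>lborel)"
    unfolding convol_def using i qi b
    by (intro Bochner_Integration.integral_norm_bound_integral) auto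
  then show "\<bar>convol q g x\<bar> \<le> K * (\<integral>x. q x \<partial>lborel)" by (simp add: qI)
qed

lemma convol_measurable [measurable (raw)]:
  assumes [measurable]: "q \<in> borel_measurable borel" "g \<in> borel_measurable borel"
  shows "convol q g \<in> borel_measurable borel"
  unfolding convol_def by measurable

lemma convol_bdd_L1:
  assumes q: "q \<in> even_kernel" and f: "f \<in> bdd_L1"
  shows "convol q f \<in> bdd_L1"
proof -
  obtain K where K: "\<And>x. \<bar>f x\<bar> \<le> K" using bdd_L1D(3)[OF f] by auto
  have "integrable lborel (\<lambda>x. \<integral>y. q (x - y) * f y * 1 \<partial>lborel)"
    using lborel_pair.integrable_fst'[OF kernel_pair_integrable(1)[OF q f, of "\<lambda>_. 1" 1]] by simp
  then have "integrable lborel (convol q f)"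
    by (simp add: convol_def[abs_def])
  then show ?thesis
    using convol_integrable(2)[OF q bdd_L1D(2)[OF f] K] by (rule bdd_L1I)
qed

lemma ip_commute: "ip f g = ip g f"
  by (simp add: ip_def mult.commute)

lemma ip_integrable:
  assumes f: "f \<in> bdd_L1" and g: "g \<in> borel_measurable borel" "\<And>y. \<bar>g y\<bar> \<le> K"
  shows "integrable lborel (\<lambda>x. f x * g x)"
proof (rule Bochner_Integration.integrable_bound[of _ "\<lambda>x. K * f x"])
  show "AE x in lborel. norm (f x * g x) \<le> norm (K * f x)"
    using g(2) by (auto simp: abs_mult mult.commute[of _ "\<bar>f _\<bar>"] intro!: mult_left_mono order_trans[OF g(2) abs_ge_self])
qed (use bdd_L1D[OF f] g in auto)

lemma ip_integrable': "f \<in> bdd_L1 \<Longrightarrow> g \<in> bdd_L1 \<Longrightarrow> integrable lborel (\<lambda>x. f x * g x)"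
  using ip_integrable[of f g] bdd_L1D[of g] by blast

lemma ip_diff_left: "f \<in> bdd_L1 \<Longrightarrow> f' \<in> bdd_L1 \<Longrightarrow> g \<in> bdd_L1 \<Longrightarrow> ip (\<lambda>x. f x - f' x) g = ip f g - ip f' g"
  unfolding ip_def left_diff_distrib by (intro Bochner_Integration.integral_diff ip_integrable')

lemma ip_scale_left: "ip (\<lambda>x. c * f x) g = c * ip f g"
  unfolding ip_def by (simp add: mult.assoc)

lemma ip_convol_commute:
  assumes q: "q \<in> even_kernel" and f: "f \<in> bdd_L1" and g: "g \<in> borel_measurable borel" "\<And>y. \<bar>g y\<bar> \<le> K"
  shows "ip f (convol q g) = ip (convol q f) g"
proof -
  have "ip f (convol q g) = (\<integral>x. \<integral>y. f x * (q (x - y) * g y) \<partial>lborel \<partial>lborel)"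
    unfolding ip_def convol_def by simp
  also have "\<dots> = (\<integral>y. \<integral>x. f x * (q (x - y) * g y) \<partial>lborel \<partial>lborel)"
    using lborel_pair.Fubini_integral[OF kernel_pair_integrable(2)[OF q f g]] by simp
  also have "\<dots> = (\<integral>y. \<integral>x. (q (y - x) * f x) * g y \<partial>lborel \<partial>lborel)"
    by (simp add: even_kernelD(4)[OF q] mult_ac)
  also have "\<dots> = ip (convol q f) g"
    unfolding ip_def convol_def by simp
  finally show ?thesis .
qed

lemma ip_convol_commute': "q \<in> even_kernel \<Longrightarrow> f \<in> bdd_L1 \<Longrightarrow> g \<in> bdd_L1 \<Longrightarrow> ip f (convol q g) = ip (convol q f) g"
  using ip_convol_commute[of q f g] bdd_L1D[of g] by blast

lemma gauss_even_kernel: 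
  assumes t: "0 < t"
  shows "gauss t \<in> (even_kernel :: ('a::euclidean_space \<Rightarrow> real) set)" "(\<integral>x. gauss t (x::'a) \<partial>lborel) = 1"
proof -
  have "integrable lborel (gauss t :: 'a \<Rightarrow> real)"
    using nn_integral_gauss[OF t, where 'a='a] t by (intro integrableI_bounded) auto
  then show "gauss t \<in> (even_kernel :: ('a \<Rightarrow> real) set)" using t by (simp add: even_kernel_def)
  show "(\<integral>x. gauss t (x::'a) \<partial>lborel) = 1"
    using t nn_integral_gauss[OF t, where 'a='a] by (subst integral_eq_nn_integral) auto
qed

lemma gauss_le: "0 < t \<Longrightarrow> gauss t (z::'a::euclidean_space) \<le> 1 / sqrt (4 * pi * t) ^ DIM('a)"
  unfolding gauss_def by (intro divide_right_mono) auto

text \<open>Time 0 is a separate case because \<open>gauss 0\<close> is 0, not a point mass; the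
  zeroth term of the operator series has to be the identity.\<close>

definition heat :: "real \<Rightarrow> ('a::euclidean_space \<Rightarrow> real) \<Rightarrow> 'a \<Rightarrow> real" where
  "heat s f = (if s = 0 then f else convol (gauss s) f)"

lemma heat_bdd_L1: "0 \<le> s \<Longrightarrow> f \<in> bdd_L1 \<Longrightarrow> heat s f \<in> bdd_L1"
  by (auto simp: heat_def intro!: convol_bdd_L1 gauss_even_kernel)

lemma heat_self_adjoint: "0 \<le> s \<Longrightarrow> f \<in> bdd_L1 \<Longrightarrow> g \<in> bdd_L1 \<Longrightarrow> ip f (heat s g) = ip (heat s f) g"
  by (cases "s = 0") (auto simp: heat_def intro!: ip_convol_commute' gauss_even_kernel)

lemma heat_heat:
  assumes s: "0 \<le> s" and t: "0 \<le> t" and f: "f \<in> bdd_L1"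
  shows "heat s (heat t f) = heat (s + t) f"
proof (cases "s = 0 \<or> t = 0")
  case False
  then have st: "0 < s" "0 < t" using s t by auto
  note [measurable] = bdd_L1D(2)[OF f]
  have "convol (gauss s) (convol (gauss t) f) x = convol (gauss (s + t)) f x" for x
  proof -
    obtain K where K: "\<And>y. \<bar>f y\<bar> \<le> K" using bdd_L1D(3)[OF f] by auto
    have gi: "(\<integral>z. gauss s (x - z) * gauss t (z - y) \<partial>lborel) = gauss (s + t) (x - y)" for y
      using nn_integral_gauss_conv[OF st, of x y] st by (subst integral_eq_nn_integral) auto
    have fin: "(\<integral>\<^sup>+z. \<integral>\<^sup>+y. ennreal \<bar>gauss s (x - z) * (gauss t (z - y) * f y)\<bar> \<partial>lborel \<partial>lborel) < \<infinity>"
    proof -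
      have "(\<integral>\<^sup>+z. \<integral>\<^sup>+y. ennreal \<bar>gauss s (x - z) * (gauss t (z - y) * f y)\<bar> \<partial>lborel \<partial>lborel)
        \<le> (\<integral>\<^sup>+z. \<integral>\<^sup>+y. ennreal (K * gauss s (x - z)) * ennreal (gauss t (z - y)) \<partial>lborel \<partial>lborel)"
      proof (intro nn_integral_mono)
        fix z y
        have "gauss s (x - z) * (gauss t (z - y) * \<bar>f y\<bar>) \<le> gauss s (x - z) * (gauss t (z - y) * K)"
          using st K by (intro mult_left_mono) auto
        then show "ennreal \<bar>gauss s (x - z) * (gauss t (z - y) * f y)\<bar> \<le> ennreal (K * gauss s (x - z)) * ennreal (gauss t (z - y))"
          using st order_trans[OF abs_ge_zero K] by (simp add: abs_mult ennreal_mult[symmetric] ennreal_leI ac_simps)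
      qed
      also have "\<dots> = (\<integral>\<^sup>+z. ennreal K * ennreal (gauss s (x - z)) \<partial>lborel)"
        using st order_trans[OF abs_ge_zero K]
        by (intro nn_integral_cong) (simp add: nn_integral_cmult even_kernel_nn_integral(1) gauss_even_kernel ennreal_mult)
      also have "\<dots> < \<infinity>"
        using st by (simp add: nn_integral_cmult even_kernel_nn_integral(1) gauss_even_kernel)
      finally show ?thesis .
    qed
    have "convol (gauss s) (convol (gauss t) f) x = (\<integral>z. \<integral>y. gauss s (x - z) * (gauss t (z - y) * f y) \<partial>lborel \<partial>lborel)"
      unfolding convol_def by simp
    also have "\<dots> = (\<integral>y. \<integral>z. gauss s (x - z) * (gauss t (z - y) * f y) \<partial>lborel \<partial>lborel)"
      using lborel_pair.Fubini_integral[OF integrable_lborel_pairI[OF _ fin]] by simp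
    also have "\<dots> = (\<integral>y. \<integral>z. gauss s (x - z) * gauss t (z - y) * f y \<partial>lborel \<partial>lborel)"
      by (simp add: mult.assoc)
    also have "\<dots> = convol (gauss (s + t)) f x"
      by (simp add: convol_def gi)
    finally show ?thesis .
  qed
  then show ?thesis using st by (auto simp: heat_def)
qed (auto simp: heat_def)

lemma ip_self_nonneg: "0 \<le> ip f f"
  by (simp add: ip_def)

text \<open>The Schur test for a symmetric kernel: \<open>2 * f x * f y\<close> is at most the sum
  of the squares, and each square is integrated against a kernel of the same total mass.\<close>

lemma ip_convol_self_le:
  assumes q: "q \<in> even_kernel" and f: "f \<in> bdd_L1"
  shows "ip f (convol q f) \<le> (\<integral>x. q x \<partial>lborel) * ip f f"
proof -
  note [measurable] = even_kernelD(2)[OF q] bdd_L1D(2)[OF f]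
  obtain K where K: "\<And>y. \<bar>f y\<bar> \<le> K" using bdd_L1D(3)[OF f] by auto
  have f2: "(\<lambda>x. f x * f x) \<in> bdd_L1"
    using ip_integrable'[OF f f]
  proof (rule bdd_L1I)
    show "\<bar>f x * f x\<bar> \<le> K * K" for x
      unfolding abs_mult using order_trans[OF abs_ge_zero K] by (intro mult_mono K) auto
  qed
  have i1: "integrable (lborel \<Otimes>\<^sub>M lborel) (\<lambda>(x, y). f x * (q (x - y) * f y))"
    by (rule kernel_pair_integrable(2)[OF q f _ K]) simp
  have i2: "integrable (lborel \<Otimes>\<^sub>M lborel) (\<lambda>(x, y). (f x * f x) * (q (x - y) * 1))"
    by (rule kernel_pair_integrable(2)[OF q f2, of _ 1]) auto
  have i3: "integrable (lborel \<Otimes>\<^sub>M lborel) (\<lambda>(x, y). q (x - y) * (f y * f y) * 1)"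
    by (rule kernel_pair_integrable(1)[OF q f2, of _ 1]) auto
  have qI: "(\<integral>y. q (x - y) \<partial>lborel) = (\<integral>x. q x \<partial>lborel)" "(\<integral>y. q (y - x) \<partial>lborel) = (\<integral>x. q x \<partial>lborel)" for x
    using even_kernel_nn_integral[OF q, of x] even_kernelD(3)[OF q]
    by (subst integral_eq_nn_integral; auto intro!: integral_nonneg_AE)+
  let ?P = "lborel \<Otimes>\<^sub>M (lborel :: 'a measure)"
  have "2 * ip f (convol q f) = (\<integral>z. 2 * (case_prod (\<lambda>x y. f x * (q (x - y) * f y)) z) \<partial>?P)"
    using lborel_pair.integral_fst'[OF i1] by (simp add: ip_def convol_def)
  also have "\<dots> \<le> (\<integral>z. (case_prod (\<lambda>x y. (f x * f x) * (q (x - y) * 1)) z) + (case_prod (\<lambda>x y. q (x - y) * (f y * f y) * 1) z) \<partial>?P)"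
  proof (rule integral_mono)
    fix z :: "'a \<times> 'a"
    obtain x y where z: "z = (x, y)" by (cases z)
    have "0 \<le> q (x - y) * ((f x - f y) * (f x - f y))"
      by (intro mult_nonneg_nonneg even_kernelD(3)[OF q] zero_le_square)
    then show "2 * (case_prod (\<lambda>x y. f x * (q (x - y) * f y)) z) \<le>
      (case_prod (\<lambda>x y. (f x * f x) * (q (x - y) * 1)) z) + (case_prod (\<lambda>x y. q (x - y) * (f y * f y) * 1) z)"
      unfolding z by (simp add: algebra_simps)
  qed (use i1 i2 i3 in auto)
  also have "\<dots> = (\<integral>x. \<integral>y. (f x * f x) * (q (x - y) * 1) \<partial>lborel \<partial>lborel) + (\<integral>y. \<integral>x. q (x - y) * (f y * f y) * 1 \<partial>lborel \<partial>lborel)"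
    using lborel_pair.integral_fst'[OF i2] lborel_pair.integral_snd[OF i3] i2 i3 by simp
  also have "\<dots> = 2 * ((\<integral>x. q x \<partial>lborel) * ip f f)"
    by (simp add: qI ip_def mult.commute)
  finally show ?thesis by simp
qed

text \<open>By self-adjointness and the semigroup law this is the square of the L^2 norm of
  \<open>heat (s / 2) f\<close>.\<close>

lemma ip_heat_nonneg: "0 \<le> s \<Longrightarrow> f \<in> bdd_L1 \<Longrightarrow> 0 \<le> ip f (heat s f)"
  using ip_self_nonneg[of "heat (s / 2) f"] heat_heat[of "s / 2" "s / 2" f]
    heat_self_adjoint[of "s / 2" f "heat (s / 2) f"] heat_bdd_L1[of "s / 2" f] by simp

text \<open>Half of the common time \<open>s\<close> is moved to either side, giving
  \<open>F\<close>; what remains is that \<open>heat (t - s)\<close> does not increase the quadratic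
  form of \<open>F\<close>.\<close>

lemma ip_heat_antimono:
  assumes "0 \<le> s" "s \<le> t" and f: "f \<in> bdd_L1"
  shows "ip f (heat t f) \<le> ip f (heat s f)"
proof (cases "s = t")
  case False
  define F where "F = heat (s / 2) f"
  have F: "F \<in> bdd_L1" unfolding F_def using assms by (intro heat_bdd_L1) auto
  have sh: "ip f (heat (s + r) f) = ip F (heat r F)" if "0 \<le> r" for r
  proof -
    have "heat (s + r) f = heat (s / 2) (heat r F)"
      unfolding F_def using assms that heat_bdd_L1[of "s / 2" f] by (simp add: heat_heat)
    then show ?thesis
      using heat_self_adjoint[of "s / 2" f "heat r F"] heat_bdd_L1[OF that F] assms by (simp add: F_def)
  qed
  have "ip F (heat (t - s) F) \<le> 1 * ip F F"
    using ip_convol_self_le[OF gauss_even_kernel(1) F, of "t - s"] gauss_even_kernel(2)[of "t - s", where 'a='a] assms False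
    by (simp add: heat_def)
  then show ?thesis using sh[of 0] sh[of "t - s"] assms by (simp add: heat_def)
qed simp

lemma ip_heat_bound:
  fixes f g :: "'a::euclidean_space \<Rightarrow> real"
  assumes s: "0 < s" and f: "f \<in> bdd_L1" and g: "g \<in> bdd_L1"
  shows "\<bar>ip f (heat s g)\<bar> \<le> (\<integral>x. \<bar>f x\<bar> \<partial>lborel) * (\<integral>x. \<bar>g x\<bar> \<partial>lborel) / sqrt (4 * pi * s) ^ DIM('a)"
proof -
  let ?c = "1 / sqrt (4 * pi * s) ^ DIM('a)"
  note [measurable] = bdd_L1D(2)[OF f] bdd_L1D(2)[OF g]
  have gi: "integrable lborel g" by (rule bdd_L1D(1)[OF g])
  have b: "\<bar>heat s g x\<bar> \<le> ?c * (\<integral>x. \<bar>g x\<bar> \<partial>lborel)" for x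
  proof -
    obtain K where K: "\<And>y. \<bar>g y\<bar> \<le> K" using bdd_L1D(3)[OF g] by auto
    have "norm (\<integral>y. gauss s (x - y) * g y \<partial>lborel) \<le> (\<integral>y. ?c * \<bar>g y\<bar> \<partial>lborel)"
    proof (rule Bochner_Integration.integral_norm_bound_integral)
      show "integrable lborel (\<lambda>y. gauss s (x - y) * g y)"
        by (rule convol_integrable[OF gauss_even_kernel(1)[OF s] _ K]) simp
      show "norm (gauss s (x - y) * g y) \<le> ?c * \<bar>g y\<bar>" for y
        using mult_right_mono[OF gauss_le[OF s, of "x - y"], of "\<bar>g y\<bar>"] s by (simp add: abs_mult)
    qed (use gi in simp)
    then show ?thesis using s by (simp add: heat_def convol_def)
  qed
  have "norm (ip f (heat s g)) \<le> (\<integral>x. \<bar>f x\<bar> * (?c * (\<integral>x. \<bar>g x\<bar> \<partial>lborel)) \<partial>lborel)"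
    unfolding ip_def
  proof (rule Bochner_Integration.integral_norm_bound_integral)
    show "integrable lborel (\<lambda>x. f x * heat s g x)"
      using s by (intro ip_integrable' f heat_bdd_L1 g) simp
    show "norm (f x * heat s g x) \<le> \<bar>f x\<bar> * (?c * (\<integral>x. \<bar>g x\<bar> \<partial>lborel))" for x
      unfolding real_norm_def abs_mult by (intro mult_left_mono b) simp
  qed (use bdd_L1D(1)[OF f] in simp)
  then show ?thesis by (simp add: mult.commute)
qed

text \<open>The coefficients of 1 - (1 - X)^(1/2), with an index shift: \<open>bcoef k\<close>
  belongs to X^(k+1), and the constant coefficient is 0.\<close>

definition bcoef :: "nat \<Rightarrow> real" where "bcoef k = cbin k - cbin (Suc k)"

lemma bcoef_nonneg: "0 \<le> bcoef k"
  using cbin_Suc_le[of k] by (simp add: bcoef_def)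

lemma sum_bcoef: "(\<Sum>j<n. bcoef (m + j)) = cbin m - cbin (m + n)"
  by (induction n) (auto simp: bcoef_def)

lemma sum_bcoef_le: "(\<Sum>j<n. bcoef (m + j)) \<le> cbin m"
  using cbin_pos[of "m + n"] by (simp add: sum_bcoef)

lemma summable_bcoef: "summable (\<lambda>j. bcoef (m + j))" and suminf_bcoef_le: "(\<Sum>j. bcoef (m + j)) \<le> cbin m"
proof -
  show s: "summable (\<lambda>j. bcoef (m + j))"
    using bcoef_nonneg sum_bcoef_le by (intro summableI_nonneg_bounded)
  show "(\<Sum>j. bcoef (m + j)) \<le> cbin m"
    using s sum_bcoef_le by (intro suminf_le_const)
qed

text \<open>The power series \<open>\<Sum>\<^sub>k cbin k X\<^sup>k\<close> is inverse to \<open>1 - \<Sum>\<^sub>k bcoef k X\<^sup>(k+1)\<close>.\<close>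
lemma cbin_bcoef_inverse:
  fixes \<beta> :: "nat \<Rightarrow> real"
  assumes \<beta>: "\<And>i. \<bar>\<beta> i\<bar> \<le> C / (real i + 1)"
  shows "(\<lambda>k. cbin k * (\<beta> k - (\<Sum>j. bcoef j * \<beta> (k + j + 1)))) sums \<beta> 0"
proof -
  have C: "0 \<le> C" using order_trans[OF abs_ge_zero \<beta>[of 0]] by simp
  have bC: "\<bar>\<beta> i\<bar> \<le> C" for i
  proof -
    have "C / (real i + 1) \<le> C / 1" using C by (intro divide_left_mono) auto
    then show ?thesis using \<beta>[of i] by simp
  qed
  have sm: "summable (\<lambda>j. bcoef j * \<beta> (k + j))" for k
  proof (rule summable_comparison_test')
    show "summable (\<lambda>j. bcoef j * C)" using summable_bcoef[of 0] by (intro summable_mult2) simp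
    show "norm (bcoef j * \<beta> (k + j)) \<le> bcoef j * C" for j
      using bcoef_nonneg bC by (simp add: abs_mult mult_left_mono)
  qed
  \<comment> \<open>\<open>T k m\<close> is the tail, from index \<open>m\<close> on, of the series
    subtracted from \<open>\<beta> k\<close>; \<open>T k 0\<close> is the whole series.\<close>
  define T where "T k m = (\<Sum>j. bcoef (m + j) * \<beta> (k + m + j + 1))" for k m
  have T0: "T k m = bcoef m * \<beta> (k + m + 1) + T k (Suc m)" for k m
  proof -
    have "summable (\<lambda>j. bcoef (j + m) * \<beta> (k + 1 + (j + m)))"
      using sm[of "k + 1"] by (subst summable_iff_shift)
    then have "summable (\<lambda>j. bcoef (m + j) * \<beta> (k + m + j + 1))" by (simp add: ac_simps)
    from suminf_split_head[OF this] show ?thesis by (simp add: T_def)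
  qed
  have Tb: "\<bar>T k m\<bar> \<le> cbin m * (C / (real (k + m) + 1))" for k m
  proof -
    let ?D = "C / (real (k + m) + 1)"
    have le: "norm (bcoef (m + j) * \<beta> (k + m + j + 1)) \<le> bcoef (m + j) * ?D" for j
    proof -
      have "C / (real (k + m + j + 1) + 1) \<le> ?D" using C by (intro divide_left_mono) auto
      then have "\<bar>\<beta> (k + m + j + 1)\<bar> \<le> ?D" using \<beta>[of "k + m + j + 1"] by linarith
      then show ?thesis unfolding real_norm_def abs_mult abs_of_nonneg[OF bcoef_nonneg]
        using bcoef_nonneg by (rule mult_left_mono)
    qed
    have "norm (T k m) \<le> (\<Sum>j. bcoef (m + j) * ?D)"
      unfolding T_def using le summable_mult2[OF summable_bcoef] by (rule norm_suminf_le)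
    also have "\<dots> = (\<Sum>j. bcoef (m + j)) * ?D" using summable_bcoef by (rule suminf_mult2[symmetric])
    also have "\<dots> \<le> cbin m * ?D" using C suminf_bcoef_le by (intro mult_right_mono) auto
    finally show ?thesis by simp
  qed
  define r where "r k = \<beta> k - (\<Sum>j. bcoef j * \<beta> (k + j + 1))" for k
  have r: "r k = \<beta> k - T k 0" for k by (simp add: r_def T_def)
  \<comment> \<open>The renewal identity cancels every \<open>\<beta> i\<close> with 0 < i \<le> N.
    Only \<open>\<beta> 0\<close> and tails involving \<open>\<beta>\<close> beyond \<open>N\<close>
    are left. By \<open>Tb\<close> each tail is of size \<open>cbin (N - k) / (N + 1)\<close> up to
    a constant, and \<open>cbin_convolution\<close> sums these weights to 1.\<close>
  have key: "(\<Sum>k\<le>N. cbin k * r k) = \<beta> 0 - (\<Sum>k\<le>N. cbin k * T k (N - k))" for N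
  proof (induction N)
    case 0 then show ?case by (simp add: r)
  next
    case (Suc N)
    have "(\<Sum>k\<le>N. cbin k * T k (N - k)) = (\<Sum>k\<le>N. cbin k * (bcoef (N - k) * \<beta> (Suc N)) + cbin k * T k (Suc N - k))"
      by (intro sum.cong refl) (simp add: T0[of _ "N - _"] distrib_left Suc_diff_le)
    also have "\<dots> = (\<Sum>k\<le>N. cbin k * bcoef (N - k)) * \<beta> (Suc N) + (\<Sum>k\<le>N. cbin k * T k (Suc N - k))"
      by (simp add: sum.distrib sum_distrib_right mult.assoc)
    also have "(\<Sum>k\<le>N. cbin k * bcoef (N - k)) = cbin (Suc N)"
    proof -
      have "cbin (Suc N) = (\<Sum>j<Suc N. bcoef j * cbin (Suc N - Suc j))"
        by (subst cbin_renewal) (simp add: bcoef_def)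
      also have "\<dots> = (\<Sum>j<Suc N. cbin j * bcoef (N - j))"
        by (subst sum.nat_diff_reindex[symmetric]) (auto intro!: sum.cong)
      finally show ?thesis by (simp only: lessThan_Suc_atMost)
    qed
    finally show ?case using Suc.IH by (simp add: r algebra_simps del: cbin.simps(2))
  qed
  have "(\<lambda>N. \<Sum>k\<le>N. cbin k * r k) \<longlonglongrightarrow> \<beta> 0"
  proof (rule LIM_zero_cancel, rule Lim_null_comparison)
    show "\<forall>\<^sub>F N in sequentially. norm ((\<Sum>k\<le>N. cbin k * r k) - \<beta> 0) \<le> C / (real N + 1)"
    proof (intro always_eventually allI)
      fix N
      have "norm (\<Sum>k\<le>N. cbin k * T k (N - k)) \<le> (\<Sum>k\<le>N. cbin k * cbin (N - k) * (C / (real N + 1)))"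
      proof (rule sum_norm_le)
        fix k assume "k \<in> {..N}"
        then have "\<bar>T k (N - k)\<bar> \<le> cbin (N - k) * (C / (real N + 1))" using Tb[of k "N - k"] by simp
        then have "cbin k * \<bar>T k (N - k)\<bar> \<le> cbin k * (cbin (N - k) * (C / (real N + 1)))"
          using cbin_pos[of k] by (intro mult_left_mono) auto
        then show "norm (cbin k * T k (N - k)) \<le> cbin k * cbin (N - k) * (C / (real N + 1))"
          unfolding real_norm_def abs_mult mult.assoc using cbin_pos[of k] by simp
      qed
      also have "\<dots> = C / (real N + 1)"
        unfolding sum_distrib_right[symmetric] cbin_convolution by simp
      finally show "norm ((\<Sum>k\<le>N. cbin k * r k) - \<beta> 0) \<le> C / (real N + 1)" unfolding key by simp
    qed
    show "(\<lambda>N. C / (real N + 1)) \<longlonglongrightarrow> 0"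
      using tendsto_mult_right_zero[OF LIMSEQ_inverse_real_of_nat, of C] by (simp add: inverse_eq_divide add.commute)
  qed
  then show ?thesis unfolding sums_def_le r_def .
qed

text \<open>With H the heat operator at time \<open>\<epsilon>\<close>, this is the convolution
  kernel of 1 - (1 - H)^(1/2). The time \<open>(real k + 1) * \<epsilon>\<close> corresponds to the
  power X^(k+1).\<close>

definition qker :: "real \<Rightarrow> 'a::euclidean_space \<Rightarrow> real" where
  "qker \<epsilon> x = (\<Sum>k. bcoef k * gauss ((real k + 1) * \<epsilon>) x)"

section \<open>The square root of 1 - H and its inverse, for the time step \<epsilon>\<close>

context
  fixes \<epsilon> :: real
  assumes \<epsilon>: "0 < \<epsilon>"
begin

lemma step_pos: "0 < (real k + 1) * \<epsilon>"
  using \<epsilon> by (intro mult_pos_pos) auto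

lemma summable_qker: "summable (\<lambda>k. bcoef k * gauss ((real k + 1) * \<epsilon>) (x::'a::euclidean_space))"
proof (rule summable_comparison_test')
  let ?c = "1 / sqrt (4 * pi * \<epsilon>) ^ DIM('a)"
  show "summable (\<lambda>k. bcoef k * ?c)" using summable_bcoef[of 0] by (intro summable_mult2) simp
  show "norm (bcoef k * gauss ((real k + 1) * \<epsilon>) x) \<le> bcoef k * ?c" for k
  proof -
    have "gauss ((real k + 1) * \<epsilon>) x \<le> 1 / sqrt (4 * pi * ((real k + 1) * \<epsilon>)) ^ DIM('a)"
      by (rule gauss_le[OF step_pos])
    also have "\<dots> \<le> ?c"
      using \<epsilon> by (intro divide_left_mono power_mono real_sqrt_le_mono) (auto simp: mult_le_cancel_right1)
    finally have "gauss ((real k + 1) * \<epsilon>) x \<le> ?c" .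
    then show ?thesis using bcoef_nonneg[of k] gauss_nonneg[of "(real k + 1) * \<epsilon>" x] step_pos[of k]
      by (simp add: abs_mult mult_left_mono del: times_divide_eq_right)
  qed
qed

lemma qker_even_kernel: "qker \<epsilon> \<in> (even_kernel :: ('a::euclidean_space \<Rightarrow> real) set)"
  and integral_qker_le: "(\<integral>x. qker \<epsilon> (x::'a) \<partial>lborel) \<le> 1"
proof -
  have [measurable]: "qker \<epsilon> \<in> borel_measurable (borel :: 'a measure)"
    unfolding qker_def by measurable
  have nn: "0 \<le> bcoef k * gauss ((real k + 1) * \<epsilon>) x" for k and x :: 'a
    using bcoef_nonneg[of k] step_pos[of k] by (intro mult_nonneg_nonneg) auto
  have q0: "0 \<le> qker \<epsilon> x" for x :: 'a
    unfolding qker_def by (intro suminf_nonneg summable_qker nn)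
  have le: "(\<integral>\<^sup>+x. ennreal (qker \<epsilon> (x::'a)) \<partial>lborel) \<le> 1"
  proof -
    have "(\<integral>\<^sup>+x. ennreal (qker \<epsilon> (x::'a)) \<partial>lborel) = (\<integral>\<^sup>+x. (\<Sum>k. ennreal (bcoef k * gauss ((real k + 1) * \<epsilon>) (x::'a))) \<partial>lborel)"
      unfolding qker_def by (intro nn_integral_cong suminf_ennreal2[symmetric] nn summable_qker)
    also have "\<dots> = (\<Sum>k. \<integral>\<^sup>+x. ennreal (bcoef k * gauss ((real k + 1) * \<epsilon>) (x::'a)) \<partial>lborel)"
      by (rule nn_integral_suminf) measurable
    also have "\<dots> = (\<Sum>k. ennreal (bcoef k))"
      using bcoef_nonneg nn_integral_gauss[OF step_pos, where 'a='a] step_pos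
      by (intro suminf_cong) (simp add: ennreal_mult nn_integral_cmult less_imp_le)
    also have "\<dots> = ennreal (\<Sum>k. bcoef k)"
      using summable_bcoef[of 0] by (intro suminf_ennreal2 bcoef_nonneg) simp
    also have "\<dots> \<le> 1" using suminf_bcoef_le[of 0] by (simp add: ennreal_le_1)
    finally show ?thesis .
  qed
  have i: "integrable lborel (qker \<epsilon> :: 'a \<Rightarrow> real)"
    using le q0 by (intro integrableI_bounded) (auto intro: le_less_trans)
  then show "qker \<epsilon> \<in> (even_kernel :: ('a \<Rightarrow> real) set)"
    using q0 by (simp add: even_kernel_def) (simp add: qker_def)
  show "(\<integral>x. qker \<epsilon> (x::'a) \<partial>lborel) \<le> 1"
    using le nn_integral_eq_integral[OF i] q0 by simp
qed

lemma qker_radial_decreasing: "radial_decreasing (qker \<epsilon> :: 'a::euclidean_space \<Rightarrow> real)"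
  unfolding radial_decreasing_def
proof (intro allI impI)
  fix x y :: 'a assume xy: "norm x \<le> norm y"
  show "qker \<epsilon> y \<le> qker \<epsilon> x"
    unfolding qker_def
  proof (intro suminf_le summable_qker mult_left_mono bcoef_nonneg)
    fix k
    have "(norm x)\<^sup>2 \<le> (norm y)\<^sup>2" using xy by (intro power_mono) auto
    then show "gauss ((real k + 1) * \<epsilon>) y \<le> gauss ((real k + 1) * \<epsilon>) x"
      unfolding gauss_def using step_pos[of k] \<epsilon> by (intro divide_right_mono) (auto simp: divide_right_mono)
  qed
qed

lemma ip_convol_qker:
  fixes w g :: "'a::euclidean_space \<Rightarrow> real"
  assumes w: "w \<in> bdd_L1" and g: "g \<in> bdd_L1"
  shows "ip (convol (qker \<epsilon>) w) g = (\<Sum>k. bcoef k * ip (heat ((real k + 1) * \<epsilon>) w) g)"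
proof -
  obtain K where K: "\<And>x. \<bar>w x\<bar> \<le> K" using bdd_L1D(3)[OF w] by auto
  note wm = bdd_L1D(2)[OF w]
  let ?s = "\<lambda>k. (real k + 1) * \<epsilon>"
  have hb: "\<bar>heat (?s k) w x\<bar> \<le> K" for k x
    using convol_integrable(2)[OF gauss_even_kernel(1)[OF step_pos] wm K, of k x] gauss_even_kernel(2)[OF step_pos, where 'a='a] step_pos[of k] \<epsilon>
    by (simp add: heat_def)
  have 1: "convol (qker \<epsilon>) w x = (\<Sum>k. bcoef k * heat (?s k) w x)" for x
  proof -
    let ?f = "\<lambda>k y. bcoef k * (gauss (?s k) (x - y) * w y)"
    have int: "integrable lborel (?f k)" for k
      using convol_integrable(1)[OF gauss_even_kernel(1)[OF step_pos] wm K] by simp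
    have sm: "summable (\<lambda>k. norm (?f k y))" for y
    proof -
      have "norm (?f k y) = bcoef k * gauss (?s k) (x - y) * \<bar>w y\<bar>" for k
        using bcoef_nonneg[of k] step_pos[of k] by (simp add: abs_mult less_imp_le)
      then show ?thesis using summable_mult2[OF summable_qker[of "x - y"], of "\<bar>w y\<bar>"] by simp
    qed
    have si: "summable (\<lambda>k. \<integral>y. norm (?f k y) \<partial>lborel)"
    proof (rule summable_comparison_test')
      show "summable (\<lambda>k. bcoef k * K)" using summable_bcoef[of 0] by (intro summable_mult2) simp
      show "norm (\<integral>y. norm (?f k y) \<partial>lborel) \<le> bcoef k * K" for k
      proof -
        have "norm (?f k y) = bcoef k * (gauss (?s k) (x - y) * \<bar>w y\<bar>)" for y
          using bcoef_nonneg[of k] step_pos[of k] by (simp add: abs_mult less_imp_le)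
        then have eq: "(\<integral>y. norm (?f k y) \<partial>lborel) = bcoef k * (\<integral>y. gauss (?s k) (x - y) * \<bar>w y\<bar> \<partial>lborel)"
          by simp
        have "\<bar>\<integral>y. gauss (?s k) (x - y) * \<bar>w y\<bar> \<partial>lborel\<bar> \<le> K"
          using convol_integrable(2)[OF gauss_even_kernel(1)[OF step_pos], of "\<lambda>y. \<bar>w y\<bar>" K k x] wm K
            gauss_even_kernel(2)[OF step_pos, where 'a='a]
          by (simp add: convol_def)
        then have "bcoef k * \<bar>\<integral>y. gauss (?s k) (x - y) * \<bar>w y\<bar> \<partial>lborel\<bar> \<le> bcoef k * K"
          using bcoef_nonneg by (rule mult_left_mono)
        then show ?thesis
          unfolding eq by (simp only: real_norm_def abs_mult abs_of_nonneg[OF bcoef_nonneg])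
      qed
    qed
    have "qker \<epsilon> (x - y) * w y = (\<Sum>k. ?f k y)" for y
      unfolding qker_def using suminf_mult2[OF summable_qker[of "x - y"], of "w y"] by (simp add: mult.assoc)
    then have "convol (qker \<epsilon>) w x = (\<integral>y. (\<Sum>k. ?f k y) \<partial>lborel)"
      by (simp add: convol_def)
    also have "\<dots> = (\<Sum>k. \<integral>y. ?f k y \<partial>lborel)"
      by (rule integral_suminf[OF int _ si]) (use sm in simp)
    also have "\<dots> = (\<Sum>k. bcoef k * heat (?s k) w x)"
      using \<epsilon> by (intro suminf_cong) (auto simp: heat_def convol_def add_nonneg_eq_0_iff)
    finally show ?thesis .
  qed
  have hbd: "heat (?s k) w \<in> bdd_L1" for k using step_pos[of k] w by (intro heat_bdd_L1) auto
  have gi: "integrable lborel g" by (rule bdd_L1D(1)[OF g])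
  let ?h = "\<lambda>k x. bcoef k * (heat (?s k) w x * g x)"
  have hle: "norm (?h k x) \<le> bcoef k * (K * \<bar>g x\<bar>)" for k x
    using bcoef_nonneg[of k] hb[of k x] by (simp add: abs_mult mult_left_mono mult_right_mono)
  have hs: "summable (\<lambda>k. bcoef k * c)" for c using summable_bcoef[of 0] by (intro summable_mult2) simp
  have int: "integrable lborel (?h k)" for k
    using ip_integrable'[OF hbd g] by simp
  have "ip (convol (qker \<epsilon>) w) g = (\<integral>x. (\<Sum>k. ?h k x) \<partial>lborel)"
  proof -
    have "summable (\<lambda>k. bcoef k * heat (?s k) w x)" for x
      by (rule summable_comparison_test'[OF hs[of K]])
        (use bcoef_nonneg hb in \<open>simp add: abs_mult mult_left_mono\<close>)
    from suminf_mult2[OF this] have "(\<Sum>k. bcoef k * heat (?s k) w x) * g x = (\<Sum>k. ?h k x)" for x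
      by (simp add: mult.assoc)
    then show ?thesis unfolding ip_def 1 by simp
  qed
  also have "\<dots> = (\<Sum>k. \<integral>x. ?h k x \<partial>lborel)"
  proof (rule integral_suminf[OF int])
    show "AE x in lborel. summable (\<lambda>k. norm (?h k x))"
      using hle by (intro AE_I2 summable_comparison_test'[OF hs]) (auto simp del: norm_mult)
    show "summable (\<lambda>k. \<integral>x. norm (?h k x) \<partial>lborel)"
    proof (rule summable_comparison_test'[OF hs])
      show "norm (\<integral>x. norm (?h k x) \<partial>lborel) \<le> bcoef k * (\<integral>x. K * \<bar>g x\<bar> \<partial>lborel)" for k
      proof -
        have "(\<integral>x. norm (?h k x) \<partial>lborel) \<le> (\<integral>x. bcoef k * (K * \<bar>g x\<bar>) \<partial>lborel)"
          using gi by (intro integral_mono integrable_norm int hle) simp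
        then show ?thesis by simp
      qed
    qed
  qed
  also have "\<dots> = (\<Sum>k. bcoef k * ip (heat (?s k) w) g)" by (simp add: ip_def)
  finally show ?thesis .
qed

text \<open>The bound of the heat kernel gives decay of order k^(-n/2). Since n \<ge> 2 this is at
  least as fast as 1/k, the rate assumed in \<open>cbin_bcoef_inverse\<close>.\<close>

lemma ip_heat_decay:
  fixes f g :: "'a::euclidean_space \<Rightarrow> real"
  assumes n: "2 \<le> DIM('a)" and f: "f \<in> bdd_L1" and g: "g \<in> bdd_L1"
  obtains C where "\<And>k::nat. \<bar>ip f (heat (real k * \<epsilon>) g)\<bar> \<le> C / (real k + 1)"
proof -
  define A where "A = (\<integral>x. \<bar>f x\<bar> \<partial>lborel) * (\<integral>x. \<bar>g x\<bar> \<partial>lborel) / sqrt (4 * pi * \<epsilon>) ^ DIM('a)"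
  have A: "0 \<le> A" using \<epsilon> by (simp add: A_def)
  have "\<bar>ip f (heat (real k * \<epsilon>) g)\<bar> \<le> (\<bar>ip f g\<bar> + 2 * A) / (real k + 1)" for k :: nat
  proof (cases "k = 0")
    case True then show ?thesis using A by (simp add: heat_def)
  next
    case False
    then have k: "1 \<le> real k" by simp
    have "sqrt (real k) ^ 2 \<le> sqrt (real k) ^ DIM('a)" using k n by (intro power_increasing) auto
    then have "real k \<le> sqrt (real k) ^ DIM('a)" by simp
    then have "A / sqrt (real k) ^ DIM('a) \<le> A / real k"
      using A k by (intro divide_left_mono) (auto intro: mult_pos_pos)
    moreover have "\<bar>ip f (heat (real k * \<epsilon>) g)\<bar> \<le> A / sqrt (real k) ^ DIM('a)"
      using ip_heat_bound[OF _ f g, of "real k * \<epsilon>"] k \<epsilon>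
      by (simp add: A_def real_sqrt_mult power_mult_distrib mult_ac)
    moreover have "A / real k \<le> 2 * A / (real k + 1)"
      using k A mult_left_mono[of 1 "real k" A] by (simp add: field_simps)
    moreover have "2 * A / (real k + 1) \<le> (\<bar>ip f g\<bar> + 2 * A) / (real k + 1)"
      by (intro divide_right_mono) auto
    ultimately show ?thesis by linarith
  qed
  then show thesis by (rule that)
qed

text \<open>The identity (1 - H)^(-1/2) (1 - H)^(1/2) w = w, tested against \<open>g\<close>. Only
  the numbers \<open>\<beta> k\<close> = <w, H^k g> are summed, so convergence of the operator
  series itself is not an issue.\<close>

lemma cbin_heat_sums:
  fixes w g :: "'a::euclidean_space \<Rightarrow> real"
  assumes n: "2 \<le> DIM('a)" and w: "w \<in> bdd_L1" and g: "g \<in> bdd_L1"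
  shows "(\<lambda>k. cbin k * ip (\<lambda>x. w x - convol (qker \<epsilon>) w x) (heat (real k * \<epsilon>) g)) sums ip w g"
proof -
  define \<beta> where "\<beta> k = ip w (heat (real k * \<epsilon>) g)" for k :: nat
  obtain C where C: "\<And>k. \<bar>\<beta> k\<bar> \<le> C / (real k + 1)" unfolding \<beta>_def using ip_heat_decay[OF n w g] by blast
  have "ip (\<lambda>x. w x - convol (qker \<epsilon>) w x) (heat (real k * \<epsilon>) g) = \<beta> k - (\<Sum>j. bcoef j * \<beta> (k + j + 1))" for k
  proof -
    have h: "heat (real k * \<epsilon>) g \<in> bdd_L1" using \<epsilon> g by (intro heat_bdd_L1) auto
    have "ip (heat ((real j + 1) * \<epsilon>) w) (heat (real k * \<epsilon>) g) = \<beta> (k + j + 1)" for j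
    proof -
      have "ip (heat ((real j + 1) * \<epsilon>) w) (heat (real k * \<epsilon>) g) = ip w (heat ((real j + 1) * \<epsilon>) (heat (real k * \<epsilon>) g))"
        using step_pos[of j] heat_self_adjoint[OF _ w h, of "(real j + 1) * \<epsilon>"] by simp
      also have "heat ((real j + 1) * \<epsilon>) (heat (real k * \<epsilon>) g) = heat (real (k + j + 1) * \<epsilon>) g"
        using \<epsilon> by (subst heat_heat[OF _ _ g]) (auto simp: algebra_simps)
      finally show ?thesis by (simp add: \<beta>_def)
    qed
    then show ?thesis
      using ip_diff_left[OF w convol_bdd_L1[OF qker_even_kernel w] h] ip_convol_qker[OF w h]
      by (simp add: \<beta>_def)
  qed
  then show ?thesis using cbin_bcoef_inverse[OF C] by (simp add: \<beta>_def heat_def)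
qed

end

section \<open>Comparison of the binomial series with an integral over heat times\<close>

context
  fixes \<epsilon> om :: real and \<phi> :: "real \<Rightarrow> real"
  assumes \<epsilon>: "0 < \<epsilon>" and om: "0 < om"
    and om1: "\<And>k. om * (cbin k)\<^sup>2 * real k \<le> 1" and om2: "\<And>k. 1 \<le> om * (cbin k)\<^sup>2 * (real k + 1 / 2)"
    and anti: "\<And>s t. 0 \<le> s \<Longrightarrow> s \<le> t \<Longrightarrow> \<phi> t \<le> \<phi> s"
    and nonneg: "\<And>s. 0 \<le> s \<Longrightarrow> 0 \<le> \<phi> s"
begin

text \<open>Breakpoints in the variable \<open>\<sigma>\<close>: their increments are exactly the weights \<open>cbin k\<close>, and
  \<open>\<epsilon> / 2 + \<sigma>\<^sup>2 \<ge> k * \<epsilon>\<close> from the \<open>k\<close>-th one on.\<close>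
definition node :: "nat \<Rightarrow> real" where "node k = sqrt (om * \<epsilon>) * (real k * cbin k)"

lemma node_0: "node 0 = 0" by (simp add: node_def)

lemma node_Suc: "node (Suc k) = node k + sqrt (om * \<epsilon>) * cbin k / 2"
proof -
  have "real (Suc k) * cbin (Suc k) = (real k + 1 / 2) * cbin k" by (simp add: field_simps)
  then show ?thesis unfolding node_def by (simp only:) (simp add: algebra_simps)
qed

lemma node_less: "node k < node (Suc k)"
  unfolding node_Suc using cbin_pos[of k] om \<epsilon> by simp

lemma node_mono: "i \<le> j \<Longrightarrow> node i \<le> node j"
  by (rule lift_Suc_mono_le[of node]) (simp_all add: less_imp_le[OF node_less])

lemma node_nonneg: "0 \<le> node k"
  using node_mono[of 0 k] by (simp add: node_0)

lemma node_sq: "(node k)\<^sup>2 = \<epsilon> * (om * (cbin k)\<^sup>2 * (real k)\<^sup>2)"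
  unfolding node_def using om \<epsilon> by (simp add: power_mult_distrib mult_ac)

lemma node_sq_le: "(node k)\<^sup>2 \<le> \<epsilon> * real k"
proof -
  have "om * (cbin k)\<^sup>2 * real k * real k \<le> 1 * real k" by (rule mult_right_mono[OF om1]) simp
  then show ?thesis unfolding node_sq using \<epsilon> by (intro mult_left_mono) (simp_all add: power2_eq_square mult_ac)
qed

text \<open>From (k + 1/2)(k - 1/2) \<le> k^2. Together with \<open>node_sq_le\<close> the square of
  the \<open>k\<close>-th breakpoint is known up to \<open>\<epsilon> / 2\<close>.\<close>

lemma node_sq_ge: "\<epsilon> * (real k - 1 / 2) \<le> (node k)\<^sup>2"
proof -
  have "1 * (real k - 1 / 2) \<le> om * (cbin k)\<^sup>2 * (real k)\<^sup>2"
  proof (cases "k = 0")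
    case False
    then have "1 * (real k - 1 / 2) \<le> om * (cbin k)\<^sup>2 * (real k + 1 / 2) * (real k - 1 / 2)"
      by (intro mult_right_mono om2) auto
    also have "\<dots> = om * (cbin k)\<^sup>2 * ((real k)\<^sup>2 - 1 / 4)"
    proof -
      have "(real k + 1 / 2) * (real k - 1 / 2) = (real k)\<^sup>2 - 1 / 4"
      by (simp add: power2_eq_square field_simps)
      then show ?thesis by (simp only: mult.assoc)
    qed
    also have "\<dots> \<le> om * (cbin k)\<^sup>2 * (real k)\<^sup>2" using om by (intro mult_left_mono) auto
    finally show ?thesis .
  qed simp
  then show ?thesis unfolding node_sq using \<epsilon> by (intro mult_left_mono) auto
qed

lemma node_locate:
  assumes "0 \<le> x"
  obtains k where "node k \<le> x" "x < node (Suc k)"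
proof -
  obtain N :: nat where N: "x\<^sup>2 / \<epsilon> + 1 / 2 < real N" using reals_Archimedean2 by blast
  then have "x\<^sup>2 < \<epsilon> * (real N - 1 / 2)" using \<epsilon> by (simp add: field_simps)
  then have "x\<^sup>2 < (node N)\<^sup>2" using node_sq_ge[of N] by linarith
  then have xN: "x < node N" using node_nonneg by (rule power2_less_imp_less)
  define m where "m = (LEAST m. x < node m)"
  have m: "x < node m" unfolding m_def using xN by (rule LeastI)
  then have "m \<noteq> 0" using assms node_0 by (cases m) auto
  then obtain k where k: "m = Suc k" by (cases m) auto
  have "\<not> x < node k" using not_less_Least[of k "\<lambda>m. x < node m"] k unfolding m_def[symmetric] by simp
  then show thesis using m k that by force
qed

text \<open>Between the breakpoints \<open>k\<close> and \<open>k + 1\<close> the time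
  \<open>\<epsilon> / 2 + \<sigma>\<^sup>2\<close> is at least \<open>k * \<epsilon>\<close>, so
  \<open>\<phi>\<close> is at most its value there. The interval and its mirror image at negative
  \<sigma> have total length \<open>sqrt (om * \<epsilon>) * cbin k\<close>, exactly the weight of
  the \<open>k\<close>-th term, and no error arises.\<close>

lemma nn_integral_phi_le:
  "(\<integral>\<^sup>+\<sigma>. ennreal (\<phi> (\<epsilon> / 2 + \<sigma>\<^sup>2)) \<partial>lborel) \<le> (\<Sum>k. ennreal (sqrt (om * \<epsilon>) * (cbin k * \<phi> (real k * \<epsilon>))))"
proof -
  let ?A = "\<lambda>k. {node k..<node (Suc k)} \<union> {- node (Suc k)<..- node k}"
  have "(\<integral>\<^sup>+\<sigma>. ennreal (\<phi> (\<epsilon> / 2 + \<sigma>\<^sup>2)) \<partial>lborel) \<le> (\<integral>\<^sup>+\<sigma>. (\<Sum>k. ennreal (\<phi> (real k * \<epsilon>)) * indicator (?A k) \<sigma>) \<partial>lborel)"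
  proof (intro nn_integral_mono)
    fix \<sigma> :: real
    obtain k where k: "node k \<le> \<bar>\<sigma>\<bar>" "\<bar>\<sigma>\<bar> < node (Suc k)" using node_locate[of "\<bar>\<sigma>\<bar>"] by auto
    have "(node k)\<^sup>2 \<le> \<bar>\<sigma>\<bar>\<^sup>2" using k(1) node_nonneg by (intro power_mono) auto
    then have "real k * \<epsilon> \<le> \<epsilon> / 2 + \<sigma>\<^sup>2" using node_sq_ge[of k] by (simp add: algebra_simps)
    then have "ennreal (\<phi> (\<epsilon> / 2 + \<sigma>\<^sup>2)) \<le> ennreal (\<phi> (real k * \<epsilon>))" using \<epsilon> by (intro ennreal_leI anti) auto
    also have "\<dots> = ennreal (\<phi> (real k * \<epsilon>)) * indicator (?A k) \<sigma>" using k by (auto split: split_indicator)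
    also have "\<dots> \<le> (\<Sum>k. ennreal (\<phi> (real k * \<epsilon>)) * indicator (?A k) \<sigma>)"
    proof -
      define g where "g = (\<lambda>k. ennreal (\<phi> (real k * \<epsilon>)) * indicator (?A k) \<sigma>)"
      have "sum g {k} \<le> suminf g" by (rule sum_le_suminf) auto
      moreover have "sum g {k} = g k" by simp
      ultimately have "g k \<le> suminf g" by simp
      then show ?thesis by (simp only: g_def)
    qed
    finally show "ennreal (\<phi> (\<epsilon> / 2 + \<sigma>\<^sup>2)) \<le> (\<Sum>k. ennreal (\<phi> (real k * \<epsilon>)) * indicator (?A k) \<sigma>)" .
  qed
  also have "\<dots> = (\<Sum>k. ennreal (\<phi> (real k * \<epsilon>)) * emeasure lborel (?A k))"
    by (subst nn_integral_suminf) (auto simp: nn_integral_cmult_indicator)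
  also have "\<dots> \<le> (\<Sum>k. ennreal (sqrt (om * \<epsilon>) * (cbin k * \<phi> (real k * \<epsilon>))))"
  proof (intro suminf_le allI)
    fix k
    have "emeasure lborel (?A k) \<le> emeasure lborel {node k..<node (Suc k)} + emeasure lborel {- node (Suc k)<..- node k}"
      by (rule emeasure_subadditive) auto
    also have "\<dots> = ennreal (sqrt (om * \<epsilon>) * cbin k)"
      using node_less[of k] by (simp add: ennreal_plus[symmetric] node_Suc mult.commute[of "cbin k"] del: ennreal_plus)
    finally have "ennreal (\<phi> (real k * \<epsilon>)) * emeasure lborel (?A k) \<le> ennreal (\<phi> (real k * \<epsilon>)) * ennreal (sqrt (om * \<epsilon>) * cbin k)"
      by (intro mult_left_mono) auto
    also have "\<dots> = ennreal (sqrt (om * \<epsilon>) * (cbin k * \<phi> (real k * \<epsilon>)))"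
      using nonneg[of "real k * \<epsilon>"] cbin_pos[of k] om \<epsilon> by (simp add: ennreal_mult[symmetric] mult_ac)
    finally show "ennreal (\<phi> (real k * \<epsilon>)) * emeasure lborel (?A k) \<le> ennreal (sqrt (om * \<epsilon>) * (cbin k * \<phi> (real k * \<epsilon>)))" .
  qed auto
  finally show ?thesis .
qed

text \<open>On the \<open>k\<close>-th pair of intervals the time is at most
  \<open>(k + 2) * \<epsilon>\<close>, which bounds the series shifted by two indices. Lowering the
  coefficient indices by two only increases them, and the two terms lost by the shift are each at
  most \<open>\<phi> 0\<close>; this is the error term. Open intervals make the pairs
  disjoint.\<close>

lemma sum_phi_le:
  assumes I: "(\<integral>\<^sup>+\<sigma>. ennreal (\<phi> (\<epsilon> / 2 + \<sigma>\<^sup>2)) \<partial>lborel) \<le> ennreal I" "0 \<le> I"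
  shows "sqrt (om * \<epsilon>) * (\<Sum>k<N. cbin k * \<phi> (real k * \<epsilon>)) \<le> 2 * sqrt (om * \<epsilon>) * \<phi> 0 + I"
proof -
  let ?A = "\<lambda>k. {node k<..<node (Suc k)} \<union> {- node (Suc k)<..<- node k}"
  have disj: "j = k" if "\<sigma> \<in> ?A j" "\<sigma> \<in> ?A k" for \<sigma> j k
  proof (rule ccontr)
    have *: "False" if "node j < \<bar>\<sigma>\<bar>" "\<bar>\<sigma>\<bar> < node (Suc j)" "node k < \<bar>\<sigma>\<bar>" "\<bar>\<sigma>\<bar> < node (Suc k)" "j < k" for j k
      using that node_mono[of "Suc j" k] by simp
    have "node i < \<bar>\<sigma>\<bar> \<and> \<bar>\<sigma>\<bar> < node (Suc i)" if "\<sigma> \<in> ?A i" for i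
      using that node_nonneg[of i] by auto
    then have "node j < \<bar>\<sigma>\<bar>" "\<bar>\<sigma>\<bar> < node (Suc j)" "node k < \<bar>\<sigma>\<bar>" "\<bar>\<sigma>\<bar> < node (Suc k)" using that by auto
    moreover assume "j \<noteq> k"
    ultimately show False using *[of j k] *[of k j] by (cases "j < k") auto
  qed
  have le: "sqrt (om * \<epsilon>) * (\<Sum>k<N. cbin k * \<phi> (real (k + 2) * \<epsilon>)) \<le> I" for N
  proof -
    have "ennreal (\<Sum>k<N. \<phi> (real (k + 2) * \<epsilon>) * (sqrt (om * \<epsilon>) * cbin k)) = (\<Sum>k<N. ennreal (\<phi> (real (k + 2) * \<epsilon>)) * emeasure lborel (?A k))"
    proof (subst sum_ennreal[symmetric])
      show "0 \<le> \<phi> (real (k + 2) * \<epsilon>) * (sqrt (om * \<epsilon>) * cbin k)" for k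
        using nonneg[of "real (k + 2) * \<epsilon>"] cbin_pos[of k] om \<epsilon> by simp
      show "(\<Sum>k<N. ennreal (\<phi> (real (k + 2) * \<epsilon>) * (sqrt (om * \<epsilon>) * cbin k))) = (\<Sum>k<N. ennreal (\<phi> (real (k + 2) * \<epsilon>)) * emeasure lborel (?A k))"
      proof (intro sum.cong refl)
        fix k
        have "emeasure lborel (?A k) = emeasure lborel {node k<..<node (Suc k)} + emeasure lborel {- node (Suc k)<..<- node k}"
          using node_nonneg[of k] by (intro plus_emeasure[symmetric]) auto
        also have "\<dots> = ennreal (sqrt (om * \<epsilon>) * cbin k)"
          using node_less[of k] by (simp add: ennreal_plus[symmetric] node_Suc mult.commute[of "cbin k"] del: ennreal_plus)
        finally show "ennreal (\<phi> (real (k + 2) * \<epsilon>) * (sqrt (om * \<epsilon>) * cbin k)) = ennreal (\<phi> (real (k + 2) * \<epsilon>)) * emeasure lborel (?A k)"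
          using nonneg[of "real (k + 2) * \<epsilon>"] cbin_pos[of k] om \<epsilon> by (simp add: ennreal_mult[symmetric])
      qed
    qed
    also have "\<dots> = (\<integral>\<^sup>+\<sigma>. (\<Sum>k<N. ennreal (\<phi> (real (k + 2) * \<epsilon>)) * indicator (?A k) \<sigma>) \<partial>lborel)"
      by (subst nn_integral_sum) (auto simp: nn_integral_cmult_indicator)
    also have "\<dots> \<le> (\<integral>\<^sup>+\<sigma>. ennreal (\<phi> (\<epsilon> / 2 + \<sigma>\<^sup>2)) \<partial>lborel)"
    proof (intro nn_integral_mono)
      fix \<sigma> :: real
      show "(\<Sum>k<N. ennreal (\<phi> (real (k + 2) * \<epsilon>)) * indicator (?A k) \<sigma>) \<le> ennreal (\<phi> (\<epsilon> / 2 + \<sigma>\<^sup>2))"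
      proof (cases "\<exists>k<N. \<sigma> \<in> ?A k")
        case True
        then obtain k where k: "k < N" "\<sigma> \<in> ?A k" by blast
        have "(\<Sum>j<N. ennreal (\<phi> (real (j + 2) * \<epsilon>)) * indicator (?A j) \<sigma>)
          = (\<Sum>j\<in>{k}. ennreal (\<phi> (real (j + 2) * \<epsilon>)) * indicator (?A j) \<sigma>)"
        proof (rule sum.mono_neutral_right)
          show "\<forall>j\<in>{..<N} - {k}. ennreal (\<phi> (real (j + 2) * \<epsilon>)) * indicator (?A j) \<sigma> = 0"
          proof
            fix j assume "j \<in> {..<N} - {k}"
            then have "\<sigma> \<notin> ?A j" using disj[OF _ k(2), of j] by blast
            then have "indicator (?A j) \<sigma> = (0::ennreal)" by (rule indicator_simps(2))
            then show "ennreal (\<phi> (real (j + 2) * \<epsilon>)) * indicator (?A j) \<sigma> = 0"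
              by (simp only: mult_zero_right)
          qed
        qed (use k(1) in simp_all)
        also have "\<dots> = ennreal (\<phi> (real (k + 2) * \<epsilon>))" using k by simp
        also have "\<dots> \<le> ennreal (\<phi> (\<epsilon> / 2 + \<sigma>\<^sup>2))"
        proof (intro ennreal_leI anti)
          have "\<bar>\<sigma>\<bar> \<le> node (Suc k)" using k(2) node_nonneg[of k] by auto
          then have "\<bar>\<sigma>\<bar>\<^sup>2 \<le> (node (Suc k))\<^sup>2" by (intro power_mono) auto
          then show "\<epsilon> / 2 + \<sigma>\<^sup>2 \<le> real (k + 2) * \<epsilon>"
            using node_sq_le[of "Suc k"] \<epsilon> by (simp add: algebra_simps)
        qed (use \<epsilon> in auto)
        finally show ?thesis .
      next
        case False
        have "(\<Sum>k<N. ennreal (\<phi> (real (k + 2) * \<epsilon>)) * indicator (?A k) \<sigma>) = 0"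
        proof (rule sum.neutral, rule ballI)
          fix j assume "j \<in> {..<N}"
          then have "\<sigma> \<notin> ?A j" using False by blast
          then have "indicator (?A j) \<sigma> = (0::ennreal)" by (rule indicator_simps(2))
          then show "ennreal (\<phi> (real (j + 2) * \<epsilon>)) * indicator (?A j) \<sigma> = 0"
            by (simp only: mult_zero_right)
        qed
        then show ?thesis by (simp only: zero_le)
      qed
    qed
    also have "\<dots> \<le> ennreal I" by (rule I)
    finally show ?thesis using I(2) by (simp add: sum_distrib_left mult_ac)
  qed
  have c0: "0 \<le> cbin k * \<phi> (real k * \<epsilon>)" for k
    using cbin_pos[of k] nonneg[of "real k * \<epsilon>"] \<epsilon> by simp
  have "(\<Sum>k<N. cbin k * \<phi> (real k * \<epsilon>)) \<le> (\<Sum>k<N + 2. cbin k * \<phi> (real k * \<epsilon>))"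
    by (rule sum_mono2) (use c0 in auto)
  also have "\<dots> = cbin 0 * \<phi> (real 0 * \<epsilon>) + (cbin 1 * \<phi> (real 1 * \<epsilon>) + (\<Sum>k<N. cbin (k + 2) * \<phi> (real (k + 2) * \<epsilon>)))"
    by (simp only: add_2_eq_Suc' sum.lessThan_Suc_shift One_nat_def)
  also have "\<dots> \<le> 1 * \<phi> 0 + (1 * \<phi> 0 + (\<Sum>k<N. cbin k * \<phi> (real (k + 2) * \<epsilon>)))"
    using \<epsilon> anti[of 0 "real 1 * \<epsilon>"] 
    by (intro add_mono mult_mono sum_mono mult_right_mono cbin_antimono cbin_le_1 nonneg)
       (auto intro!: nonneg mult_nonneg_nonneg simp del: cbin.simps)
  finally have "sqrt (om * \<epsilon>) * (\<Sum>k<N. cbin k * \<phi> (real k * \<epsilon>)) \<le> sqrt (om * \<epsilon>) * (2 * \<phi> 0 + (\<Sum>k<N. cbin k * \<phi> (real (k + 2) * \<epsilon>)))"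
    using om \<epsilon> by (intro mult_left_mono) auto
  then show ?thesis using le[of N] by (simp add: distrib_left mult_ac)
qed

end

section \<open>The Grassmannian of hyperplanes\<close>

lemma orth_proj_hyperplane:
  assumes v: "norm v = 1"
  shows "orth_proj {x. x \<bullet> v = 0} = perp v"
proof
  fix x
  have "subspace {x. x \<bullet> v = 0}" using subspace_hyperplane[of v] by (simp add: inner_commute)
  then show "orth_proj {x. x \<bullet> v = 0} x = perp v x"
  proof (rule orth_proj_unique)
    show "perp v x \<in> {x. x \<bullet> v = 0}" using v by (simp add: perp_def inner_diff_left dot_square_norm)
    show "orthogonal (x - perp v x) y" if "y \<in> {x. x \<bullet> v = 0}" for y
      using that by (simp add: perp_def orthogonal_def inner_commute)
  qed
qed

lemma grassmannian_hyperplaneE: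
  fixes V :: "'a::euclidean_space set"
  assumes V: "V \<in> grassmannian (DIM('a) - 1)"
  obtains v where "norm v = 1" "V = {x. x \<bullet> v = 0}" "orth_proj V = perp v"
proof -
  have sV: "subspace V" and dV: "dim V = DIM('a) - 1" using V by (auto simp: grassmannian_def)
  have "dim V < DIM('a)" using dV DIM_positive[where 'a='a] by simp
  then obtain w where w: "w \<noteq> 0" "\<And>y. y \<in> span V \<Longrightarrow> orthogonal w y" using orthogonal_to_subspace_exists by blast
  define v where "v = (1 / norm w) *\<^sub>R w"
  have v: "norm v = 1" using w by (simp add: v_def)
  have sub: "V \<subseteq> {x. v \<bullet> x = 0}"
    using w(2) by (auto simp: v_def orthogonal_def span_base)
  have "v \<noteq> 0" using v by auto
  then have "V = {x. v \<bullet> x = 0}"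
    using sub dV dim_hyperplane[of v] by (intro subspace_dim_equal sV subspace_hyperplane) auto
  then have "V = {x. x \<bullet> v = 0}" by (simp add: inner_commute)
  then show thesis using that[OF v] orth_proj_hyperplane[OF v] by simp
qed

lemma hyperplane_in_grassmannian:
  fixes v :: "'a::euclidean_space"
  assumes "v \<noteq> 0"
  shows "{x. x \<bullet> v = 0} \<in> grassmannian (DIM('a) - 1)"
  using subspace_hyperplane[of v] dim_hyperplane[OF assms] by (simp add: grassmannian_def inner_commute)

lemma orth_proj_blinfun:
  assumes "V \<in> grassmannian k"
  shows "blinfun_apply (Blinfun (orth_proj V)) = orth_proj V"
  using assms by (intro bounded_linear_Blinfun_apply bounded_linear_orth_proj) (simp add: grassmannian_def)

lemma orth_proj_Blinfun_measurable:
  "(\<lambda>V. Blinfun (orth_proj V)) \<in> borel_measurable (grassmannian_borel k)"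
  unfolding grassmannian_borel_def by (rule measurable_vimage_algebra1) simp

lemma space_grassmannian_borel [simp]: "space (grassmannian_borel k) = grassmannian k"
  by (simp add: grassmannian_borel_def)

text \<open>Expanding the argument in the basis reduces joint measurability to that of
  \<open>orth_proj V b\<close> for fixed \<open>b\<close>, which is evaluation of a bounded operator
  and hence continuous in it.\<close>

lemma orth_proj_measurable [measurable (raw)]:
  fixes g :: "'b \<Rightarrow> 'a::euclidean_space"
  assumes f: "f \<in> N \<rightarrow>\<^sub>M grassmannian_borel k" and [measurable]: "g \<in> borel_measurable N"
  shows "(\<lambda>x. orth_proj (f x) (g x)) \<in> borel_measurable N"
proof -
  have "(\<lambda>V. blinfun_apply (Blinfun (orth_proj V)) b) \<in> borel_measurable (grassmannian_borel k)" for b :: 'a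
    by (rule measurable_compose[OF orth_proj_Blinfun_measurable])
      (intro borel_measurable_continuous_onI continuous_intros)
  then have b: "(\<lambda>V. orth_proj V b) \<in> borel_measurable (grassmannian_borel k)" for b :: 'a
    by (rule measurable_cong[THEN iffD1, rotated]) (simp add: orth_proj_blinfun)
  have [measurable]: "(\<lambda>x. orth_proj (f x) b) \<in> borel_measurable N" for b :: 'a
    by (rule measurable_compose[OF f b])
  have "(\<lambda>x. \<Sum>b\<in>Basis. (g x \<bullet> b) *\<^sub>R orth_proj (f x) b) \<in> borel_measurable N"
    by measurable
  then show ?thesis
  proof (rule measurable_cong[THEN iffD1, rotated])
    fix x assume "x \<in> space N"
    then have "f x \<in> grassmannian k" using measurable_space[OF f] by simp
    then have l: "linear (orth_proj (f x))"
      by (intro bounded_linear.linear bounded_linear_orth_proj) (simp add: grassmannian_def)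
    have "orth_proj (f x) (g x) = orth_proj (f x) (\<Sum>b\<in>Basis. (g x \<bullet> b) *\<^sub>R b)"
      by (simp add: euclidean_representation)
    then show "(\<Sum>b\<in>Basis. (g x \<bullet> b) *\<^sub>R orth_proj (f x) b) = orth_proj (f x) (g x)"
      by (simp add: linear_sum[OF l] linear_cmul[OF l])
  qed
qed

lemma orth_proj_image:
  fixes f :: "'a::euclidean_space \<Rightarrow> 'a"
  assumes f: "orthogonal_transformation f" and V: "subspace V"
  shows "orth_proj (f ` V) x = f (orth_proj V (inv f x))"
proof (rule orth_proj_unique)
  have lin: "linear f" using f by (rule orthogonal_transformation_linear)
  then show "subspace (f ` V)" using V by (rule linear_subspace_image)
  show "f (orth_proj V (inv f x)) \<in> f ` V" using orth_proj(1)[OF V] by blast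
  fix w assume "w \<in> f ` V"
  then obtain u where u: "u \<in> V" "w = f u" by auto
  have "x = f (inv f x)" using orthogonal_transformation_surj[OF f] by (simp add: surj_f_inv_f)
  then have "x - f (orth_proj V (inv f x)) = f (inv f x - orth_proj V (inv f x))"
    by (simp add: linear_diff[OF lin])
  then show "orthogonal (x - f (orth_proj V (inv f x))) w"
    using orth_proj(2)[OF V u(1), of "inv f x"] f by (simp add: u(2) orthogonal_orthogonal_transformation)
qed

lemma image_in_grassmannian:
  fixes f :: "'a::euclidean_space \<Rightarrow> 'a"
  assumes f: "orthogonal_transformation f" and V: "V \<in> grassmannian k"
  shows "f ` V \<in> grassmannian k"
proof -
  have "linear f" "inj_on f (span V)"
    using orthogonal_transformation_linear[OF f] orthogonal_transformation_inj[OF f] by (auto intro: inj_on_subset)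
  then show ?thesis using V by (simp add: grassmannian_def linear_subspace_image dim_image_eq)
qed

text \<open>In terms of projections the action of \<open>f\<close> is conjugation by
  \<open>f\<close>, a continuous map on bounded operators.\<close>

lemma grassmannian_image_measurable:
  fixes f :: "'a::euclidean_space \<Rightarrow> 'a"
  assumes f: "orthogonal_transformation f"
  shows "(\<lambda>V. f ` V) \<in> grassmannian_borel k \<rightarrow>\<^sub>M grassmannian_borel k"
  unfolding grassmannian_borel_def
proof (rule measurable_vimage_algebra2)
  show "(`) f \<in> space (vimage_algebra (grassmannian k) (\<lambda>V. Blinfun (orth_proj V)) borel) \<rightarrow> grassmannian k"
    using image_in_grassmannian[OF f] by auto
  have fi: "orthogonal_transformation (inv f)" by (rule orthogonal_transformation_inv[OF f])
  have bl: "bounded_linear f" "bounded_linear (inv f)"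
    using orthogonal_transformation_linear[OF f] orthogonal_transformation_linear[OF fi] by (simp_all add: linear_conv_bounded_linear)
  have "(\<lambda>A. Blinfun f o\<^sub>L A o\<^sub>L Blinfun (inv f)) \<in> borel_measurable borel"
    by (intro borel_measurable_continuous_onI continuous_intros)
  from measurable_compose[OF orth_proj_Blinfun_measurable[of k] this]
  have "(\<lambda>V. Blinfun f o\<^sub>L Blinfun (orth_proj V) o\<^sub>L Blinfun (inv f)) \<in> borel_measurable (grassmannian_borel k)" .
  then show "(\<lambda>V. Blinfun (orth_proj (f ` V))) \<in> borel_measurable (vimage_algebra (grassmannian k) (\<lambda>V. Blinfun (orth_proj V)) borel)"
    unfolding grassmannian_borel_def[symmetric]
  proof (rule measurable_cong[THEN iffD1, rotated])
    fix V :: "'a set" assume "V \<in> space (grassmannian_borel k)"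
    then have V: "V \<in> grassmannian k" by simp
    then have "subspace V" by (simp add: grassmannian_def)
    then show "Blinfun f o\<^sub>L Blinfun (orth_proj V) o\<^sub>L Blinfun (inv f) = Blinfun (orth_proj (f ` V))"
      by (intro blinfun_eqI)
        (simp add: orth_proj_blinfun[OF V] orth_proj_blinfun[OF image_in_grassmannian[OF f V]] orth_proj_image[OF f]
          bl[THEN bounded_linear_Blinfun_apply])
  qed
qed

context
  fixes M :: "'a::euclidean_space set measure" and k
  assumes M: "invariant_grassmannian_prob k M"
begin

lemma igp_prob: "prob_space M" and igp_space: "space M = grassmannian k" and igp_sets: "sets M = sets (grassmannian_borel k)"
  using M by (auto simp: invariant_grassmannian_prob_def)

lemma igp_id_measurable: "(\<lambda>V. V) \<in> M \<rightarrow>\<^sub>M grassmannian_borel k"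
  using measurable_cong_sets[OF igp_sets refl, of M] by (simp add: measurable_ident_sets igp_sets)

lemma nn_integral_igp_image:
  assumes f: "orthogonal_transformation f" and g: "g \<in> borel_measurable M"
  shows "(\<integral>\<^sup>+V. g (f ` V) \<partial>M) = (\<integral>\<^sup>+V. g V \<partial>M)"
proof -
  have fm: "(\<lambda>V. f ` V) \<in> M \<rightarrow>\<^sub>M M"
    using grassmannian_image_measurable[OF f, of k] measurable_cong_sets[OF igp_sets igp_sets] by blast
  have fi: "orthogonal_transformation (inv f)" by (rule orthogonal_transformation_inv[OF f])
  have inj: "inj f" and surj: "surj f" using orthogonal_transformation_inj[OF f] orthogonal_transformation_surj[OF f] by auto
  have "distr M M (\<lambda>V. f ` V) = M"
  proof (rule measure_eqI)
    fix A assume "A \<in> sets (distr M M (\<lambda>V. f ` V))"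
    then have A: "A \<in> sets M" by simp
    \<comment> \<open>Invariance is assumed for images of sets, while a push-forward evaluates
      preimages; the inverse of \<open>f\<close> turns one into the other.\<close>
    have "(\<lambda>V. f ` V) -` A \<inter> space M = (\<lambda>V. inv f ` V) ` A"
    proof (intro set_eqI iffI)
      fix V assume "V \<in> (\<lambda>V. f ` V) -` A \<inter> space M"
      then have "f ` V \<in> A" "V = inv f ` (f ` V)" using inj by (auto simp: image_comp)
      then show "V \<in> (\<lambda>V. inv f ` V) ` A" by blast
    next
      fix V assume "V \<in> (\<lambda>V. inv f ` V) ` A"
      then obtain W where W: "W \<in> A" "V = inv f ` W" by auto
      have "W \<in> grassmannian k" using sets.sets_into_space[OF A] W igp_space by auto
      moreover have "f ` V = W" using surj by (simp add: W(2) image_f_inv_f)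
      ultimately show "V \<in> (\<lambda>V. f ` V) -` A \<inter> space M"
        using W image_in_grassmannian[OF fi] igp_space by auto
    qed
    then show "emeasure (distr M M (\<lambda>V. f ` V)) A = emeasure M A"
      using M fi A by (subst emeasure_distr[OF fm A]) (auto simp: invariant_grassmannian_prob_def)
  qed simp
  then have "(\<integral>\<^sup>+V. g V \<partial>M) = (\<integral>\<^sup>+V. g V \<partial>distr M M (\<lambda>V. f ` V))" by simp
  also have "\<dots> = (\<integral>\<^sup>+V. g (f ` V) \<partial>M)" by (subst nn_integral_distr[OF fm]) (simp_all add: g)
  finally show ?thesis by simp
qed

text \<open>For distinct points of equal norm the reflection in their bisector passes through 0,
  maps one to the other and preserves \<open>M\<close>. So these means depend on the norm
  only.\<close>

lemma nn_integral_igp_radial: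
  fixes h :: "real \<Rightarrow> ennreal"
  assumes [measurable]: "h \<in> borel_measurable borel" and xy: "norm x = norm y"
  shows "(\<integral>\<^sup>+V. h (norm (orth_proj V x)) \<partial>M) = (\<integral>\<^sup>+V. h (norm (orth_proj V y)) \<partial>M)"
proof (cases "x = y")
  case False
  note [measurable] = igp_id_measurable
  define e where "e = (1 / norm (x - y)) *\<^sub>R (x - y)"
  have e: "norm e = 1" using False by (simp add: e_def)
  define f where "f = reflect e 0"
  have f: "orthogonal_transformation f"
  proof -
    have "linear f" unfolding f_def reflect_def by (rule linearI) (simp_all add: inner_add_left algebra_simps)
    moreover have "norm (f z) = norm z" for z
      unfolding f_def using norm_reflect_diff[OF e, of 0 z 0] by (simp add: reflect_def)
    ultimately show ?thesis by (simp add: orthogonal_transformation)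
  qed
  have "f x = y"
  proof -
    define n where "n = norm (x - y)"
    have n: "n \<noteq> 0" using False by (simp add: n_def)
    have "n * n = x \<bullet> x + y \<bullet> y - 2 * (x \<bullet> y)"
      unfolding n_def power2_eq_square[symmetric] power2_norm_eq_inner
      by (simp add: inner_diff_left inner_diff_right inner_commute)
    moreover have "y \<bullet> y = x \<bullet> x" using xy by (simp add: norm_eq)
    ultimately have "2 * (x \<bullet> e) = n"
      using n by (simp add: e_def n_def[symmetric] inner_diff_right field_simps)
    then show ?thesis using n unfolding f_def reflect_def by (simp add: e_def n_def[symmetric])
  qed
  then have "inv f y = x" using orthogonal_transformation_inj[OF f] by (metis inv_f_f)
  then have "norm (orth_proj (f ` V) y) = norm (orth_proj V x)" if "V \<in> space M" for V
    using that igp_space orth_proj_image[OF f, of V y] f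
    by (simp add: grassmannian_def orthogonal_transformation_norm)
  then have "(\<integral>\<^sup>+V. h (norm (orth_proj V x)) \<partial>M) = (\<integral>\<^sup>+V. h (norm (orth_proj (f ` V) y)) \<partial>M)"
    by (intro nn_integral_cong) simp
  also have "\<dots> = (\<integral>\<^sup>+V. h (norm (orth_proj V y)) \<partial>M)"
    by (rule nn_integral_igp_image[OF f]) measurable
  finally show ?thesis .
qed simp

end

section \<open>The mean over hyperplanes of the projected heat kernel\<close>

lemma norm_perp_swap:
  assumes "norm a = 1" "norm v = 1"
  shows "norm (perp v (c *\<^sub>R a)) = norm (perp a (c *\<^sub>R v))"
proof (rule power2_eq_imp_eq)
  show "(norm (perp v (c *\<^sub>R a)))\<^sup>2 = (norm (perp a (c *\<^sub>R v)))\<^sup>2"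
    using assms by (simp add: norm_perp inner_commute)
qed simp_all

lemma nn_integral_gauss_line:
  fixes e z :: "'a::euclidean_space"
  assumes e: "norm e = 1" and t: "0 < t"
  shows "(\<integral>\<^sup>+r. ennreal (gauss t (z - r *\<^sub>R e)) \<partial>lborel) = ennreal (pgauss t (perp e z))"
proof -
  have "gauss t (z - r *\<^sub>R e) = pgauss t (perp e z) * gauss t (z \<bullet> e - r)" for r
    using gauss_split[OF e t, of "z - r *\<^sub>R e"] perp_line[OF e, of z "- r"] e
    by (simp add: inner_diff_left dot_square_norm)
  then have "(\<integral>\<^sup>+r. ennreal (gauss t (z - r *\<^sub>R e)) \<partial>lborel) = (\<integral>\<^sup>+r. ennreal (pgauss t (perp e z)) * ennreal (gauss t (z \<bullet> e - r)) \<partial>lborel)"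
    using t by (simp add: ennreal_mult)
  also have "\<dots> = ennreal (pgauss t (perp e z)) * 1"
    using t nn_integral_lborel_reflect[of "\<lambda>r. ennreal (gauss t r)" "z \<bullet> e"] nn_integral_gauss[OF t, where 'a=real]
    by (subst nn_integral_cmult) auto
  finally show ?thesis by simp
qed

text \<open>This takes the place of polar coordinates. The projected kernel is the line integral of
  \<open>gauss t\<close> in direction \<open>y\<close>; parametrizing the line by multiples of
  \<open>y\<close> itself uses up the factor \<open>1 / norm y\<close>. For fixed \<sigma> the
  vector \<open>\<sigma> *\<^sub>R y\<close> is then, up to a constant, distributed with density
  \<open>gauss (\<sigma>\<^sup>2)\<close>, so convolution adds \<open>\<sigma>\<^sup>2\<close> to
  the time.\<close>

lemma nn_integral_gauss_ray_average:
  fixes z :: "'a::euclidean_space"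
  assumes t: "0 < t"
  shows "(\<integral>\<^sup>+y. ennreal (exp (- (norm y)\<^sup>2 / 4) / norm y) * ennreal (pgauss t (perp ((1 / norm y) *\<^sub>R y) z)) \<partial>lborel)
    = ennreal (sqrt (4 * pi) ^ DIM('a)) * (\<integral>\<^sup>+\<sigma>. ennreal (gauss (t + \<sigma>\<^sup>2) z) \<partial>lborel)"
proof -
  have "(\<integral>\<^sup>+y. ennreal (exp (- (norm y)\<^sup>2 / 4) / norm y) * ennreal (pgauss t (perp ((1 / norm y) *\<^sub>R y) z)) \<partial>lborel)
     = (\<integral>\<^sup>+y. \<integral>\<^sup>+\<sigma>. ennreal (exp (- (norm y)\<^sup>2 / 4) * gauss t (z - \<sigma> *\<^sub>R y)) \<partial>lborel \<partial>lborel)"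
  proof (rule nn_integral_cong_AE)
    show "AE y in lborel. ennreal (exp (- (norm y)\<^sup>2 / 4) / norm y) * ennreal (pgauss t (perp ((1 / norm y) *\<^sub>R y) z))
      = (\<integral>\<^sup>+\<sigma>. ennreal (exp (- (norm y)\<^sup>2 / 4) * gauss t (z - \<sigma> *\<^sub>R y)) \<partial>lborel)"
      using AE_lborel_singleton[of "0::'a"]
    proof eventually_elim
      fix y :: 'a assume y: "y \<noteq> 0"
      let ?e = "(1 / norm y) *\<^sub>R y"
      have e: "norm ?e = 1" using y by simp
      have "ennreal (pgauss t (perp ?e z)) = (\<integral>\<^sup>+r. ennreal (gauss t (z - r *\<^sub>R ?e)) \<partial>lborel)"
        by (rule nn_integral_gauss_line[OF e t, symmetric])
      also have "\<dots> = ennreal (\<bar>norm y\<bar> ^ DIM(real)) * (\<integral>\<^sup>+\<sigma>. ennreal (gauss t (z - (norm y *\<^sub>R \<sigma>) *\<^sub>R ?e)) \<partial>lborel)"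
        using y by (intro nn_integral_lborel_scale) auto
      finally have "ennreal (exp (- (norm y)\<^sup>2 / 4) / norm y) * ennreal (pgauss t (perp ?e z))
        = ennreal (exp (- (norm y)\<^sup>2 / 4) / norm y) * (ennreal (norm y) * (\<integral>\<^sup>+\<sigma>. ennreal (gauss t (z - \<sigma> *\<^sub>R y)) \<partial>lborel))"
        using y by simp
      also have "\<dots> = ennreal (exp (- (norm y)\<^sup>2 / 4)) * (\<integral>\<^sup>+\<sigma>. ennreal (gauss t (z - \<sigma> *\<^sub>R y)) \<partial>lborel)"
        using y by (simp add: mult.assoc[symmetric] ennreal_mult[symmetric])
      also have "\<dots> = (\<integral>\<^sup>+\<sigma>. ennreal (exp (- (norm y)\<^sup>2 / 4) * gauss t (z - \<sigma> *\<^sub>R y)) \<partial>lborel)"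
        using t by (subst nn_integral_cmult[symmetric]) (auto simp: ennreal_mult)
      finally show "ennreal (exp (- (norm y)\<^sup>2 / 4) / norm y) * ennreal (pgauss t (perp ?e z))
        = (\<integral>\<^sup>+\<sigma>. ennreal (exp (- (norm y)\<^sup>2 / 4) * gauss t (z - \<sigma> *\<^sub>R y)) \<partial>lborel)" .
    qed
  qed
  also have "\<dots> = (\<integral>\<^sup>+\<sigma>. \<integral>\<^sup>+y. ennreal (exp (- (norm y)\<^sup>2 / 4) * gauss t (z - \<sigma> *\<^sub>R y)) \<partial>lborel \<partial>lborel)"
    by (rule lborel_pair.Fubini') measurable
  also have "\<dots> = (\<integral>\<^sup>+\<sigma>. ennreal (sqrt (4 * pi) ^ DIM('a)) * ennreal (gauss (t + \<sigma>\<^sup>2) z) \<partial>lborel)"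
  proof (rule nn_integral_cong_AE)
    show "AE \<sigma> in lborel. (\<integral>\<^sup>+y. ennreal (exp (- (norm y)\<^sup>2 / 4) * gauss t (z - \<sigma> *\<^sub>R y)) \<partial>lborel)
       = ennreal (sqrt (4 * pi) ^ DIM('a)) * ennreal (gauss (t + \<sigma>\<^sup>2) z)"
      using AE_lborel_singleton[of "0::real"]
    proof eventually_elim
      fix \<sigma> :: real assume \<sigma>: "\<sigma> \<noteq> 0"
      let ?c = "\<bar>\<sigma>\<bar> ^ DIM('a)"
      have c: "0 < ?c" using \<sigma> by simp
      have s2: "0 < \<sigma>\<^sup>2" using \<sigma> by simp
      have g: "gauss (\<sigma>\<^sup>2) (u::'a) * (?c * sqrt (4 * pi) ^ DIM('a)) = exp (- (norm u)\<^sup>2 / (4 * \<sigma>\<^sup>2))" for u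
        using \<sigma> by (simp add: gauss_def real_sqrt_mult power_mult_distrib)
      have "ennreal ?c * (\<integral>\<^sup>+y. ennreal (exp (- (norm y)\<^sup>2 / 4) * gauss t (z - \<sigma> *\<^sub>R y)) \<partial>lborel)
        = ennreal ?c * (\<integral>\<^sup>+y. ennreal (exp (- (norm (\<sigma> *\<^sub>R y))\<^sup>2 / (4 * \<sigma>\<^sup>2)) * gauss t (z - \<sigma> *\<^sub>R y)) \<partial>lborel)"
        using \<sigma> by (simp add: power_mult_distrib)
      also have "\<dots> = (\<integral>\<^sup>+u. ennreal (exp (- (norm u)\<^sup>2 / (4 * \<sigma>\<^sup>2)) * gauss t (z - u)) \<partial>lborel)"
        by (rule nn_integral_lborel_scale[symmetric]) (use \<sigma> in auto)
      also have "\<dots> = (\<integral>\<^sup>+u. ennreal (?c * sqrt (4 * pi) ^ DIM('a)) * ennreal (gauss t (z - u) * gauss (\<sigma>\<^sup>2) (u - 0)) \<partial>lborel)"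
      proof (rule nn_integral_cong)
        fix u
        have "exp (- (norm u)\<^sup>2 / (4 * \<sigma>\<^sup>2)) * gauss t (z - u) = (?c * sqrt (4 * pi) ^ DIM('a)) * (gauss t (z - u) * gauss (\<sigma>\<^sup>2) (u - 0))"
          unfolding g[symmetric] by simp
        note eq = this
        show "ennreal (exp (- (norm u)\<^sup>2 / (4 * \<sigma>\<^sup>2)) * gauss t (z - u)) = ennreal (?c * sqrt (4 * pi) ^ DIM('a)) * ennreal (gauss t (z - u) * gauss (\<sigma>\<^sup>2) (u - 0))"
          unfolding eq by (rule ennreal_mult) (use t s2 in auto)
      qed
      also have "\<dots> = ennreal (?c * sqrt (4 * pi) ^ DIM('a)) * ennreal (gauss (t + \<sigma>\<^sup>2) (z - 0))"
        by (subst nn_integral_cmult, measurable, simp only: nn_integral_gauss_conv[OF t s2, of z 0])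
      also have "\<dots> = ennreal ?c * (ennreal (sqrt (4 * pi) ^ DIM('a)) * ennreal (gauss (t + \<sigma>\<^sup>2) z))"
        by (simp add: ennreal_mult mult.assoc)
      finally show "(\<integral>\<^sup>+y. ennreal (exp (- (norm y)\<^sup>2 / 4) * gauss t (z - \<sigma> *\<^sub>R y)) \<partial>lborel)
       = ennreal (sqrt (4 * pi) ^ DIM('a)) * ennreal (gauss (t + \<sigma>\<^sup>2) z)"
        using c by (simp add: ennreal_mult_cancel_left)
    qed
  qed
  also have "\<dots> = ennreal (sqrt (4 * pi) ^ DIM('a)) * (\<integral>\<^sup>+\<sigma>. ennreal (gauss (t + \<sigma>\<^sup>2) z) \<partial>lborel)"
    by (rule nn_integral_cmult) measurable
  finally show ?thesis .
qed

lemma nn_integral_gauss_sq_finite: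
  fixes z :: "'a::euclidean_space"
  assumes n: "2 \<le> DIM('a)" and t: "0 < t"
  shows "(\<integral>\<^sup>+\<sigma>. ennreal (1 / sqrt (4 * pi * (t + \<sigma>\<^sup>2)) ^ DIM('a)) \<partial>lborel) < \<infinity>"
proof -
  have half: "(\<integral>\<^sup>+\<sigma>. ennreal (1 / (1 + \<sigma>\<^sup>2)) * indicator {0..} \<sigma> \<partial>lborel) = ennreal (pi / 2 - arctan 0)"
    by (rule nn_integral_FTC_atLeast)
      (auto intro!: derivative_eq_intros tendsto_arctan_at_top simp: inverse_eq_divide add_nonneg_eq_0_iff)
  have "(\<integral>\<^sup>+\<sigma>. ennreal (1 / (1 + \<sigma>\<^sup>2)) \<partial>lborel)
     \<le> (\<integral>\<^sup>+\<sigma>. ennreal (1 / (1 + \<sigma>\<^sup>2)) * indicator {0..} \<sigma> + ennreal (1 / (1 + (0 - \<sigma>)\<^sup>2)) * indicator {0..} (0 - \<sigma>) \<partial>lborel)"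
    by (intro nn_integral_mono) (auto split: split_indicator)
  also have "\<dots> = ennreal (pi / 2 - arctan 0) + ennreal (pi / 2 - arctan 0)"
    using half nn_integral_lborel_reflect[of "\<lambda>\<sigma>. ennreal (1 / (1 + \<sigma>\<^sup>2)) * indicator {0..} \<sigma>" "0::real"]
    by (subst nn_integral_add) auto
  finally have fin: "(\<integral>\<^sup>+(\<sigma>::real). ennreal (1 / (1 + \<sigma>\<^sup>2)) \<partial>lborel) < \<infinity>" by (auto intro: le_less_trans)
  \<comment> \<open>Chosen so that
    \<open>m * (1 + \<sigma>\<^sup>2) \<le> t + \<sigma>\<^sup>2\<close>; the integrand is then
    dominated by a multiple of 1 / (1 + \<sigma>^2), where n \<ge> 2 is used.\<close>
  define m where "m = min 1 t"
  have m: "0 < m" "m \<le> 1" "m \<le> t" using t by (auto simp: m_def)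
  define K where "K = 1 / (sqrt (4 * pi * m) ^ DIM('a))"
  have le: "1 / sqrt (4 * pi * (t + \<sigma>\<^sup>2)) ^ DIM('a) \<le> K * (1 / (1 + \<sigma>\<^sup>2))" for \<sigma> :: real
  proof -
    have 1: "1 \<le> 1 + \<sigma>\<^sup>2" by simp
    have "sqrt (1 + \<sigma>\<^sup>2) ^ 2 \<le> sqrt (1 + \<sigma>\<^sup>2) ^ DIM('a)" using n by (intro power_increasing) auto
    then have a: "1 + \<sigma>\<^sup>2 \<le> sqrt (1 + \<sigma>\<^sup>2) ^ DIM('a)" by simp
    have "m * (1 + \<sigma>\<^sup>2) \<le> t + \<sigma>\<^sup>2" using m mult_right_mono[of m 1 "\<sigma>\<^sup>2"] by (simp add: distrib_left)
    then have "sqrt (4 * pi * m) * sqrt (1 + \<sigma>\<^sup>2) \<le> sqrt (4 * pi * (t + \<sigma>\<^sup>2))"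
      unfolding real_sqrt_mult[symmetric] by (intro real_sqrt_le_mono) (simp add: mult.assoc)
    then have "(sqrt (4 * pi * m) * sqrt (1 + \<sigma>\<^sup>2)) ^ DIM('a) \<le> sqrt (4 * pi * (t + \<sigma>\<^sup>2)) ^ DIM('a)"
      using m by (intro power_mono) auto
    moreover have "sqrt (4 * pi * m) ^ DIM('a) * (1 + \<sigma>\<^sup>2) \<le> (sqrt (4 * pi * m) * sqrt (1 + \<sigma>\<^sup>2)) ^ DIM('a)"
      unfolding power_mult_distrib using m a by (intro mult_left_mono) auto
    ultimately have "sqrt (4 * pi * m) ^ DIM('a) * (1 + \<sigma>\<^sup>2) \<le> sqrt (4 * pi * (t + \<sigma>\<^sup>2)) ^ DIM('a)" by linarith
    moreover have "0 < sqrt (4 * pi * m) ^ DIM('a) * (1 + \<sigma>\<^sup>2)"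
      using m by (intro mult_pos_pos zero_less_power add_pos_nonneg) auto
    ultimately have "1 / sqrt (4 * pi * (t + \<sigma>\<^sup>2)) ^ DIM('a) \<le> 1 / (sqrt (4 * pi * m) ^ DIM('a) * (1 + \<sigma>\<^sup>2))"
      by (intro divide_left_mono) (auto intro: mult_pos_pos)
    then show ?thesis by (simp add: K_def)
  qed
  have "(\<integral>\<^sup>+\<sigma>. ennreal (1 / sqrt (4 * pi * (t + \<sigma>\<^sup>2)) ^ DIM('a)) \<partial>lborel) \<le> (\<integral>\<^sup>+\<sigma>. ennreal K * ennreal (1 / (1 + \<sigma>\<^sup>2)) \<partial>lborel)"
  proof (intro nn_integral_mono)
    fix \<sigma> :: real
    have "0 \<le> K" using m by (simp add: K_def)
    then show "ennreal (1 / sqrt (4 * pi * (t + \<sigma>\<^sup>2)) ^ DIM('a)) \<le> ennreal K * ennreal (1 / (1 + \<sigma>\<^sup>2))"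
      using le[of \<sigma>] by (subst ennreal_mult[symmetric]) (auto intro: ennreal_leI)
  qed
  also have "\<dots> < \<infinity>" using fin by (subst nn_integral_cmult) (auto simp: ennreal_mult_less_top)
  finally show ?thesis .
qed

text \<open>Only the invariance of \<open>M\<close> is used, no parametrization of it. The left side
  depends on \<open>norm x\<close> alone, so \<open>x\<close> may be spread over all directions by a
  Gaussian weight in \<open>y\<close>. After exchanging the integrals, the inner one over
  \<open>y\<close> is the same for every \<open>V\<close>.\<close>

theorem nn_integral_igp_pgauss:
  fixes M :: "'a::euclidean_space set measure"
  assumes n: "2 \<le> DIM('a)" and M: "invariant_grassmannian_prob (DIM('a) - 1) M"
  obtains C where "0 < C"
    "\<And>t x. 0 < t \<Longrightarrow> (\<integral>\<^sup>+V. ennreal (pgauss t (orth_proj V x)) \<partial>M) = ennreal C * (\<integral>\<^sup>+\<sigma>. ennreal (gauss (t + \<sigma>\<^sup>2) x) \<partial>lborel)"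
proof -
  interpret M: prob_space M by (rule igp_prob[OF M])
  interpret pair_sigma_finite "lborel :: 'a measure" M ..
  note [measurable] = igp_id_measurable[OF M]
  let ?\<gamma> = "\<lambda>y::'a. ennreal (exp (- (norm y)\<^sup>2 / 4) / norm y)"
  define Z where "Z = (\<integral>\<^sup>+y. ?\<gamma> y \<partial>lborel)"
  define A where "A = sqrt (4 * pi) ^ DIM('a)"
  have A: "0 < A" by (simp add: A_def)
  let ?I = "\<lambda>t x::'a. \<integral>\<^sup>+\<sigma>. ennreal (gauss (t + \<sigma>\<^sup>2) x) \<partial>lborel"
  let ?N = "\<lambda>t x. \<integral>\<^sup>+V. ennreal (pgauss t (orth_proj V x)) \<partial>M"
  have main: "Z * ?N t x = ennreal A * ?I t x" if t: "0 < t" for t x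
  proof -
    let ?u = "\<lambda>y::'a. (1 / norm y) *\<^sub>R y"
    have pg: "pgauss t z = exp (- (norm z)\<^sup>2 / (4 * t)) / sqrt (4 * pi * t) ^ (DIM('a) - 1)" for z :: 'a
      by (simp add: pgauss_def)
    have "Z * ?N t x = (\<integral>\<^sup>+y. ?\<gamma> y * ?N t x \<partial>lborel)"
      unfolding Z_def by (rule nn_integral_multc[symmetric]) measurable
    also have "\<dots> = (\<integral>\<^sup>+y. \<integral>\<^sup>+V. ?\<gamma> y * ennreal (pgauss t (orth_proj V (norm x *\<^sub>R ?u y))) \<partial>M \<partial>lborel)"
    proof (rule nn_integral_cong)
      fix y :: 'a
      show "?\<gamma> y * ?N t x = (\<integral>\<^sup>+V. ?\<gamma> y * ennreal (pgauss t (orth_proj V (norm x *\<^sub>R ?u y))) \<partial>M)"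
      proof (cases "y = 0")
        case False
        then have "norm x = norm (norm x *\<^sub>R ?u y)" by simp
        from nn_integral_igp_radial[OF M _ this, of "\<lambda>r. ennreal (exp (- r\<^sup>2 / (4 * t)) / sqrt (4 * pi * t) ^ (DIM('a) - 1))"]
        have "?N t x = ?N t (norm x *\<^sub>R ?u y)" unfolding pg by measurable
        then show ?thesis by (simp add: nn_integral_cmult)
      qed simp
    qed
    also have "\<dots> = (\<integral>\<^sup>+V. \<integral>\<^sup>+y. ?\<gamma> y * ennreal (pgauss t (orth_proj V (norm x *\<^sub>R ?u y))) \<partial>lborel \<partial>M)"
      by (rule Fubini'[symmetric]) measurable
    also have "\<dots> = (\<integral>\<^sup>+V. ennreal A * ?I t x \<partial>M)"
    proof (rule nn_integral_cong)
      fix V assume "V \<in> space M"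
      then have "V \<in> grassmannian (DIM('a) - 1)" using igp_space[OF M] by simp
      then obtain v where v: "norm v = 1" "orth_proj V = perp v" by (rule grassmannian_hyperplaneE)
      have "(\<integral>\<^sup>+y. ?\<gamma> y * ennreal (pgauss t (orth_proj V (norm x *\<^sub>R ?u y))) \<partial>lborel)
        = (\<integral>\<^sup>+y. ?\<gamma> y * ennreal (pgauss t (perp (?u y) (norm x *\<^sub>R v))) \<partial>lborel)"
      proof (rule nn_integral_cong)
        fix y :: 'a
        show "?\<gamma> y * ennreal (pgauss t (orth_proj V (norm x *\<^sub>R ?u y))) = ?\<gamma> y * ennreal (pgauss t (perp (?u y) (norm x *\<^sub>R v)))"
        proof (cases "y = 0")
          case False
          then have "norm (?u y) = 1" by simp
          \<comment> \<open>Normal vector and direction change places: the length of the projection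
            depends only on their angle. This brings the integrand into the form of
            \<open>nn_integral_gauss_ray_average\<close>.\<close>
          then have "norm (perp v (norm x *\<^sub>R ?u y)) = norm (perp (?u y) (norm x *\<^sub>R v))"
            using v(1) by (rule norm_perp_swap)
          then show ?thesis unfolding v(2) pg by (simp only:)
        qed simp
      qed
      also have "\<dots> = ennreal A * ?I t (norm x *\<^sub>R v)"
        unfolding A_def by (rule nn_integral_gauss_ray_average[OF t])
      also have "?I t (norm x *\<^sub>R v) = ?I t x"
        using gauss_cong_norm[of "norm x *\<^sub>R v" x] v(1) by simp
      finally show "(\<integral>\<^sup>+y. ?\<gamma> y * ennreal (pgauss t (orth_proj V (norm x *\<^sub>R ?u y))) \<partial>lborel) = ennreal A * ?I t x" .
    qed
    also have "\<dots> = ennreal A * ?I t x" by (simp add: M.emeasure_space_1)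
    finally show ?thesis .
  qed
  have Ifin: "?I t x < \<infinity>" if t: "0 < t" for t x
  proof -
    have "?I t x \<le> (\<integral>\<^sup>+\<sigma>. ennreal (1 / sqrt (4 * pi * (t + \<sigma>\<^sup>2)) ^ DIM('a)) \<partial>lborel)"
      using t by (intro nn_integral_mono ennreal_leI gauss_le) (simp add: add_pos_nonneg)
    then show ?thesis using nn_integral_gauss_sq_finite[OF n t] by (rule le_less_trans)
  qed
  have N0: "?N 1 0 = ennreal (pgauss 1 (0::'a))"
  proof -
    have "orth_proj V 0 = 0" if "V \<in> space M" for V :: "'a set"
    proof -
      have "V \<in> grassmannian (DIM('a) - 1)" using that igp_space[OF M] by simp
      then obtain v where "orth_proj V = perp v" by (rule grassmannian_hyperplaneE)
      then show ?thesis by (simp add: perp_def)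
    qed
    then have "?N 1 0 = (\<integral>\<^sup>+V. ennreal (pgauss 1 (0::'a)) \<partial>M)" by (intro nn_integral_cong) simp
    then show ?thesis by (simp add: M.emeasure_space_1)
  qed
  have p0: "0 < pgauss 1 (0::'a)" by (simp add: pgauss_def)
  \<comment> \<open>Finiteness of \<open>Z\<close> comes from the identity itself at
    \<open>t = 1\<close> and \<open>x = 0\<close>, where the mean over \<open>V\<close> is an
    explicit positive number and the right side is finite.\<close>
  have "Z * ennreal (pgauss 1 (0::'a)) < \<infinity>"
    using main[of 1 0] Ifin[of 1 0] unfolding N0 by (simp add: ennreal_mult_less_top)
  then have Zfin: "Z < \<infinity>" using p0 by (auto simp: ennreal_mult_less_top)
  have Zpos: "Z \<noteq> 0"
  proof
    assume "Z = 0"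
    then have "AE y in lborel. ?\<gamma> y = 0" unfolding Z_def by (subst (asm) nn_integral_0_iff_AE) auto
    then have "AE y in (lborel :: 'a measure). False"
      using AE_lborel_singleton[of "0::'a"] by eventually_elim (simp add: divide_le_0_iff not_le[symmetric])
    then show False by (simp add: AE_iff_null null_sets_def)
  qed
  obtain z where z: "Z = ennreal z" "0 < z"
    using Zfin Zpos by (cases Z) (auto simp: less_top order_less_le)
  show thesis
  proof (rule that[of "A / z"])
    show "0 < A / z" using A z by simp
    fix t x assume t: "0 < (t::real)"
    have "ennreal z * ?N t x = ennreal z * (ennreal (A / z) * ?I t x)"
      using main[OF t, of x] z A by (simp add: mult.assoc[symmetric] ennreal_mult[symmetric])
    then show "?N t x = ennreal (A / z) * ?I t x"
      using z by (simp add: ennreal_mult_cancel_left)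
  qed
qed

section \<open>Smoothed line transforms\<close>

text \<open>The square-function identity \<open>\<parallel>R f\<parallel>\<^sup>2 = \<langle>f, R\<^sup>* R f\<rangle>\<close> for the smoothed line transform \<open>R\<close> with kernel \<open>\<kappa>\<close>.\<close>
lemma kernel_square:
  fixes \<kappa> :: "'a::euclidean_space \<Rightarrow> 'a \<Rightarrow> real" and f :: "'a \<Rightarrow> real"
  assumes \<kappa>m[measurable]: "case_prod \<kappa> \<in> borel_measurable (borel \<Otimes>\<^sub>M borel)" and \<kappa>0: "\<And>x z. 0 \<le> \<kappa> x z"
    and \<kappa>1: "\<And>x. (\<integral>\<^sup>+z. ennreal (\<kappa> x z) \<partial>lborel) \<le> 1"
    and \<kappa>2: "\<And>x y. (\<integral>\<^sup>+z. ennreal (\<kappa> x z * \<kappa> y z) \<partial>lborel) = ennreal (K x y)"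
    and K: "\<And>x y. 0 \<le> K x y" "\<And>x y. K x y \<le> B"
    and f: "integrable lborel f"
  defines "F \<equiv> \<lambda>z. \<integral>x. f x * \<kappa> x z \<partial>lborel"
  shows "integrable lborel (\<lambda>z. (F z)\<^sup>2)"
    and "(\<integral>z. (F z)\<^sup>2 \<partial>lborel) = (\<integral>x. \<integral>y. f x * f y * K x y \<partial>lborel \<partial>lborel)"
    and "integrable lborel F"
    and "S \<in> sets borel \<Longrightarrow> (\<integral>z. indicator S z * F z \<partial>lborel) = (\<integral>x. f x * (\<integral>z. indicator S z * \<kappa> x z \<partial>lborel) \<partial>lborel)"
proof -
  have fm[measurable]: "f \<in> borel_measurable borel" using borel_measurable_integrable[OF f] by simp
  have fi: "(\<integral>\<^sup>+x. ennreal \<bar>f x\<bar> \<partial>lborel) < \<infinity>" using f by (simp add: integrable_iff_bounded)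
  have B0: "0 \<le> B" using order_trans[OF K(1) K(2)] .
  have [measurable]: "fst \<in> borel_measurable (borel :: ('a \<times> 'a) measure)" "snd \<in> borel_measurable (borel :: ('a \<times> 'a) measure)"
    unfolding borel_prod[symmetric] by measurable
  have m1: "(\<lambda>p. \<kappa> (g p) (h p)) \<in> borel_measurable N" if "g \<in> borel_measurable N" "h \<in> borel_measurable N" for N g h
    using measurable_compose[OF measurable_Pair[OF that] \<kappa>m] by simp
  note [measurable] = m1
  have i1: "integrable (lborel \<Otimes>\<^sub>M lborel) (\<lambda>(x, z). f x * \<kappa> x z)"
  proof (rule integrable_lborel_pairI)
    have "(\<integral>\<^sup>+x. \<integral>\<^sup>+z. ennreal \<bar>f x * \<kappa> x z\<bar> \<partial>lborel \<partial>lborel) = (\<integral>\<^sup>+x. ennreal \<bar>f x\<bar> * (\<integral>\<^sup>+z. ennreal (\<kappa> x z) \<partial>lborel) \<partial>lborel)"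
      using \<kappa>0 by (intro nn_integral_cong) (simp add: abs_mult ennreal_mult nn_integral_cmult)
    also have "\<dots> \<le> (\<integral>\<^sup>+x. ennreal \<bar>f x\<bar> * 1 \<partial>lborel)"
      by (intro nn_integral_mono mult_left_mono \<kappa>1) simp
    finally show "(\<integral>\<^sup>+x. \<integral>\<^sup>+z. ennreal \<bar>f x * \<kappa> x z\<bar> \<partial>lborel \<partial>lborel) < \<infinity>" using fi by (simp add: le_less_trans)
  qed measurable
  show "integrable lborel F"
    unfolding F_def using lborel_pair.integrable_snd[OF i1] by simp
  show "(\<integral>z. indicator S z * F z \<partial>lborel) = (\<integral>x. f x * (\<integral>z. indicator S z * \<kappa> x z \<partial>lborel) \<partial>lborel)"
    if S[measurable]: "S \<in> sets borel"
  proof -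
    have "integrable (lborel \<Otimes>\<^sub>M lborel) (\<lambda>(x, z). f x * (indicator S z * \<kappa> x z))"
      by (rule Bochner_Integration.integrable_bound[OF i1]) (auto split: split_indicator)
    from lborel_pair.Fubini_integral[OF this]
    have "(\<integral>z. \<integral>x. f x * (indicator S z * \<kappa> x z) \<partial>lborel \<partial>lborel) = (\<integral>x. \<integral>z. f x * (indicator S z * \<kappa> x z) \<partial>lborel \<partial>lborel)" .
    moreover have "(\<integral>x. f x * (indicator S z * \<kappa> x z) \<partial>lborel) = indicator S z * F z" for z
      unfolding F_def by (subst integral_mult_right_zero[symmetric]) (simp add: mult_ac)
    ultimately show ?thesis by simp
  qed
  let ?g = "\<lambda>p z. f (fst p) * f (snd p) * (\<kappa> (fst p) z * \<kappa> (snd p) z)"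
  have i3: "integrable (lborel \<Otimes>\<^sub>M lborel) (\<lambda>(p, z). ?g p z)"
  proof (rule integrable_lborel_pairI)
    have "(\<integral>\<^sup>+p. \<integral>\<^sup>+z. ennreal \<bar>?g p z\<bar> \<partial>lborel \<partial>lborel) = (\<integral>\<^sup>+p. ennreal \<bar>f (fst p) * f (snd p)\<bar> * ennreal (K (fst p) (snd p)) \<partial>lborel)"
    proof (rule nn_integral_cong)
      fix p
      have "ennreal \<bar>?g p z\<bar> = ennreal \<bar>f (fst p) * f (snd p)\<bar> * ennreal (\<kappa> (fst p) z * \<kappa> (snd p) z)" for z
        using \<kappa>0 by (simp add: abs_mult ennreal_mult mult_ac)
      then show "(\<integral>\<^sup>+z. ennreal \<bar>?g p z\<bar> \<partial>lborel) = ennreal \<bar>f (fst p) * f (snd p)\<bar> * ennreal (K (fst p) (snd p))"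
        by (simp add: nn_integral_cmult \<kappa>2)
    qed
    also have "\<dots> \<le> (\<integral>\<^sup>+p. ennreal B * (ennreal \<bar>f (fst p)\<bar> * ennreal \<bar>f (snd p)\<bar>) \<partial>lborel)"
    proof (intro nn_integral_mono)
      fix p
      have "ennreal \<bar>f (fst p) * f (snd p)\<bar> * ennreal (K (fst p) (snd p)) \<le> ennreal \<bar>f (fst p) * f (snd p)\<bar> * ennreal B"
        using K by (intro mult_left_mono ennreal_leI) auto
      then show "ennreal \<bar>f (fst p) * f (snd p)\<bar> * ennreal (K (fst p) (snd p)) \<le> ennreal B * (ennreal \<bar>f (fst p)\<bar> * ennreal \<bar>f (snd p)\<bar>)"
        by (simp add: abs_mult ennreal_mult mult_ac)
    qed
    also have "\<dots> = ennreal B * ((\<integral>\<^sup>+x. ennreal \<bar>f x\<bar> \<partial>lborel) * (\<integral>\<^sup>+x. ennreal \<bar>f x\<bar> \<partial>lborel))"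
    proof -
      have "(\<integral>\<^sup>+p. ennreal \<bar>f (fst p)\<bar> * ennreal \<bar>f (snd p)\<bar> \<partial>lborel) = (\<integral>\<^sup>+x. \<integral>\<^sup>+y. ennreal \<bar>f x\<bar> * ennreal \<bar>f y\<bar> \<partial>lborel \<partial>lborel)"
        unfolding lborel_prod[symmetric] by (subst lborel.nn_integral_fst[symmetric]) auto
      also have "\<dots> = (\<integral>\<^sup>+x. ennreal \<bar>f x\<bar> \<partial>lborel) * (\<integral>\<^sup>+x. ennreal \<bar>f x\<bar> \<partial>lborel)"
        by (simp add: nn_integral_cmult nn_integral_multc)
      finally show ?thesis by (subst nn_integral_cmult) auto
    qed
    also have "\<dots> < \<infinity>" using fi by (simp add: ennreal_mult_less_top)
    finally show "(\<integral>\<^sup>+p. \<integral>\<^sup>+z. ennreal \<bar>?g p z\<bar> \<partial>lborel \<partial>lborel) < \<infinity>" .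
  qed measurable
  have ae: "AE z in lborel. integrable (lborel \<Otimes>\<^sub>M lborel) (\<lambda>p. ?g p z)"
    using lborel_pair.AE_integrable_snd[OF i3] by (simp add: lborel_prod)
  have sq: "AE z in lborel. (\<integral>p. ?g p z \<partial>lborel) = (F z)\<^sup>2"
    using ae
  proof eventually_elim
    fix z assume i: "integrable (lborel \<Otimes>\<^sub>M lborel) (\<lambda>p. ?g p z)"
    have "(\<integral>p. ?g p z \<partial>lborel) = (\<integral>x. \<integral>y. f x * f y * (\<kappa> x z * \<kappa> y z) \<partial>lborel \<partial>lborel)"
      unfolding lborel_prod[symmetric] by (subst lborel_pair.integral_fst'[OF i, symmetric]) simp
    also have "\<dots> = (\<integral>x. (f x * \<kappa> x z) * F z \<partial>lborel)"
      unfolding F_def by (simp add: mult_ac flip: integral_mult_right_zero)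
    also have "\<dots> = (F z)\<^sup>2" unfolding F_def by (simp add: power2_eq_square)
    finally show "(\<integral>p. ?g p z \<partial>lborel) = (F z)\<^sup>2" .
  qed
  have Fm[measurable]: "F \<in> borel_measurable borel" unfolding F_def by measurable
  have i4: "integrable lborel (\<lambda>z. \<integral>p. ?g p z \<partial>lborel)"
    using lborel_pair.integrable_snd[OF i3] by simp
  show "integrable lborel (\<lambda>z. (F z)\<^sup>2)"
    by (rule integrable_cong_AE_imp[OF i4]) (use sq in auto)
  have "(\<integral>z. (F z)\<^sup>2 \<partial>lborel) = (\<integral>z. \<integral>p. ?g p z \<partial>lborel \<partial>lborel)"
    using sq borel_measurable_integrable[OF i4] by (intro integral_cong_AE) auto
  also have "\<dots> = (\<integral>p. \<integral>z. ?g p z \<partial>lborel \<partial>lborel)"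
    by (rule lborel_pair.Fubini_integral[OF i3])
  also have "\<dots> = (\<integral>p. f (fst p) * f (snd p) * K (fst p) (snd p) \<partial>lborel)"
  proof (rule Bochner_Integration.integral_cong[OF refl])
    fix p
    have "(\<integral>z. \<kappa> (fst p) z * \<kappa> (snd p) z \<partial>lborel) = K (fst p) (snd p)"
      using \<kappa>2 \<kappa>0 K by (subst integral_eq_nn_integral) auto
    then show "(\<integral>z. ?g p z \<partial>lborel) = f (fst p) * f (snd p) * K (fst p) (snd p)" by simp
  qed
  also have "\<dots> = (\<integral>x. \<integral>y. f x * f y * K x y \<partial>lborel \<partial>lborel)"
  proof -
    have "integrable lborel (\<lambda>p. \<integral>z. ?g p z \<partial>lborel)" using lborel_pair.integrable_fst[OF i3] by simp
    moreover have "(\<integral>z. ?g p z \<partial>lborel) = f (fst p) * f (snd p) * K (fst p) (snd p)" for p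
    proof -
      have "(\<integral>z. \<kappa> (fst p) z * \<kappa> (snd p) z \<partial>lborel) = K (fst p) (snd p)"
        using \<kappa>2 \<kappa>0 K by (subst integral_eq_nn_integral) auto
      then show ?thesis by simp
    qed
    ultimately have "integrable (lborel \<Otimes>\<^sub>M lborel) (\<lambda>p. f (fst p) * f (snd p) * K (fst p) (snd p))"
      unfolding lborel_prod by (simp only:)
    from lborel_pair.integral_fst'[OF this] show ?thesis by (simp add: lborel_prod)
  qed
  finally show "(\<integral>z. (F z)\<^sup>2 \<partial>lborel) = (\<integral>x. \<integral>y. f x * f y * K x y \<partial>lborel \<partial>lborel)" .
qed

text \<open>The slab over \<open>V\<close> written through \<open>orth_proj V\<close> and not
  through a normal vector, which is unique only up to sign; measurability in \<open>V\<close> is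
  then immediate.\<close>

definition strip :: "'a::euclidean_space set \<Rightarrow> 'a set" where
  "strip V = {z. norm (z - orth_proj V z) \<le> 1 / 2}"

definition cyl :: "'a::euclidean_space set \<Rightarrow> 'a set \<Rightarrow> 'a set" where
  "cyl V E = {z. orth_proj V z \<in> orth_proj V ` E}"

text \<open>The projection is measured by the volume of the slab of height 1 over it, so that Lebesgue
  measure on hyperplanes is not needed.\<close>
definition proj_vol :: "'a::euclidean_space set \<Rightarrow> 'a set \<Rightarrow> ennreal" where
  "proj_vol V E = emeasure lborel (cyl V E \<inter> strip V)"

lemma strip_eq_slab: "norm v = 1 \<Longrightarrow> orth_proj V = perp v \<Longrightarrow> strip V = slab v"
  by (simp add: strip_def slab_def perp_def)

text \<open>Integrating a function against it in \<open>x\<close> gives its line integrals normal to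
  \<open>V\<close>, smoothed by the heat kernel of \<open>V\<close>. The indicator of the strip
  makes Lebesgue measure in \<open>z\<close> act as the measure on \<open>V\<close>.\<close>

definition line_kernel :: "real \<Rightarrow> 'a::euclidean_space set \<Rightarrow> 'a \<Rightarrow> 'a \<Rightarrow> real" where
  "line_kernel t V x z = indicator (strip V) z * pgauss t (orth_proj V (x - z))"

lemma pgauss_le: "0 < t \<Longrightarrow> pgauss t (z::'a::euclidean_space) \<le> 1 / sqrt (4 * pi * t) ^ (DIM('a) - 1)"
  unfolding pgauss_def by (intro divide_right_mono) auto

context
  fixes V :: "'a::euclidean_space set"
  assumes V: "V \<in> grassmannian (DIM('a) - 1)"
begin

lemma orth_proj_borel [measurable]: "orth_proj V \<in> borel_measurable borel"
  using V by (intro borel_measurable_continuous_onI linear_continuous_on bounded_linear_orth_proj) (simp add: grassmannian_def)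

lemma strip_borel [measurable]: "strip V \<in> sets borel"
  unfolding strip_def by measurable

lemma line_kernel_measurable: "case_prod (line_kernel t V) \<in> borel_measurable (borel \<Otimes>\<^sub>M borel)"
  unfolding line_kernel_def by measurable

lemma nn_integral_line_kernel_cylinder:
  assumes t: "0 < t" and [measurable]: "A \<in> sets borel" and A: "\<And>z z'. orth_proj V z = orth_proj V z' \<Longrightarrow> z \<in> A \<Longrightarrow> z' \<in> A"
  shows "(\<integral>\<^sup>+z. ennreal (indicator A z * line_kernel t V x z) \<partial>lborel) = (\<integral>\<^sup>+z. indicator A z * ennreal (gauss t (x - z)) \<partial>lborel)"
proof -
  obtain v where v: "norm v = 1" "orth_proj V = perp v" using grassmannian_hyperplaneE[OF V] by metis
  have "indicator A (z + r *\<^sub>R v) = (indicator A z :: ennreal)" for z r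
    using A[of "z + r *\<^sub>R v" z] A[of z "z + r *\<^sub>R v"] v by (auto split: split_indicator)
  from nn_integral_slab_pgauss[OF _ v(1) this t, of x] show ?thesis
    unfolding line_kernel_def strip_eq_slab[OF v] v(2) using t
    by (simp add: indicator_times_eq_if(1) ennreal_indicator[symmetric] ennreal_mult[symmetric] mult_ac del: ennreal_indicator)
qed

lemma nn_integral_line_kernel:
  assumes t: "0 < t"
  shows "(\<integral>\<^sup>+z. ennreal (line_kernel t V x z) \<partial>lborel) = 1"
  using nn_integral_line_kernel_cylinder[OF t, of UNIV x] nn_integral_gauss[OF t, where 'a='a] t
    nn_integral_lborel_reflect[of "\<lambda>z. ennreal (gauss t z)" x]
  by simp

lemma nn_integral_line_kernel_conv:
  assumes t: "0 < t"
  shows "(\<integral>\<^sup>+z. ennreal (line_kernel t V x z * line_kernel t V y z) \<partial>lborel) = ennreal (pgauss (2 * t) (orth_proj V (x - y)))"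
proof -
  obtain v where v: "norm v = 1" "orth_proj V = perp v" using grassmannian_hyperplaneE[OF V] by metis
  have "pgauss t (perp v (y - z)) = pgauss t (perp v (z - y))" for z
    by (simp add: pgauss_def perp_diff norm_minus_commute)
  then have "ennreal (line_kernel t V x z * line_kernel t V y z) = indicator (slab v) z * ennreal (pgauss t (perp v (x - z)) * pgauss t (perp v (z - y)))" for z
    unfolding line_kernel_def strip_eq_slab[OF v] v(2) by (auto split: split_indicator)
  then show ?thesis using nn_integral_slab_pgauss_conv[OF v(1) t t, of x y] by (simp add: v(2))
qed

lemmas line_kernel_square = kernel_square[OF line_kernel_measurable _ eq_refl[OF nn_integral_line_kernel] nn_integral_line_kernel_conv]

lemma line_kernel_nonneg: "0 < t \<Longrightarrow> 0 \<le> line_kernel t V x z"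
  by (simp add: line_kernel_def)

text \<open>Cauchy-Schwarz in the linear form 2 a b \<le> s a^2 + b^2 / s, with the indicator of the
  set and the transform \<open>F\<close>. The parameter \<open>s\<close> stays free so that the
  inequality can be integrated over \<open>V\<close> with one common value.\<close>

lemma line_kernel_cauchy_schwarz:
  assumes t: "0 < t" and f: "integrable lborel f" and S[measurable]: "S \<in> sets borel" "emeasure lborel (S \<inter> strip V) < \<infinity>" and s: "0 < s"
  shows "2 * (\<integral>x. f x * (\<integral>z. indicator S z * line_kernel t V x z \<partial>lborel) \<partial>lborel)
    \<le> s * measure lborel (S \<inter> strip V) + (1 / s) * (\<integral>x. \<integral>y. f x * f y * pgauss (2 * t) (orth_proj V (x - y)) \<partial>lborel \<partial>lborel)"
proof -
  define F where "F z = (\<integral>x. f x * line_kernel t V x z \<partial>lborel)" for z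
  let ?S = "S \<inter> strip V"
  have t2: "0 < 2 * t" using t by simp
  note sq = line_kernel_square[OF line_kernel_nonneg[OF t] t t pgauss_nonneg pgauss_le[OF t2] f, folded F_def]
  have S'[measurable]: "?S \<in> sets borel" by measurable
  have 1: "(\<integral>x. f x * (\<integral>z. indicator S z * line_kernel t V x z \<partial>lborel) \<partial>lborel) = (\<integral>z. indicator ?S z * F z \<partial>lborel)"
  proof -
    have "indicator S z * line_kernel t V x z = indicator ?S z * line_kernel t V x z" for x z
      by (simp add: line_kernel_def split: split_indicator)
    then have "(\<integral>x. f x * (\<integral>z. indicator S z * line_kernel t V x z \<partial>lborel) \<partial>lborel)
      = (\<integral>x. f x * (\<integral>z. indicator ?S z * line_kernel t V x z \<partial>lborel) \<partial>lborel)" by (simp only:)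
    then show ?thesis using sq(4)[OF _ S'] t by simp
  qed
  have i2: "integrable lborel (\<lambda>z. (F z)\<^sup>2)" and iF: "integrable lborel F"
    using sq(1,3) t by simp_all
  have iS: "integrable lborel (\<lambda>z. indicator ?S z :: real)" using S by simp
  have iSF: "integrable lborel (\<lambda>z. indicator ?S z * F z)"
    by (rule Bochner_Integration.integrable_bound[OF iF]) (use borel_measurable_integrable[OF iF] in \<open>auto split: split_indicator\<close>)
  have "2 * (\<integral>z. indicator ?S z * F z \<partial>lborel) = (\<integral>z. 2 * (indicator ?S z * F z) \<partial>lborel)" by simp
  also have "\<dots> \<le> (\<integral>z. s * indicator ?S z + (1 / s) * (F z)\<^sup>2 \<partial>lborel)"
  proof (rule integral_mono)
    fix z
    have "0 \<le> (s * indicator ?S z - F z)\<^sup>2" by simp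
    then have "2 * s * (indicator ?S z * F z) \<le> s * s * indicator ?S z + (F z)\<^sup>2"
      by (cases "z \<in> ?S") (simp_all add: power2_eq_square algebra_simps)
    then show "2 * (indicator ?S z * F z) \<le> s * indicator ?S z + (1 / s) * (F z)\<^sup>2"
      using s by (simp add: field_simps)
  qed (use i2 iS iSF in auto)
  also have "\<dots> = s * measure lborel ?S + (1 / s) * (\<integral>z. (F z)\<^sup>2 \<partial>lborel)"
    using i2 iS by simp
  finally show ?thesis using sq(2) t unfolding 1 by simp
qed

text \<open>If all normal line integrals of \<open>f\<close> are at most \<open>b\<close>, so are
  the smoothed ones \<open>F\<close>, and the integral of \<open>F\<close> squared is at most
  \<open>b\<close> times that of \<open>F\<close>, which is the integral of
  \<open>f\<close>.\<close>

lemma line_kernel_square_le: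
  assumes t: "0 < t" and f: "integrable lborel f" "\<And>x. 0 \<le> f x"
    and b: "\<And>x. (\<integral>\<^sup>+r. ennreal (f (orth_proj V x + r *\<^sub>R v)) \<partial>lborel) \<le> ennreal b" and v: "norm v = 1" "orth_proj V = perp v" and b0: "0 \<le> b"
  shows "(\<integral>x. \<integral>y. f x * f y * pgauss (2 * t) (orth_proj V (x - y)) \<partial>lborel \<partial>lborel) \<le> b * (\<integral>x. f x \<partial>lborel)"
proof -
  define F where "F z = (\<integral>x. f x * line_kernel t V x z \<partial>lborel)" for z
  have fm[measurable]: "f \<in> borel_measurable borel" using borel_measurable_integrable[OF f(1)] by simp
  have t2: "0 < 2 * t" using t by simp
  note sq = line_kernel_square[OF line_kernel_nonneg[OF t] t t pgauss_nonneg pgauss_le[OF t2] f(1), folded F_def]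
  have i2: "integrable lborel (\<lambda>z. (F z)\<^sup>2)" and iF: "integrable lborel F"
    using sq(1,3) t by simp_all
  have F0: "0 \<le> F z" for z unfolding F_def using f(2) line_kernel_nonneg[OF t] by (intro integral_nonneg_AE AE_I2) simp
  have Fb: "F z \<le> b" for z
  proof -
    have "(\<integral>\<^sup>+x. ennreal (f x * line_kernel t V x z) \<partial>lborel) \<le> (\<integral>\<^sup>+x. ennreal (f x * pgauss t (perp v (z - x))) \<partial>lborel)"
    proof (intro nn_integral_mono ennreal_leI)
      fix x
      have "pgauss t (perp v (x - z)) = pgauss t (perp v (z - x))" by (simp add: pgauss_def perp_diff norm_minus_commute)
      then show "f x * line_kernel t V x z \<le> f x * pgauss t (perp v (z - x))"
        using f(2)[of x] t by (auto simp: line_kernel_def v(2) split: split_indicator)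
    qed
    also have "\<dots> = (\<integral>\<^sup>+x. indicator (slab v) x * (\<integral>\<^sup>+r. ennreal (f (perp v x + r *\<^sub>R v) * pgauss t (perp v (z - (perp v x + r *\<^sub>R v)))) \<partial>lborel) \<partial>lborel)"
      by (rule nn_integral_slab_fubini[OF _ v(1)]) measurable
    also have "\<dots> \<le> (\<integral>\<^sup>+x. indicator (slab v) x * (ennreal b * ennreal (pgauss t (perp v (z - x)))) \<partial>lborel)"
    proof (intro nn_integral_mono mult_left_mono)
      fix x
      have "perp v (perp v x) = perp v x" using v(1) by (simp add: perp_def inner_diff_left dot_square_norm)
      then have "perp v (z - (perp v x + r *\<^sub>R v)) = perp v (z - x)" for r
        using v(1) by (simp add: perp_diff)
      then have "(\<integral>\<^sup>+r. ennreal (f (perp v x + r *\<^sub>R v) * pgauss t (perp v (z - (perp v x + r *\<^sub>R v)))) \<partial>lborel)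
        = (\<integral>\<^sup>+r. ennreal (f (perp v x + r *\<^sub>R v)) \<partial>lborel) * ennreal (pgauss t (perp v (z - x)))"
        using t f(2) by (simp add: ennreal_mult nn_integral_multc)
      also have "\<dots> \<le> ennreal b * ennreal (pgauss t (perp v (z - x)))"
        using b[of x] by (intro mult_right_mono) (auto simp: v(2))
      finally show "(\<integral>\<^sup>+r. ennreal (f (perp v x + r *\<^sub>R v) * pgauss t (perp v (z - (perp v x + r *\<^sub>R v)))) \<partial>lborel) \<le> ennreal b * ennreal (pgauss t (perp v (z - x)))" .
    qed simp
    also have "\<dots> = ennreal b * (\<integral>\<^sup>+x. ennreal (line_kernel t V z x) \<partial>lborel)"
      unfolding line_kernel_def strip_eq_slab[OF v] v(2)
      by (subst nn_integral_cmult[symmetric], measurable) (auto intro!: nn_integral_cong split: split_indicator)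
    also have "\<dots> = ennreal b" by (simp add: nn_integral_line_kernel[OF t])
    finally have "(\<integral>\<^sup>+x. ennreal (f x * line_kernel t V x z) \<partial>lborel) \<le> ennreal b" .
    moreover have "F z = enn2real (\<integral>\<^sup>+x. ennreal (f x * line_kernel t V x z) \<partial>lborel)"
      unfolding F_def using f(2) line_kernel_nonneg[OF t] measurable_compose[OF measurable_Pair line_kernel_measurable, of "\<lambda>x. x" lborel "\<lambda>_. z" t]
      by (intro integral_eq_nn_integral) auto
    ultimately show ?thesis using b0 by (simp add: enn2real_leI)
  qed
  have "(\<integral>z. (F z)\<^sup>2 \<partial>lborel) \<le> (\<integral>z. b * F z \<partial>lborel)"
  proof (rule integral_mono[OF i2])
    show "integrable lborel (\<lambda>z. b * F z)" using iF by simp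
    show "(F z)\<^sup>2 \<le> b * F z" for z unfolding power2_eq_square using Fb F0 by (rule mult_right_mono)
  qed
  also have "(\<integral>z. b * F z \<partial>lborel) = b * (\<integral>x. f x \<partial>lborel)"
  proof -
    have "(\<integral>z. line_kernel t V x z \<partial>lborel) = 1" for x
      using nn_integral_line_kernel[OF t, of x] line_kernel_nonneg[OF t] measurable_compose[OF measurable_Pair line_kernel_measurable, of "\<lambda>_. x" lborel "\<lambda>z. z" t]
      by (subst integral_eq_nn_integral) auto
    then show ?thesis using sq(4)[of UNIV] t by simp
  qed
  finally show ?thesis using sq(2) t by simp
qed

end

text \<open>Fubini for quadratic forms whose kernel is a mixture. It is applied both to the mean
  over \<open>V\<close> and to the integral over heat times.\<close>

lemma form_mixture:
  fixes f :: "'a::euclidean_space \<Rightarrow> real" and k :: "'b \<Rightarrow> 'a \<times> 'a \<Rightarrow> real"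
  assumes \<Omega>: "sigma_finite_measure \<Omega>" and f: "integrable lborel f"
    and km[measurable]: "case_prod k \<in> borel_measurable (\<Omega> \<Otimes>\<^sub>M borel)"
    and k: "\<And>\<omega> p. \<omega> \<in> space \<Omega> \<Longrightarrow> \<bar>k \<omega> p\<bar> \<le> h \<omega>" and h: "integrable \<Omega> h"
  shows "integrable \<Omega> (\<lambda>\<omega>. \<integral>x. \<integral>y. f x * f y * k \<omega> (x, y) \<partial>lborel \<partial>lborel)"
    and "(\<integral>\<omega>. \<integral>x. \<integral>y. f x * f y * k \<omega> (x, y) \<partial>lborel \<partial>lborel \<partial>\<Omega>) = (\<integral>x. \<integral>y. f x * f y * (\<integral>\<omega>. k \<omega> (x, y) \<partial>\<Omega>) \<partial>lborel \<partial>lborel)"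
proof -
  interpret \<Omega>: sigma_finite_measure \<Omega> by (rule \<Omega>)
  interpret L: sigma_finite_measure "lborel :: ('a \<times> 'a) measure" by (rule sigma_finite_lborel)
  interpret P: pair_sigma_finite \<Omega> "lborel :: ('a \<times> 'a) measure" ..
  have fm[measurable]: "f \<in> borel_measurable borel" using borel_measurable_integrable[OF f] by simp
  let ?g = "\<lambda>p. f (fst p) * f (snd p)"
  have gm[measurable]: "?g \<in> borel_measurable (borel :: ('a \<times> 'a) measure)"
    unfolding borel_prod[symmetric] by measurable
  have fi: "(\<integral>\<^sup>+x. ennreal \<bar>f x\<bar> \<partial>lborel) < \<infinity>" using f by (simp add: integrable_iff_bounded)
  have g: "integrable lborel ?g"
  proof (rule integrableI_bounded)
    have "(\<integral>\<^sup>+p. ennreal (norm (?g p)) \<partial>lborel) = (\<integral>\<^sup>+x. \<integral>\<^sup>+y. ennreal \<bar>f x\<bar> * ennreal \<bar>f y\<bar> \<partial>lborel \<partial>lborel)"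
      unfolding lborel_prod[symmetric] by (subst lborel.nn_integral_fst[symmetric]) (auto simp: abs_mult ennreal_mult)
    also have "\<dots> = (\<integral>\<^sup>+x. ennreal \<bar>f x\<bar> \<partial>lborel) * (\<integral>\<^sup>+x. ennreal \<bar>f x\<bar> \<partial>lborel)"
      by (simp add: nn_integral_cmult nn_integral_multc)
    finally show "(\<integral>\<^sup>+p. ennreal (norm (?g p)) \<partial>lborel) < \<infinity>" using fi by (simp add: ennreal_mult_less_top)
  qed simp
  have gi: "(\<integral>\<^sup>+p. ennreal \<bar>?g p\<bar> \<partial>lborel) < \<infinity>" using g by (simp add: integrable_iff_bounded)
  have hi: "(\<integral>\<^sup>+\<omega>. ennreal (norm (h \<omega>)) \<partial>\<Omega>) < \<infinity>" using h by (simp add: integrable_iff_bounded)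
  have hm[measurable]: "h \<in> borel_measurable \<Omega>" using h by simp
  have km'[measurable]: "\<And>\<omega>. \<omega> \<in> space \<Omega> \<Longrightarrow> k \<omega> \<in> borel_measurable borel"
    using measurable_Pair2[OF km] by simp
  have i: "integrable (\<Omega> \<Otimes>\<^sub>M lborel) (\<lambda>(\<omega>, p). ?g p * k \<omega> p)"
  proof (rule integrableI_bounded)
    have "(\<integral>\<^sup>+z. ennreal (norm (case z of (\<omega>, p) \<Rightarrow> ?g p * k \<omega> p)) \<partial>(\<Omega> \<Otimes>\<^sub>M lborel))
      = (\<integral>\<^sup>+\<omega>. \<integral>\<^sup>+p. ennreal (norm (?g p * k \<omega> p)) \<partial>lborel \<partial>\<Omega>)"
      by (subst lborel.nn_integral_fst[symmetric]) auto
    also have "\<dots> \<le> (\<integral>\<^sup>+\<omega>. \<integral>\<^sup>+p. ennreal (norm (h \<omega>)) * ennreal \<bar>?g p\<bar> \<partial>lborel \<partial>\<Omega>)"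
    proof (intro nn_integral_mono)
      fix \<omega> p assume "\<omega> \<in> space \<Omega>"
      then have "\<bar>k \<omega> p\<bar> \<le> norm (h \<omega>)" using k[of \<omega> p] by simp
      then have "\<bar>?g p\<bar> * \<bar>k \<omega> p\<bar> \<le> norm (h \<omega>) * \<bar>?g p\<bar>" by (subst mult.commute) (rule mult_right_mono, auto)
      then show "ennreal (norm (?g p * k \<omega> p)) \<le> ennreal (norm (h \<omega>)) * ennreal \<bar>?g p\<bar>"
        by (subst ennreal_mult[symmetric]) (auto simp: abs_mult intro: ennreal_leI)
    qed
    also have "\<dots> = (\<integral>\<^sup>+\<omega>. ennreal (norm (h \<omega>)) \<partial>\<Omega>) * (\<integral>\<^sup>+p. ennreal \<bar>?g p\<bar> \<partial>lborel)"
      by (simp add: nn_integral_cmult nn_integral_multc)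
    also have "\<dots> < \<infinity>" using hi gi by (simp add: ennreal_mult_less_top)
    finally show "(\<integral>\<^sup>+z. ennreal (norm (case z of (\<omega>, p) \<Rightarrow> ?g p * k \<omega> p)) \<partial>(\<Omega> \<Otimes>\<^sub>M lborel)) < \<infinity>" .
  qed measurable
  have it: "(\<integral>p. G p \<partial>lborel) = (\<integral>x. \<integral>y. G (x, y) \<partial>lborel \<partial>lborel)" if "integrable lborel G" for G :: "'a \<times> 'a \<Rightarrow> real"
    using lborel_pair.integral_fst'[of G] that by (simp add: lborel_prod)
  have inner: "(\<integral>p. ?g p * k \<omega> p \<partial>lborel) = (\<integral>x. \<integral>y. f x * f y * k \<omega> (x, y) \<partial>lborel \<partial>lborel)" if \<omega>: "\<omega> \<in> space \<Omega>" for \<omega>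
  proof -
    have "integrable lborel (\<lambda>p. ?g p * k \<omega> p)"
    proof (rule Bochner_Integration.integrable_bound[of _ "\<lambda>p. h \<omega> * ?g p"])
      show "integrable lborel (\<lambda>p. h \<omega> * ?g p)" using g by simp
      show "AE p in lborel. norm (?g p * k \<omega> p) \<le> norm (h \<omega> * ?g p)"
      proof (rule AE_I2)
        fix p
        have "\<bar>k \<omega> p\<bar> \<le> \<bar>h \<omega>\<bar>" using k[OF \<omega>, of p] by simp
        then have "\<bar>?g p\<bar> * \<bar>k \<omega> p\<bar> \<le> \<bar>?g p\<bar> * \<bar>h \<omega>\<bar>" by (rule mult_left_mono) simp
        then show "norm (?g p * k \<omega> p) \<le> norm (h \<omega> * ?g p)" by (simp add: abs_mult mult_ac)
      qed
      show "(\<lambda>p. ?g p * k \<omega> p) \<in> borel_measurable lborel" using km'[OF \<omega>] gm by simp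
    qed
    from it[OF this] show ?thesis by simp
  qed
  have "integrable \<Omega> (\<lambda>\<omega>. \<integral>p. ?g p * k \<omega> p \<partial>lborel)" using P.integrable_fst[OF i] by simp
  then show "integrable \<Omega> (\<lambda>\<omega>. \<integral>x. \<integral>y. f x * f y * k \<omega> (x, y) \<partial>lborel \<partial>lborel)"
    using inner by (simp cong: Bochner_Integration.integrable_cong)
  have "(\<integral>\<omega>. \<integral>x. \<integral>y. f x * f y * k \<omega> (x, y) \<partial>lborel \<partial>lborel \<partial>\<Omega>) = (\<integral>\<omega>. \<integral>p. ?g p * k \<omega> p \<partial>lborel \<partial>\<Omega>)"
    using inner by (intro Bochner_Integration.integral_cong) auto
  also have "\<dots> = (\<integral>p. \<integral>\<omega>. ?g p * k \<omega> p \<partial>\<Omega> \<partial>lborel)"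
    using P.Fubini_integral[OF i] by simp
  also have "\<dots> = (\<integral>x. \<integral>y. \<integral>\<omega>. ?g (x, y) * k \<omega> (x, y) \<partial>\<Omega> \<partial>lborel \<partial>lborel)"
    using P.integrable_snd[OF i] by (intro it) simp
  finally show "(\<integral>\<omega>. \<integral>x. \<integral>y. f x * f y * k \<omega> (x, y) \<partial>lborel \<partial>lborel \<partial>\<Omega>) = (\<integral>x. \<integral>y. f x * f y * (\<integral>\<omega>. k \<omega> (x, y) \<partial>\<Omega>) \<partial>lborel \<partial>lborel)"
    by simp
qed

section \<open>Cylinders over compact sets and their dependence on V\<close>

lemma norm_orth_proj_le:
  assumes "V \<in> grassmannian (DIM('a) - 1)"
  shows "norm (orth_proj V (x::'a::euclidean_space)) \<le> norm x"
proof -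
  obtain v where v: "norm v = 1" "orth_proj V = perp v" using grassmannian_hyperplaneE[OF assms] by metis
  have "(norm (perp v x))\<^sup>2 \<le> (norm x)\<^sup>2" unfolding norm_perp[OF v(1)] by simp
  then show ?thesis unfolding v(2) by (rule power2_le_imp_le) simp
qed

lemma orth_proj_diff:
  assumes "V \<in> grassmannian (DIM('a) - 1)"
  shows "orth_proj V (x - y) = orth_proj V x - orth_proj V (y::'a::euclidean_space)"
proof -
  obtain v where v: "norm v = 1" "orth_proj V = perp v" using grassmannian_hyperplaneE[OF assms] by metis
  then show ?thesis by (simp add: perp_diff)
qed

lemma compact_orth_proj_image:
  fixes E :: "'a::euclidean_space set"
  assumes V: "V \<in> grassmannian (DIM('a) - 1)" and E: "compact E"
  shows "compact (orth_proj V ` E)"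
  using V E by (intro compact_continuous_image linear_continuous_on bounded_linear_orth_proj) (simp_all add: grassmannian_def)

text \<open>The projection of a compact set is closed, so lying in the cylinder means having
  projected distance 0 from \<open>E\<close>, which can be tested on a countable dense subset. This
  yields joint measurability in the subspace and the point.\<close>

lemma cyl_measurable [measurable]:
  fixes E :: "'a::euclidean_space set" and f :: "'b \<Rightarrow> 'a set"
  assumes E: "compact E" and f: "f \<in> N \<rightarrow>\<^sub>M grassmannian_borel (DIM('a) - 1)" and g: "g \<in> borel_measurable N"
  shows "Measurable.pred N (\<lambda>p. g p \<in> cyl (f p) E)"
proof -
  note [measurable] = f g
  obtain D where D: "countable D" "D \<subseteq> E" "E \<subseteq> closure D" using separable by blast
  have "Measurable.pred N (\<lambda>p. \<forall>k::nat. \<exists>e\<in>D. norm (orth_proj (f p) (g p - e)) < 1 / (real k + 1))"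
    using D(1) by measurable
  then show ?thesis
  proof (rule measurable_cong[THEN iffD1, rotated])
    fix p assume "p \<in> space N"
    then have V: "f p \<in> grassmannian (DIM('a) - 1)" using measurable_space[OF f] by simp
    let ?P = "orth_proj (f p)" and ?x = "g p"
    show "(\<forall>k::nat. \<exists>e\<in>D. norm (?P (?x - e)) < 1 / (real k + 1)) = (?x \<in> cyl (f p) E)"
    proof
      assume *: "\<forall>k::nat. \<exists>e\<in>D. norm (?P (?x - e)) < 1 / (real k + 1)"
      have "?P ?x \<in> closure (?P ` E)"
        unfolding closure_approachable
      proof (intro allI impI)
        fix \<delta> :: real assume "0 < \<delta>"
        then obtain k :: nat where "1 / (real k + 1) < \<delta>" using reals_Archimedean[of \<delta>] by (auto simp: inverse_eq_divide add.commute)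
        moreover obtain e where "e \<in> D" "norm (?P (?x - e)) < 1 / (real k + 1)" using * by blast
        ultimately show "\<exists>y\<in>?P ` E. dist y (?P ?x) < \<delta>"
          using D(2) by (intro bexI[of _ "?P e"]) (auto simp: dist_norm norm_minus_commute orth_proj_diff[OF V])
      qed
      moreover have "closed (?P ` E)" using compact_orth_proj_image[OF V E] by (rule compact_imp_closed)
      ultimately show "?x \<in> cyl (f p) E" by (simp add: cyl_def)
    next
      assume "?x \<in> cyl (f p) E"
      then obtain e0 where e0: "e0 \<in> E" "?P ?x = ?P e0" by (auto simp: cyl_def)
      show "\<forall>k::nat. \<exists>e\<in>D. norm (?P (?x - e)) < 1 / (real k + 1)"
      proof
        fix k :: nat
        have "e0 \<in> closure D" using D(3) e0 by blast
        moreover have "0 < 1 / (real k + 1)" by simp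
        ultimately obtain e where e: "e \<in> D" "dist e e0 < 1 / (real k + 1)" unfolding closure_approachable by blast
        have "?P (?x - e) = ?P (e0 - e)" by (simp add: orth_proj_diff[OF V] e0(2))
        then have "norm (?P (?x - e)) \<le> norm (e0 - e)" using norm_orth_proj_le[OF V, of "e0 - e"] by simp
        then show "\<exists>e\<in>D. norm (?P (?x - e)) < 1 / (real k + 1)"
          using e by (intro bexI[of _ e]) (auto simp: dist_norm norm_minus_commute)
      qed
    qed
  qed
qed

lemma cyl_borel:
  fixes E :: "'a::euclidean_space set"
  assumes V: "V \<in> grassmannian (DIM('a) - 1)" and E: "compact E"
  shows "cyl V E \<in> sets borel"
proof -
  have "closed (orth_proj V ` E)" using compact_orth_proj_image[OF V E] by (rule compact_imp_closed)
  then have "orth_proj V ` E \<in> sets borel" by simp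
  from measurable_sets[OF orth_proj_borel[OF V] this] show ?thesis by (simp add: cyl_def vimage_def)
qed

lemma cyl_strip_bounded:
  fixes E :: "'a::euclidean_space set"
  assumes V: "V \<in> grassmannian (DIM('a) - 1)" and E: "E \<subseteq> cball 0 R"
  shows "cyl V E \<inter> strip V \<subseteq> cball 0 (R + 1)"
proof
  fix z assume z: "z \<in> cyl V E \<inter> strip V"
  then obtain e where e: "e \<in> E" "orth_proj V z = orth_proj V e" by (auto simp: cyl_def)
  have "norm z \<le> norm (z - orth_proj V z) + norm (orth_proj V z)" using norm_triangle_ineq[of "z - orth_proj V z" "orth_proj V z"] by simp
  also have "\<dots> \<le> 1 / 2 + R" using z e E norm_orth_proj_le[OF V, of e] by (intro add_mono) (auto simp: strip_def)
  finally show "z \<in> cball 0 (R + 1)" by simp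
qed

lemma cyl_mono: "E \<subseteq> E' \<Longrightarrow> cyl V E \<subseteq> cyl V E'"
  by (auto simp: cyl_def)

lemma proj_vol_mono:
  fixes E :: "'a::euclidean_space set"
  assumes V: "V \<in> grassmannian (DIM('a) - 1)" and E: "E \<subseteq> E'" "compact E'"
  shows "proj_vol V E \<le> proj_vol V E'"
  unfolding proj_vol_def using cyl_borel[OF V E(2)] strip_borel[OF V] cyl_mono[OF E(1)]
  by (intro emeasure_mono) auto

lemma proj_vol_le_cball:
  fixes E :: "'a::euclidean_space set"
  assumes V: "V \<in> grassmannian (DIM('a) - 1)" and E: "E \<subseteq> cball 0 R"
  shows "proj_vol V E \<le> emeasure lborel (cball (0::'a) (R + 1))"
  unfolding proj_vol_def by (rule emeasure_mono[OF cyl_strip_bounded[OF V E]]) simp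

section \<open>The mean projection volume, the back projection and the averaged form\<close>

context
  fixes M :: "'a::euclidean_space set measure" and C :: real and E :: "'a set" and t R :: real
  assumes n: "2 \<le> DIM('a)" and M: "invariant_grassmannian_prob (DIM('a) - 1) M"
    and C: "0 < C" "\<forall>t>0. \<forall>x. (\<integral>\<^sup>+V. ennreal (pgauss t (orth_proj V x)) \<partial>M) = ennreal C * (\<integral>\<^sup>+\<sigma>. ennreal (gauss (t + \<sigma>\<^sup>2) x) \<partial>lborel)"
    and E: "compact E" "E \<subseteq> cball 0 R" and t: "0 < t"
begin

interpretation M: prob_space M by (rule igp_prob[OF M])

lemma M_grassmannian: "V \<in> space M \<Longrightarrow> V \<in> grassmannian (DIM('a) - 1)"
  using igp_space[OF M] by simp

lemma fst_M_measurable [measurable]: "fst \<in> M \<Otimes>\<^sub>M N \<rightarrow>\<^sub>M grassmannian_borel (DIM('a) - 1)"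
  using measurable_compose[OF measurable_fst igp_id_measurable[OF M], of N] by simp

lemma proj_vol_measurable: "(\<lambda>V. proj_vol V E) \<in> borel_measurable M"
proof -
  have "Measurable.pred (M \<Otimes>\<^sub>M lborel) (\<lambda>p. snd p \<in> cyl (fst p) E)"
    using E(1) by (rule cyl_measurable) measurable
  then have [measurable]: "Measurable.pred (M \<Otimes>\<^sub>M lborel) (\<lambda>p. snd p \<in> cyl (fst p) E \<inter> strip (fst p))"
    unfolding strip_def by measurable
  have "(\<lambda>V. emeasure lborel (Pair V -` {p \<in> space (M \<Otimes>\<^sub>M lborel). snd p \<in> cyl (fst p) E \<inter> strip (fst p)})) \<in> borel_measurable M"
    by (rule lborel.measurable_emeasure_Pair) measurable
  then show ?thesis
    by (rule measurable_cong[THEN iffD1, rotated]) (auto simp: proj_vol_def space_pair_measure intro!: arg_cong[where f="emeasure lborel"])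
qed

text \<open>By \<open>line_avg_nn\<close> this is the indicator of the cylinder over
  \<open>E\<close> after heat flow for time \<open>t\<close>. It is written with
  \<open>line_kernel\<close> so that its mean over \<open>V\<close>, the smoothed potential
  \<open>backproj\<close>, is paired with a function through the line transforms of that
  function.\<close>

definition line_avg :: "'a set \<Rightarrow> 'a \<Rightarrow> real" where
  "line_avg V x = (\<integral>z. indicator (cyl V E) z * line_kernel t V x z \<partial>lborel)"

definition backproj :: "'a \<Rightarrow> real" where
  "backproj x = (\<integral>V. line_avg V x \<partial>M)"

lemma line_avg_measurable: "(\<lambda>p. line_avg (fst p) (snd p)) \<in> borel_measurable (M \<Otimes>\<^sub>M lborel)"
proof -
  have [measurable]: "(\<lambda>q. fst (fst q)) \<in> (M \<Otimes>\<^sub>M lborel) \<Otimes>\<^sub>M lborel \<rightarrow>\<^sub>M grassmannian_borel (DIM('a) - 1)"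
    using measurable_compose[OF measurable_fst fst_M_measurable] by simp
  have 1: "Measurable.pred ((M \<Otimes>\<^sub>M lborel) \<Otimes>\<^sub>M lborel) (\<lambda>q. snd q \<in> cyl (fst (fst q)) E)"
    using E(1) by (rule cyl_measurable) measurable
  have 2: "Measurable.pred ((M \<Otimes>\<^sub>M lborel) \<Otimes>\<^sub>M lborel) (\<lambda>q. snd q \<in> strip (fst (fst q)))"
    unfolding strip_def by measurable
  have [measurable]: "(\<lambda>q. indicator (cyl (fst (fst q)) E) (snd q) :: real) \<in> borel_measurable ((M \<Otimes>\<^sub>M lborel) \<Otimes>\<^sub>M lborel)"
    "(\<lambda>q. indicator (strip (fst (fst q))) (snd q) :: real) \<in> borel_measurable ((M \<Otimes>\<^sub>M lborel) \<Otimes>\<^sub>M lborel)"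
    unfolding indicator_def using 1 2 by measurable
  show ?thesis unfolding line_avg_def line_kernel_def by measurable
qed

lemma line_avg_nn:
  assumes V: "V \<in> space M"
  shows "ennreal (line_avg V x) = (\<integral>\<^sup>+z. indicator (cyl V E) z * ennreal (gauss t (x - z)) \<partial>lborel)"
    "integrable lborel (\<lambda>z. indicator (cyl V E) z * line_kernel t V x z)" "0 \<le> line_avg V x" "line_avg V x \<le> 1"
proof -
  note V = M_grassmannian[OF V]
  note [measurable] = cyl_borel[OF V E(1)] strip_borel[OF V] orth_proj_borel[OF V]
  have lk[measurable]: "line_kernel t V x \<in> borel_measurable borel" unfolding line_kernel_def by measurable
  have nn: "0 \<le> indicator (cyl V E) z * line_kernel t V x z" for z
    using line_kernel_nonneg[OF V t] by simp
  have eq: "(\<integral>\<^sup>+z. ennreal (indicator (cyl V E) z * line_kernel t V x z) \<partial>lborel) = (\<integral>\<^sup>+z. indicator (cyl V E) z * ennreal (gauss t (x - z)) \<partial>lborel)"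
    by (rule nn_integral_line_kernel_cylinder[OF V t cyl_borel[OF V E(1)]]) (auto simp: cyl_def)
  have "(\<integral>\<^sup>+z. indicator (cyl V E) z * ennreal (gauss t (x - z)) \<partial>lborel) \<le> (\<integral>\<^sup>+z. ennreal (gauss t (x - z)) \<partial>lborel)"
    by (intro nn_integral_mono) (auto split: split_indicator)
  also have "\<dots> = 1"
    using nn_integral_lborel_reflect[of "\<lambda>z. ennreal (gauss t z)" x] nn_integral_gauss[OF t, where 'a='a] by simp
  finally have le: "(\<integral>\<^sup>+z. indicator (cyl V E) z * ennreal (gauss t (x - z)) \<partial>lborel) \<le> 1" .
  show i: "integrable lborel (\<lambda>z. indicator (cyl V E) z * line_kernel t V x z)"
    using le eq nn by (intro integrableI_bounded) (auto intro: le_less_trans)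
  show la: "ennreal (line_avg V x) = (\<integral>\<^sup>+z. indicator (cyl V E) z * ennreal (gauss t (x - z)) \<partial>lborel)"
    unfolding line_avg_def eq[symmetric] using nn by (intro nn_integral_eq_integral[symmetric] i) auto
  have "ennreal (line_avg V x) \<le> 1" unfolding la by (rule le)
  then show "line_avg V x \<le> 1" by (simp add: ennreal_le_1)
  show "0 \<le> line_avg V x" unfolding line_avg_def using nn by (intro integral_nonneg_AE AE_I2)
qed

lemma backproj_bounds: "0 \<le> backproj x" "backproj x \<le> 1" and line_avg_integrable: "integrable M (\<lambda>V. line_avg V x)"
proof -
  have m: "(\<lambda>V. line_avg V x) \<in> borel_measurable M"
    using measurable_compose[OF measurable_Pair[OF measurable_ident measurable_const] line_avg_measurable] by simp
  show i: "integrable M (\<lambda>V. line_avg V x)"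
    by (rule M.integrable_const_bound[of _ 1]) (use m line_avg_nn(3,4) in auto)
  show "0 \<le> backproj x" unfolding backproj_def using line_avg_nn(3) by (intro integral_nonneg_AE AE_I2)
  have "backproj x \<le> (\<integral>V. 1 \<partial>M)" unfolding backproj_def using i line_avg_nn(4) by (intro integral_mono) auto
  then show "backproj x \<le> 1" by (simp add: M.prob_space)
qed

definition mean_kernel :: "'a \<Rightarrow> real" where
  "mean_kernel x = (\<integral>V. pgauss (2 * t) (orth_proj V x) \<partial>M)"

definition mean_form :: "('a \<Rightarrow> real) \<Rightarrow> real" where
  "mean_form f = (\<integral>x. \<integral>y. f x * f y * mean_kernel (x - y) \<partial>lborel \<partial>lborel)"

definition mean_vol :: real where
  "mean_vol = (\<integral>V. measure lborel (cyl V E \<inter> strip V) \<partial>M)"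

lemma proj_vol_finite: "V \<in> space M \<Longrightarrow> proj_vol V E < \<infinity>"
  using proj_vol_le_cball[OF M_grassmannian E(2)] emeasure_lborel_cball_finite[of "0::'a" "R + 1"] by (auto intro: le_less_trans)

lemma mean_vol_nn: "(\<integral>\<^sup>+V. proj_vol V E \<partial>M) = ennreal mean_vol" and mean_vol_nonneg: "0 \<le> mean_vol"
  and proj_vol_integrable: "integrable M (\<lambda>V. measure lborel (cyl V E \<inter> strip V))"
proof -
  have eq: "ennreal (measure lborel (cyl V E \<inter> strip V)) = proj_vol V E" if "V \<in> space M" for V
    using proj_vol_finite[OF that] by (simp add: proj_vol_def measure_def)
  have "(\<lambda>V. measure lborel (cyl V E \<inter> strip V)) = (\<lambda>V. enn2real (proj_vol V E))" by (simp add: proj_vol_def measure_def)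
  then have m: "(\<lambda>V. measure lborel (cyl V E \<inter> strip V)) \<in> borel_measurable M" using proj_vol_measurable by simp
  define B where "B = measure lborel (cball (0::'a) (R + 1))"
  have B: "emeasure lborel (cball (0::'a) (R + 1)) = ennreal B"
    unfolding B_def using emeasure_lborel_cball_finite[of "0::'a" "R + 1"] by (simp add: emeasure_eq_ennreal_measure)
  have "measure lborel (cyl V E \<inter> strip V) \<le> B" if V: "V \<in> space M" for V
    using proj_vol_le_cball[OF M_grassmannian[OF V] E(2)] unfolding B eq[OF V, symmetric] by (simp add: B_def)
  then show i: "integrable M (\<lambda>V. measure lborel (cyl V E \<inter> strip V))"
    by (intro M.integrable_const_bound[of _ B] m) auto
  show "0 \<le> mean_vol" unfolding mean_vol_def by (intro integral_nonneg_AE) simp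
  have "(\<integral>\<^sup>+V. proj_vol V E \<partial>M) = (\<integral>\<^sup>+V. ennreal (measure lborel (cyl V E \<inter> strip V)) \<partial>M)"
    using eq by (intro nn_integral_cong) simp
  also have "\<dots> = ennreal mean_vol" unfolding mean_vol_def by (rule nn_integral_eq_integral[OF i]) simp
  finally show "(\<integral>\<^sup>+V. proj_vol V E \<partial>M) = ennreal mean_vol" .
qed

lemma mean_form_mixture:
  assumes f: "integrable lborel f"
  shows "integrable M (\<lambda>V. \<integral>x. \<integral>y. f x * f y * pgauss (2 * t) (orth_proj V (x - y)) \<partial>lborel \<partial>lborel)"
    "(\<integral>V. (\<integral>x. \<integral>y. f x * f y * pgauss (2 * t) (orth_proj V (x - y)) \<partial>lborel \<partial>lborel) \<partial>M) = mean_form f"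
proof -
  let ?k = "\<lambda>V p. pgauss (2 * t) (orth_proj V (fst p - snd p))"
  have t2: "0 < 2 * t" using t by simp
  have "(\<lambda>q. fst (snd q) - snd (snd q)) \<in> borel_measurable (M \<Otimes>\<^sub>M (borel :: ('a \<times> 'a) measure))"
    unfolding borel_prod[symmetric] by measurable
  then have m: "case_prod ?k \<in> borel_measurable (M \<Otimes>\<^sub>M borel)"
    unfolding case_prod_beta by measurable
  have b: "\<bar>?k V p\<bar> \<le> 1 / sqrt (4 * pi * (2 * t)) ^ (DIM('a) - 1)" for V and p :: "'a \<times> 'a"
    using pgauss_le[OF t2, of "orth_proj V (fst p - snd p)"] t by simp
  show "integrable M (\<lambda>V. \<integral>x. \<integral>y. f x * f y * pgauss (2 * t) (orth_proj V (x - y)) \<partial>lborel \<partial>lborel)"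
    "(\<integral>V. (\<integral>x. \<integral>y. f x * f y * pgauss (2 * t) (orth_proj V (x - y)) \<partial>lborel \<partial>lborel) \<partial>M) = mean_form f"
    using form_mixture[OF M.sigma_finite_measure_axioms f m b] unfolding mean_form_def mean_kernel_def by simp_all
qed

text \<open>The inequality of \<open>line_kernel_cauchy_schwarz\<close> for the cylinders over
  \<open>E\<close>, averaged over \<open>V\<close>.\<close>

lemma backproj_estimate:
  assumes f: "f \<in> bdd_L1" and s: "0 < s"
  shows "2 * ip f backproj \<le> s * mean_vol + (1 / s) * mean_form f"
proof -
  have fi: "integrable lborel f" by (rule bdd_L1D(1)[OF f])
  note [measurable] = bdd_L1D(2)[OF f] line_avg_measurable
  interpret P: pair_sigma_finite M "lborel :: 'a measure" ..
  have i: "integrable (M \<Otimes>\<^sub>M lborel) (\<lambda>(V, x). f x * line_avg V x)"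
  proof (rule integrableI_bounded)
    show "(\<lambda>(V, x). f x * line_avg V x) \<in> borel_measurable (M \<Otimes>\<^sub>M lborel)"
      unfolding case_prod_beta by measurable
    have "(\<integral>\<^sup>+p. ennreal (norm (case p of (V, x) \<Rightarrow> f x * line_avg V x)) \<partial>(M \<Otimes>\<^sub>M lborel)) \<le> (\<integral>\<^sup>+p. ennreal \<bar>f (snd p)\<bar> \<partial>(M \<Otimes>\<^sub>M (lborel :: 'a measure)))"
    proof (intro nn_integral_mono)
      fix p assume "p \<in> space (M \<Otimes>\<^sub>M (lborel :: 'a measure))"
      then have "fst p \<in> space M" by (auto simp: space_pair_measure)
      from line_avg_nn(3,4)[OF this, of "snd p"] mult_left_mono[of "line_avg (fst p) (snd p)" 1 "\<bar>f (snd p)\<bar>"]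
      show "ennreal (norm (case p of (V, x) \<Rightarrow> f x * line_avg V x)) \<le> ennreal \<bar>f (snd p)\<bar>"
        by (auto simp: abs_mult case_prod_beta intro: ennreal_leI)
    qed
    also have "\<dots> = (\<integral>\<^sup>+x. ennreal \<bar>f x\<bar> \<partial>lborel)"
      by (subst lborel.nn_integral_fst[symmetric]) (auto simp: M.emeasure_space_1)
    also have "\<dots> < \<infinity>" using fi by (simp add: integrable_iff_bounded)
    finally show "(\<integral>\<^sup>+p. ennreal (norm (case p of (V, x) \<Rightarrow> f x * line_avg V x)) \<partial>(M \<Otimes>\<^sub>M lborel)) < \<infinity>" .
  qed
  have "ip f backproj = (\<integral>x. \<integral>V. f x * line_avg V x \<partial>M \<partial>lborel)"
    by (simp add: ip_def backproj_def)
  also have "\<dots> = (\<integral>V. \<integral>x. f x * line_avg V x \<partial>lborel \<partial>M)" by (rule P.Fubini_integral[OF i])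
  finally have eq: "2 * ip f backproj = (\<integral>V. 2 * (\<integral>x. f x * line_avg V x \<partial>lborel) \<partial>M)" by simp
  also have "\<dots> \<le> (\<integral>V. s * measure lborel (cyl V E \<inter> strip V) + (1 / s) * (\<integral>x. \<integral>y. f x * f y * pgauss (2 * t) (orth_proj V (x - y)) \<partial>lborel \<partial>lborel) \<partial>M)"
  proof (rule integral_mono)
    show "integrable M (\<lambda>V. 2 * (\<integral>x. f x * line_avg V x \<partial>lborel))" using P.integrable_fst[OF i] by simp
    show "integrable M (\<lambda>V. s * measure lborel (cyl V E \<inter> strip V) + (1 / s) * (\<integral>x. \<integral>y. f x * f y * pgauss (2 * t) (orth_proj V (x - y)) \<partial>lborel \<partial>lborel))"
      using proj_vol_integrable mean_form_mixture(1)[OF fi] by simp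
    fix V assume V: "V \<in> space M"
    show "2 * (\<integral>x. f x * line_avg V x \<partial>lborel) \<le> s * measure lborel (cyl V E \<inter> strip V) + (1 / s) * (\<integral>x. \<integral>y. f x * f y * pgauss (2 * t) (orth_proj V (x - y)) \<partial>lborel \<partial>lborel)"
      unfolding line_avg_def
      using proj_vol_finite[OF V] cyl_borel[OF M_grassmannian[OF V] E(1)] s
      by (intro line_kernel_cauchy_schwarz[OF M_grassmannian[OF V] t fi]) (auto simp: proj_vol_def)
  qed
  also have "\<dots> = s * mean_vol + (1 / s) * mean_form f"
    using proj_vol_integrable mean_form_mixture[OF fi] by (simp add: mean_vol_def)
  finally show ?thesis .
qed

lemma gauss_sq_integrable:
  "integrable lborel (\<lambda>\<sigma>::real. 1 / sqrt (4 * pi * (2 * t + \<sigma>\<^sup>2)) ^ DIM('a))"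
  "integrable lborel (\<lambda>\<sigma>. gauss (2 * t + \<sigma>\<^sup>2) (x::'a))"
proof -
  have t2: "0 < 2 * t" using t by simp
  have tp: "0 < 2 * t + \<sigma>\<^sup>2" for \<sigma> :: real using t by (simp add: add_pos_nonneg)
  let ?h = "\<lambda>\<sigma>::real. 1 / sqrt (4 * pi * (2 * t + \<sigma>\<^sup>2)) ^ DIM('a)"
  show h: "integrable lborel ?h"
    using nn_integral_gauss_sq_finite[OF n t2] tp by (intro integrableI_bounded) (auto simp: less_imp_le)
  show "integrable lborel (\<lambda>\<sigma>. gauss (2 * t + \<sigma>\<^sup>2) (x::'a))"
    by (rule Bochner_Integration.integrable_bound[OF h]) (use gauss_le[OF tp] tp in \<open>auto simp: less_imp_le\<close>)
qed

lemma mean_kernel_eq: "mean_kernel x = C * (\<integral>\<sigma>. gauss (2 * t + \<sigma>\<^sup>2) x \<partial>lborel)"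
proof -
  have t2: "0 < 2 * t" using t by simp
  have tp: "0 < 2 * t + \<sigma>\<^sup>2" for \<sigma> :: real using t by (simp add: add_pos_nonneg)
  have "mean_kernel x = enn2real (\<integral>\<^sup>+V. ennreal (pgauss (2 * t) (orth_proj V x)) \<partial>M)"
    unfolding mean_kernel_def using t igp_id_measurable[OF M] by (intro integral_eq_nn_integral) (auto simp: orth_proj_measurable)
  also have "\<dots> = enn2real (ennreal C * ennreal (\<integral>\<sigma>. gauss (2 * t + \<sigma>\<^sup>2) x \<partial>lborel))"
    using tp by (simp add: C(2)[rule_format, OF t2] nn_integral_eq_integral[OF gauss_sq_integrable(2)] less_imp_le)
  also have "\<dots> = C * (\<integral>\<sigma>. gauss (2 * t + \<sigma>\<^sup>2) x \<partial>lborel)"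
    using C(1) tp by (subst ennreal_mult[symmetric]) (auto simp: less_imp_le intro!: integral_nonneg_AE)
  finally show ?thesis .
qed

text \<open>The averaged form is a superposition of heat forms over the times
  \<open>2 * t + \<sigma>\<^sup>2\<close>. The integrand is a nonnegative decreasing function of the
  time, as required for the comparison with the binomial series.\<close>

lemma mean_form_heat:
  assumes f: "f \<in> bdd_L1"
  shows "0 \<le> mean_form f" "ennreal (mean_form f) = ennreal C * (\<integral>\<^sup>+\<sigma>. ennreal (ip f (heat (2 * t + \<sigma>\<^sup>2) f)) \<partial>lborel)"
proof -
  have fi: "integrable lborel f" by (rule bdd_L1D(1)[OF f])
  have t2: "0 < 2 * t" using t by simp
  have tp: "0 < 2 * t + \<sigma>\<^sup>2" for \<sigma> :: real using t by (simp add: add_pos_nonneg)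
  let ?h = "\<lambda>\<sigma>::real. 1 / sqrt (4 * pi * (2 * t + \<sigma>\<^sup>2)) ^ DIM('a)"
  note h = gauss_sq_integrable(1) and mk = mean_kernel_eq
  let ?k = "\<lambda>\<sigma> p. gauss (2 * t + \<sigma>\<^sup>2) (fst p - snd p :: 'a)"
  have "(\<lambda>q. fst (snd q) - snd (snd q)) \<in> borel_measurable ((lborel :: real measure) \<Otimes>\<^sub>M (borel :: ('a \<times> 'a) measure))"
    unfolding borel_prod[symmetric] by measurable
  then have m: "case_prod ?k \<in> borel_measurable ((lborel :: real measure) \<Otimes>\<^sub>M borel)"
    unfolding case_prod_beta by measurable
  have b: "\<bar>?k \<sigma> p\<bar> \<le> ?h \<sigma>" for \<sigma> p using gauss_le[OF tp, of \<sigma> "fst p - snd p"] tp[of \<sigma>] by (simp add: less_imp_le)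
  note fm = form_mixture[OF sigma_finite_lborel fi m b h]
  have inner: "(\<integral>x. \<integral>y. f x * f y * gauss (2 * t + \<sigma>\<^sup>2) (x - y) \<partial>lborel \<partial>lborel) = ip f (heat (2 * t + \<sigma>\<^sup>2) f)" for \<sigma>
    using tp[of \<sigma>] by (simp add: ip_def heat_def convol_def mult_ac flip: integral_mult_right_zero)
  have i: "integrable lborel (\<lambda>\<sigma>. ip f (heat (2 * t + \<sigma>\<^sup>2) f))" using fm(1) by (simp add: inner)
  have "(\<integral>\<sigma>. ip f (heat (2 * t + \<sigma>\<^sup>2) f) \<partial>lborel) = (\<integral>x. \<integral>y. f x * f y * (\<integral>\<sigma>. gauss (2 * t + \<sigma>\<^sup>2) (x - y) \<partial>lborel) \<partial>lborel \<partial>lborel)"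
    using fm(2) by (simp add: inner)
  then have eq: "mean_form f = C * (\<integral>\<sigma>. ip f (heat (2 * t + \<sigma>\<^sup>2) f) \<partial>lborel)"
    unfolding mean_form_def mk by (simp add: mult_ac flip: integral_mult_right_zero)
  have nn: "0 \<le> ip f (heat (2 * t + \<sigma>\<^sup>2) f)" for \<sigma> using tp[of \<sigma>] f by (intro ip_heat_nonneg) auto
  then have I: "0 \<le> (\<integral>\<sigma>. ip f (heat (2 * t + \<sigma>\<^sup>2) f) \<partial>lborel)" by (intro integral_nonneg_AE) simp
  show "0 \<le> mean_form f" unfolding eq using C(1) I by simp
  show "ennreal (mean_form f) = ennreal C * (\<integral>\<^sup>+\<sigma>. ennreal (ip f (heat (2 * t + \<sigma>\<^sup>2) f)) \<partial>lborel)"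
    unfolding eq using C(1) I nn by (simp add: ennreal_mult nn_integral_eq_integral[OF i])
qed

end

lemma gauss_mass_cball:
  assumes \<eta>: "0 < \<eta>" and \<delta>: "0 < \<delta>"
  obtains t0 where "0 < t0" "\<And>t. 0 < t \<Longrightarrow> t \<le> t0 \<Longrightarrow> ennreal (1 - \<delta>) \<le> (\<integral>\<^sup>+z. indicator (cball 0 \<eta>) z * ennreal (gauss t (z::'a::euclidean_space)) \<partial>lborel)"
proof -
  let ?I = "\<lambda>s t. (\<integral>\<^sup>+z. indicator (cball 0 s) z * ennreal (gauss t (z::'a)) \<partial>lborel)"
  have "(\<integral>\<^sup>+z. (SUP k::nat. indicator (cball 0 (real k)) z * ennreal (gauss 1 (z::'a))) \<partial>lborel) = (SUP k::nat. ?I (real k) 1)"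
  proof (rule nn_integral_monotone_convergence_SUP)
    show "incseq (\<lambda>k z. indicator (cball 0 (real k)) z * ennreal (gauss 1 (z::'a)))"
      by (auto simp: incseq_def le_fun_def split: split_indicator)
  qed measurable
  moreover have "(SUP k::nat. indicator (cball 0 (real k)) z * ennreal (gauss 1 z)) = ennreal (gauss 1 z)" for z :: 'a
  proof (rule antisym)
    show "(SUP k::nat. indicator (cball 0 (real k)) z * ennreal (gauss 1 z)) \<le> ennreal (gauss 1 z)"
      by (rule SUP_least) (auto split: split_indicator)
    obtain k :: nat where "norm z \<le> real k" using real_arch_simple by blast
    then have "ennreal (gauss 1 z) = indicator (cball 0 (real k)) z * ennreal (gauss 1 z)" by simp
    also have "\<dots> \<le> (SUP k::nat. indicator (cball 0 (real k)) z * ennreal (gauss 1 z))" by (rule SUP_upper) simp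
    finally show "ennreal (gauss 1 z) \<le> (SUP k::nat. indicator (cball 0 (real k)) z * ennreal (gauss 1 z))" .
  qed
  ultimately have "(SUP k::nat. ?I (real k) 1) = 1" using nn_integral_gauss[of 1, where 'a='a] by simp
  moreover have "ennreal (1 - \<delta>) < 1" using \<delta> by (simp add: ennreal_less_one_iff)
  ultimately have "ennreal (1 - \<delta>) < (SUP k::nat. ?I (real k) 1)" by simp
  then obtain k :: nat where k: "ennreal (1 - \<delta>) < ?I (real k) 1" unfolding less_SUP_iff by blast
  show thesis
  \<comment> \<open>At time 1 almost all the mass lies within radius \<open>k\<close>; at time
    \<open>t\<close> the same mass lies within \<open>k * sqrt t\<close>, so \<open>sqrt t\<close>
    is kept below \<eta> / (k + 1), the 1 covering \<open>k = 0\<close>.\<close>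
  proof (rule that[of "(\<eta> / (real k + 1))\<^sup>2"])
    show "0 < (\<eta> / (real k + 1))\<^sup>2" using \<eta> by simp
    fix t assume t: "0 < t" "t \<le> (\<eta> / (real k + 1))\<^sup>2"
    have "sqrt t \<le> \<eta> / (real k + 1)" using t \<eta> by (intro real_le_lsqrt) auto
    then have kt: "real k * sqrt t \<le> \<eta>" using t by (simp add: field_simps) (smt (verit) real_sqrt_ge_zero)
    have g: "sqrt t ^ DIM('a) * gauss t (sqrt t *\<^sub>R z) = gauss 1 z" for z :: 'a
      using t by (simp add: gauss_def power_mult_distrib real_sqrt_mult)
    have "?I \<eta> t = ennreal (\<bar>sqrt t\<bar> ^ DIM('a)) * (\<integral>\<^sup>+z. indicator (cball 0 \<eta>) (sqrt t *\<^sub>R z) * ennreal (gauss t (sqrt t *\<^sub>R (z::'a))) \<partial>lborel)"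
      using t by (intro nn_integral_lborel_scale) auto
    also have "\<dots> = (\<integral>\<^sup>+z. indicator (cball 0 \<eta>) (sqrt t *\<^sub>R z) * ennreal (gauss 1 (z::'a)) \<partial>lborel)"
      using t by (subst nn_integral_cmult[symmetric]) (auto simp: g[symmetric] ennreal_mult intro!: nn_integral_cong split: split_indicator)
    finally have eq: "?I \<eta> t = (\<integral>\<^sup>+z. indicator (cball 0 \<eta>) (sqrt t *\<^sub>R z) * ennreal (gauss 1 (z::'a)) \<partial>lborel)" .
    have "?I (real k) 1 \<le> ?I \<eta> t"
      unfolding eq
    proof (intro nn_integral_mono mult_right_mono)
      fix z :: 'a
      have "sqrt t * norm z \<le> \<eta>" if "norm z \<le> real k"
      proof -
        have "norm z * sqrt t \<le> real k * sqrt t" using that t by (intro mult_right_mono) auto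
        then show ?thesis using kt by (simp add: mult.commute)
      qed
      then show "indicator (cball 0 (real k)) z \<le> (indicator (cball 0 \<eta>) (sqrt t *\<^sub>R z) :: ennreal)"
        using t by (auto split: split_indicator)
    qed simp
    then show "ennreal (1 - \<delta>) \<le> ?I \<eta> t" using k by simp
  qed
qed

lemma pgauss_lipschitz:
  assumes t: "0 < t"
  obtains L where "0 \<le> L" "\<And>a b::'a::euclidean_space. \<bar>pgauss t a - pgauss t b\<bar> \<le> L * norm (a - b)"
proof -
  define c where "c = 1 / sqrt (4 * pi * t) ^ (DIM('a) - 1)"
  have c: "0 \<le> c" using t by (simp add: c_def)
  have h: "\<bar>exp (- x\<^sup>2) - exp (- y\<^sup>2)\<bar> \<le> 1 * \<bar>x - y\<bar>" for x y :: real
  proof -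
    have "norm (exp (- x\<^sup>2) - exp (- y\<^sup>2)) \<le> 1 * norm (x - y)"
    proof (rule field_differentiable_bound[of UNIV])
      fix z :: real
      show "((\<lambda>x. exp (- x\<^sup>2)) has_field_derivative (- 2 * z * exp (- z\<^sup>2))) (at z within UNIV)"
        by (auto intro!: derivative_eq_intros)
      have "2 * \<bar>z\<bar> \<le> 1 + z\<^sup>2" using zero_le_power2[of "\<bar>z\<bar> - 1"] by (simp add: power2_diff)
      also have "\<dots> \<le> exp (z\<^sup>2)" by (rule exp_ge_add_one_self)
      finally show "norm (- 2 * z * exp (- z\<^sup>2)) \<le> 1"
        by (simp add: abs_mult exp_minus field_simps)
    qed auto
    then show ?thesis by simp
  qed
  define d where "d = 2 * sqrt t"
  have d: "0 < d" using t by (simp add: d_def)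
  have p: "pgauss t a = c * exp (- (norm a / d)\<^sup>2)" for a :: 'a
    using t by (simp add: pgauss_def c_def d_def power_divide power_mult_distrib)
  have "\<bar>pgauss t a - pgauss t b\<bar> \<le> (c / d) * norm (a - b)" for a b :: 'a
  proof -
    have "\<bar>pgauss t a - pgauss t b\<bar> = c * \<bar>exp (- (norm a / d)\<^sup>2) - exp (- (norm b / d)\<^sup>2)\<bar>"
      unfolding p using c by (simp add: abs_mult flip: right_diff_distrib)
    also have "\<dots> \<le> c * (\<bar>norm a / d - norm b / d\<bar>)"
      using h[of "norm a / d" "norm b / d"] c by (intro mult_left_mono) auto
    also have "\<bar>norm a / d - norm b / d\<bar> = \<bar>norm a - norm b\<bar> / d"
      using d by (simp flip: diff_divide_distrib)
    also have "c * (\<bar>norm a - norm b\<bar> / d) \<le> c * (norm (a - b) / d)"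
      using c d norm_triangle_ineq3[of a b] by (intro mult_left_mono divide_right_mono) auto
    finally show ?thesis by simp
  qed
  then show thesis using c d by (intro that[of "c / d"]) auto
qed

section \<open>Size, regularity and decay of the back projection\<close>

context
  fixes M :: "'a::euclidean_space set measure" and C :: real and E :: "'a set" and t R :: real
  assumes n: "2 \<le> DIM('a)" and M: "invariant_grassmannian_prob (DIM('a) - 1) M"
    and C: "0 < C" "\<forall>t>0. \<forall>x. (\<integral>\<^sup>+V. ennreal (pgauss t (orth_proj V x)) \<partial>M) = ennreal C * (\<integral>\<^sup>+\<sigma>. ennreal (gauss (t + \<sigma>\<^sup>2) x) \<partial>lborel)"
    and E: "compact E" "E \<subseteq> cball 0 R" and t: "0 < t"
begin

interpretation M: prob_space M by (rule igp_prob[OF M])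

lemmas ctx = n M C E t

lemma backproj_eq: "backproj M E t x = (\<integral>V. line_avg E t V x \<partial>M)"
  by (rule backproj_def[OF ctx])

lemma line_avg_eq: "line_avg E t V x = (\<integral>z. indicator (cyl V E) z * line_kernel t V x z \<partial>lborel)"
  by (rule line_avg_def[OF ctx])

lemma backproj_in_unit: "0 \<le> backproj M E t x" "backproj M E t x \<le> 1" and la_int: "integrable M (\<lambda>V. line_avg E t V x)"
  using backproj_bounds[OF ctx] line_avg_integrable[OF ctx] by auto

text \<open>A ball contained in \<open>E\<close> lies in the cylinder over \<open>E\<close> for
  every \<open>V\<close>, so each line average at its centre is at least the Gaussian mass of that
  ball.\<close>

lemma backproj_ge:
  assumes x: "cball x \<eta> \<subseteq> E" and G: "ennreal (1 - \<delta>) \<le> (\<integral>\<^sup>+z. indicator (cball 0 \<eta>) z * ennreal (gauss t (z::'a)) \<partial>lborel)"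
  shows "1 - \<delta> \<le> backproj M E t x"
proof -
  have "1 - \<delta> \<le> line_avg E t V x" if V: "V \<in> space M" for V
  proof -
    have "(\<integral>\<^sup>+z. indicator (cball 0 \<eta>) z * ennreal (gauss t (z::'a)) \<partial>lborel) = (\<integral>\<^sup>+z. indicator (cball 0 \<eta>) (x - z) * ennreal (gauss t (x - z)) \<partial>lborel)"
      by (rule nn_integral_lborel_reflect[symmetric]) measurable
    also have "\<dots> \<le> (\<integral>\<^sup>+z. indicator (cyl V E) z * ennreal (gauss t (x - z)) \<partial>lborel)"
    proof (intro nn_integral_mono mult_right_mono)
      fix z
      have "z \<in> cyl V E" if "norm (x - z) \<le> \<eta>"
        using x that by (auto simp: cyl_def dist_norm subset_iff)
      then show "indicator (cball 0 \<eta>) (x - z) \<le> (indicator (cyl V E) z :: ennreal)" by (auto split: split_indicator)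
    qed simp
    also have "\<dots> = ennreal (line_avg E t V x)" by (rule line_avg_nn(1)[OF ctx V, symmetric])
    finally have "ennreal (1 - \<delta>) \<le> ennreal (line_avg E t V x)" using G by (rule order_trans[rotated])
    then show ?thesis using line_avg_nn(3)[OF ctx V, of x] by simp
  qed
  then have "(\<integral>V. 1 - \<delta> \<partial>M) \<le> backproj M E t x" unfolding backproj_eq using la_int by (intro integral_mono) auto
  then show ?thesis by (simp add: M.prob_space)
qed

text \<open>Inside the strip the cylinder is bounded, so a uniform estimate of the kernel suffices.
  Taking for \<open>g\<close> the kernel at another point yields the Lipschitz bound, taking
  \<open>g\<close> to be 0 the decay.\<close>

lemma line_avg_difference:
  assumes V: "V \<in> space M" and D: "\<And>z. norm z \<le> R + 1 \<Longrightarrow> \<bar>pgauss t (orth_proj V (x - z)) - g z\<bar> \<le> D"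
    and g: "integrable lborel (\<lambda>z. indicator (cyl V E) z * (indicator (strip V) z * g z))"
  shows "\<bar>line_avg E t V x - (\<integral>z. indicator (cyl V E) z * (indicator (strip V) z * g z) \<partial>lborel)\<bar> \<le> D * measure lborel (cball (0::'a) (R + 1))"
proof -
  have VG: "V \<in> grassmannian (DIM('a) - 1)" by (rule M_grassmannian[OF ctx V])
  let ?d = "\<lambda>z. indicator (cyl V E) z * line_kernel t V x z - indicator (cyl V E) z * (indicator (strip V) z * g z)"
  have i: "integrable lborel ?d" by (intro Bochner_Integration.integrable_diff line_avg_nn(2)[OF ctx V] g)
  have "norm (\<integral>z. ?d z \<partial>lborel) \<le> (\<integral>z. D * indicator (cball (0::'a) (R + 1)) z \<partial>lborel)"
  proof (rule Bochner_Integration.integral_norm_bound_integral[OF i])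
    show "integrable lborel (\<lambda>z. D * indicator (cball (0::'a) (R + 1)) z)"
      using emeasure_lborel_cball_finite[of "0::'a" "R + 1"] by simp
    fix z
    show "norm (?d z) \<le> D * indicator (cball 0 (R + 1)) z"
    proof (cases "z \<in> cyl V E \<and> z \<in> strip V")
      case True
      then have "norm z \<le> R + 1" using cyl_strip_bounded[OF VG E(2)] by auto
      with D[of z] True show ?thesis by (simp add: line_kernel_def)
    next
      case False
      then have "?d z = 0" by (auto simp: line_kernel_def)
      moreover have "0 \<le> D" if "norm z \<le> R + 1" using order_trans[OF abs_ge_zero D[OF that]] .
      ultimately show ?thesis by (auto split: split_indicator)
    qed
  qed
  moreover have "(\<integral>z. ?d z \<partial>lborel) = line_avg E t V x - (\<integral>z. indicator (cyl V E) z * (indicator (strip V) z * g z) \<partial>lborel)"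
    unfolding line_avg_eq by (intro Bochner_Integration.integral_diff line_avg_nn(2)[OF ctx V] g)
  ultimately show ?thesis by simp
qed

lemma backproj_lipschitz:
  obtains L where "0 \<le> L" "\<And>x y. \<bar>backproj M E t x - backproj M E t y\<bar> \<le> L * norm (x - y)"
proof -
  obtain L where L: "0 \<le> L" "\<And>a b::'a. \<bar>pgauss t a - pgauss t b\<bar> \<le> L * norm (a - b)" using pgauss_lipschitz[OF t] by metis
  let ?B = "measure lborel (cball (0::'a) (R + 1))"
  have la: "\<bar>line_avg E t V x - line_avg E t V y\<bar> \<le> (L * norm (x - y)) * ?B" if V: "V \<in> space M" for V x y
  proof -
    have VG: "V \<in> grassmannian (DIM('a) - 1)" by (rule M_grassmannian[OF ctx V])
    have "\<bar>line_avg E t V x - (\<integral>z. indicator (cyl V E) z * (indicator (strip V) z * pgauss t (orth_proj V (y - z))) \<partial>lborel)\<bar> \<le> (L * norm (x - y)) * ?B"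
    proof (rule line_avg_difference[OF V])
      fix z
      have "\<bar>pgauss t (orth_proj V (x - z)) - pgauss t (orth_proj V (y - z))\<bar> \<le> L * norm (orth_proj V (x - z) - orth_proj V (y - z))"
        by (rule L)
      also have "orth_proj V (x - z) - orth_proj V (y - z) = orth_proj V (x - y)" by (simp add: orth_proj_diff[OF VG])
      also have "L * norm (orth_proj V (x - y)) \<le> L * norm (x - y)" by (intro mult_left_mono norm_orth_proj_le[OF VG] L)
      finally show "\<bar>pgauss t (orth_proj V (x - z)) - pgauss t (orth_proj V (y - z))\<bar> \<le> L * norm (x - y)" .
    qed (use line_avg_nn(2)[OF ctx V, of y] in \<open>simp add: line_kernel_def\<close>)
    then show ?thesis by (simp add: line_avg_eq line_kernel_def)
  qed
  have "\<bar>backproj M E t x - backproj M E t y\<bar> \<le> (L * ?B) * norm (x - y)" for x y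
  proof -
    have "backproj M E t x - backproj M E t y = (\<integral>V. line_avg E t V x - line_avg E t V y \<partial>M)"
      unfolding backproj_eq using la_int by simp
    moreover have "norm (\<integral>V. line_avg E t V x - line_avg E t V y \<partial>M) \<le> (\<integral>V. (L * norm (x - y)) * ?B \<partial>M)"
    proof (rule order_trans[OF integral_norm_bound integral_mono])
      show "integrable M (\<lambda>V. norm (line_avg E t V x - line_avg E t V y))"
        by (intro integrable_norm Bochner_Integration.integrable_diff la_int)
      show "norm (line_avg E t V x - line_avg E t V y) \<le> (L * norm (x - y)) * ?B" if "V \<in> space M" for V
        using la[OF that] by simp
    qed simp
    ultimately show ?thesis by (simp add: M.prob_space mult_ac)
  qed
  then show thesis using L(1) by (intro that[of "L * ?B"]) auto
qed

text \<open>Each line average is dominated by the projected heat kernel at time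
  \<open>2 * t\<close>, whose mean over \<open>V\<close> is known. That mean decreases with the
  norm, so its limit along a single ray, found by dominated convergence, is enough.\<close>

lemma backproj_decay:
  assumes \<delta>: "0 < \<delta>"
  obtains R0 where "\<And>x. R0 < norm x \<Longrightarrow> backproj M E t x \<le> \<delta>"
proof -
  let ?B = "measure lborel (cball (0::'a) (R + 1))"
  \<comment> \<open>Doubling the time pays for the shift by \<open>z\<close> with
    \<open>norm z \<le> R + 1\<close>, since (a + b)^2 \<le> 2 a^2 + 2 b^2. The power of
    \<open>sqrt 2\<close> is the ratio of the normalizations at times \<open>t\<close> and
    \<open>2 * t\<close>.\<close>
  define c where "c = exp ((R + 1)\<^sup>2 / (4 * t)) * sqrt 2 ^ (DIM('a) - 1)"
  have c: "0 < c" by (simp add: c_def)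
  have t2: "0 < 2 * t" using t by simp
  have tp: "0 < 2 * t + \<sigma>\<^sup>2" for \<sigma> :: real using t by (simp add: add_pos_nonneg)
  have la: "line_avg E t V x \<le> (c * ?B) * pgauss (2 * t) (orth_proj V x)" if V: "V \<in> space M" for V x
  proof -
    have VG: "V \<in> grassmannian (DIM('a) - 1)" by (rule M_grassmannian[OF ctx V])
    have "\<bar>line_avg E t V x - (\<integral>z. indicator (cyl V E) z * (indicator (strip V) z * 0) \<partial>lborel)\<bar> \<le> (c * pgauss (2 * t) (orth_proj V x)) * ?B"
    proof (rule line_avg_difference[OF V])
      fix z :: 'a assume z: "norm z \<le> R + 1"
      let ?a = "orth_proj V (x - z)"
      have "norm (orth_proj V x) \<le> norm ?a + norm (orth_proj V z)"
        using norm_triangle_ineq[of ?a "orth_proj V z"] by (simp add: orth_proj_diff[OF VG])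
      also have "\<dots> \<le> norm ?a + (R + 1)" using norm_orth_proj_le[OF VG, of z] z by simp
      finally have "(norm (orth_proj V x))\<^sup>2 \<le> (norm ?a + (R + 1))\<^sup>2" by (intro power_mono) auto
      also have "\<dots> \<le> 2 * (norm ?a)\<^sup>2 + 2 * (R + 1)\<^sup>2"
        using zero_le_power2[of "norm ?a - (R + 1)"] by (simp add: power2_eq_square algebra_simps)
      finally have "- (norm ?a)\<^sup>2 / (4 * t) \<le> (R + 1)\<^sup>2 / (4 * t) + - (norm (orth_proj V x))\<^sup>2 / (4 * (2 * t))"
        using t by (simp add: field_simps)
      then have "exp (- (norm ?a)\<^sup>2 / (4 * t)) \<le> exp ((R + 1)\<^sup>2 / (4 * t)) * exp (- (norm (orth_proj V x))\<^sup>2 / (4 * (2 * t)))"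
        unfolding exp_add[symmetric] by simp
      then have "pgauss t ?a \<le> exp ((R + 1)\<^sup>2 / (4 * t)) * exp (- (norm (orth_proj V x))\<^sup>2 / (4 * (2 * t))) / sqrt (4 * pi * t) ^ (DIM('a) - 1)"
        unfolding pgauss_def using t by (intro divide_right_mono) auto
      also have "\<dots> = c * pgauss (2 * t) (orth_proj V x)"
      proof -
        have "sqrt (4 * pi * (2 * t)) = sqrt 2 * sqrt (4 * pi * t)" by (simp add: real_sqrt_mult[symmetric])
        then show ?thesis unfolding c_def pgauss_def by (simp add: power_mult_distrib)
      qed
      finally show "\<bar>pgauss t ?a - 0\<bar> \<le> c * pgauss (2 * t) (orth_proj V x)" using t by simp
    qed simp
    then show ?thesis by (simp add: mult_ac)
  qed
  have pi: "integrable M (\<lambda>V. pgauss (2 * t) (orth_proj V x))" for x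
    using pgauss_le[OF t2, where 'a='a] t igp_id_measurable[OF M]
    by (intro M.integrable_const_bound[of _ "1 / sqrt (4 * pi * (2 * t)) ^ (DIM('a) - 1)"]) (auto simp: orth_proj_measurable)
  have ub: "backproj M E t x \<le> (c * ?B * C) * (\<integral>\<sigma>. gauss (2 * t + \<sigma>\<^sup>2) x \<partial>lborel)" for x
  proof -
    have "backproj M E t x \<le> (\<integral>V. (c * ?B) * pgauss (2 * t) (orth_proj V x) \<partial>M)"
    proof -
      have "(\<integral>V. line_avg E t V x \<partial>M) \<le> (\<integral>V. (c * ?B) * pgauss (2 * t) (orth_proj V x) \<partial>M)"
        using la la_int pi by (intro integral_mono) auto
      then show ?thesis by (simp only: backproj_eq)
    qed
    also have "\<dots> = (c * ?B) * mean_kernel M t x" by (simp add: mean_kernel_def[OF ctx])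
    finally show ?thesis by (simp add: mean_kernel_eq[OF ctx] mult.assoc)
  qed
  obtain e :: 'a where e: "norm e = 1" using vector_choose_size[of 1] by auto
  have lim: "(\<lambda>k. \<integral>\<sigma>. gauss (2 * t + \<sigma>\<^sup>2) (real k *\<^sub>R e) \<partial>lborel) \<longlonglongrightarrow> (\<integral>(\<sigma>::real). 0 \<partial>lborel)"
  proof (rule integral_dominated_convergence[OF _ _ gauss_sq_integrable(1)[OF ctx]])
    show "AE \<sigma> in lborel. (\<lambda>k. gauss (2 * t + \<sigma>\<^sup>2) (real k *\<^sub>R e)) \<longlonglongrightarrow> 0"
    proof (rule AE_I2)
      fix \<sigma> :: real
      define s where "s = 2 * t + \<sigma>\<^sup>2"
      have s: "0 < s" using tp by (simp add: s_def)
      have "(\<lambda>k. exp (- ((real k)\<^sup>2 / (4 * s)))) \<longlonglongrightarrow> 0"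
        using s by real_asymp
      from tendsto_divide[OF this tendsto_const[of "sqrt (4 * pi * s) ^ DIM('a)"]]
      have "(\<lambda>k. exp (- ((real k)\<^sup>2 / (4 * s))) / sqrt (4 * pi * s) ^ DIM('a)) \<longlonglongrightarrow> 0" using s by simp
      then show "(\<lambda>k. gauss (2 * t + \<sigma>\<^sup>2) (real k *\<^sub>R e)) \<longlonglongrightarrow> 0"
        by (simp add: gauss_def e s_def)
    qed
    show "AE \<sigma> in lborel. norm (gauss (2 * t + \<sigma>\<^sup>2) (real k *\<^sub>R e)) \<le> 1 / sqrt (4 * pi * (2 * t + \<sigma>\<^sup>2)) ^ DIM('a)" for k
      using gauss_le[OF tp, of _ "real k *\<^sub>R e"] tp by (intro AE_I2) (simp add: less_imp_le)
  qed measurable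
  have "(\<lambda>k. (c * ?B * C) * (\<integral>\<sigma>. gauss (2 * t + \<sigma>\<^sup>2) (real k *\<^sub>R e) \<partial>lborel)) \<longlonglongrightarrow> 0"
    using tendsto_mult_right_zero[OF lim[simplified]] by simp
  then have "\<forall>\<^sub>F k in sequentially. (c * ?B * C) * (\<integral>\<sigma>. gauss (2 * t + \<sigma>\<^sup>2) (real k *\<^sub>R e) \<partial>lborel) < \<delta>"
    using \<delta> by (rule order_tendstoD(2))
  then obtain k where k: "(c * ?B * C) * (\<integral>\<sigma>. gauss (2 * t + \<sigma>\<^sup>2) (real k *\<^sub>R e) \<partial>lborel) < \<delta>"
    by (auto simp: eventually_sequentially)
  have "backproj M E t x \<le> \<delta>" if x: "real k < norm x" for x
  proof -
    have "(\<integral>\<sigma>. gauss (2 * t + \<sigma>\<^sup>2) x \<partial>lborel) \<le> (\<integral>\<sigma>. gauss (2 * t + \<sigma>\<^sup>2) (real k *\<^sub>R e) \<partial>lborel)"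
    proof (rule integral_mono[OF gauss_sq_integrable(2)[OF ctx] gauss_sq_integrable(2)[OF ctx]])
      fix \<sigma> :: real
      have "(real k)\<^sup>2 \<le> (norm x)\<^sup>2" using x by (intro power_mono) auto
      then show "gauss (2 * t + \<sigma>\<^sup>2) x \<le> gauss (2 * t + \<sigma>\<^sup>2) (real k *\<^sub>R e)"
        unfolding gauss_def using tp[of \<sigma>] e by (intro divide_right_mono) (auto simp: divide_right_mono)
    qed
    then have "(c * ?B * C) * (\<integral>\<sigma>. gauss (2 * t + \<sigma>\<^sup>2) x \<partial>lborel) \<le> (c * ?B * C) * (\<integral>\<sigma>. gauss (2 * t + \<sigma>\<^sup>2) (real k *\<^sub>R e) \<partial>lborel)"
      using c C(1) by (intro mult_left_mono) auto
    then show ?thesis using ub[of x] k by linarith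
  qed
  then show thesis by (rule that)
qed

end

section \<open>The lower bound for the mean projection\<close>

lemma quadratic_nonneg_discriminant:
  fixes A B D :: real
  assumes q: "\<And>\<rho>. 0 \<le> A - 2 * \<rho> * B + \<rho>\<^sup>2 * D" and D: "0 \<le> D"
  shows "B\<^sup>2 \<le> A * D"
proof (cases "D = 0")
  case True
  have "B = 0"
  proof (rule ccontr)
    assume "B \<noteq> 0"
    then show False using q[of "(A + 1) / (2 * B)"] True by simp
  qed
  then show ?thesis using True by simp
next
  case False
  then have D: "0 < D" using D by simp
  have "0 \<le> A - 2 * (B / D) * B + (B / D)\<^sup>2 * D" by (rule q)
  also have "\<dots> = A - B\<^sup>2 / D" using D by (simp add: power2_eq_square field_simps)
  finally show ?thesis using D by (simp add: field_simps)
qed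

lemma kernel_form_eq_ip:
  assumes v: "v \<in> bdd_L1" "\<And>x. 0 \<le> v x" and q: "q \<in> even_kernel"
  shows "kernel_form q v = ennreal (ip v (convol q v))"
proof -
  note [measurable] = bdd_L1D(2)[OF v(1)] even_kernelD(2)[OF q]
  obtain K where K: "\<And>x. \<bar>v x\<bar> \<le> K" using bdd_L1D(3)[OF v(1)] by auto
  have q0: "0 \<le> q x" for x by (rule even_kernelD(3)[OF q])
  have ci: "integrable lborel (\<lambda>y. q (x - y) * v y)" for x
    by (rule convol_integrable(1)[OF q _ K]) simp
  have c0: "0 \<le> convol q v x" for x unfolding convol_def using q0 v(2) by (intro integral_nonneg_AE AE_I2) simp
  have "(\<integral>\<^sup>+y. ennreal (q (x - y) * (v x * v y)) \<partial>lborel) = ennreal (v x * convol q v x)" for x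
  proof -
    have "ennreal (q (x - y) * (v x * v y)) = ennreal (v x) * ennreal (q (x - y) * v y)" for y
      using q0 v(2) by (simp add: ennreal_mult[symmetric] mult_ac)
    then have "(\<integral>\<^sup>+y. ennreal (q (x - y) * (v x * v y)) \<partial>lborel) = ennreal (v x) * (\<integral>\<^sup>+y. ennreal (q (x - y) * v y) \<partial>lborel)"
      by (simp add: nn_integral_cmult)
    also have "(\<integral>\<^sup>+y. ennreal (q (x - y) * v y) \<partial>lborel) = ennreal (convol q v x)"
      unfolding convol_def using q0 v(2) by (intro nn_integral_eq_integral ci AE_I2) simp
    finally show ?thesis using v(2) c0 by (simp add: ennreal_mult)
  qed
  then have "kernel_form q v = (\<integral>\<^sup>+x. ennreal (v x * convol q v x) \<partial>lborel)" by (simp add: kernel_form_def)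
  also have "\<dots> = ennreal (ip v (convol q v))"
    unfolding ip_def using v c0 by (intro nn_integral_eq_integral ip_integrable' convol_bdd_L1 q AE_I2) simp_all
  finally show ?thesis .
qed

lemma nn_integral_square_eq_ip:
  assumes v: "v \<in> bdd_L1"
  shows "(\<integral>\<^sup>+x. ennreal ((v x)\<^sup>2) \<partial>lborel) = ennreal (ip v v)"
  unfolding ip_def power2_eq_square using v by (intro nn_integral_eq_integral ip_integrable' AE_I2) simp_all

lemma emeasure_cball_less_ball:
  fixes a r :: real
  assumes "0 \<le> a" "a < r"
  shows "emeasure lborel (cball (0::'a::euclidean_space) a) < emeasure lborel (ball (0::'a) r)"
proof -
  obtain e :: 'a where e: "norm e = 1" using vector_choose_size[of 1] by auto
  define p where "p = ((a + r) / 2) *\<^sub>R e"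
  define \<rho> where "\<rho> = (r - a) / 2"
  have np: "norm p = (a + r) / 2" using assms e by (simp add: p_def)
  have "cball 0 a \<inter> ball p \<rho> = {}"
  proof (rule ccontr)
    assume "cball 0 a \<inter> ball p \<rho> \<noteq> {}"
    then obtain x where x: "norm x \<le> a" "norm (p - x) < \<rho>" by (auto simp: dist_norm)
    have "norm p \<le> norm (p - x) + norm x" using norm_triangle_ineq[of "p - x" x] by simp
    then show False using x np by (simp add: \<rho>_def field_simps)
  qed
  moreover have "cball 0 a \<union> ball p \<rho> \<subseteq> ball 0 r"
  proof
    fix x assume "x \<in> cball 0 a \<union> ball p \<rho>"
    then have "norm x \<le> a \<or> norm (p - x) < \<rho>" by (auto simp: dist_norm)
    moreover have "norm x \<le> norm (p - x) + norm p" using norm_triangle_ineq[of "x - p" p] by (simp add: norm_minus_commute)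
    ultimately show "x \<in> ball 0 r" using assms np by (auto simp: \<rho>_def field_simps)
  qed
  ultimately have "emeasure lborel (cball (0::'a) a) + emeasure lborel (ball p \<rho>) \<le> emeasure lborel (ball (0::'a) r)"
    by (subst plus_emeasure) (auto intro: emeasure_mono)
  moreover have "emeasure lborel (cball (0::'a) a) + 0 < emeasure lborel (cball (0::'a) a) + emeasure lborel (ball p \<rho>)"
  proof -
    have "0 < measure lborel (ball p \<rho>)" by (rule content_ball_pos) (use assms in \<open>simp add: \<rho>_def\<close>)
    then have "0 < emeasure lborel (ball p \<rho>)" unfolding measure_def enn2real_positive_iff by blast
    moreover have "emeasure lborel (cball (0::'a) a) \<noteq> top" using emeasure_lborel_cball_finite[of "0::'a" a] by auto
    ultimately show ?thesis unfolding ennreal_add_left_cancel_less by simp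
  qed
  ultimately show ?thesis unfolding add_0_right by (rule less_le_trans[rotated])
qed

text \<open>Nonnegativity of the truncated form (1 - H)^(-1/2) at \<open>f - \<rho> * g\<close>.
  Partial sums are used because for one of the three series only an upper bound, and no limit, will
  be at hand.\<close>

lemma heat_sum_nonneg:
  fixes f g :: "'a::euclidean_space \<Rightarrow> real"
  assumes f: "f \<in> bdd_L1" and g: "g \<in> bdd_L1" and \<epsilon>: "0 < \<epsilon>"
  shows "0 \<le> (\<Sum>k<N. cbin k * ip f (heat (real k * \<epsilon>) f)) - 2 * \<rho> * (\<Sum>k<N. cbin k * ip f (heat (real k * \<epsilon>) g))
    + \<rho>\<^sup>2 * (\<Sum>k<N. cbin k * ip g (heat (real k * \<epsilon>) g))"
proof -
  have "0 \<le> ip f (heat s f) - 2 * \<rho> * ip f (heat s g) + \<rho>\<^sup>2 * ip g (heat s g)" if s: "0 \<le> s" for s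
  proof -
    let ?h = "\<lambda>x. f x - \<rho> * g x"
    have rg: "(\<lambda>x. \<rho> * g x) \<in> bdd_L1" by (rule bdd_L1_scale[OF g])
    have h: "?h \<in> bdd_L1" by (rule bdd_L1_diff[OF f rg])
    note H = heat_bdd_L1[OF s]
    have 1: "ip ?h (heat s k) = ip f (heat s k) - \<rho> * ip g (heat s k)" if "k \<in> bdd_L1" for k
      using ip_diff_left[OF f rg H[OF that]] by (simp add: ip_scale_left)
    have 2: "ip k (heat s ?h) = ip k (heat s f) - \<rho> * ip k (heat s g)" if k: "k \<in> bdd_L1" for k
    proof -
      have "ip k (heat s ?h) = ip (heat s k) ?h" by (rule heat_self_adjoint[OF s k h])
      also have "\<dots> = ip ?h (heat s k)" by (rule ip_commute)
      also have "\<dots> = ip f (heat s k) - \<rho> * ip g (heat s k)" by (rule 1[OF k])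
      also have "ip f (heat s k) = ip k (heat s f)" using heat_self_adjoint[OF s f k] ip_commute by metis
      also have "ip g (heat s k) = ip k (heat s g)" using heat_self_adjoint[OF s g k] ip_commute by metis
      finally show ?thesis .
    qed
    have 3: "ip g (heat s f) = ip f (heat s g)" using heat_self_adjoint[OF s f g] ip_commute by metis
    have "0 \<le> ip ?h (heat s ?h)" by (rule ip_heat_nonneg[OF s h])
    also have "\<dots> = ip f (heat s f) - 2 * \<rho> * ip f (heat s g) + \<rho>\<^sup>2 * ip g (heat s g)"
      unfolding 1[OF h] 2[OF f] 2[OF g] 3 by (simp add: power2_eq_square algebra_simps)
    finally show ?thesis .
  qed
  then have "0 \<le> (\<Sum>k<N. cbin k * (ip f (heat (real k * \<epsilon>) f) - 2 * \<rho> * ip f (heat (real k * \<epsilon>) g) + \<rho>\<^sup>2 * ip g (heat (real k * \<epsilon>) g)))"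
    using \<epsilon> cbin_pos by (intro sum_nonneg mult_nonneg_nonneg) (auto simp: less_imp_le)
  then show ?thesis by (simp add: sum_distrib_left sum.distrib sum_subtractf algebra_simps)
qed

text \<open>\<open>u\<close> is the sum of the truncated function and
  \<open>min (u x) \<delta>\<close>. Where the former is positive the latter has its maximal value
  \<delta>, while convolution with a kernel of mass at most 1 gives at most \<delta>; hence the
  cross term is nonnegative.\<close>

lemma truncation_energy:
  assumes u: "u \<in> borel_measurable borel" "\<And>x. 0 \<le> u x" "\<And>x. u x \<le> 1" and \<delta>: "0 < \<delta>"
    and w: "(\<lambda>x. max (u x - \<delta>) 0) \<in> bdd_L1" and q: "q \<in> even_kernel" "(\<integral>x. q x \<partial>lborel) \<le> 1"
  defines "f \<equiv> \<lambda>x. max (u x - \<delta>) 0 - convol q (\<lambda>x. max (u x - \<delta>) 0) x"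
  shows "ip f (\<lambda>x. max (u x - \<delta>) 0) \<le> ip f u"
proof -
  let ?w = "\<lambda>x. max (u x - \<delta>) 0" and ?m = "\<lambda>x. min (u x) \<delta>"
  note [measurable] = u(1)
  have qw: "convol q ?w \<in> bdd_L1" by (rule convol_bdd_L1[OF q(1) w])
  have f: "f \<in> bdd_L1" unfolding f_def by (rule bdd_L1_diff[OF w qw])
  have mb: "\<bar>?m y\<bar> \<le> \<delta>" for y using u(2)[of y] \<delta> by simp
  have mm: "?m \<in> borel_measurable borel" by measurable
  have "ip f u = ip f (\<lambda>x. ?w x + ?m x)"
    by (rule arg_cong[where f="ip f"]) (auto simp: max_def min_def)
  also have "\<dots> = ip f ?w + ip f ?m"
    unfolding ip_def distrib_left using ip_integrable'[OF f w] ip_integrable[OF f mm mb] by simp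
  finally have 1: "ip f u = ip f ?w + ip f ?m" .
  have "ip f ?m = ip ?w ?m - ip (convol q ?w) ?m"
    unfolding ip_def f_def left_diff_distrib
    using ip_integrable[OF w mm mb] ip_integrable[OF qw mm mb] by simp
  also have "ip (convol q ?w) ?m = ip ?w (convol q ?m)" by (rule ip_convol_commute[OF q(1) w mm mb, symmetric])
  also have "ip ?w ?m - ip ?w (convol q ?m) = (\<integral>x. ?w x * ?m x - ?w x * convol q ?m x \<partial>lborel)"
  proof -
    have "convol q ?m \<in> borel_measurable borel" using even_kernelD(2)[OF q(1)] mm by measurable
    then have "integrable lborel (\<lambda>x. ?w x * convol q ?m x)"
      using convol_integrable(2)[OF q(1) mm mb] by (rule ip_integrable[OF w])
    then show ?thesis unfolding ip_def using ip_integrable[OF w mm mb] by simp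
  qed
  also have "0 \<le> \<dots>"
  proof (intro integral_nonneg_AE AE_I2)
    fix x
    have "convol q ?m x \<le> \<delta> * (\<integral>x. q x \<partial>lborel)" using convol_integrable(2)[OF q(1) mm mb, of x] by simp
    also have "\<dots> \<le> \<delta> * 1" using q(2) \<delta> by (intro mult_left_mono) auto
    finally have "convol q ?m x \<le> \<delta>" by simp
    then show "0 \<le> ?w x * ?m x - ?w x * convol q ?m x"
      by (cases "u x \<le> \<delta>") (auto simp: max_def min_def intro: mult_left_mono)
  qed
  finally show ?thesis using 1 by simp
qed

text \<open>Let w be the truncated potential, f = (1 - H)^(1/2) w and X = <f, w>. The averaged form
  of f is at most s X with \<open>s = C * sqrt (om * \<epsilon>)\<close>, and Cauchy-Schwarz turns
  this into X \<le> s times the mean volume. A radial v in the polarization class has energy at most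
  X and is at least \<open>1 - 2 * \<delta>\<close> on the ball of radius \<open>r\<close>. Testing
  v with \<mu>, whose inverse energy is controlled through its line integrals, gives the claim; the
  term with \<open>ip \<mu> \<mu>\<close> is the discretization error.\<close>

lemma capacity_step:
  fixes M :: "'a::euclidean_space set measure" and E :: "'a set" and \<mu> :: "'a \<Rightarrow> real"
  assumes n: "2 \<le> DIM('a)" and M: "invariant_grassmannian_prob (DIM('a) - 1) M"
    and C: "0 < C" "\<forall>t>0. \<forall>x. (\<integral>\<^sup>+V. ennreal (pgauss t (orth_proj V x)) \<partial>M) = ennreal C * (\<integral>\<^sup>+\<sigma>. ennreal (gauss (t + \<sigma>\<^sup>2) x) \<partial>lborel)"
    and E: "compact E" "E \<subseteq> cball 0 R" and \<epsilon>: "0 < \<epsilon>"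
    and A: "A \<in> sets borel" "\<And>x. x \<in> A \<Longrightarrow> cball x \<eta> \<subseteq> E" and r: "emeasure lborel (ball (0::'a) r) \<le> emeasure lborel A"
    and \<delta>: "0 < \<delta>" "\<delta> < 1 / 2" and G: "ennreal (1 - \<delta>) \<le> (\<integral>\<^sup>+z. indicator (cball 0 \<eta>) z * ennreal (gauss (\<epsilon> / 4) (z::'a)) \<partial>lborel)"
    and om: "0 < om" "\<And>k. om * (cbin k)\<^sup>2 * real k \<le> 1" "\<And>k. 1 \<le> om * (cbin k)\<^sup>2 * (real k + 1 / 2)"
    and \<mu>: "\<mu> \<in> bdd_L1" "\<And>x. 0 \<le> \<mu> x" "\<And>x. r \<le> norm x \<Longrightarrow> \<mu> x = 0"
    and b: "0 \<le> b" "\<And>x v. norm v = 1 \<Longrightarrow> (\<integral>\<^sup>+s. ennreal (\<mu> (x + s *\<^sub>R v)) \<partial>lborel) \<le> ennreal b"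
  shows "((1 - 2 * \<delta>) * (\<integral>x. \<mu> x \<partial>lborel))\<^sup>2 \<le> mean_vol M E * (2 * C * sqrt (om * \<epsilon>) * ip \<mu> \<mu> + b * (\<integral>x. \<mu> x \<partial>lborel))"
proof -
  \<comment> \<open>The square of a line transform at time \<open>t\<close> has time
    \<open>2 * t\<close>, here \<epsilon> / 2, which is the offset in
    \<open>nn_integral_phi_le\<close>.\<close>
  define t where "t = \<epsilon> / 4"
  have t: "0 < t" and t2: "2 * t = \<epsilon> / 2" using \<epsilon> by (simp_all add: t_def)
  note ctx = n M C E t
  define u where "u = backproj M E t"
  define q where "q = (qker \<epsilon> :: 'a \<Rightarrow> real)"
  have q: "q \<in> even_kernel" "(\<integral>x. q x \<partial>lborel) \<le> 1" "radial_decreasing q"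
    unfolding q_def by (intro qker_even_kernel integral_qker_le qker_radial_decreasing \<epsilon>)+
  have s0: "0 < sqrt (om * \<epsilon>)" using om \<epsilon> by simp
  have u01: "0 \<le> u x" "u x \<le> 1" for x unfolding u_def by (rule backproj_in_unit[OF ctx])+
  obtain L where L: "0 \<le> L" "\<And>x y. \<bar>u x - u y\<bar> \<le> L * norm (x - y)"
    unfolding u_def using backproj_lipschitz[OF ctx] by metis
  have um[measurable]: "u \<in> borel_measurable borel"
    by (intro borel_measurable_continuous_onI lipschitz_imp_continuous[of _ L] L)
  obtain R0 where R0: "\<And>x. R0 < norm x \<Longrightarrow> u x \<le> \<delta>"
    unfolding u_def using backproj_decay[OF ctx \<delta>(1)] by metis
  have uA: "1 - \<delta> \<le> u x" if "x \<in> A" for x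
    unfolding u_def using A(2)[OF that] G unfolding t_def[symmetric] by (rule backproj_ge[OF ctx])
  let ?Lam = "mean_vol M E"
  have Lam: "0 \<le> ?Lam" by (rule mean_vol_nonneg[OF ctx])
  let ?w = "\<lambda>x. max (u x - \<delta>) 0"
  have w01: "0 \<le> ?w x" "?w x \<le> 1" for x using u01[of x] \<delta> by auto
  have wR: "?w x = 0" if "R0 < norm x" for x using R0[OF that] by simp
  have wL: "\<bar>?w x - ?w y\<bar> \<le> L * norm (x - y)" for x y
  proof -
    have "\<bar>?w x - ?w y\<bar> \<le> \<bar>u x - u y\<bar>" by (simp add: max_def)
    then show ?thesis using L(2)[of x y] by linarith
  qed
  have w: "?w \<in> bdd_L1" by (rule bdd_L1_bounded_support[of _ 1 R0]) (use w01 wR in auto)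
  define f where "f = (\<lambda>x. ?w x - convol q ?w x)"
  have f: "f \<in> bdd_L1" unfolding f_def by (intro bdd_L1_diff w convol_bdd_L1 q)
  define X where "X = ip f ?w"
  have Xu: "X \<le> ip f u" unfolding X_def f_def by (rule truncation_energy[OF um u01 \<delta>(1) w q(1,2)])
  have phi: "\<And>s t. 0 \<le> s \<Longrightarrow> s \<le> t \<Longrightarrow> ip g (heat t g) \<le> ip g (heat s g)" "\<And>s. 0 \<le> s \<Longrightarrow> 0 \<le> ip g (heat s g)" if "g \<in> bdd_L1" for g :: "'a \<Rightarrow> real"
    using ip_heat_antimono[OF _ _ that] ip_heat_nonneg[OF _ that] by auto
  have Xsum: "(\<lambda>k. cbin k * ip f (heat (real k * \<epsilon>) f)) sums X"
  proof -
    have "ip ?w f = X" unfolding X_def by (rule ip_commute)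
    then show ?thesis using cbin_heat_sums[OF \<epsilon> n w f] unfolding f_def q_def by simp
  qed
  have X0: "0 \<le> X"
  proof (rule sums_le[OF _ sums_zero Xsum])
    show "0 \<le> cbin k * ip f (heat (real k * \<epsilon>) f)" for k
      using cbin_pos[of k] phi(2)[OF f, of "real k * \<epsilon>"] \<epsilon> by simp
  qed
  have mf: "mean_form M t f \<le> C * sqrt (om * \<epsilon>) * X"
  proof -
    have "ennreal (mean_form M t f) = ennreal C * (\<integral>\<^sup>+\<sigma>. ennreal (ip f (heat (\<epsilon> / 2 + \<sigma>\<^sup>2) f)) \<partial>lborel)"
      using mean_form_heat(2)[OF ctx f] unfolding t2 .
    also have "\<dots> \<le> ennreal C * (\<Sum>k. ennreal (sqrt (om * \<epsilon>) * (cbin k * ip f (heat (real k * \<epsilon>) f))))"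
      by (intro mult_left_mono nn_integral_phi_le[OF \<epsilon> om phi[OF f]]) simp_all
    also have "(\<Sum>k. ennreal (sqrt (om * \<epsilon>) * (cbin k * ip f (heat (real k * \<epsilon>) f)))) = ennreal (sqrt (om * \<epsilon>) * X)"
    proof (rule suminf_ennreal_eq)
      show "(\<lambda>k. sqrt (om * \<epsilon>) * (cbin k * ip f (heat (real k * \<epsilon>) f))) sums (sqrt (om * \<epsilon>) * X)"
        by (rule sums_mult[OF Xsum])
      show "0 \<le> sqrt (om * \<epsilon>) * (cbin k * ip f (heat (real k * \<epsilon>) f))" for k
        using s0 cbin_pos[of k] phi(2)[OF f, of "real k * \<epsilon>"] \<epsilon> by simp
    qed
    also have "ennreal C * ennreal (sqrt (om * \<epsilon>) * X) = ennreal (C * (sqrt (om * \<epsilon>) * X))"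
      using C(1) s0 X0 by (intro ennreal_mult[symmetric]) simp_all
    finally have "ennreal (mean_form M t f) \<le> ennreal (C * (sqrt (om * \<epsilon>) * X))" .
    then show ?thesis using C(1) s0 X0 by (simp add: mult.assoc)
  qed
  \<comment> \<open>With this \<open>s\<close> the form term of \<open>backproj_estimate\<close> is
    at most X, half of the left side, and can be absorbed.\<close>
  define s where "s = C * sqrt (om * \<epsilon>)"
  have s: "0 < s" using C(1) s0 by (simp add: s_def)
  have XL: "X \<le> s * ?Lam"
  proof -
    have "2 * X \<le> s * ?Lam + (1 / s) * mean_form M t f"
      using Xu backproj_estimate[OF ctx f s] unfolding u_def by linarith
    also have "(1 / s) * mean_form M t f \<le> (1 / s) * (s * X)" using mf s unfolding s_def by (intro mult_left_mono) auto
    also have "(1 / s) * (s * X) = X" using s by simp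
    finally show ?thesis by simp
  qed
  \<comment> \<open>One \<delta> is lost by smoothing the potential on \<open>A\<close>, the other
    by truncation.\<close>
  let ?c = "1 - 2 * \<delta>" and ?m = "emeasure lborel A"
  have qm: "q \<in> borel_measurable borel" and q0: "\<And>x. 0 \<le> q x" using even_kernelD[OF q(1)] by auto
  have "(\<integral>\<^sup>+x. ennreal (q x) \<partial>lborel) < \<infinity>" using even_kernelD(5)[OF q(1)] by simp
  moreover have "?m \<le> emeasure lborel {x. c' < ?w x}" if "c' < ?c" for c'
  proof (rule emeasure_mono)
    show "A \<subseteq> {x. c' < ?w x}" using uA that by fastforce
  qed measurable
  ultimately obtain v where v: "v \<in> polarization_class 1 L R0 q ?w ?c ?m" "radial_decreasing v"
    using exists_symmetrization[OF w01 wL wR L(1) q(3) q0 qm, where c="?c" and m="?m"] by blast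
  have v01: "0 \<le> v x" "v x \<le> 1" and vR: "R0 < norm x \<Longrightarrow> v x = 0" for x using v(1) by (auto simp: polarization_class_def)
  have vm[measurable]: "v \<in> borel_measurable borel" by (rule polarization_class_measurable[OF v(1)])
  have vb: "v \<in> bdd_L1" by (rule bdd_L1_bounded_support[of _ 1 R0]) (use v01 vR in auto)
  define g where "g = (\<lambda>x. v x - convol q v x)"
  have g: "g \<in> bdd_L1" unfolding g_def by (intro bdd_L1_diff vb convol_bdd_L1 q)
  \<comment> \<open>The energy is the L^2 norm squared minus the kernel form; in the class the first
    is unchanged and the second not smaller.\<close>
  have "ip v g \<le> X"
  proof -
    have "ennreal (ip ?w (convol q ?w)) \<le> ennreal (ip v (convol q v))"
      using v(1) kernel_form_eq_ip[OF w w01(1) q(1)] kernel_form_eq_ip[OF vb v01(1) q(1)] by (simp add: polarization_class_def)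
    moreover have "0 \<le> ip v (convol q v)"
      unfolding ip_def convol_def using v01 q0 by (intro integral_nonneg_AE AE_I2 mult_nonneg_nonneg) auto
    ultimately have 1: "ip ?w (convol q ?w) \<le> ip v (convol q v)" by simp
    have "ennreal (ip v v) = ennreal (ip ?w ?w)"
      using v(1) nn_integral_square_eq_ip[OF w] nn_integral_square_eq_ip[OF vb] by (simp add: polarization_class_def)
    then have 2: "ip v v = ip ?w ?w" by (simp add: ip_self_nonneg)
    have "X = ip ?w ?w - ip (convol q ?w) ?w" unfolding X_def f_def by (intro ip_diff_left w convol_bdd_L1 q)
    moreover have "ip v g = ip v v - ip (convol q v) v"
      unfolding g_def ip_commute[of v "\<lambda>x. v x - convol q v x"] by (intro ip_diff_left vb convol_bdd_L1 q)
    ultimately show ?thesis using 1 2 ip_commute[of "convol q ?w" ?w] ip_commute[of "convol q v" v] by simp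
  qed
  \<comment> \<open>Otherwise a superlevel set of \<open>v\<close>, which has at least the volume of
    \<open>A\<close>, would by radial monotonicity fit into a ball strictly smaller than the one of
    radius \<open>r\<close>.\<close>
  have vc: "?c \<le> v x" if x: "norm x < r" for x
  proof (rule ccontr)
    assume "\<not> ?c \<le> v x"
    then obtain c' where c': "v x < c'" "c' < ?c" using dense[of "v x" ?c] by auto
    have "?m \<le> emeasure lborel {y. c' < v y}" using v(1) c'(2) by (auto simp: polarization_class_def)
    also have "\<dots> \<le> emeasure lborel (cball (0::'a) (norm x))"
    proof (rule emeasure_mono)
      show "{y. c' < v y} \<subseteq> cball 0 (norm x)"
      proof
        fix y assume "y \<in> {y. c' < v y}"
        then have "v x < v y" using c' by simp
        then have "\<not> norm x \<le> norm y" using v(2) unfolding radial_decreasing_def by fastforce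
        then show "y \<in> cball 0 (norm x)" by simp
      qed
    qed simp
    also have "\<dots> < emeasure lborel (ball (0::'a) r)" using x by (intro emeasure_cball_less_ball) auto
    finally show False using r by simp
  qed
  let ?I = "\<integral>x. \<mu> x \<partial>lborel"
  have I0: "0 \<le> ?I" using \<mu>(2) by simp
  have Y: "?c * ?I \<le> ip v \<mu>"
  proof -
    have "(\<integral>x. ?c * \<mu> x \<partial>lborel) \<le> (\<integral>x. v x * \<mu> x \<partial>lborel)"
    proof (rule integral_mono)
      show "integrable lborel (\<lambda>x. ?c * \<mu> x)" using bdd_L1D(1)[OF \<mu>(1)] by simp
      show "integrable lborel (\<lambda>x. v x * \<mu> x)" by (rule ip_integrable'[OF vb \<mu>(1)])
      show "?c * \<mu> x \<le> v x * \<mu> x" for x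
      proof (cases "norm x < r")
        case True then show ?thesis using vc[OF True] \<mu>(2) by (intro mult_right_mono) auto
      qed (use \<mu>(3)[of x] in simp)
    qed
    then show ?thesis by (simp add: ip_def)
  qed
  have mfm: "mean_form M t \<mu> \<le> b * ?I"
  proof -
    interpret M: prob_space M by (rule igp_prob[OF M])
    have mi: "integrable lborel \<mu>" by (rule bdd_L1D(1)[OF \<mu>(1)])
    have "mean_form M t \<mu> \<le> (\<integral>V. b * ?I \<partial>M)"
      unfolding mean_form_mixture(2)[OF ctx mi, symmetric]
    proof (rule integral_mono[OF mean_form_mixture(1)[OF ctx mi]])
      fix V assume "V \<in> space M"
      then have V: "V \<in> grassmannian (DIM('a) - 1)" by (rule M_grassmannian[OF ctx])
      obtain a where a: "norm a = 1" "orth_proj V = perp a" using grassmannian_hyperplaneE[OF V] by metis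
      show "(\<integral>x. \<integral>y. \<mu> x * \<mu> y * pgauss (2 * t) (orth_proj V (x - y)) \<partial>lborel \<partial>lborel) \<le> b * ?I"
        using b(2)[OF a(1)] by (intro line_kernel_square_le[OF V t mi \<mu>(2) _ a b(1)]) simp
    qed simp
    then show ?thesis by (simp add: M.prob_space)
  qed
  define J where "J = b * ?I / C"
  have J: "0 \<le> J" using b(1) I0 C(1) by (simp add: J_def)
  have JI: "(\<integral>\<^sup>+\<sigma>. ennreal (ip \<mu> (heat (\<epsilon> / 2 + \<sigma>\<^sup>2) \<mu>)) \<partial>lborel) \<le> ennreal J"
  proof -
    have "ennreal C * (\<integral>\<^sup>+\<sigma>. ennreal (ip \<mu> (heat (\<epsilon> / 2 + \<sigma>\<^sup>2) \<mu>)) \<partial>lborel) = ennreal (mean_form M t \<mu>)"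
      using mean_form_heat(2)[OF ctx \<mu>(1)] unfolding t2 by simp
    also have "\<dots> \<le> ennreal (C * J)" using mfm C(1) by (intro ennreal_leI) (simp add: J_def)
    also have "\<dots> = ennreal C * ennreal J" using C(1) J by (simp add: ennreal_mult)
    finally show ?thesis using C(1) by (subst (asm) ennreal_mult_le_mult_iff) auto
  qed
  \<comment> \<open>An upper bound for all partial sums of <\<mu>, (1 - H)^(-1/2) \<mu>>. The
    divisors \<open>C\<close> (inside \<open>J\<close>) and \<open>sqrt (om * \<epsilon>)\<close>
    are those that cancel against \<open>s\<close>.\<close>
  define Z where "Z = 2 * ip \<mu> \<mu> + J / sqrt (om * \<epsilon>)"
  have Z: "0 \<le> Z" using ip_self_nonneg[of \<mu>] J s0 by (simp add: Z_def)
  have SZ: "(\<Sum>k<N. cbin k * ip \<mu> (heat (real k * \<epsilon>) \<mu>)) \<le> Z" for N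
  proof -
    have "sqrt (om * \<epsilon>) * (\<Sum>k<N. cbin k * ip \<mu> (heat (real k * \<epsilon>) \<mu>)) \<le> 2 * sqrt (om * \<epsilon>) * ip \<mu> (heat 0 \<mu>) + J"
      by (rule sum_phi_le[OF \<epsilon> om phi[OF \<mu>(1)] JI J])
    also have "\<dots> = sqrt (om * \<epsilon>) * Z"
    proof -
      have "2 * \<sigma> * i + J = \<sigma> * (2 * i + J / \<sigma>)" if "0 < \<sigma>" for \<sigma> i :: real
        using that by (simp add: distrib_left)
      from this[OF s0] show ?thesis unfolding Z_def by (simp add: heat_def)
    qed
    finally show ?thesis using s0 by (simp only: mult_le_cancel_left_pos)
  qed
  \<comment> \<open>Cauchy-Schwarz for (1 - H)^(-1/2) at \<open>g\<close> and \<mu>: that operator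
    takes \<open>g\<close> back to \<open>v\<close>, so the two series containing \<open>g\<close>
    converge to <v, g> and <v, \<mu>>, and the third is replaced by its bound
    \<open>Z\<close>.\<close>
  have "(ip v \<mu>)\<^sup>2 \<le> ip v g * Z"
  proof (rule quadratic_nonneg_discriminant[OF _ Z])
    fix \<rho> :: real
    have l1: "(\<lambda>N. \<Sum>k<N. cbin k * ip g (heat (real k * \<epsilon>) g)) \<longlonglongrightarrow> ip v g"
      using cbin_heat_sums[OF \<epsilon> n vb g] unfolding g_def q_def sums_def .
    have l2: "(\<lambda>N. \<Sum>k<N. cbin k * ip g (heat (real k * \<epsilon>) \<mu>)) \<longlonglongrightarrow> ip v \<mu>"
      using cbin_heat_sums[OF \<epsilon> n vb \<mu>(1)] unfolding g_def q_def sums_def .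
    show "0 \<le> ip v g - 2 * \<rho> * ip v \<mu> + \<rho>\<^sup>2 * Z"
    proof (rule LIMSEQ_le_const)
      show "(\<lambda>N. (\<Sum>k<N. cbin k * ip g (heat (real k * \<epsilon>) g)) - 2 * \<rho> * (\<Sum>k<N. cbin k * ip g (heat (real k * \<epsilon>) \<mu>)) + \<rho>\<^sup>2 * Z)
         \<longlonglongrightarrow> ip v g - 2 * \<rho> * ip v \<mu> + \<rho>\<^sup>2 * Z"
        by (intro tendsto_intros l1 l2)
      show "\<exists>N. \<forall>n\<ge>N. 0 \<le> (\<Sum>k<n. cbin k * ip g (heat (real k * \<epsilon>) g)) - 2 * \<rho> * (\<Sum>k<n. cbin k * ip g (heat (real k * \<epsilon>) \<mu>)) + \<rho>\<^sup>2 * Z"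
      proof (intro exI allI impI)
        fix N
        have "\<rho>\<^sup>2 * (\<Sum>k<N. cbin k * ip \<mu> (heat (real k * \<epsilon>) \<mu>)) \<le> \<rho>\<^sup>2 * Z" by (intro mult_left_mono SZ) simp
        then show "0 \<le> (\<Sum>k<N. cbin k * ip g (heat (real k * \<epsilon>) g)) - 2 * \<rho> * (\<Sum>k<N. cbin k * ip g (heat (real k * \<epsilon>) \<mu>)) + \<rho>\<^sup>2 * Z"
          using heat_sum_nonneg[OF g \<mu>(1) \<epsilon>, of N \<rho>] by linarith
      qed
    qed
  qed
  moreover have "(?c * ?I)\<^sup>2 \<le> (ip v \<mu>)\<^sup>2" using Y \<delta> I0 by (intro power_mono) auto
  moreover have "ip v g * Z \<le> (s * ?Lam) * Z" using \<open>ip v g \<le> X\<close> XL Z by (intro mult_right_mono) auto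
  moreover have "(s * ?Lam) * Z = ?Lam * (2 * C * sqrt (om * \<epsilon>) * ip \<mu> \<mu> + b * ?I)"
  proof -
    have "(C * \<sigma> * l) * (2 * i + (b * I / C) / \<sigma>) = l * (2 * C * \<sigma> * i + b * I)" if "0 < \<sigma>" for \<sigma> l i I
      using that C(1) by (simp add: field_simps)
    from this[OF s0] show ?thesis unfolding Z_def s_def J_def .
  qed
  ultimately show ?thesis by linarith
qed

text \<open>In \<open>capacity_step\<close> first \<epsilon> and then \<delta> tends to 0;
  afterwards one factor, the integral of \<mu>, is cancelled. The set \<open>A\<close> consists of
  points with a margin \<eta> inside \<open>E\<close>, which is what the smoothing needs.\<close>

theorem mean_projection_lower_bound:
  fixes M :: "'a::euclidean_space set measure" and E :: "'a set" and \<mu> :: "'a \<Rightarrow> real"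
  assumes n: "2 \<le> DIM('a)" and M: "invariant_grassmannian_prob (DIM('a) - 1) M"
    and E: "compact E" and A: "A \<in> sets borel" "\<And>x. x \<in> A \<Longrightarrow> cball x \<eta> \<subseteq> E" "0 < \<eta>"
    and r: "emeasure lborel (ball (0::'a) r) \<le> emeasure lborel A"
    and \<mu>: "\<mu> \<in> bdd_L1" "\<And>x. 0 \<le> \<mu> x" "\<And>x. r \<le> norm x \<Longrightarrow> \<mu> x = 0"
    and b: "0 \<le> b" "\<And>x v. norm v = 1 \<Longrightarrow> (\<integral>\<^sup>+s. ennreal (\<mu> (x + s *\<^sub>R v)) \<partial>lborel) \<le> ennreal b"
  shows "ennreal (\<integral>x. \<mu> x \<partial>lborel) \<le> ennreal b * (\<integral>\<^sup>+V. proj_vol V E \<partial>M)"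
proof -
  obtain C where C: "0 < C" "\<forall>t>0. \<forall>x. (\<integral>\<^sup>+V. ennreal (pgauss t (orth_proj V x)) \<partial>M) = ennreal C * (\<integral>\<^sup>+\<sigma>. ennreal (gauss (t + \<sigma>\<^sup>2) x) \<partial>lborel)"
  proof (rule nn_integral_igp_pgauss[OF n M])
    fix C :: real
    assume C: "0 < C" "\<And>t x. 0 < t \<Longrightarrow> (\<integral>\<^sup>+V. ennreal (pgauss t (orth_proj V x)) \<partial>M) = ennreal C * (\<integral>\<^sup>+\<sigma>. ennreal (gauss (t + \<sigma>\<^sup>2) x) \<partial>lborel)"
    show thesis by (rule that[OF C(1)]) (intro allI impI C(2))
  qed
  obtain om :: real where om: "0 < om" "\<And>k. om * (cbin k)\<^sup>2 * real k \<le> 1" "\<And>k. 1 \<le> om * (cbin k)\<^sup>2 * (real k + 1 / 2)"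
    by (rule cbin_asymptotics) (rule that)
  obtain R where R: "E \<subseteq> cball 0 R" using compact_imp_bounded[OF E] unfolding bounded_iff by (auto simp: subset_iff)
  let ?I = "\<integral>x. \<mu> x \<partial>lborel" and ?Lam = "mean_vol M E"
  have Lam: "0 \<le> ?Lam" and vol: "(\<integral>\<^sup>+V. proj_vol V E \<partial>M) = ennreal ?Lam"
    using mean_vol_nonneg[OF n M C E R zero_less_one] mean_vol_nn[OF n M C E R zero_less_one] .
  have I0: "0 \<le> ?I" using \<mu>(2) by simp
  have step: "((1 - 2 * \<delta>) * ?I)\<^sup>2 \<le> ?Lam * (b * ?I)" if \<delta>: "0 < \<delta>" "\<delta> < 1 / 2" for \<delta>
  proof -
    obtain t0 where t0: "0 < t0" "\<And>t. 0 < t \<Longrightarrow> t \<le> t0 \<Longrightarrow> ennreal (1 - \<delta>) \<le> (\<integral>\<^sup>+z. indicator (cball 0 \<eta>) z * ennreal (gauss t (z::'a)) \<partial>lborel)"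
      using gauss_mass_cball[OF A(3) \<delta>(1), where 'a='a] by metis
    \<comment> \<open>The steps tend to 0, and a quarter of each, the smoothing time, is at most
      \<open>t0\<close>.\<close>
    define e where "e k = 4 * t0 / real (Suc k)" for k
    have e: "0 < e k" "e k / 4 \<le> t0" "0 < e k / 4" for k using t0(1) by (simp_all add: e_def field_simps)
    have "((1 - 2 * \<delta>) * ?I)\<^sup>2 \<le> ?Lam * (2 * C * sqrt (om * e k) * ip \<mu> \<mu> + b * ?I)" for k
      by (rule capacity_step[OF n M C E R e(1) A(1,2) r \<delta> t0(2)[OF e(3,2)] om \<mu> b])
    moreover have "(\<lambda>k. ?Lam * (2 * C * sqrt (om * e k) * ip \<mu> \<mu> + b * ?I)) \<longlonglongrightarrow> ?Lam * (2 * C * sqrt (om * 0) * ip \<mu> \<mu> + b * ?I)"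
    proof -
      have "(\<lambda>k. 4 * t0 * inverse (real (Suc k))) \<longlonglongrightarrow> 0"
        by (rule tendsto_mult_right_zero[OF LIMSEQ_inverse_real_of_nat])
      then have "e \<longlonglongrightarrow> 0" unfolding e_def[abs_def] by (simp only: divide_inverse)
      then show ?thesis by (intro tendsto_intros)
    qed
    ultimately have "((1 - 2 * \<delta>) * ?I)\<^sup>2 \<le> ?Lam * (2 * C * sqrt (om * 0) * ip \<mu> \<mu> + b * ?I)"
      by (intro LIMSEQ_le_const) auto
    then show ?thesis by simp
  qed
  have "?I\<^sup>2 \<le> ?Lam * (b * ?I)"
  proof -
    \<comment> \<open>The divisor 3 keeps \<delta> below 1/2 also for \<open>k = 0\<close>.\<close>
    have "(\<lambda>k. ((1 - 2 * (inverse (real (Suc k)) / 3)) * ?I)\<^sup>2) \<longlonglongrightarrow> ((1 - 2 * (0 / 3)) * ?I)\<^sup>2"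
      by (intro tendsto_intros LIMSEQ_inverse_real_of_nat) simp_all
    moreover have "((1 - 2 * (inverse (real (Suc k)) / 3)) * ?I)\<^sup>2 \<le> ?Lam * (b * ?I)" for k
      by (rule step) (simp_all add: field_simps)
    ultimately have "((1 - 2 * (0 / 3)) * ?I)\<^sup>2 \<le> ?Lam * (b * ?I)"
      by (intro LIMSEQ_le_const2) auto
    then show ?thesis by simp
  qed
  then have "?I * ?I \<le> (b * ?Lam) * ?I" by (simp add: power2_eq_square mult_ac)
  then have "?I \<le> b * ?Lam" using I0 b(1) Lam by (cases "?I = 0") auto
  then show ?thesis unfolding vol using b(1) Lam by (simp add: ennreal_mult[symmetric] ennreal_leI)
qed

text \<open>The equilibrium density of the ball of radius \<open>\<rho>\<close> for the Riesz kernel of order \<open>n - 1\<close>,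
  restricted to a smaller ball to keep it bounded.\<close>
definition ball_density :: "real \<Rightarrow> real \<Rightarrow> 'a::euclidean_space \<Rightarrow> real" where
  "ball_density r \<rho> x = indicator (ball 0 r) x / sqrt (\<rho>\<^sup>2 - (norm x)\<^sup>2)"

section \<open>Line integrals of the test density, and passage to arbitrary compact sets\<close>

lemma nn_integral_arcsin:
  fixes a b :: real
  assumes "0 \<le> a" "a < b"
  shows "(\<integral>\<^sup>+s. ennreal (indicator {-a..a} s / sqrt (b\<^sup>2 - s\<^sup>2)) \<partial>lborel) = ennreal (2 * arcsin (a / b))"
proof -
  have "has_bochner_integral lborel (\<lambda>s. 1 / sqrt (b\<^sup>2 - s\<^sup>2) * indicator {-a..a} s) (arcsin (a / b) - arcsin (- a / b))"
  proof (rule has_bochner_integral_FTC_Icc_real)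
    fix s assume s: "- a \<le> s" "s \<le> a"
    then have sb: "\<bar>s\<bar> < b" using assms by auto
    then have "s\<^sup>2 < b\<^sup>2" using power_strict_mono[of "\<bar>s\<bar>" b 2] by simp
    then have pos: "0 < b\<^sup>2 - s\<^sup>2" by simp
    show "isCont (\<lambda>s. 1 / sqrt (b\<^sup>2 - s\<^sup>2)) s" using pos by (intro continuous_intros) auto
    have b: "0 < b" using assms by simp
    have "DERIV (\<lambda>s. arcsin (s / b)) s :> inverse (sqrt (1 - (s / b)\<^sup>2)) * (1 / b)"
      using sb b by (auto intro!: derivative_eq_intros simp: field_simps abs_less_iff)
    also have "inverse (sqrt (1 - (s / b)\<^sup>2)) * (1 / b) = 1 / sqrt (b\<^sup>2 - s\<^sup>2)"
    proof -
      have "b\<^sup>2 - s\<^sup>2 = b\<^sup>2 * (1 - (s / b)\<^sup>2)" using b by (simp add: field_simps power_divide)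
      then have "sqrt (b\<^sup>2 - s\<^sup>2) = b * sqrt (1 - (s / b)\<^sup>2)" using b by (simp add: real_sqrt_mult)
      then show ?thesis by (simp add: field_simps)
    qed
    finally show "DERIV (\<lambda>s. arcsin (s / b)) s :> 1 / sqrt (b\<^sup>2 - s\<^sup>2)" .
  qed (use assms in auto)
  moreover have "arcsin (- a / b) = - arcsin (a / b)"
    using assms arcsin_minus[of "a / b"] by (simp add: field_simps)
  ultimately have h: "has_bochner_integral lborel (\<lambda>s. indicator {-a..a} s / sqrt (b\<^sup>2 - s\<^sup>2)) (2 * arcsin (a / b))"
    by (simp add: field_simps)
  have "s\<^sup>2 \<le> b\<^sup>2" if "s \<in> {-a..a}" for s
    using that assms by (intro abs_le_square_iff[THEN iffD1]) auto
  then have "0 \<le> indicator {-a..a} s / sqrt (b\<^sup>2 - s\<^sup>2)" for s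
    by (auto split: split_indicator)
  then have "(\<integral>\<^sup>+s. ennreal (indicator {-a..a} s / sqrt (b\<^sup>2 - s\<^sup>2)) \<partial>lborel) = ennreal (\<integral>s. indicator {-a..a} s / sqrt (b\<^sup>2 - s\<^sup>2) \<partial>lborel)"
    by (intro nn_integral_eq_integral AE_I2) (use h in \<open>simp_all add: has_bochner_integral_iff\<close>)
  then show ?thesis using h by (simp add: has_bochner_integral_iff)
qed

text \<open>On a line at distance \<open>norm (perp v x)\<close> from the centre the density is 1 /
  sqrt (b^2 - s^2) on a chord of half-length a < b, with primitive arcsin (s / b). As \<rho>
  decreases to \<open>r\<close> the quotient a / b tends to 1 and the integral to \<pi>, for every
  line meeting the open ball.\<close>

lemma ball_density_line:
  fixes x v :: "'a::euclidean_space"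
  assumes r: "0 < r" "r < \<rho>" and v: "norm v = 1"
  shows "(\<integral>\<^sup>+s. ennreal (ball_density r \<rho> (x + s *\<^sub>R v)) \<partial>lborel)
    = ennreal (if norm (perp v x) < r then 2 * arcsin (sqrt (r\<^sup>2 - (norm (perp v x))\<^sup>2) / sqrt (\<rho>\<^sup>2 - (norm (perp v x))\<^sup>2)) else 0)"
proof -
  let ?p = "perp v x"
  have vv: "v \<bullet> v = 1" using v by (simp add: dot_square_norm)
  have pv: "?p \<bullet> v = 0" by (simp add: perp_def inner_diff_left vv)
  have ns: "(norm (?p + s *\<^sub>R v))\<^sup>2 = (norm ?p)\<^sup>2 + s\<^sup>2" for s
    unfolding power2_norm_eq_inner by (simp add: inner_add_left inner_add_right pv pv[unfolded inner_commute[of _ v]] vv power2_eq_square)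
  have x: "x = ?p + (x \<bullet> v) *\<^sub>R v" by (simp add: perp_def)
  have "(\<integral>\<^sup>+s. ennreal (ball_density r \<rho> (x + s *\<^sub>R v)) \<partial>lborel) = (\<integral>\<^sup>+s. ennreal (ball_density r \<rho> (?p + (x \<bullet> v + s) *\<^sub>R v)) \<partial>lborel)"
    by (subst x) (simp add: scaleR_add_left add.assoc)
  also have "\<dots> = (\<integral>\<^sup>+s. ennreal (ball_density r \<rho> (?p + s *\<^sub>R v)) \<partial>lborel)"
    by (rule nn_integral_lborel_translation) (unfold ball_density_def, measurable)
  finally have 1: "(\<integral>\<^sup>+s. ennreal (ball_density r \<rho> (x + s *\<^sub>R v)) \<partial>lborel) = (\<integral>\<^sup>+s. ennreal (ball_density r \<rho> (?p + s *\<^sub>R v)) \<partial>lborel)" .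
  show ?thesis
  proof (cases "norm ?p < r")
    case False
    have "ball_density r \<rho> (?p + s *\<^sub>R v) = 0" for s
    proof -
      have "r\<^sup>2 \<le> (norm ?p)\<^sup>2" using False r by (intro power_mono) auto
      then have "r\<^sup>2 \<le> (norm (?p + s *\<^sub>R v))\<^sup>2" unfolding ns using zero_le_power2[of s] by linarith
      then have "r \<le> norm (?p + s *\<^sub>R v)" by (rule power2_le_imp_le) simp
      then show ?thesis by (simp add: ball_density_def)
    qed
    then show ?thesis using False unfolding 1 by simp
  next
    case True
    define a where "a = sqrt (r\<^sup>2 - (norm ?p)\<^sup>2)"
    define b where "b = sqrt (\<rho>\<^sup>2 - (norm ?p)\<^sup>2)"
    have pr: "(norm ?p)\<^sup>2 < r\<^sup>2" using True by (intro power_strict_mono) auto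
    have rr: "r\<^sup>2 < \<rho>\<^sup>2" using r by (intro power_strict_mono) auto
    have a: "0 < a" "a\<^sup>2 = r\<^sup>2 - (norm ?p)\<^sup>2" using pr by (simp_all add: a_def)
    have b: "a < b" "b\<^sup>2 = \<rho>\<^sup>2 - (norm ?p)\<^sup>2" using pr rr by (simp_all add: a_def b_def)
    have "(\<integral>\<^sup>+s. ennreal (ball_density r \<rho> (?p + s *\<^sub>R v)) \<partial>lborel) = (\<integral>\<^sup>+s. ennreal (indicator {-a..a} s / sqrt (b\<^sup>2 - s\<^sup>2)) \<partial>lborel)"
    proof (rule nn_integral_cong_AE)
      show "AE s in lborel. ennreal (ball_density r \<rho> (?p + s *\<^sub>R v)) = ennreal (indicator {-a..a} s / sqrt (b\<^sup>2 - s\<^sup>2))"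
        using AE_lborel_singleton[of a] AE_lborel_singleton[of "- a"]
      proof eventually_elim
        fix s :: real assume s: "s \<noteq> a" "s \<noteq> - a"
        have "norm (?p + s *\<^sub>R v) < r \<longleftrightarrow> (norm (?p + s *\<^sub>R v))\<^sup>2 < r\<^sup>2"
          using r by (auto intro: power_strict_mono power2_less_imp_less)
        also have "\<dots> \<longleftrightarrow> s\<^sup>2 < a\<^sup>2" unfolding ns a(2) by auto
        also have "\<dots> \<longleftrightarrow> \<bar>s\<bar> < a" using a(1) abs_le_square_iff[of a s] by linarith
        also have "\<dots> \<longleftrightarrow> s \<in> {-a..a}" using s by auto
        finally have "indicator (ball 0 r) (?p + s *\<^sub>R v) = (indicator {-a..a} s :: real)" by (simp add: indicator_def)
        moreover have "\<rho>\<^sup>2 - (norm (?p + s *\<^sub>R v))\<^sup>2 = b\<^sup>2 - s\<^sup>2" unfolding ns b(2) by simp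
        ultimately show "ennreal (ball_density r \<rho> (?p + s *\<^sub>R v)) = ennreal (indicator {-a..a} s / sqrt (b\<^sup>2 - s\<^sup>2))"
          by (simp add: ball_density_def)
      qed
    qed
    also have "\<dots> = ennreal (2 * arcsin (a / b))" using a(1) b(1) by (intro nn_integral_arcsin) auto
    finally show ?thesis using True unfolding 1 by (simp add: a_def b_def)
  qed
qed

lemma ball_density_facts:
  assumes r: "0 < r" "r < \<rho>"
  shows "ball_density r \<rho> \<in> (bdd_L1 :: ('a::euclidean_space \<Rightarrow> real) set)" "0 \<le> ball_density r \<rho> (x::'a)"
    "r \<le> norm x \<Longrightarrow> ball_density r \<rho> x = 0"
proof -
  have rr: "r\<^sup>2 < \<rho>\<^sup>2" using r by (intro power_strict_mono) auto
  have lt: "\<rho>\<^sup>2 - r\<^sup>2 \<le> \<rho>\<^sup>2 - (norm x)\<^sup>2" if "norm x < r" for x :: 'a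
    using that by (auto intro!: power_mono)
  show nn: "0 \<le> ball_density r \<rho> x" for x :: 'a
    using lt[of x] rr by (auto simp: ball_density_def split: split_indicator)
  show z: "r \<le> norm x \<Longrightarrow> ball_density r \<rho> x = 0" for x :: 'a by (simp add: ball_density_def)
  have "ball_density r \<rho> x \<le> 1 / sqrt (\<rho>\<^sup>2 - r\<^sup>2)" for x :: 'a
  proof (cases "norm x < r")
    case True
    then have "1 / sqrt (\<rho>\<^sup>2 - (norm x)\<^sup>2) \<le> 1 / sqrt (\<rho>\<^sup>2 - r\<^sup>2)"
      using lt[OF True] rr by (intro divide_left_mono real_sqrt_le_mono mult_pos_pos) auto
    then show ?thesis using True by (simp add: ball_density_def)
  qed (use rr in \<open>simp add: ball_density_def\<close>)
  then have b: "\<bar>ball_density r \<rho> x\<bar> \<le> 1 / sqrt (\<rho>\<^sup>2 - r\<^sup>2)" for x :: 'a using nn[of x] by simp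
  have "ball_density r \<rho> \<in> borel_measurable (borel :: 'a measure)" unfolding ball_density_def by measurable
  then show "ball_density r \<rho> \<in> (bdd_L1 :: ('a \<Rightarrow> real) set)"
    using b by (rule bdd_L1_bounded_support[where R=r]) (use z in simp)
qed

text \<open>All line integrals of the test density are at most \<pi>, so \<open>b\<close> is \<pi>.
  Fubini over the slab expresses its mass by the same line integrals over the projected ball, which
  tend to \<pi>; Fatou passes to the limit and \<pi> cancels.\<close>

lemma mean_proj_vol_ge_fattened:
  fixes M :: "'a::euclidean_space set measure" and E :: "'a set" and v :: 'a
  assumes n: "2 \<le> DIM('a)" and M: "invariant_grassmannian_prob (DIM('a) - 1) M"
    and E: "compact E" and A: "A \<in> sets borel" "\<And>x. x \<in> A \<Longrightarrow> cball x \<eta> \<subseteq> E" "0 < \<eta>"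
    and r: "0 < r" "emeasure lborel (ball (0::'a) r) \<le> emeasure lborel A" and v: "norm v = 1"
  shows "emeasure lborel (slab v \<inter> {x. norm (perp v x) < r}) \<le> (\<integral>\<^sup>+V. proj_vol V E \<partial>M)"
proof -
  define \<rho> where "\<rho> k = r + inverse (real (Suc k))" for k
  have \<rho>: "r < \<rho> k" for k by (simp add: \<rho>_def)
  have \<rho>l: "\<rho> \<longlonglongrightarrow> r"
    using tendsto_add[OF tendsto_const[of r] LIMSEQ_inverse_real_of_nat] by (simp add: \<rho>_def[abs_def])
  let ?F = "\<lambda>k x. if norm (perp v x) < r then 2 * arcsin (sqrt (r\<^sup>2 - (norm (perp v x))\<^sup>2) / sqrt ((\<rho> k)\<^sup>2 - (norm (perp v x))\<^sup>2)) else 0"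
  have ar: "sqrt (r\<^sup>2 - (norm p)\<^sup>2) / sqrt ((\<rho> k)\<^sup>2 - (norm p)\<^sup>2) \<le> 1" "0 \<le> sqrt (r\<^sup>2 - (norm p)\<^sup>2) / sqrt ((\<rho> k)\<^sup>2 - (norm p)\<^sup>2)" if "norm p < r" for k and p :: 'a
  proof -
    have "r\<^sup>2 \<le> (\<rho> k)\<^sup>2" using \<rho>[of k] r by (intro power_mono) auto
    moreover have "(norm p)\<^sup>2 < r\<^sup>2" using that by (intro power_strict_mono) auto
    ultimately show "sqrt (r\<^sup>2 - (norm p)\<^sup>2) / sqrt ((\<rho> k)\<^sup>2 - (norm p)\<^sup>2) \<le> 1" "0 \<le> sqrt (r\<^sup>2 - (norm p)\<^sup>2) / sqrt ((\<rho> k)\<^sup>2 - (norm p)\<^sup>2)"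
      by (auto simp: divide_le_eq_1)
  qed
  have mass: "(\<integral>\<^sup>+x. indicator (slab v) x * ennreal (?F k x) \<partial>lborel) \<le> ennreal pi * (\<integral>\<^sup>+V. proj_vol V E \<partial>M)" for k
  proof -
    note bd = ball_density_facts[OF r(1) \<rho>[of k], where 'a='a]
    have [measurable]: "ball_density r (\<rho> k) \<in> borel_measurable (borel :: 'a measure)" by (rule bdd_L1D(2)[OF bd(1)])
    have line: "(\<integral>\<^sup>+s. ennreal (ball_density r (\<rho> k) (x + s *\<^sub>R w)) \<partial>lborel) \<le> ennreal pi" if "norm w = 1" for x w :: 'a
    proof -
      have "2 * arcsin y \<le> pi" if "0 \<le> y" "y \<le> 1" for y using arcsin_bounded[of y] that by simp
      then show ?thesis unfolding ball_density_line[OF r(1) \<rho> that] using ar[of "perp w x" k] by (intro ennreal_leI) auto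
    qed
    have "(\<integral>\<^sup>+x. indicator (slab v) x * ennreal (?F k x) \<partial>lborel) = (\<integral>\<^sup>+x. ennreal (ball_density r (\<rho> k) (x::'a)) \<partial>lborel)"
    proof -
      have "(\<integral>\<^sup>+x. ennreal (ball_density r (\<rho> k) (x::'a)) \<partial>lborel)
        = (\<integral>\<^sup>+x. indicator (slab v) x * (\<integral>\<^sup>+s. ennreal (ball_density r (\<rho> k) (perp v x + s *\<^sub>R v)) \<partial>lborel) \<partial>lborel)"
        by (rule nn_integral_slab_fubini[OF _ v]) simp
      moreover have "perp v (perp v x) = perp v x" for x using v by (simp add: perp_def inner_diff_left dot_square_norm)
      ultimately show ?thesis by (simp only: ball_density_line[OF r(1) \<rho> v])
    qed
    also have "\<dots> = ennreal (\<integral>x. ball_density r (\<rho> k) (x::'a) \<partial>lborel)"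
      using bd by (intro nn_integral_eq_integral bdd_L1D(1)) auto
    also have "\<dots> \<le> ennreal pi * (\<integral>\<^sup>+V. proj_vol V E \<partial>M)"
      by (rule mean_projection_lower_bound[OF n M E A r(2) bd(1,2,3)]) (use line in auto)
    finally show ?thesis .
  qed
  have lim: "liminf (\<lambda>k. indicator (slab v) x * ennreal (?F k x)) = ennreal pi * indicator (slab v \<inter> {x. norm (perp v x) < r}) x" for x
  proof (cases "norm (perp v x) < r")
    case True
    then have p: "0 < r\<^sup>2 - (norm (perp v x))\<^sup>2" by (simp add: power_strict_mono)
    have "(\<lambda>k. ?F k x) \<longlonglongrightarrow> 2 * arcsin (sqrt (r\<^sup>2 - (norm (perp v x))\<^sup>2) / sqrt (r\<^sup>2 - (norm (perp v x))\<^sup>2))"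
    proof -
      have "(\<lambda>k. sqrt (r\<^sup>2 - (norm (perp v x))\<^sup>2) / sqrt ((\<rho> k)\<^sup>2 - (norm (perp v x))\<^sup>2)) \<longlonglongrightarrow> sqrt (r\<^sup>2 - (norm (perp v x))\<^sup>2) / sqrt (r\<^sup>2 - (norm (perp v x))\<^sup>2)"
        using p by (intro tendsto_intros \<rho>l) auto
      then have "(\<lambda>k. arcsin (sqrt (r\<^sup>2 - (norm (perp v x))\<^sup>2) / sqrt ((\<rho> k)\<^sup>2 - (norm (perp v x))\<^sup>2))) \<longlonglongrightarrow> arcsin (sqrt (r\<^sup>2 - (norm (perp v x))\<^sup>2) / sqrt (r\<^sup>2 - (norm (perp v x))\<^sup>2))"
        by (rule continuous_on_tendsto_compose[OF continuous_on_arcsin'])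
          (use p ar[OF True] in \<open>auto intro!: always_eventually intro: order_trans[of _ 0]\<close>)
      from tendsto_mult_left[OF this, of 2] show ?thesis using True by simp
    qed
    then have "(\<lambda>k. ?F k x) \<longlonglongrightarrow> pi" using p by simp
    then have "(\<lambda>k. indicator (slab v) x * ennreal (?F k x)) \<longlonglongrightarrow> indicator (slab v) x * ennreal pi"
      by (intro ennreal_tendsto_cmult tendsto_ennrealI) (auto split: split_indicator)
    then show ?thesis using True by (simp add: lim_imp_Liminf indicator_def mult.commute)
  qed (simp add: Liminf_const)
  have [measurable]: "(\<lambda>x. ennreal (?F k x)) \<in> borel_measurable borel" for k
  proof -
    have [measurable]: "ball_density r (\<rho> k) \<in> borel_measurable (borel :: 'a measure)"
      by (rule bdd_L1D(2)[OF ball_density_facts(1)[OF r(1) \<rho>]])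
    have "(\<lambda>x. \<integral>\<^sup>+s. ennreal (ball_density r (\<rho> k) (x + s *\<^sub>R v)) \<partial>lborel) \<in> borel_measurable borel" by measurable
    then show ?thesis unfolding ball_density_line[OF r(1) \<rho> v] .
  qed
  have "ennreal pi * emeasure lborel (slab v \<inter> {x. norm (perp v x) < r}) = (\<integral>\<^sup>+x. liminf (\<lambda>k. indicator (slab v) x * ennreal (?F k x)) \<partial>lborel)"
    unfolding lim by (subst nn_integral_cmult_indicator) auto
  also have "\<dots> \<le> liminf (\<lambda>k. \<integral>\<^sup>+x. indicator (slab v) x * ennreal (?F k x) \<partial>lborel)"
    by (rule nn_integral_liminf) measurable
  also have "\<dots> \<le> liminf (\<lambda>k. ennreal pi * (\<integral>\<^sup>+V. proj_vol V E \<partial>M))"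
    using mass by (intro Liminf_mono always_eventually) auto
  also have "\<dots> = ennreal pi * (\<integral>\<^sup>+V. proj_vol V E \<partial>M)" by (simp add: Liminf_const)
  finally show ?thesis by (subst (asm) ennreal_mult_le_mult_iff) auto
qed

lemma igp_proj_vol_measurable:
  fixes M :: "'a::euclidean_space set measure" and E :: "'a set"
  assumes n: "2 \<le> DIM('a)" and M: "invariant_grassmannian_prob (DIM('a) - 1) M" and E: "compact E"
  shows "(\<lambda>V. proj_vol V E) \<in> borel_measurable M"
proof -
  obtain C where C: "0 < C" "\<forall>t>0. \<forall>x. (\<integral>\<^sup>+V. ennreal (pgauss t (orth_proj V x)) \<partial>M) = ennreal C * (\<integral>\<^sup>+\<sigma>. ennreal (gauss (t + \<sigma>\<^sup>2) x) \<partial>lborel)"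
  proof (rule nn_integral_igp_pgauss[OF n M])
    fix C :: real
    assume C: "0 < C" "\<And>t x. 0 < t \<Longrightarrow> (\<integral>\<^sup>+V. ennreal (pgauss t (orth_proj V x)) \<partial>M) = ennreal C * (\<integral>\<^sup>+\<sigma>. ennreal (gauss (t + \<sigma>\<^sup>2) x) \<partial>lborel)"
    show thesis by (rule that[OF C(1)]) (intro allI impI C(2))
  qed
  obtain R where R: "E \<subseteq> cball 0 R" using compact_imp_bounded[OF E] unfolding bounded_iff by (auto simp: subset_iff)
  show ?thesis by (rule proj_vol_measurable[OF n M C E R zero_less_one])
qed

text \<open>The closed neighbourhoods \<open>F k\<close> give every point of \<open>E\<close> the
  required margin. By compactness the cylinders over them decrease to the cylinder over
  \<open>E\<close>, and boundedness of the strips allows monotone convergence from above, first in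
  the volume and then in the mean.\<close>

theorem mean_proj_vol_ge:
  fixes M :: "'a::euclidean_space set measure" and E :: "'a set" and v :: 'a
  assumes n: "2 \<le> DIM('a)" and M: "invariant_grassmannian_prob (DIM('a) - 1) M"
    and E: "compact E" and r: "0 < r" "emeasure lborel (ball (0::'a) r) \<le> emeasure lborel E" and v: "norm v = 1"
  shows "emeasure lborel (slab v \<inter> {x. norm (perp v x) < r}) \<le> (\<integral>\<^sup>+V. proj_vol V E \<partial>M)"
proof -
  obtain R where R: "E \<subseteq> cball 0 R" using compact_imp_bounded[OF E] unfolding bounded_iff by (auto simp: subset_iff)
  define \<eta> where "\<eta> k = inverse (real (Suc k))" for k
  define F where "F k = {x + y | x y. x \<in> E \<and> y \<in> cball 0 (\<eta> k)}" for k
  have \<eta>: "0 < \<eta> k" "\<eta> k \<le> 1" for k by (auto simp: \<eta>_def inverse_le_1_iff)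
  have \<eta>d: "\<eta> j \<le> \<eta> k" if "k \<le> j" for j k using that by (simp add: \<eta>_def le_imp_inverse_le)
  have Fc: "compact (F k)" for k unfolding F_def by (intro compact_sums E compact_cball)
  have Fd: "F j \<subseteq> F k" if "k \<le> j" for j k unfolding F_def using \<eta>d[OF that] by fastforce
  have FR: "F k \<subseteq> cball 0 (R + 1)" for k
  proof
    fix z assume "z \<in> F k"
    then obtain x y where xy: "z = x + y" "x \<in> E" "norm y \<le> \<eta> k" by (auto simp: F_def)
    then show "z \<in> cball 0 (R + 1)" using R \<eta>(2)[of k] norm_triangle_ineq[of x y] by (auto simp: subset_iff)
  qed
  have Fx: "cball x (\<eta> k) \<subseteq> F k" if "x \<in> E" for x k
  proof
    fix z assume "z \<in> cball x (\<eta> k)"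
    then have "z = x + (z - x)" "z - x \<in> cball 0 (\<eta> k)" by (auto simp: dist_norm norm_minus_commute)
    then show "z \<in> F k" unfolding F_def using that by blast
  qed
  have Eb: "E \<in> sets borel" using E by (simp add: compact_imp_closed)
  have G: "V \<in> grassmannian (DIM('a) - 1)" if "V \<in> space M" for V using that igp_space[OF M] by simp
  have lim: "proj_vol V E = (INF k. proj_vol V (F k))" if V: "V \<in> grassmannian (DIM('a) - 1)" for V
  proof -
    have "(\<Inter>k. cyl V (F k)) = cyl V E"
    proof
      have "E \<subseteq> F k" for k
      proof
        fix x assume "x \<in> E"
        then show "x \<in> F k" using Fx[of x k] \<eta>(1)[of k] centre_in_cball[of x "\<eta> k"] less_imp_le by blast
      qed
      then show "cyl V E \<subseteq> (\<Inter>k. cyl V (F k))" using cyl_mono by blast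
      show "(\<Inter>k. cyl V (F k)) \<subseteq> cyl V E"
      proof
        fix z assume z: "z \<in> (\<Inter>k. cyl V (F k))"
        have "orth_proj V z \<in> closure (orth_proj V ` E)"
          unfolding closure_approachable
        proof (intro allI impI)
          fix e :: real assume "0 < e"
          then obtain k where k: "\<eta> k < e" using reals_Archimedean[of e] by (auto simp: \<eta>_def)
          from z have "orth_proj V z \<in> orth_proj V ` F k" by (auto simp: cyl_def)
          then obtain x y where xy: "x \<in> E" "norm y \<le> \<eta> k" "orth_proj V z = orth_proj V (x + y)"
            unfolding F_def by auto
          have "orth_proj V x - orth_proj V z = orth_proj V (x - (x + y))" unfolding xy(3) by (rule orth_proj_diff[OF V, symmetric])
          then have "norm (orth_proj V x - orth_proj V z) \<le> norm y" using norm_orth_proj_le[OF V, of "- y"] by simp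
          then have "dist (orth_proj V x) (orth_proj V z) < e" using xy k by (simp add: dist_norm)
          then show "\<exists>w\<in>orth_proj V ` E. dist w (orth_proj V z) < e" using xy(1) by blast
        qed
        moreover have "closed (orth_proj V ` E)" using compact_orth_proj_image[OF V E] by (rule compact_imp_closed)
        ultimately show "z \<in> cyl V E" by (simp add: cyl_def)
      qed
    qed
    then have eq: "cyl V E \<inter> strip V = (\<Inter>k. cyl V (F k) \<inter> strip V)" by auto
    have "(INF k. emeasure lborel (cyl V (F k) \<inter> strip V)) = emeasure lborel (\<Inter>k. cyl V (F k) \<inter> strip V)"
    proof (rule INF_emeasure_decseq)
      show "range (\<lambda>k. cyl V (F k) \<inter> strip V) \<subseteq> sets lborel" using cyl_borel[OF V Fc] strip_borel[OF V] by auto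
      show "decseq (\<lambda>k. cyl V (F k) \<inter> strip V)" using cyl_mono[OF Fd] by (fastforce simp: decseq_def)
      show "emeasure lborel (cyl V (F k) \<inter> strip V) \<noteq> \<infinity>" for k
        using proj_vol_le_cball[OF V FR, of k] emeasure_lborel_cball_finite[of "0::'a" "R + 1 + 1"]
        unfolding proj_vol_def by (auto simp: top_unique)
    qed
    then show ?thesis unfolding proj_vol_def eq by simp
  qed
  interpret M: prob_space M by (rule igp_prob[OF M])
  have pm: "(\<lambda>V. proj_vol V (F k)) \<in> borel_measurable M" for k
    by (rule igp_proj_vol_measurable[OF n M Fc])
  have "(\<integral>\<^sup>+V. proj_vol V E \<partial>M) = (\<integral>\<^sup>+V. (INF k. proj_vol V (F k)) \<partial>M)"
    using lim G by (intro nn_integral_cong) auto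
  also have "\<dots> = (INF k. \<integral>\<^sup>+V. proj_vol V (F k) \<partial>M)"
  proof (rule nn_integral_monotone_convergence_INF_AE')
    show "(\<integral>\<^sup>+V. proj_vol V (F 0) \<partial>M) < \<infinity>"
    proof -
      have "(\<integral>\<^sup>+V. proj_vol V (F 0) \<partial>M) \<le> (\<integral>\<^sup>+V. emeasure lborel (cball (0::'a) (R + 1 + 1)) \<partial>M)"
        by (intro nn_integral_mono proj_vol_le_cball[OF G FR])
      also have "\<dots> < \<infinity>" using emeasure_lborel_cball_finite[of "0::'a" "R + 1 + 1"] by (simp add: M.emeasure_space_1)
      finally show ?thesis .
    qed
    show "AE V in M. proj_vol V (F (Suc k)) \<le> proj_vol V (F k)" for k
      by (intro AE_I2 proj_vol_mono[OF G _ Fc] Fd) auto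
  qed (use pm in auto)
  also have "emeasure lborel (slab v \<inter> {x. norm (perp v x) < r}) \<le> \<dots>"
    by (intro INF_greatest mean_proj_vol_ge_fattened[OF n M Fc Eb Fx \<eta>(1) r v])
  finally show ?thesis .
qed

section \<open>Hausdorff measure and Lebesgue measure\<close>

lemma hausdorff_content_le:
  assumes "\<And>i. bounded (U i)" "\<And>i. diameter (U i) \<le> \<delta>" "A \<subseteq> (\<Union>i. U i)"
  shows "hausdorff_content k \<delta> A \<le> (\<Sum>i. if U i = {} then 0 else ennreal (diameter (U i) ^ k))"
  unfolding hausdorff_content_def using assms by (intro INF_lower) auto

lemma hausdorff_content_mono:
  assumes "A \<subseteq> B"
  shows "hausdorff_content k \<delta> A \<le> hausdorff_content k \<delta> B"
  unfolding hausdorff_content_def using assms by (intro INF_superset_mono) auto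

lemma hausdorff_content_UN_le:
  "hausdorff_content k \<delta> (\<Union>i::nat. A i) \<le> (\<Sum>i. hausdorff_content k \<delta> (A i))"
proof (rule ennreal_le_epsilon)
  fix e :: real assume e: "0 < e" and fin: "(\<Sum>i. hausdorff_content k \<delta> (A i)) < top"
  have "\<exists>U. ((\<forall>j. bounded (U j) \<and> diameter (U j) \<le> \<delta>) \<and> A i \<subseteq> (\<Union>j. U j))
    \<and> (\<Sum>j. if U j = {} then 0 else ennreal (diameter (U j) ^ k)) \<le> hausdorff_content k \<delta> (A i) + ennreal (e * (1/2) ^ Suc i)" for i
  proof -
    have "hausdorff_content k \<delta> (A i) < top" using fin by (rule ennreal_suminf_lessD)
    then have "hausdorff_content k \<delta> (A i) < hausdorff_content k \<delta> (A i) + ennreal (e * (1/2) ^ Suc i)"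
      using e by (simp add: ennreal_add_less_top less_top ennreal_add_left_cancel_less)
    then show ?thesis
      unfolding hausdorff_content_def[of k \<delta> "A i"] INF_less_iff by (auto intro: less_imp_le)
  qed
  then have "\<exists>U. \<forall>i. ((\<forall>j. bounded (U i j) \<and> diameter (U i j) \<le> \<delta>) \<and> A i \<subseteq> (\<Union>j. U i j))
    \<and> (\<Sum>j. if U i j = {} then 0 else ennreal (diameter (U i j) ^ k)) \<le> hausdorff_content k \<delta> (A i) + ennreal (e * (1/2) ^ Suc i)"
    by (intro choice allI)
  then obtain U where U: "\<And>i j. bounded (U i j)" "\<And>i j. diameter (U i j) \<le> \<delta>" "\<And>i. A i \<subseteq> (\<Union>j. U i j)"
    "\<And>i. (\<Sum>j. if U i j = {} then 0 else ennreal (diameter (U i j) ^ k)) \<le> hausdorff_content k \<delta> (A i) + ennreal (e * (1/2) ^ Suc i)"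
    by blast
  let ?w = "\<lambda>S :: 'a set. if S = {} then 0 else ennreal (diameter S ^ k)"
  let ?W = "\<lambda>m. case_prod U (prod_decode m)"
  have cov: "(\<Union>i. A i) \<subseteq> (\<Union>m. ?W m)"
  proof
    fix x assume "x \<in> (\<Union>i. A i)"
    then obtain i j where "x \<in> U i j" using U(3) by blast
    then have "x \<in> ?W (prod_encode (i, j))" by simp
    then show "x \<in> (\<Union>m. ?W m)" by (rule UN_I[OF UNIV_I])
  qed
  have "hausdorff_content k \<delta> (\<Union>i. A i) \<le> (\<Sum>m. ?w (?W m))"
    using U(1,2) cov by (intro hausdorff_content_le) (auto split: prod.split)
  also have "\<dots> = (\<Sum>m. (\<lambda>(i, j). ?w (U i j)) (prod_decode m))" by (intro suminf_cong) (auto split: prod.split)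
  also have "\<dots> = (\<Sum>i. \<Sum>j. ?w (U i j))" by (rule suminf_ennreal_2dimen) simp
  also have "\<dots> \<le> (\<Sum>i. hausdorff_content k \<delta> (A i) + ennreal (e * (1/2) ^ Suc i))" by (intro suminf_le U(4)) auto
  also have "\<dots> = (\<Sum>i. hausdorff_content k \<delta> (A i)) + (\<Sum>i. ennreal (e * (1/2) ^ Suc i))" by (intro suminf_add[symmetric]) auto
  also have "(\<Sum>i. ennreal (e * (1/2) ^ Suc i)) = ennreal e"
  proof -
    have "(\<lambda>i. e * (1/2) ^ Suc i) sums (e * 1)" by (intro sums_mult power_half_series)
    then show ?thesis using e by (subst suminf_ennreal2) (auto simp: sums_iff)
  qed
  finally show "hausdorff_content k \<delta> (\<Union>i. A i) \<le> (\<Sum>i. hausdorff_content k \<delta> (A i)) + ennreal e" .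
qed

lemma unnormalized_hausdorff_mono:
  assumes "A \<subseteq> B"
  shows "unnormalized_hausdorff k A \<le> unnormalized_hausdorff k B"
  unfolding unnormalized_hausdorff_def using hausdorff_content_mono[OF assms] by (intro SUP_mono) blast

lemma unnormalized_hausdorff_UN_le:
  "unnormalized_hausdorff k (\<Union>i::nat. A i) \<le> (\<Sum>i. unnormalized_hausdorff k (A i))"
  unfolding unnormalized_hausdorff_def
  by (intro SUP_least order_trans[OF hausdorff_content_UN_le] suminf_le) (auto intro!: SUP_upper)

lemma hausdorff_content_empty: "hausdorff_content k \<delta> ({} :: 'a::metric_space set) = 0" if "0 \<le> \<delta>"
proof -
  have "hausdorff_content k \<delta> ({} :: 'a set) \<le> (\<Sum>i::nat. if ({} :: 'a set) = {} then 0 else ennreal (diameter ({} :: 'a set) ^ k))"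
    by (rule hausdorff_content_le) (use that in auto)
  then show ?thesis by simp
qed

lemma unnormalized_hausdorff_empty: "unnormalized_hausdorff k {} = 0"
  unfolding unnormalized_hausdorff_def by (simp add: hausdorff_content_empty SUP_eq_const)

lemma unnormalized_hausdorff_Un_le:
  "unnormalized_hausdorff k (A \<union> B) \<le> unnormalized_hausdorff k A + unnormalized_hausdorff k B"
proof -
  let ?S = "\<lambda>i::nat. if i = 0 then A else if i = 1 then B else {}"
  have "A \<union> B \<subseteq> (\<Union>i. ?S i)" by (auto intro: exI[of _ 0] exI[of _ 1])
  then have "unnormalized_hausdorff k (A \<union> B) \<le> (\<Sum>i. unnormalized_hausdorff k (?S i))"
    by (rule order_trans[OF unnormalized_hausdorff_mono unnormalized_hausdorff_UN_le])
  also have "\<dots> = (\<Sum>i\<in>{0, 1}. unnormalized_hausdorff k (?S i))"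
    by (intro suminf_finite) (auto simp: unnormalized_hausdorff_empty)
  finally show ?thesis by simp
qed

lemma unnormalized_hausdorff_lipschitz_image:
  fixes f :: "'a::euclidean_space \<Rightarrow> 'b::euclidean_space"
  assumes s: "0 < s" and f: "\<And>x y. dist (f x) (f y) \<le> s * dist x y"
  shows "unnormalized_hausdorff k (f ` A) \<le> ennreal (s ^ k) * unnormalized_hausdorff k A"
  unfolding unnormalized_hausdorff_def[of k "f ` A"]
proof (rule SUP_least)
  fix \<delta> :: real assume "\<delta> \<in> {0<..}"
  then have \<delta>: "0 < \<delta> / s" using s by simp
  let ?c = "\<lambda>U :: nat \<Rightarrow> 'a set. \<Sum>i. if U i = {} then 0 else ennreal (diameter (U i) ^ k)"
  have "hausdorff_content k \<delta> (f ` A) \<le> ennreal (s ^ k) * ?c U"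
    if U: "\<And>i. bounded (U i)" "\<And>i. diameter (U i) \<le> \<delta> / s" "A \<subseteq> (\<Union>i. U i)" for U
  proof -
    have d: "diameter (f ` U i) \<le> s * diameter (U i)" for i
    proof (rule diameter_le)
      show "f ` U i \<noteq> {} \<or> 0 \<le> s * diameter (U i)" using s U(1) by (simp add: diameter_ge_0)
    next
      fix x y assume "x \<in> f ` U i" "y \<in> f ` U i"
      then obtain x' y' where xy: "x = f x'" "y = f y'" "x' \<in> U i" "y' \<in> U i" by blast
      have "norm (x - y) \<le> s * dist x' y'" unfolding xy dist_norm[symmetric] by (rule f)
      also have "\<dots> \<le> s * diameter (U i)" using s diameter_bounded_bound[OF U(1) xy(3,4)] by simp
      finally show "norm (x - y) \<le> s * diameter (U i)" .
    qed
    have bd: "bounded (f ` U i)" for i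
    proof -
      obtain x0 e where "\<forall>y\<in>U i. dist x0 y \<le> e" using U(1)[of i] unfolding bounded_def by blast
      then have "\<forall>y\<in>f ` U i. dist (f x0) y \<le> s * e" using f s by (auto intro!: order_trans[OF f] mult_left_mono)
      then show ?thesis unfolding bounded_def by blast
    qed
    have "hausdorff_content k \<delta> (f ` A) \<le> (\<Sum>i. if f ` U i = {} then 0 else ennreal (diameter (f ` U i) ^ k))"
    proof (rule hausdorff_content_le[OF bd])
      show "diameter (f ` U i) \<le> \<delta>" for i
        using d[of i] mult_left_mono[OF U(2)[of i], of s] s by (simp add: field_simps)
    qed (use U(3) in blast)
    also have "\<dots> \<le> (\<Sum>i. ennreal (s ^ k) * (if U i = {} then 0 else ennreal (diameter (U i) ^ k)))"
    proof (intro suminf_le)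
      fix i
      have "diameter (f ` U i) ^ k \<le> s ^ k * diameter (U i) ^ k"
        unfolding power_mult_distrib[symmetric] using d bd by (intro power_mono diameter_ge_0)
      then show "(if f ` U i = {} then 0 else ennreal (diameter (f ` U i) ^ k)) \<le> ennreal (s ^ k) * (if U i = {} then 0 else ennreal (diameter (U i) ^ k))"
        using s by (auto simp: ennreal_mult'[symmetric] intro!: ennreal_leI)
    qed auto
    finally show ?thesis by simp
  qed
  note cover = this
  have "ennreal (1 / s ^ k) * hausdorff_content k \<delta> (f ` A) \<le> hausdorff_content k (\<delta> / s) A"
    unfolding hausdorff_content_def[of k "\<delta> / s" A]
  proof (intro INF_greatest)
    fix U :: "nat \<Rightarrow> 'a set" assume "U \<in> {U. (\<forall>i. bounded (U i) \<and> diameter (U i) \<le> \<delta> / s) \<and> A \<subseteq> (\<Union>i. U i)}"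
    then have "ennreal (1 / s ^ k) * hausdorff_content k \<delta> (f ` A) \<le> ennreal (1 / s ^ k) * (ennreal (s ^ k) * ?c U)"
      by (intro mult_left_mono cover) auto
    also have "\<dots> = ?c U" using s by (simp add: mult.assoc[symmetric] ennreal_mult'[symmetric])
    finally show "ennreal (1 / s ^ k) * hausdorff_content k \<delta> (f ` A) \<le> ?c U" .
  qed
  then have "ennreal (s ^ k) * (ennreal (1 / s ^ k) * hausdorff_content k \<delta> (f ` A)) \<le> ennreal (s ^ k) * unnormalized_hausdorff k A"
    using \<delta> by (intro mult_left_mono) (auto simp: unnormalized_hausdorff_def intro: order_trans SUP_upper)
  then show "hausdorff_content k \<delta> (f ` A) \<le> ennreal (s ^ k) * unnormalized_hausdorff k A"
    using s by (simp add: mult.assoc[symmetric] ennreal_mult'[symmetric])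
qed

lemma unnormalized_hausdorff_isometry:
  fixes f :: "'a::euclidean_space \<Rightarrow> 'a"
  assumes "orthogonal_transformation f"
  shows "unnormalized_hausdorff k (f ` A) = unnormalized_hausdorff k A"
proof -
  have le: "unnormalized_hausdorff k (g ` B) \<le> unnormalized_hausdorff k B" if "orthogonal_transformation g" for g :: "'a \<Rightarrow> 'a" and B
    using unnormalized_hausdorff_lipschitz_image[of 1 g k B] that by (simp add: orthogonal_transformation_isometry)
  have "inv f ` f ` A = A" using orthogonal_transformation_inj[OF assms] by (simp add: image_comp)
  then show ?thesis using le[OF assms, of A] le[OF orthogonal_transformation_inv[OF assms], of "f ` A"] by simp
qed

text \<open>Outer regularity gives an open set, and the covering lemma fills it with nonoverlapping
  dyadic cubes; the gauge \<open>ball x (\<delta> / 2)\<close> bounds their size. Indices not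
  belonging to a cube get side 0, that is a single point of weight 0.\<close>

lemma cube_cover:
  fixes S :: "'a::euclidean_space set"
  assumes S: "bounded S" "S \<in> sets borel" and e: "0 < e" and \<delta>: "0 < \<delta>"
  obtains c :: "nat \<Rightarrow> 'a" and s :: "nat \<Rightarrow> real" where "\<forall>i. 0 \<le> s i \<and> s i \<le> \<delta>"
    "S \<subseteq> (\<Union>i. cbox (c i) (c i + s i *\<^sub>R One))" "(\<Sum>i. ennreal (s i ^ DIM('a))) \<le> emeasure lborel S + ennreal e"
proof -
  obtain U where U: "open U" "S \<subseteq> U" "emeasure lborel (U - S) < ennreal e" by (rule outer_regular_lborel[OF S(2) e])
  obtain L where L: "0 < L" "\<And>x. x \<in> S \<Longrightarrow> norm x \<le> L" using S(1) unfolding bounded_pos by blast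
  have SL: "S \<subseteq> cbox (- L *\<^sub>R One) (L *\<^sub>R One)"
  proof
    fix x assume "x \<in> S"
    then have "\<bar>x \<bullet> i\<bar> \<le> L" if "i \<in> Basis" for i using Basis_le_norm[OF that, of x] L(2) by fastforce
    then show "x \<in> cbox (- L *\<^sub>R One) (L *\<^sub>R One)" by (auto simp: mem_box abs_le_iff) (smt (verit))
  qed
  define g where "g x = U \<inter> ball x (\<delta> / 2)" for x
  have ne: "box (- L *\<^sub>R One) (L *\<^sub>R One) \<noteq> ({} :: 'a set)" using L(1) by (simp add: box_ne_empty)
  have ga: "gauge (\<lambda>x. if x \<in> U then g x else ball x 1)" using U(1) \<delta> by (auto simp: gauge_def g_def)
  obtain \<D> where \<D>: "countable \<D>" "\<Union>\<D> \<subseteq> cbox (- L *\<^sub>R One) (L *\<^sub>R One)"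
    "\<And>K. K \<in> \<D> \<Longrightarrow> interior K \<noteq> {} \<and> (\<exists>c d. K = cbox c d)" "pairwise (\<lambda>A B. interior A \<inter> interior B = {}) \<D>"
    "\<And>K. K \<in> \<D> \<Longrightarrow> \<exists>x\<in>S \<inter> K. K \<subseteq> (if x \<in> U then g x else ball x 1)"
    "\<And>u v. cbox u v \<in> \<D> \<Longrightarrow> \<exists>n. \<forall>i\<in>Basis. v \<bullet> i - u \<bullet> i = (L *\<^sub>R One \<bullet> i - (- L *\<^sub>R One) \<bullet> i) / 2 ^ n"
    "S \<subseteq> \<Union>\<D>"
  proof (rule covering_lemma[OF SL ne ga])
    fix \<D> :: "'a set set"
    assume D: "countable \<D>" "\<Union>\<D> \<subseteq> cbox (- L *\<^sub>R One) (L *\<^sub>R One)"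
    "\<And>K. K \<in> \<D> \<Longrightarrow> interior K \<noteq> {} \<and> (\<exists>c d. K = cbox c d)" "pairwise (\<lambda>A B. interior A \<inter> interior B = {}) \<D>"
    "\<And>K. K \<in> \<D> \<Longrightarrow> \<exists>x\<in>S \<inter> K. K \<subseteq> (if x \<in> U then g x else ball x 1)"
    "\<And>u v. cbox u v \<in> \<D> \<Longrightarrow> \<exists>n. \<forall>i\<in>Basis. v \<bullet> i - u \<bullet> i = (L *\<^sub>R One \<bullet> i - (- L *\<^sub>R One) \<bullet> i) / 2 ^ n"
    "S \<subseteq> \<Union>\<D>"
    show thesis by (rule that[OF D])
  qed
  have cube: "\<exists>c s. K = cbox c (c + s *\<^sub>R One) \<and> 0 < s \<and> s \<le> \<delta> \<and> K \<subseteq> U" if K: "K \<in> \<D>" for K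
  proof -
    obtain u v where uv: "K = cbox u v" using \<D>(3)[OF K] by blast
    then obtain n where n: "\<forall>i\<in>Basis. v \<bullet> i - u \<bullet> i = (L *\<^sub>R One \<bullet> i - (- L *\<^sub>R One) \<bullet> i) / 2 ^ n" using \<D>(6) K by blast
    define s where "s = 2 * L / 2 ^ n"
    have s: "0 < s" using L(1) by (simp add: s_def)
    have v: "v = u + s *\<^sub>R One" 
    proof (rule euclidean_eqI)
      fix i :: 'a assume i: "i \<in> Basis"
      then have "v \<bullet> i - u \<bullet> i = s" using n by (simp add: s_def)
      then show "v \<bullet> i = (u + s *\<^sub>R One) \<bullet> i" using i by (simp add: inner_add_left)
    qed
    obtain x where x: "x \<in> S" "K \<subseteq> g x" using \<D>(5)[OF K] U(2) by (auto split: if_splits)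
    obtain b :: 'a where b: "b \<in> Basis" using nonempty_Basis by blast
    have "u \<in> K" "v \<in> K" using s unfolding uv v by (auto simp: mem_box inner_add_left)
    then have "dist x u < \<delta> / 2" "dist x v < \<delta> / 2" using x(2) by (auto simp: g_def)
    then have "norm (v - u) < \<delta>" using dist_triangle_half_r[of x u \<delta> v] by (simp add: dist_norm norm_minus_commute)
    moreover have "s \<le> norm (v - u)" using Basis_le_norm[OF b, of "v - u"] b s by (simp add: v)
    ultimately have "s \<le> \<delta>" by linarith
    then show ?thesis using x(2) s uv v by (intro exI[of _ u] exI[of _ s]) (auto simp: g_def)
  qed
  define I where "I = to_nat_on \<D> ` \<D>"
  define Q where "Q i = from_nat_into \<D> i" for i
  have Q: "Q i \<in> \<D>" if "i \<in> I" for i using that \<D>(1) unfolding I_def Q_def by auto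
  have Qinj: "i = j" if "i \<in> I" "j \<in> I" "Q i = Q j" for i j using that \<D>(1) unfolding I_def Q_def by auto
  have "\<forall>i. \<exists>cs. 0 \<le> snd cs \<and> snd cs \<le> \<delta> \<and> (if i \<in> I then Q i = cbox (fst cs) (fst cs + snd cs *\<^sub>R One) \<and> 0 < snd cs \<and> Q i \<subseteq> U else snd cs = 0)"
  proof
    fix i
    show "\<exists>cs. 0 \<le> snd cs \<and> snd cs \<le> \<delta> \<and> (if i \<in> I then Q i = cbox (fst cs) (fst cs + snd cs *\<^sub>R One) \<and> 0 < snd cs \<and> Q i \<subseteq> U else snd cs = 0)"
    proof (cases "i \<in> I")
      case True
      from cube[OF Q[OF True]] obtain c s where "Q i = cbox c (c + s *\<^sub>R One)" "0 < s" "s \<le> \<delta>" "Q i \<subseteq> U" by blast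
      then show ?thesis using True by (intro exI[of _ "(c, s)"]) auto
    next
      case False
      then show ?thesis using \<delta> by (intro exI[of _ "(0, 0)"]) auto
    qed
  qed
  from choice[OF this] obtain cs where cs0: "\<forall>i. 0 \<le> snd (cs i) \<and> snd (cs i) \<le> \<delta> \<and>
    (if i \<in> I then Q i = cbox (fst (cs i)) (fst (cs i) + snd (cs i) *\<^sub>R One) \<and> 0 < snd (cs i) \<and> Q i \<subseteq> U else snd (cs i) = 0)" ..
  have cs: "0 \<le> snd (cs i)" "snd (cs i) \<le> \<delta>"
    "i \<in> I \<Longrightarrow> Q i = cbox (fst (cs i)) (fst (cs i) + snd (cs i) *\<^sub>R One)" "i \<in> I \<Longrightarrow> 0 < snd (cs i)"
    "i \<in> I \<Longrightarrow> Q i \<subseteq> U" "i \<notin> I \<Longrightarrow> snd (cs i) = 0" for i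
    using spec[OF cs0, of i] by (auto split: if_splits)
  let ?J = "\<lambda>i. if i \<in> I then interior (Q i) else {}"
  have em: "emeasure lborel (?J i) = ennreal (snd (cs i) ^ DIM('a))" for i
  proof (cases "i \<in> I")
    case True
    then show ?thesis using cs(4)[OF True]
      by (simp add: cs(3) interior_cbox emeasure_lborel_box_eq inner_add_left)
  qed (simp add: cs(6))
  have "(\<Sum>i. ennreal (snd (cs i) ^ DIM('a))) = (\<Sum>i. emeasure lborel (?J i))" by (simp add: em)
  also have "\<dots> = emeasure lborel (\<Union>i. ?J i)"
  proof (rule suminf_emeasure)
    show "disjoint_family ?J"
      unfolding disjoint_family_on_def
    proof (intro ballI impI)
      fix i j :: nat assume ij: "i \<noteq> j"
      have "interior (Q i) \<inter> interior (Q j) = {}" if "i \<in> I" "j \<in> I"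
        using pairwiseD[OF \<D>(4) Q[OF that(1)] Q[OF that(2)]] Qinj[OF that] ij by blast
      then show "?J i \<inter> ?J j = {}" by simp
    qed
  qed auto
  also have "\<dots> \<le> emeasure lborel U"
  proof (rule emeasure_mono)
    have "?J i \<subseteq> U" for i using cs(5)[of i] interior_subset[of "Q i"] by (cases "i \<in> I") auto
    then show "(\<Union>i. ?J i) \<subseteq> U" by blast
  qed (use U(1) in simp)
  also have "\<dots> = emeasure lborel (S \<union> (U - S))" using U(2) by (simp add: Un_absorb1)
  also have "\<dots> \<le> emeasure lborel S + emeasure lborel (U - S)"
    using S(2) U(1) by (intro emeasure_subadditive) auto
  also have "\<dots> \<le> emeasure lborel S + ennreal e" using U(3) by (intro add_left_mono less_imp_le)
  finally have sum: "(\<Sum>i. ennreal (snd (cs i) ^ DIM('a))) \<le> emeasure lborel S + ennreal e" .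
  have "S \<subseteq> (\<Union>i. cbox (fst (cs i)) (fst (cs i) + snd (cs i) *\<^sub>R One))"
  proof
    fix x assume "x \<in> S"
    then obtain K where K: "K \<in> \<D>" "x \<in> K" using \<D>(7) by blast
    then have "to_nat_on \<D> K \<in> I" "Q (to_nat_on \<D> K) = K" using \<D>(1) by (auto simp: I_def Q_def)
    then show "x \<in> (\<Union>i. cbox (fst (cs i)) (fst (cs i) + snd (cs i) *\<^sub>R One))" using cs(3) K(2) by blast
  qed
  then show thesis using cs(1,2) sum that[of "\<lambda>i. snd (cs i)" "\<lambda>i. fst (cs i)"] by blast
qed

section \<open>Products with unit cubes and slices\<close>

definition coord :: "'a::euclidean_space set \<Rightarrow> 'a \<Rightarrow> 'a" where
  "coord D x = (\<Sum>b\<in>D. (x \<bullet> b) *\<^sub>R b)"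

text \<open>The product of a subset of the span of \<open>D\<close> with the unit cube in the
  remaining coordinates. Its n-dimensional volume stands for the k-dimensional Lebesgue measure of
  the set.\<close>

definition thick :: "'a::euclidean_space set \<Rightarrow> 'a set \<Rightarrow> 'a set" where
  "thick D A = {x. coord D x \<in> A \<and> (\<forall>b\<in>Basis - D. \<bar>x \<bullet> b\<bar> \<le> 1 / 2)}"

definition box_pt :: "'a::euclidean_space set \<Rightarrow> ('a \<Rightarrow> real) \<Rightarrow> ('a \<Rightarrow> real) \<Rightarrow> 'a" where
  "box_pt D f g = (\<Sum>b\<in>Basis. (if b \<in> D then f b else g b) *\<^sub>R b)"

lemma box_pt_inner: "b \<in> Basis \<Longrightarrow> box_pt D f g \<bullet> b = (if b \<in> D then f b else g b)"
  by (simp add: box_pt_def)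

lemma emeasure_box_pt:
  fixes D :: "'a::euclidean_space set"
  assumes D: "D \<subseteq> Basis" and le: "0 \<le> u" "0 \<le> w"
  shows "emeasure lborel (cbox (box_pt D f g) (box_pt D (\<lambda>b. f b + u) (\<lambda>b. g b + w)))
    = ennreal (u ^ card D * w ^ (DIM('a) - card D))"
proof -
  have "emeasure lborel (cbox (box_pt D f g) (box_pt D (\<lambda>b. f b + u) (\<lambda>b. g b + w)))
    = ennreal (\<Prod>b\<in>Basis. if b \<in> D then u else w)"
    using le by (subst emeasure_lborel_cbox_eq) (auto simp: box_pt_inner inner_diff_left intro!: arg_cong[where f=ennreal] prod.cong)
  also have "(\<Prod>b\<in>Basis. if b \<in> D then u else w) = u ^ card D * w ^ card (Basis - D)"
  proof -
    have "Basis \<inter> {b. b \<in> D} = D" "Basis \<inter> - {b. b \<in> D} = Basis - D" using D by auto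
    then show ?thesis by (simp add: prod.If_cases)
  qed
  also have "card (Basis - D) = DIM('a) - card D"
    using D by (intro card_Diff_subset) (auto intro: finite_subset)
  finally show ?thesis .
qed

context
  fixes D :: "'a::euclidean_space set" and k :: nat
  assumes D: "D \<subseteq> Basis" "card D = k" and k: "1 \<le> k"
begin

lemma coord_inner: "b \<in> Basis \<Longrightarrow> coord D x \<bullet> b = (if b \<in> D then x \<bullet> b else 0)"
proof -
  assume b: "b \<in> Basis"
  have "coord D x \<bullet> b = (\<Sum>c\<in>D. (x \<bullet> c) * (c \<bullet> b))" by (simp add: coord_def inner_sum_left)
  also have "\<dots> = (\<Sum>c\<in>D. if c = b then x \<bullet> b else 0)"
    using D b by (intro sum.cong) (auto simp: inner_Basis)
  also have "\<dots> = (if b \<in> D then x \<bullet> b else 0)" using finite_subset[OF D(1)] by simp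
  finally show ?thesis .
qed

lemma sum_inner: "b \<in> Basis \<Longrightarrow> \<Sum>D \<bullet> b = (if b \<in> D then 1 else 0)"
proof -
  assume b: "b \<in> Basis"
  have "\<Sum>D \<bullet> b = (\<Sum>c\<in>D. if c = b then 1 else 0)"
    unfolding inner_sum_left using D b by (intro sum.cong) (auto simp: inner_Basis)
  then show ?thesis using finite_subset[OF D(1)] by simp
qed

lemma norm_coord_le: "norm (coord D x) \<le> norm x"
  unfolding norm_eq_sqrt_inner
proof (rule real_sqrt_le_mono)
  have "coord D x \<bullet> coord D x \<le> (\<Sum>b\<in>Basis. (x \<bullet> b) * (x \<bullet> b))"
    unfolding euclidean_inner[of "coord D x" "coord D x"] by (intro sum_mono) (simp add: coord_inner)
  then show "coord D x \<bullet> coord D x \<le> x \<bullet> x" by (simp add: euclidean_inner[of x x])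
qed

lemma coord_diff: "coord D (x - y) = coord D x - coord D y"
  by (simp add: coord_def inner_diff_left scaleR_left_diff_distrib sum_subtractf)

lemma coord_fixed_iff: "coord D x = x \<longleftrightarrow> (\<forall>b\<in>Basis - D. x \<bullet> b = 0)"
  by (subst euclidean_eq_iff) (auto simp: coord_inner)

text \<open>A cover of the thickened set by n-cubes covers \<open>A\<close> in every slice: the
  cubes met by the slice, projected by \<open>coord D\<close>, cover \<open>A\<close>. The estimate
  \<open>h\<close> for one slice is averaged over all slices; the \<open>i\<close>-th cube is met by
  a set of slices of measure \<open>s i ^ (n - k)\<close>, completing the power
  \<open>s i ^ k\<close>.\<close>

lemma slice_bound:
  fixes c :: "nat \<Rightarrow> 'a" and s :: "nat \<Rightarrow> real" and h L :: ennreal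
  assumes s: "\<And>i. 0 \<le> s i" and A: "\<And>a. a \<in> A \<Longrightarrow> coord D a = a"
    and cov: "thick D A \<subseteq> (\<Union>i. cbox (c i) (c i + s i *\<^sub>R One))"
    and h: "\<And>I. A \<subseteq> (\<Union>i\<in>I. coord D ` cbox (c i) (c i + s i *\<^sub>R One)) \<Longrightarrow> h \<le> (\<Sum>i. indicator I i * (L * ennreal (s i ^ k)))"
  shows "h \<le> L * (\<Sum>i. ennreal (s i ^ DIM('a)))"
proof -
  \<comment> \<open>Slices are indexed by points of a unit cube of the whole space; the coordinates
    in \<open>D\<close> are idle and contribute the factor 1, also in \<open>W\<close>.\<close>
  define T where "T = cbox (box_pt D (\<lambda>_. 0) (\<lambda>_. - 1 / 2)) (box_pt D (\<lambda>_. 0 + 1) (\<lambda>_. - 1 / 2 + 1) :: 'a)"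
  have T: "emeasure lborel T = 1" unfolding T_def by (subst emeasure_box_pt[OF D(1)]) auto
  define W where "W i = cbox (box_pt D (\<lambda>_. 0) (\<lambda>b. c i \<bullet> b)) (box_pt D (\<lambda>_. 0 + 1) (\<lambda>b. c i \<bullet> b + s i))" for i
  have W: "emeasure lborel (W i) = ennreal (s i ^ (DIM('a) - k))" for i
    unfolding W_def by (subst emeasure_box_pt[OF D(1)]) (simp_all add: D(2) s)
  have pt: "h \<le> (\<Sum>i. indicator (W i) x * (L * ennreal (s i ^ k)))" if x: "x \<in> T" for x
  proof -
    have "A \<subseteq> (\<Union>i\<in>{i. x \<in> W i}. coord D ` cbox (c i) (c i + s i *\<^sub>R One))"
    proof
      fix a assume a: "a \<in> A"
      define z where "z = a + (x - coord D x)"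
      have zb: "z \<bullet> b = (if b \<in> D then a \<bullet> b else x \<bullet> b)" if "b \<in> Basis" for b
        using A[OF a] that by (auto simp: z_def inner_diff_left inner_add_left coord_inner coord_fixed_iff)
      have za: "coord D z = a"
        using A[OF a] by (subst euclidean_eq_iff) (auto simp: coord_inner zb coord_fixed_iff)
      have "\<bar>x \<bullet> b\<bar> \<le> 1 / 2" if "b \<in> Basis - D" for b
      proof -
        have "box_pt D (\<lambda>_. 0) (\<lambda>_. - 1 / 2) \<bullet> b \<le> x \<bullet> b" "x \<bullet> b \<le> box_pt D (\<lambda>_. 0 + 1) (\<lambda>_. - 1 / 2 + 1) \<bullet> b"
          using x that unfolding T_def mem_box by auto
        then show ?thesis using that by (auto simp: box_pt_inner abs_le_iff)
      qed
      then have "z \<in> thick D A" using za a by (auto simp: thick_def zb)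
      then obtain i where i: "z \<in> cbox (c i) (c i + s i *\<^sub>R One)" using cov by blast
      have "x \<in> W i"
        unfolding W_def mem_box
      proof
        fix b :: 'a assume b: "b \<in> Basis"
        have "c i \<bullet> b \<le> z \<bullet> b \<and> z \<bullet> b \<le> c i \<bullet> b + s i" using i b by (auto simp: mem_box inner_add_left)
        moreover have "box_pt D (\<lambda>_. 0) (\<lambda>_. - 1 / 2) \<bullet> b \<le> x \<bullet> b \<and> x \<bullet> b \<le> box_pt D (\<lambda>_. 0 + 1) (\<lambda>_. - 1 / 2 + 1) \<bullet> b"
          using x b unfolding T_def mem_box by auto
        ultimately show "box_pt D (\<lambda>_. 0) (\<lambda>b. c i \<bullet> b) \<bullet> b \<le> x \<bullet> b \<and> x \<bullet> b \<le> box_pt D (\<lambda>_. 0 + 1) (\<lambda>b. c i \<bullet> b + s i) \<bullet> b"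
          using b by (auto simp: box_pt_inner zb split: if_splits)
      qed
      then show "a \<in> (\<Union>i\<in>{i. x \<in> W i}. coord D ` cbox (c i) (c i + s i *\<^sub>R One))" using i za by blast
    qed
    from h[OF this] show ?thesis by (simp add: indicator_def)
  qed
  have "h = (\<integral>\<^sup>+x. h * indicator T x \<partial>lborel)" using T by (subst nn_integral_cmult_indicator) (auto simp: T_def)
  also have "\<dots> \<le> (\<integral>\<^sup>+x. (\<Sum>i. indicator (W i) x * (L * ennreal (s i ^ k))) \<partial>lborel)"
    using pt by (intro nn_integral_mono) (auto split: split_indicator)
  also have "\<dots> = (\<Sum>i. \<integral>\<^sup>+x. indicator (W i) x * (L * ennreal (s i ^ k)) \<partial>lborel)"
    by (rule nn_integral_suminf) (simp add: W_def)
  also have "\<dots> = (\<Sum>i. L * ennreal (s i ^ DIM('a)))"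
  proof (intro suminf_cong)
    fix i
    have kn: "k \<le> DIM('a)" using D card_mono[of Basis D] by auto
    have "(\<integral>\<^sup>+x. indicator (W i) x * (L * ennreal (s i ^ k)) \<partial>lborel) = (L * ennreal (s i ^ k)) * emeasure lborel (W i)"
      by (subst mult.commute) (rule nn_integral_cmult_indicator, simp add: W_def)
    also have "\<dots> = L * ennreal (s i ^ k * s i ^ (DIM('a) - k))" using s by (simp add: W ennreal_mult mult.assoc)
    finally show "(\<integral>\<^sup>+x. indicator (W i) x * (L * ennreal (s i ^ k)) \<partial>lborel) = L * ennreal (s i ^ DIM('a))"
      using kn by (simp add: power_add[symmetric])
  qed
  finally show ?thesis by simp
qed

lemma bounded_thick:
  assumes "bounded A"
  shows "bounded (thick D A)"
proof -
  obtain R where R: "\<And>a. a \<in> A \<Longrightarrow> norm a \<le> R" using assms unfolding bounded_iff by blast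
  have "norm x \<le> real DIM('a) * (R + 1)" if x: "x \<in> thick D A" for x
  proof -
    have 0: "norm (coord D x) \<le> R" using R x by (simp add: thick_def)
    have "\<bar>x \<bullet> b\<bar> \<le> R + 1" if b: "b \<in> Basis" for b
    proof (cases "b \<in> D")
      case True
      then show ?thesis using Basis_le_norm[OF b, of "coord D x"] 0 b by (simp add: coord_inner)
    next
      case False
      then have "\<bar>x \<bullet> b\<bar> \<le> 1 / 2" using x b by (simp add: thick_def)
      then show ?thesis using 0 norm_ge_zero[of "coord D x"] by linarith
    qed
    then have "(\<Sum>b\<in>Basis. \<bar>x \<bullet> b\<bar>) \<le> real DIM('a) * (R + 1)" by (intro sum_bounded_above)
    then show ?thesis using norm_le_l1[of x] by linarith
  qed
  then show ?thesis unfolding bounded_iff by blast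
qed

lemma thick_cube:
  assumes "l \<le> u"
  shows "thick D (cbox (l *\<^sub>R \<Sum>D) (u *\<^sub>R \<Sum>D)) = cbox (box_pt D (\<lambda>_. l) (\<lambda>_. - 1 / 2)) (box_pt D (\<lambda>_. u) (\<lambda>_. 1 / 2))"
    "emeasure lborel (thick D (cbox (l *\<^sub>R \<Sum>D) (u *\<^sub>R \<Sum>D))) = ennreal ((u - l) ^ k)"
proof -
  show 1: "thick D (cbox (l *\<^sub>R \<Sum>D) (u *\<^sub>R \<Sum>D)) = cbox (box_pt D (\<lambda>_. l) (\<lambda>_. - 1 / 2)) (box_pt D (\<lambda>_. u) (\<lambda>_. 1 / 2))"
    using D(1) by (force simp: thick_def mem_box box_pt_inner coord_inner sum_inner abs_le_iff)
  have "emeasure lborel (cbox (box_pt D (\<lambda>_. l) (\<lambda>_. - 1 / 2)) (box_pt D (\<lambda>_. l + (u - l)) (\<lambda>_. - 1 / 2 + 1))) = ennreal ((u - l) ^ k * 1 ^ (DIM('a) - card D))"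
    using assms by (subst emeasure_box_pt[OF D(1)]) (simp_all add: D(2))
  then show "emeasure lborel (thick D (cbox (l *\<^sub>R \<Sum>D) (u *\<^sub>R \<Sum>D))) = ennreal ((u - l) ^ k)" by (simp add: 1)
qed

lemma coord_cube_fixed: "a \<in> cbox (l *\<^sub>R \<Sum>D) (u *\<^sub>R \<Sum>D) \<Longrightarrow> coord D a = a"
  unfolding coord_fixed_iff by (force simp: mem_box sum_inner)

abbreviation "cube \<equiv> cbox 0 (\<Sum>D)"

lemma cube_fixed: "a \<in> cube \<Longrightarrow> coord D a = a"
  using coord_cube_fixed[of a 0 1] by simp

lemma thick_cube_measure: "thick D cube \<in> sets borel" "emeasure lborel (thick D cube) = 1"
  using thick_cube[of 0 1] by simp_all

lemma unnormalized_hausdorff_cube_finite: "unnormalized_hausdorff k cube < \<infinity>"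
proof -
  have "hausdorff_content k \<delta> cube \<le> ennreal (real DIM('a) ^ k) * 2" if \<delta>: "0 < \<delta>" for \<delta>
  proof -
    have \<delta>': "0 < \<delta> / DIM('a)" using \<delta> by simp
    obtain c :: "nat \<Rightarrow> 'a" and s where cs0: "\<forall>i. 0 \<le> s i \<and> s i \<le> \<delta> / DIM('a)"
      "thick D cube \<subseteq> (\<Union>i. cbox (c i) (c i + s i *\<^sub>R One))" "(\<Sum>i. ennreal (s i ^ DIM('a))) \<le> emeasure lborel (thick D cube) + ennreal 1"
      by (rule cube_cover[OF bounded_thick[OF bounded_cbox] thick_cube_measure(1) zero_less_one \<delta>'])
    then have cs: "0 \<le> s i" "s i \<le> \<delta> / DIM('a)" for i by auto
    have "hausdorff_content k \<delta> cube \<le> ennreal (real DIM('a) ^ k) * (\<Sum>i. ennreal (s i ^ DIM('a)))"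
    proof (rule slice_bound[OF cs(1) cube_fixed cs0(2)])
      fix I assume I: "cube \<subseteq> (\<Union>i\<in>I. coord D ` cbox (c i) (c i + s i *\<^sub>R One))"
      define U where "U i = (if i \<in> I then coord D ` cbox (c i) (c i + s i *\<^sub>R One) else {})" for i
      have dist: "norm (x - y) \<le> real DIM('a) * s i" if "x \<in> U i" "y \<in> U i" for x y i
      proof -
        from that obtain x' y' where xy: "x = coord D x'" "y = coord D y'" "x' \<in> cbox (c i) (c i + s i *\<^sub>R One)" "y' \<in> cbox (c i) (c i + s i *\<^sub>R One)"
          by (auto simp: U_def split: if_splits)
        have "\<bar>(x' - y') \<bullet> b\<bar> \<le> s i" if b: "b \<in> Basis" for b
        proof -
          have "c i \<bullet> b \<le> x' \<bullet> b" "x' \<bullet> b \<le> c i \<bullet> b + s i" "c i \<bullet> b \<le> y' \<bullet> b" "y' \<bullet> b \<le> c i \<bullet> b + s i"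
            using xy(3,4) b by (auto simp: mem_box inner_add_left)
          then show ?thesis by (simp add: inner_diff_left abs_le_iff)
        qed
        then have "(\<Sum>b\<in>Basis. \<bar>(x' - y') \<bullet> b\<bar>) \<le> real DIM('a) * s i" by (intro sum_bounded_above)
        then show ?thesis using norm_le_l1[of "x' - y'"] norm_coord_le[of "x' - y'"] unfolding xy(1,2) coord_diff by linarith
      qed
      have bd: "bounded (U i)" for i
        unfolding bounded_two_points dist_norm using dist by blast
      have diam: "diameter (U i) \<le> real DIM('a) * s i" for i
        by (rule diameter_le) (use dist cs(1) in auto)
      have "hausdorff_content k \<delta> cube \<le> (\<Sum>i. if U i = {} then 0 else ennreal (diameter (U i) ^ k))"
      proof (rule hausdorff_content_le[OF bd])
        show "diameter (U i) \<le> \<delta>" for i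
        proof -
          have "real DIM('a) * s i \<le> real DIM('a) * (\<delta> / DIM('a))" by (intro mult_left_mono cs(2)) simp
          then show ?thesis using diam[of i] by simp
        qed
        show "cube \<subseteq> (\<Union>i. U i)" using I by (fastforce simp: U_def)
      qed
      also have "\<dots> \<le> (\<Sum>i. indicator I i * (ennreal (real DIM('a) ^ k) * ennreal (s i ^ k)))"
      proof (intro suminf_le)
        fix i
        have "diameter (U i) ^ k \<le> (real DIM('a) * s i) ^ k" by (intro power_mono diam diameter_ge_0 bd)
        then show "(if U i = {} then 0 else ennreal (diameter (U i) ^ k)) \<le> indicator I i * (ennreal (real DIM('a) ^ k) * ennreal (s i ^ k))"
          using cs(1) by (auto simp: U_def indicator_def ennreal_mult'[symmetric] power_mult_distrib)
      qed auto
      finally show "hausdorff_content k \<delta> cube \<le> (\<Sum>i. indicator I i * (ennreal (real DIM('a) ^ k) * ennreal (s i ^ k)))" .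
    qed
    also have "\<dots> \<le> ennreal (real DIM('a) ^ k) * 2"
      using cs0(3) by (intro mult_left_mono) (auto simp: thick_cube_measure)
    finally show ?thesis .
  qed
  then have "unnormalized_hausdorff k cube \<le> ennreal (real DIM('a) ^ k) * 2"
    unfolding unnormalized_hausdorff_def by (intro SUP_least) auto
  also have "\<dots> < \<infinity>" by (simp add: ennreal_mult_less_top)
  finally show ?thesis .
qed

text \<open>Every covering set is enlarged to a box of side twice its diameter around one of its
  points. The boxes cover the thickened cube, of volume 1, so the weights cannot sum to less than
  2^(-k).\<close>

lemma unnormalized_hausdorff_cube_pos: "0 < unnormalized_hausdorff k cube"
proof -
  have "ennreal ((1 / 2) ^ k) \<le> hausdorff_content k 1 cube"
    unfolding hausdorff_content_def
  proof (rule INF_greatest)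
    fix U :: "nat \<Rightarrow> 'a set"
    assume "U \<in> {U. (\<forall>i. bounded (U i) \<and> diameter (U i) \<le> 1) \<and> cube \<subseteq> (\<Union>i. U i)}"
    then have U: "\<And>i. bounded (U i)" "cube \<subseteq> (\<Union>i. U i)" by auto
    define x where "x i = (SOME z. z \<in> U i)" for i
    have x: "x i \<in> U i" if "z \<in> U i" for i z unfolding x_def using that by (rule someI)
    define W where "W i = (if U i = {} then {} else cbox (box_pt D (\<lambda>b. x i \<bullet> b - diameter (U i)) (\<lambda>_. - 1 / 2))
      (box_pt D (\<lambda>b. x i \<bullet> b - diameter (U i) + 2 * diameter (U i)) (\<lambda>_. - 1 / 2 + 1)))" for i
    have W: "emeasure lborel (W i) = (if U i = {} then 0 else ennreal ((2 * diameter (U i)) ^ k))" for i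
    proof (cases "U i = {}")
      case False
      then show ?thesis
        unfolding W_def if_not_P[OF False] using diameter_ge_0[OF U(1)[of i]] by (subst emeasure_box_pt[OF D(1)]) (simp_all add: D(2))
    qed (simp add: W_def)
    have "thick D cube \<subseteq> (\<Union>i. W i)"
    proof
      fix z assume z: "z \<in> thick D cube"
      then obtain i where i: "coord D z \<in> U i" using U(2) by (auto simp: thick_def)
      have "\<bar>z \<bullet> b - x i \<bullet> b\<bar> \<le> diameter (U i)" if b: "b \<in> D" for b
      proof -
        have "\<bar>(coord D z - x i) \<bullet> b\<bar> \<le> norm (coord D z - x i)" using b D(1) by (intro Basis_le_norm) auto
        also have "\<dots> \<le> diameter (U i)" using diameter_bounded_bound[OF U(1) i x[OF i]] by (simp add: dist_norm)
        finally show ?thesis using b D(1) by (auto simp: inner_diff_left coord_inner)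
      qed
      note near = this
      have ne: "U i \<noteq> {}" using i by blast
      have "z \<in> W i"
        unfolding W_def if_not_P[OF ne] mem_box
      proof
        fix b :: 'a assume b: "b \<in> Basis"
        show "box_pt D (\<lambda>b. x i \<bullet> b - diameter (U i)) (\<lambda>_. - 1 / 2) \<bullet> b \<le> z \<bullet> b \<and>
          z \<bullet> b \<le> box_pt D (\<lambda>b. x i \<bullet> b - diameter (U i) + 2 * diameter (U i)) (\<lambda>_. - 1 / 2 + 1) \<bullet> b"
        proof (cases "b \<in> D")
          case True
          from near[OF this] True show ?thesis by (simp add: box_pt_inner b abs_le_iff)
        next
          case False
          then have "\<bar>z \<bullet> b\<bar> \<le> 1 / 2" using z b by (simp add: thick_def)
          then show ?thesis unfolding box_pt_inner[OF b] if_not_P[OF False] by linarith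
        qed
      qed
      then show "z \<in> (\<Union>i. W i)" by blast
    qed
    then have "1 \<le> emeasure lborel (\<Union>i. W i)"
      unfolding thick_cube_measure(2)[symmetric] by (intro emeasure_mono) (auto simp: W_def)
    also have "\<dots> \<le> (\<Sum>i. emeasure lborel (W i))" by (intro emeasure_subadditive_countably) (auto simp: W_def)
    also have "\<dots> = (\<Sum>i. ennreal (2 ^ k) * (if U i = {} then 0 else ennreal (diameter (U i) ^ k)))"
      unfolding W by (intro suminf_cong) (auto simp: ennreal_mult'[symmetric] power_mult_distrib)
    finally have "1 \<le> ennreal (2 ^ k) * (\<Sum>i. if U i = {} then 0 else ennreal (diameter (U i) ^ k))" by simp
    then have "ennreal ((1 / 2) ^ k) * 1 \<le> ennreal ((1 / 2) ^ k) * (ennreal (2 ^ k) * (\<Sum>i. if U i = {} then 0 else ennreal (diameter (U i) ^ k)))"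
      by (rule mult_left_mono) simp
    also have "\<dots> = (\<Sum>i. if U i = {} then 0 else ennreal (diameter (U i) ^ k))"
    proof -
      have "ennreal ((1 / 2) ^ k) * ennreal (2 ^ k) = 1" by (simp add: ennreal_mult'[symmetric] power_mult_distrib[symmetric])
      then show ?thesis by (simp only: mult.assoc[symmetric] mult_1_left)
    qed
    finally show "ennreal ((1 / 2) ^ k) \<le> (\<Sum>i. if U i = {} then 0 else ennreal (diameter (U i) ^ k))" by simp
  qed
  also have "\<dots> \<le> unnormalized_hausdorff k cube" unfolding unnormalized_hausdorff_def by (intro SUP_upper) simp
  finally show ?thesis by (rule order_less_le_trans[rotated]) simp
qed

lemma unnormalized_hausdorff_singleton: "unnormalized_hausdorff k {x :: 'a} = 0"
proof -
  have "hausdorff_content k \<delta> {x} = 0" if "0 < \<delta>" for \<delta>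
  proof -
    have "hausdorff_content k \<delta> {x} \<le> (\<Sum>i::nat. if {x} = {} then 0 else ennreal (diameter {x} ^ k))"
      by (rule hausdorff_content_le) (use that in auto)
    also have "\<dots> = 0" using k by (simp add: zero_power)
    finally show ?thesis by simp
  qed
  then have "unnormalized_hausdorff k {x} \<le> 0" unfolding unnormalized_hausdorff_def by (intro SUP_least) simp
  then show ?thesis by simp
qed

lemma unnormalized_hausdorff_coord_cube:
  assumes "0 \<le> s"
  shows "unnormalized_hausdorff k (coord D ` cbox c (c + s *\<^sub>R One)) \<le> unnormalized_hausdorff k cube * ennreal (s ^ k)"
proof (cases "s = 0")
  case True
  then show ?thesis by (simp add: unnormalized_hausdorff_singleton)
next
  case False
  then have s: "0 < s" using assms by simp
  have "coord D ` cbox c (c + s *\<^sub>R One) \<subseteq> (\<lambda>x. coord D c + s *\<^sub>R x) ` cube"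
  proof
    fix a assume "a \<in> coord D ` cbox c (c + s *\<^sub>R One)"
    then obtain z where z: "a = coord D z" "z \<in> cbox c (c + s *\<^sub>R One)" by blast
    have "(1 / s) *\<^sub>R (coord D z - coord D c) \<in> cube"
      using z(2) s by (auto simp: mem_box inner_add_left inner_diff_left coord_inner sum_inner field_simps)
    moreover have "a = coord D c + s *\<^sub>R ((1 / s) *\<^sub>R (coord D z - coord D c))" using s z(1) by simp
    ultimately show "a \<in> (\<lambda>x. coord D c + s *\<^sub>R x) ` cube" by (rule rev_image_eqI)
  qed
  then have "unnormalized_hausdorff k (coord D ` cbox c (c + s *\<^sub>R One)) \<le> unnormalized_hausdorff k ((\<lambda>x. coord D c + s *\<^sub>R x) ` cube)"
    by (rule unnormalized_hausdorff_mono)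
  also have "\<dots> \<le> ennreal (s ^ k) * unnormalized_hausdorff k cube"
    using s by (intro unnormalized_hausdorff_lipschitz_image) (auto simp: dist_norm scaleR_diff_right[symmetric])
  finally show ?thesis by (simp add: mult.commute)
qed

lemma unnormalized_hausdorff_le_thick:
  assumes A: "\<And>a. a \<in> A \<Longrightarrow> coord D a = a" and b: "bounded A" and m: "thick D A \<in> sets borel"
  shows "unnormalized_hausdorff k A \<le> unnormalized_hausdorff k cube * emeasure lborel (thick D A)"
proof (rule ennreal_le_epsilon)
  fix e :: real assume e: "0 < e"
  obtain C where C: "unnormalized_hausdorff k cube = ennreal C" "0 \<le> C"
    using unnormalized_hausdorff_cube_finite by (cases "unnormalized_hausdorff k cube") auto
  define e' where "e' = e / (C + 1)"
  have e': "0 < e'" "C * e' \<le> e" using e C(2) by (auto simp: e'_def field_simps)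
  obtain c :: "nat \<Rightarrow> 'a" and s where cs0: "\<forall>i. 0 \<le> s i \<and> s i \<le> 1"
    "thick D A \<subseteq> (\<Union>i. cbox (c i) (c i + s i *\<^sub>R One))" "(\<Sum>i. ennreal (s i ^ DIM('a))) \<le> emeasure lborel (thick D A) + ennreal e'"
    by (rule cube_cover[OF bounded_thick[OF b] m e'(1) zero_less_one])
  then have cs: "0 \<le> s i" "s i \<le> 1" for i by auto
  have "unnormalized_hausdorff k A \<le> unnormalized_hausdorff k cube * (\<Sum>i. ennreal (s i ^ DIM('a)))"
  proof (rule slice_bound[OF cs(1) A cs0(2)])
    fix I assume I: "A \<subseteq> (\<Union>i\<in>I. coord D ` cbox (c i) (c i + s i *\<^sub>R One))"
    let ?U = "\<lambda>i. if i \<in> I then coord D ` cbox (c i) (c i + s i *\<^sub>R One) else {}"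
    have "A \<subseteq> (\<Union>i. ?U i)" using I by fastforce
    then have "unnormalized_hausdorff k A \<le> (\<Sum>i. unnormalized_hausdorff k (?U i))"
      by (rule order_trans[OF unnormalized_hausdorff_mono unnormalized_hausdorff_UN_le])
    also have "\<dots> \<le> (\<Sum>i. indicator I i * (unnormalized_hausdorff k cube * ennreal (s i ^ k)))"
      by (intro suminf_le) (auto simp: unnormalized_hausdorff_empty unnormalized_hausdorff_coord_cube cs(1))
    finally show "unnormalized_hausdorff k A \<le> (\<Sum>i. indicator I i * (unnormalized_hausdorff k cube * ennreal (s i ^ k)))" .
  qed
  also have "\<dots> \<le> unnormalized_hausdorff k cube * (emeasure lborel (thick D A) + ennreal e')"
    by (intro mult_left_mono cs0(3)) simp
  also have "\<dots> = unnormalized_hausdorff k cube * emeasure lborel (thick D A) + ennreal (C * e')"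
    using C e'(1) by (simp add: distrib_left ennreal_mult'[symmetric])
  also have "\<dots> \<le> unnormalized_hausdorff k cube * emeasure lborel (thick D A) + ennreal e"
    using e'(2) by (intro add_left_mono ennreal_leI)
  finally show "unnormalized_hausdorff k A \<le> unnormalized_hausdorff k cube * emeasure lborel (thick D A) + ennreal e" .
qed

text \<open>The lower bound follows from the upper bound for the complement in a large cube
  \<open>Q\<close>: scaling bounds the measure of \<open>Q\<close> from below by exactly its volume
  times that of the unit cube, and subadditivity leaves the missing part to
  \<open>A\<close>.\<close>

lemma unnormalized_hausdorff_eq_thick:
  assumes A: "\<And>a. a \<in> A \<Longrightarrow> coord D a = a" and b: "bounded A" and m: "thick D A \<in> sets borel"
  shows "unnormalized_hausdorff k A = unnormalized_hausdorff k cube * emeasure lborel (thick D A)"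
proof (rule antisym[OF unnormalized_hausdorff_le_thick[OF assms]])
  let ?H = "unnormalized_hausdorff k :: 'a set \<Rightarrow> ennreal"
  obtain C where C: "?H cube = ennreal C" "0 \<le> C"
    using unnormalized_hausdorff_cube_finite by (cases "?H cube") auto
  obtain R where R: "0 < R" "\<And>a. a \<in> A \<Longrightarrow> norm a \<le> R" using b unfolding bounded_pos by blast
  define Q where "Q = cbox ((- R) *\<^sub>R \<Sum>D) (R *\<^sub>R \<Sum>D)"
  have AQ: "A \<subseteq> Q"
  proof
    fix a assume a: "a \<in> A"
    then have "\<bar>a \<bullet> b\<bar> \<le> R" if "b \<in> Basis" for b using Basis_le_norm[OF that, of a] R(2) by fastforce
    moreover have "a \<bullet> b = 0" if "b \<in> Basis - D" for b using A[OF a] that unfolding coord_fixed_iff by blast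
    ultimately show "a \<in> Q" unfolding Q_def by (auto simp: mem_box sum_inner abs_le_iff minus_le_iff)
  qed
  have TQ: "thick D Q \<in> sets borel" "emeasure lborel (thick D Q) = ennreal ((2 * R) ^ k)"
    using thick_cube[of "- R" R] R(1) unfolding Q_def by (simp_all del: scaleR_minus_left)
  have sub: "thick D A \<subseteq> thick D Q" using AQ by (auto simp: thick_def)
  have diff: "thick D (Q - A) = thick D Q - thick D A" by (auto simp: thick_def)
  have "emeasure lborel (thick D A) \<le> ennreal ((2 * R) ^ k)" unfolding TQ(2)[symmetric] using sub TQ(1) by (intro emeasure_mono) auto
  then obtain a where a: "emeasure lborel (thick D A) = ennreal a" "0 \<le> a" "a \<le> (2 * R) ^ k"
    using R(1) by (cases "emeasure lborel (thick D A)") (auto simp: top_unique)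
  have "cube \<subseteq> (\<lambda>x. (1 / (2 * R)) *\<^sub>R (x + R *\<^sub>R \<Sum>D)) ` Q"
  proof
    fix x assume x: "x \<in> cube"
    have "(2 * R) *\<^sub>R x - R *\<^sub>R \<Sum>D \<in> Q"
      using x R(1) unfolding Q_def by (auto simp: mem_box inner_diff_left sum_inner mult_le_cancel_left1 split: if_splits)
    moreover have "x = (1 / (2 * R)) *\<^sub>R (((2 * R) *\<^sub>R x - R *\<^sub>R \<Sum>D) + R *\<^sub>R \<Sum>D)" using R(1) by simp
    ultimately show "x \<in> (\<lambda>x. (1 / (2 * R)) *\<^sub>R (x + R *\<^sub>R \<Sum>D)) ` Q" by (rule rev_image_eqI)
  qed
  then have "?H cube \<le> ?H ((\<lambda>x. (1 / (2 * R)) *\<^sub>R (x + R *\<^sub>R \<Sum>D)) ` Q)" by (rule unnormalized_hausdorff_mono)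
  also have "\<dots> \<le> ennreal ((1 / (2 * R)) ^ k) * ?H Q"
    using R(1) by (intro unnormalized_hausdorff_lipschitz_image) (auto simp: dist_norm scaleR_diff_right[symmetric])
  also have "\<dots> \<le> ennreal ((1 / (2 * R)) ^ k) * (?H A + ennreal (C * ((2 * R) ^ k - a)))"
  proof (intro mult_left_mono)
    have "Q = A \<union> (Q - A)" using AQ by blast
    then have "?H Q \<le> ?H A + ?H (Q - A)" using unnormalized_hausdorff_Un_le[of k A "Q - A"] by simp
    also have "?H (Q - A) \<le> ?H cube * emeasure lborel (thick D (Q - A))"
    proof (rule unnormalized_hausdorff_le_thick)
      show "coord D a = a" if "a \<in> Q - A" for a using that coord_cube_fixed[of a "- R" R] by (simp add: Q_def)
      show "bounded (Q - A)" unfolding Q_def by (rule bounded_subset[OF bounded_cbox Diff_subset])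
      show "thick D (Q - A) \<in> sets borel" unfolding diff using TQ(1) m by simp
    qed
    also have "emeasure lborel (thick D (Q - A)) = ennreal ((2 * R) ^ k - a)"
      unfolding diff using m sub TQ a by (subst emeasure_Diff) (auto simp: ennreal_minus)
    finally show "?H Q \<le> ?H A + ennreal (C * ((2 * R) ^ k - a))" using C a by (simp add: ennreal_mult')
  qed simp
  finally have le: "ennreal C \<le> ennreal ((1 / (2 * R)) ^ k) * (?H A + ennreal (C * ((2 * R) ^ k - a)))" unfolding C(1) .
  show "?H cube * emeasure lborel (thick D A) \<le> ?H A"
  proof (cases "?H A")
    case (real h)
    define q where "q = (2 * R) ^ k"
    have q: "0 < q" "a \<le> q" using R(1) a(3) by (simp_all add: q_def)
    have eq: "(1 / (2 * R)) ^ k = 1 / q" unfolding q_def by (rule power_one_over)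
    have w: "0 \<le> C * (q - a)" using C(2) q(2) by simp
    have "ennreal C \<le> ennreal (1 / q) * (ennreal h + ennreal (C * (q - a)))"
      using le unfolding eq real(2) q_def[symmetric] .
    also have "\<dots> = ennreal ((1 / q) * (h + C * (q - a)))" using real(1) w q by (subst ennreal_mult) simp_all
    finally have "C \<le> (1 / q) * (h + C * (q - a))" using real(1) w q by (subst (asm) ennreal_le_iff) auto
    then have "C * q \<le> h + C * (q - a)" using q by (simp add: field_simps)
    then have "C * a \<le> h" by (simp add: algebra_simps)
    then show ?thesis using real C a by (simp add: ennreal_mult'[symmetric])
  qed simp
qed

end

section \<open>Hausdorff measure of projections\<close>

text \<open>\<open>D\<close> is the very choice made inside \<open>unit_cube\<close>, and is
  therefore obtained and not prescribed. Dividing by the measure of that cube removes the unknown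
  factor, which is positive and finite.\<close>

lemma hausdorff_measure_eq_thick:
  assumes k: "1 \<le> k" "k \<le> DIM('a::euclidean_space)"
  obtains D :: "'a::euclidean_space set" where "D \<subseteq> Basis" "card D = k"
    "\<forall>A. (\<forall>a\<in>A. coord D a = a) \<longrightarrow> bounded A \<longrightarrow> thick D A \<in> sets borel \<longrightarrow> hausdorff_measure k A = emeasure lborel (thick D A)"
proof -
  define D :: "'a set" where "D = (SOME D. D \<subseteq> Basis \<and> card D = k)"
  have "\<exists>D :: 'a set. D \<subseteq> Basis \<and> card D = k" using k(2) obtain_subset_with_card_n by metis
  then have D: "D \<subseteq> Basis" "card D = k" unfolding D_def by (metis (mono_tags, lifting) someI_ex)+
  have c: "unit_cube k = cbox 0 (\<Sum>D)" unfolding unit_cube_def D_def ..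
  have pos: "unnormalized_hausdorff k (cbox 0 (\<Sum>D)) \<noteq> 0" and fin: "unnormalized_hausdorff k (cbox 0 (\<Sum>D)) \<noteq> \<infinity>"
    using unnormalized_hausdorff_cube_pos[OF D k(1)] unnormalized_hausdorff_cube_finite[OF D k(1)] by auto
  show thesis
  proof (rule that[OF D], intro allI impI)
    fix A :: "'a set" assume A0: "\<forall>a\<in>A. coord D a = a" and A': "bounded A" "thick D A \<in> sets borel"
    then have A: "\<And>a. a \<in> A \<Longrightarrow> coord D a = a" "bounded A" "thick D A \<in> sets borel" by auto
    show "hausdorff_measure k A = emeasure lborel (thick D A)"
      unfolding hausdorff_measure_def c using unnormalized_hausdorff_eq_thick[OF D k(1) A] pos fin
      by (simp add: mult_divide_eq_ennreal mult.commute)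
  qed
qed

lemma hausdorff_measure_mono: "A \<subseteq> B \<Longrightarrow> hausdorff_measure k A \<le> hausdorff_measure k B"
  unfolding hausdorff_measure_def by (intro divide_right_mono_ennreal unnormalized_hausdorff_mono)

lemma hausdorff_measure_isometry:
  fixes f :: "'a::euclidean_space \<Rightarrow> 'a"
  assumes "orthogonal_transformation f"
  shows "hausdorff_measure k (f ` A) = hausdorff_measure k A"
  unfolding hausdorff_measure_def unnormalized_hausdorff_isometry[OF assms] ..

text \<open>In full dimension \<open>D\<close> is the whole basis and thickening does nothing. An
  unbounded set is cut into shells, for which countable subadditivity gives the inequality; this is
  the direction in which the volume of \<open>E\<close> enters the comparison.\<close>

lemma
  fixes E :: "'a::euclidean_space set"
  assumes E: "E \<in> sets borel"
  shows hausdorff_measure_full_bounded: "bounded E \<Longrightarrow> hausdorff_measure DIM('a) E = emeasure lborel E"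
    and hausdorff_measure_full_le: "hausdorff_measure DIM('a) E \<le> emeasure lborel E"
proof -
  have n: "1 \<le> DIM('a)" "DIM('a) \<le> DIM('a)" by (simp_all add: Suc_leI)
  obtain D :: "'a set" where D: "D \<subseteq> Basis" "card D = DIM('a)"
    and H: "\<forall>A. (\<forall>a\<in>A. coord D a = a) \<longrightarrow> bounded A \<longrightarrow> thick D A \<in> sets borel \<longrightarrow> hausdorff_measure DIM('a) A = emeasure lborel (thick D A)"
    by (rule hausdorff_measure_eq_thick[OF n])
  have DB: "D = Basis" using D card_subset_eq[of Basis D] by simp
  have cx: "coord D x = x" for x unfolding coord_def DB by (rule euclidean_representation)
  have tA: "thick D A = A" for A using cx unfolding thick_def DB by simp
  have bd: "hausdorff_measure DIM('a) A = emeasure lborel A" if "bounded A" "A \<in> sets borel" for A :: "'a set"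
    using H[rule_format, of A] that cx tA by simp
  then show "bounded E \<Longrightarrow> hausdorff_measure DIM('a) E = emeasure lborel E" using E by simp
  define S :: "nat \<Rightarrow> 'a set" where "S i = ball 0 (real (Suc i)) - ball 0 (real i)" for i
  have cov: "E \<subseteq> (\<Union>i. E \<inter> S i)"
  proof
    fix x assume x: "x \<in> E"
    have "nat \<lfloor>norm x\<rfloor> \<le> norm x" "norm x < real (Suc (nat \<lfloor>norm x\<rfloor>))" by (simp_all add: of_nat_nat) linarith
    then have "x \<in> S (nat \<lfloor>norm x\<rfloor>)" by (simp add: S_def not_less)
    then show "x \<in> (\<Union>i. E \<inter> S i)" using x by blast
  qed
  have disj: "disjoint_family (\<lambda>i. E \<inter> S i)"
    unfolding disjoint_family_on_def
  proof (intro ballI impI)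
    fix i j :: nat assume "i \<noteq> j"
    then have "Suc i \<le> j \<or> Suc j \<le> i" by auto
    then have "real (Suc i) \<le> real j \<or> real (Suc j) \<le> real i" by (simp only: of_nat_le_iff)
    then show "E \<inter> S i \<inter> (E \<inter> S j) = {}" by (auto simp: S_def not_less)
  qed
  have Sb: "bounded (E \<inter> S i)" for i unfolding S_def by (rule bounded_subset[OF bounded_ball[of 0 "real (Suc i)"]]) auto
  have "hausdorff_measure DIM('a) E \<le> (\<Sum>i. hausdorff_measure DIM('a) (E \<inter> S i))"
    unfolding hausdorff_measure_def divide_ennreal_def
    using order_trans[OF unnormalized_hausdorff_mono[OF cov] unnormalized_hausdorff_UN_le]
    by (subst ennreal_suminf_multc) (rule mult_right_mono, auto)
  also have "\<dots> = (\<Sum>i. emeasure lborel (E \<inter> S i))" using Sb E by (intro suminf_cong bd) (auto simp: S_def)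
  also have "\<dots> = emeasure lborel (\<Union>i. E \<inter> S i)" using E disj by (intro suminf_emeasure) (auto simp: S_def)
  also have "\<dots> \<le> emeasure lborel E" using E by (intro emeasure_mono) auto
  finally show "hausdorff_measure DIM('a) E \<le> emeasure lborel E" .
qed

text \<open>For \<open>v \<noteq> w\<close> this is the reflection in the bisector of the two unit
  vectors, otherwise the identity. It transports slabs and projections from one hyperplane to
  another.\<close>

lemma swap_reflection:
  fixes v w :: "'a::euclidean_space"
  assumes "norm v = 1" "norm w = 1"
  obtains f where "orthogonal_transformation f" "f w = v" "\<forall>x. f (f x) = x" "\<forall>x. f x \<bullet> v = x \<bullet> w"
    "\<forall>x. perp v (f x) = f (perp w x)"
proof -
  have "\<exists>f. orthogonal_transformation f \<and> f w = v \<and> (\<forall>x. f (f x) = x)"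
  proof (cases "v = w")
    case True
    then show ?thesis by (intro exI[of _ "\<lambda>x. x"]) (simp add: orthogonal_transformation_id)
  next
    case False
    define u where "u = (1 / norm (w - v)) *\<^sub>R (w - v)"
    have d: "0 < norm (w - v)" using False by simp
    have u: "norm u = 1" using d by (simp add: u_def)
    have vw: "v \<bullet> v = 1" "w \<bullet> w = 1" using assms by (simp_all add: dot_square_norm)
    have n2: "(norm (w - v))\<^sup>2 = 2 * (w \<bullet> (w - v))"
      unfolding power2_norm_eq_inner by (simp add: inner_diff_left inner_diff_right vw inner_commute[of v w])
    have "(2 * (w \<bullet> u)) *\<^sub>R u = (2 * (w \<bullet> (w - v)) / (norm (w - v))\<^sup>2) *\<^sub>R (w - v)"
      by (simp add: u_def power2_eq_square)
    then have "reflect u 0 w = v" unfolding n2[symmetric] using d by (simp add: reflect_def)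
    moreover have "linear (reflect u 0)"
      unfolding reflect_def by (rule linearI) (simp_all add: inner_add_left algebra_simps)
    moreover have "norm (reflect u 0 x) = norm x" for x
      using norm_reflect_diff[OF u, of 0 x 0] by (simp add: reflect_def)
    ultimately show ?thesis using u by (intro exI[of _ "reflect u 0"]) (simp add: orthogonal_transformation)
  qed
  then obtain f where f: "orthogonal_transformation f" "f w = v" "\<And>x. f (f x) = x" by blast
  have i: "f x \<bullet> v = x \<bullet> w" for x using f(1) unfolding orthogonal_transformation_def f(2)[symmetric] by blast
  have "perp v (f x) = f (perp w x)" for x
    using orthogonal_transformation_linear[OF f(1)] by (simp add: perp_def i linear_diff linear_cmul f(2))
  then show thesis using f i by (intro that[of f]) auto
qed

lemma emeasure_slab_cylinder_indep:
  fixes v w :: "'a::euclidean_space"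
  assumes v: "norm v = 1" and w: "norm w = 1"
  shows "emeasure lborel (slab v \<inter> {x. norm (perp v x) < r}) = emeasure lborel (slab w \<inter> {x. norm (perp w x) < r})"
proof -
  obtain f where f: "orthogonal_transformation f" "f w = v" "\<forall>x. f (f x) = x" "\<forall>x. f x \<bullet> v = x \<bullet> w" "\<forall>x. perp v (f x) = f (perp w x)"
    by (rule swap_reflection[OF v w])
  note f = f(1,2) f(3-5)[rule_format]
  have "emeasure lborel (slab v \<inter> {x. norm (perp v x) < r}) = (\<integral>\<^sup>+x. indicator (slab v \<inter> {x. norm (perp v x) < r}) (f x) \<partial>lborel)"
    by (subst nn_integral_lborel_orthogonal[OF f(1)]) simp_all
  also have "\<dots> = (\<integral>\<^sup>+x. indicator (slab w \<inter> {x. norm (perp w x) < r}) x \<partial>lborel)"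
    by (intro nn_integral_cong) (simp add: indicator_def slab_def f(4,5) orthogonal_transformation_norm[OF f(1)])
  finally show ?thesis by simp
qed

text \<open>A reflection takes \<open>V\<close> to the coordinate hyperplane spanned by
  \<open>D\<close>, without changing Hausdorff measure. There the thickened projection is the
  preimage of the cylinder cut by the slab.\<close>

lemma hausdorff_measure_orth_proj:
  fixes E :: "'a::euclidean_space set"
  assumes n: "2 \<le> DIM('a)" and V: "V \<in> grassmannian (DIM('a) - 1)"
    and E: "bounded E" "cyl V E \<in> sets borel"
  shows "hausdorff_measure (DIM('a) - 1) (orth_proj V ` E) = proj_vol V E"
proof -
  obtain v where v: "norm v = 1" "orth_proj V = perp v" using V by (rule grassmannian_hyperplaneE)
  have n1: "1 \<le> DIM('a) - 1" "DIM('a) - 1 \<le> DIM('a)" using n by auto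
  obtain D :: "'a set" where D: "D \<subseteq> Basis" "card D = DIM('a) - 1"
    and H: "\<forall>A. (\<forall>a\<in>A. coord D a = a) \<longrightarrow> bounded A \<longrightarrow> thick D A \<in> sets borel \<longrightarrow> hausdorff_measure (DIM('a) - 1) A = emeasure lborel (thick D A)"
    by (rule hausdorff_measure_eq_thick[OF n1])
  have "card (Basis - D) = 1" using D n by (subst card_Diff_subset) (auto intro: finite_subset)
  then obtain e where e: "Basis - D = {e}" by (auto simp: card_1_singleton_iff)
  have eB: "e \<in> Basis" using e by blast
  have ne: "norm e = 1" using eB by simp
  have cD: "coord D x = perp e x" for x
  proof -
    have "x = (\<Sum>b\<in>Basis. (x \<bullet> b) *\<^sub>R b)" by (rule euclidean_representation[symmetric])
    also have "\<dots> = coord D x + (\<Sum>b\<in>Basis - D. (x \<bullet> b) *\<^sub>R b)"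
      unfolding coord_def using D(1) by (subst add.commute) (intro sum.subset_diff finite_Basis)
    finally show ?thesis unfolding e by (simp add: perp_def algebra_simps)
  qed
  obtain f where f: "orthogonal_transformation f" "f e = v" "\<forall>x. f (f x) = x" "\<forall>x. f x \<bullet> v = x \<bullet> e" "\<forall>x. perp v (f x) = f (perp e x)"
    by (rule swap_reflection[OF v(1) ne])
  note f = f(1,2) f(3-5)[rule_format]
  define A where "A = perp e ` f ` E"
  have fA: "f ` A = orth_proj V ` E"
    unfolding A_def image_image v(2) f(5)[symmetric] f(3) ..
  have inA: "perp e x \<in> A \<longleftrightarrow> f x \<in> cyl V E" for x
  proof -
    have "perp e x \<in> A \<longleftrightarrow> f (perp e x) \<in> f ` A" by (metis f(3) imageE imageI)
    also have "\<dots> \<longleftrightarrow> f x \<in> cyl V E" unfolding fA cyl_def f(5)[symmetric] v(2) by simp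
    finally show ?thesis .
  qed
  have tA: "thick D A = f -` (cyl V E \<inter> slab v)"
    by (auto simp: thick_def e cD inA slab_def f(4))
  have fm: "f \<in> borel_measurable borel" by (rule orthogonal_transformation_measurable[OF f(1)])
  have "hausdorff_measure (DIM('a) - 1) (orth_proj V ` E) = hausdorff_measure (DIM('a) - 1) A"
    unfolding fA[symmetric] by (rule hausdorff_measure_isometry[OF f(1)])
  also have "\<dots> = emeasure lborel (thick D A)"
  proof (rule H[rule_format])
    show "coord D a = a" if "a \<in> A" for a
    proof -
      have "e \<bullet> e = 1" using ne by (simp add: dot_square_norm)
      then show ?thesis using that by (auto simp: A_def cD perp_def inner_diff_left)
    qed
    have "bounded_linear (perp e)" unfolding perp_def[abs_def] by (intro bounded_linear_intros)
    then show "bounded A"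
      unfolding A_def using E(1) orthogonal_transformation_linear[OF f(1)]
      by (intro bounded_linear_image) (simp_all add: linear_conv_bounded_linear)
    show "thick D A \<in> sets borel"
      unfolding tA using measurable_sets[OF fm, of "cyl V E \<inter> slab v"] E(2) by simp
  qed
  also have "\<dots> = (\<integral>\<^sup>+x. indicator (cyl V E \<inter> slab v) (f x) \<partial>lborel)"
  proof -
    have "thick D A \<in> sets lborel" unfolding tA using measurable_sets[OF fm, of "cyl V E \<inter> slab v"] E(2) by simp
    then have "emeasure lborel (thick D A) = (\<integral>\<^sup>+x. indicator (thick D A) x \<partial>lborel)" by simp
    then show ?thesis by (simp add: tA indicator_def)
  qed
  also have "\<dots> = emeasure lborel (cyl V E \<inter> slab v)"
    using E(2) by (subst nn_integral_lborel_orthogonal[OF f(1)]) simp_all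
  finally show ?thesis by (simp add: proj_vol_def strip_eq_slab[OF v])
qed

text \<open>As n \<ge> 2 there is a unit vector \<open>w\<close> orthogonal to \<open>v\<close>. On
  every line in direction \<open>w\<close> the squared norm of \<open>perp v\<close> is a monic
  quadratic, so the line meets the set in finitely many points.\<close>

lemma emeasure_cylinder_boundary:
  fixes v :: "'a::euclidean_space"
  assumes n: "2 \<le> DIM('a)" and v: "norm v = 1"
  shows "emeasure lborel {x. norm (perp v x) = r} = 0"
proof -
  obtain w0 :: 'a where w0: "w0 \<noteq> 0" "orthogonal v w0" by (rule orthogonal_to_vector_exists[OF n])
  define w where "w = w0 /\<^sub>R norm w0"
  have w: "norm w = 1" "w \<bullet> v = 0" using w0 by (simp_all add: w_def orthogonal_def inner_commute)
  have null: "{s. norm (perp v (y + s *\<^sub>R w)) = r} \<in> null_sets lborel" for y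
  proof -
    have "perp v (y + s *\<^sub>R w) = perp v y + s *\<^sub>R w" for s using w(2) by (simp add: perp_def inner_add_left)
    moreover have "(norm (perp v y + s *\<^sub>R w))\<^sup>2 = (norm (perp v y))\<^sup>2 + 2 * (perp v y \<bullet> w) * s + s\<^sup>2" for s
    proof -
      have "w \<bullet> w = 1" using w(1) by (simp add: dot_square_norm)
      then show ?thesis unfolding power2_norm_eq_inner
        by (simp add: inner_add_left inner_add_right inner_commute[of w "perp v y"] power2_eq_square distrib_left)
    qed
    ultimately have "{s. norm (perp v (y + s *\<^sub>R w)) = r} \<subseteq> {s. (\<Sum>i\<le>2. [(norm (perp v y))\<^sup>2 - r\<^sup>2, 2 * (perp v y \<bullet> w), 1] ! i * s ^ i) = 0}"
      by (auto simp: numeral_2_eq_2)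
    moreover have "finite {s :: real. (\<Sum>i\<le>2. [(norm (perp v y))\<^sup>2 - r\<^sup>2, 2 * (perp v y \<bullet> w), 1] ! i * s ^ i) = 0}"
      by (rule polyfun_rootbound[THEN conjunct1]) (rule exI[of _ 2], simp)
    ultimately have "finite {s. norm (perp v (y + s *\<^sub>R w)) = r}" by (rule finite_subset)
    then show ?thesis by (rule finite_imp_null_set_lborel)
  qed
  have 0: "(\<integral>\<^sup>+s. indicator {x. norm (perp v x) = r} (y + s *\<^sub>R w) \<partial>lborel) = 0" for y
  proof -
    have "(\<integral>\<^sup>+s. indicator {x. norm (perp v x) = r} (y + s *\<^sub>R w) \<partial>lborel) = (\<integral>\<^sup>+s. indicator {s. norm (perp v (y + s *\<^sub>R w)) = r} s \<partial>lborel)"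
      by (intro nn_integral_cong) (simp add: indicator_def)
    also have "\<dots> = emeasure lborel {s. norm (perp v (y + s *\<^sub>R w)) = r}" by (rule nn_integral_indicator) measurable
    also have "\<dots> = 0" using null[of y] by blast
    finally show ?thesis .
  qed
  have "emeasure lborel {x. norm (perp v x) = r} = (\<integral>\<^sup>+x. indicator {x. norm (perp v x) = r} x \<partial>lborel)" by simp
  also have "\<dots> = 0" by (subst nn_integral_slab_fubini[OF _ w(1)]) (simp_all add: 0)
  finally show ?thesis .
qed

text \<open>The projection is a ball of the same radius in \<open>V\<close>, translated to the
  centre 0. The right side has the open cylinder about an arbitrary \<open>v\<close>, the form of
  the bound in \<open>mean_proj_vol_ge\<close>; the boundary is a null set, and the volume is
  independent of the direction.\<close>

lemma hausdorff_measure_proj_cball: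
  fixes c v :: "'a::euclidean_space"
  assumes n: "2 \<le> DIM('a)" and V: "V \<in> grassmannian (DIM('a) - 1)" and v: "norm v = 1"
  shows "hausdorff_measure (DIM('a) - 1) (orth_proj V ` cball c r) = emeasure lborel (slab v \<inter> {x. norm (perp v x) < r})"
proof -
  obtain w where w: "norm w = 1" "orth_proj V = perp w" using V by (rule grassmannian_hyperplaneE)
  have ww: "w \<bullet> w = 1" using w(1) by (simp add: dot_square_norm)
  define p where "p = perp w c"
  have pw: "p \<bullet> w = 0" by (simp add: p_def perp_def inner_diff_left ww)
  have pp: "perp w (p + z) = p + perp w z" for z using pw by (simp add: perp_def inner_add_left)
  have "cyl V (cball c r) = {z. norm (perp w z - p) \<le> r}"
  proof (intro set_eqI iffI)
    fix z assume "z \<in> cyl V (cball c r)"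
    then obtain y where y: "norm (c - y) \<le> r" "perp w z = perp w y" by (auto simp: cyl_def w(2) dist_norm)
    have "norm (perp w z - p) = norm (perp w (y - c))" unfolding y(2) p_def perp_diff ..
    also have "\<dots> \<le> norm (y - c)" using norm_orth_proj_le[OF V] unfolding w(2) .
    finally show "z \<in> {z. norm (perp w z - p) \<le> r}" using y(1) by (simp add: norm_minus_commute)
  next
    fix z assume z: "z \<in> {z. norm (perp w z - p) \<le> r}"
    define y where "y = c + (perp w z - p)"
    have "perp w y = perp w z"
      by (simp add: y_def p_def perp_def inner_diff_left inner_add_left ww)
    moreover have "y \<in> cball c r" using z by (simp add: y_def dist_norm norm_minus_commute)
    ultimately show "z \<in> cyl V (cball c r)" using image_eqI[of "perp w z" "perp w" y] by (simp add: cyl_def w(2))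
  qed
  then have cyl: "cyl V (cball c r) = {z. norm (perp w z - p) \<le> r}" .
  have "hausdorff_measure (DIM('a) - 1) (orth_proj V ` cball c r) = proj_vol V (cball c r)"
    by (rule hausdorff_measure_orth_proj[OF n V]) (simp_all add: cyl_borel[OF V])
  also have "\<dots> = (\<integral>\<^sup>+z. indicator (slab w \<inter> {z. norm (perp w z - p) \<le> r}) z \<partial>lborel)"
    unfolding proj_vol_def strip_eq_slab[OF w] cyl by (simp add: Int_commute)
  also have "\<dots> = (\<integral>\<^sup>+z. indicator (slab w \<inter> {z. norm (perp w z - p) \<le> r}) (p + z) \<partial>lborel)"
    by (rule nn_integral_lborel_translation[symmetric]) measurable
  also have "\<dots> = (\<integral>\<^sup>+z. indicator (slab w \<inter> {z. norm (perp w z) \<le> r}) z \<partial>lborel)"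
    by (intro nn_integral_cong) (simp add: indicator_def slab_def pp inner_add_left pw)
  also have "\<dots> = (\<integral>\<^sup>+z. indicator (slab w \<inter> {z. norm (perp w z) < r}) z \<partial>lborel)"
  proof (rule nn_integral_cong_AE)
    have "{x. norm (perp w x) = r} \<in> null_sets lborel" using emeasure_cylinder_boundary[OF n w(1)] by (intro null_setsI) auto
    then show "AE z in lborel. indicator (slab w \<inter> {z. norm (perp w z) \<le> r}) z = (indicator (slab w \<inter> {z. norm (perp w z) < r}) z :: ennreal)"
      by (rule AE_I') (auto simp: indicator_def)
  qed
  also have "\<dots> = emeasure lborel (slab v \<inter> {x. norm (perp v x) < r})"
    using emeasure_slab_cylinder_indep[OF w(1) v] by simp
  finally show ?thesis .
qed

text \<open>The law of the hyperplane orthogonal to a Gaussian vector; it is invariant because the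
  Gaussian is. The vector 0, which has no orthogonal hyperplane, is replaced by a basis vector and
  forms a null set.\<close>

lemma ex_invariant_grassmannian_prob:
  "\<exists>M :: 'a::euclidean_space set measure. invariant_grassmannian_prob (DIM('a) - 1) M"
proof -
  obtain e :: 'a where e: "e \<in> Basis" using nonempty_Basis by blast
  define nz :: "'a \<Rightarrow> 'a" where "nz x = (if x = 0 then e else x)" for x
  define h where "h x = {y. y \<bullet> nz x = 0}" for x
  have nz: "nz x \<noteq> 0" for x using e by (auto simp: nz_def)
  have hG: "h x \<in> grassmannian (DIM('a) - 1)" for x unfolding h_def by (rule hyperplane_in_grassmannian[OF nz])
  let ?B = "\<lambda>x :: 'a. id_blinfun - (1 / (x \<bullet> x)) *\<^sub>R (blinfun_scaleR_left x o\<^sub>L blinfun_inner_left x)"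
  have hB: "Blinfun (orth_proj (h x)) = ?B x" if "x \<noteq> 0" for x
  proof (rule blinfun_eqI)
    fix y
    define u where "u = x /\<^sub>R norm x"
    have u: "norm u = 1" "h x = {y. y \<bullet> u = 0}" using that by (simp_all add: u_def h_def nz_def)
    have "blinfun_apply (Blinfun (orth_proj (h x))) y = perp u y"
      unfolding orth_proj_blinfun[OF hG] using orth_proj_hyperplane[OF u(1)] u(2) by simp
    also have "\<dots> = blinfun_apply (?B x) y"
      using that by (simp add: perp_def u_def blinfun.diff_left blinfun.scaleR_left dot_square_norm power2_eq_square divide_inverse)
    finally show "blinfun_apply (Blinfun (orth_proj (h x))) y = blinfun_apply (?B x) y" .
  qed
  have hm: "h \<in> borel \<rightarrow>\<^sub>M grassmannian_borel (DIM('a) - 1)"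
    unfolding grassmannian_borel_def
  proof (rule measurable_vimage_algebra2)
    show "h \<in> space borel \<rightarrow> grassmannian (DIM('a) - 1)" using hG by simp
    have "continuous_on (- {0}) ?B"
      by (intro continuous_intros bounded_linear.continuous_on[OF bounded_linear_blinfun_scaleR_left] bounded_linear.continuous_on[OF bounded_linear_blinfun_inner_left]) auto
    then have "continuous_on (- {0}) (\<lambda>x. Blinfun (orth_proj (h x)))"
      by (rule continuous_on_eq) (simp add: hB)
    then show "(\<lambda>x. Blinfun (orth_proj (h x))) \<in> borel_measurable borel"
      by (intro borel_measurable_continuous_countable_exceptions[of "{0}"]) auto
  qed
  define N where "N = density lborel (\<lambda>x::'a. ennreal (gauss 1 x))"
  have Nsp: "space N = UNIV" "sets N = sets borel" by (simp_all add: N_def)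
  interpret N: prob_space N
    by (rule prob_spaceI) (simp add: N_def emeasure_density nn_integral_gauss)
  have hN: "h \<in> N \<rightarrow>\<^sub>M grassmannian_borel (DIM('a) - 1)" using hm by (simp add: measurable_cong_sets[OF Nsp(2) refl])
  define M where "M = distr N (grassmannian_borel (DIM('a) - 1)) h"
  have "emeasure M ((\<lambda>V. f ` V) ` A) = emeasure M A" if f: "orthogonal_transformation f" and A: "A \<in> sets M" for f and A
  proof -
    let ?g = "inv f"
    have g: "orthogonal_transformation ?g" by (rule orthogonal_transformation_inv[OF f])
    have fg: "f (?g x) = x" "?g (f x) = x" for x
      using orthogonal_transformation_bij[OF f] by (auto simp: bij_def surj_f_inv_f)
    have A': "A \<in> sets (grassmannian_borel (DIM('a) - 1))" using A by (simp add: M_def)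
    have AG: "A \<subseteq> grassmannian (DIM('a) - 1)" using sets.sets_into_space[OF A'] by simp
    have im: "(\<lambda>V. f ` V) ` A = (\<lambda>V. ?g ` V) -` A \<inter> space (grassmannian_borel (DIM('a) - 1))"
    proof (intro set_eqI iffI)
      fix V assume "V \<in> (\<lambda>V. f ` V) ` A"
      then obtain W where W: "W \<in> A" "V = f ` W" by blast
      then show "V \<in> (\<lambda>V. ?g ` V) -` A \<inter> space (grassmannian_borel (DIM('a) - 1))"
        using AG image_in_grassmannian[OF f] by (auto simp: image_image fg)
    next
      fix V assume "V \<in> (\<lambda>V. ?g ` V) -` A \<inter> space (grassmannian_borel (DIM('a) - 1))"
      then have "?g ` V \<in> A" by simp
      moreover have "V = f ` ?g ` V" by (simp add: image_image fg)
      ultimately show "V \<in> (\<lambda>V. f ` V) ` A" by (rule rev_image_eqI)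
    qed
    have ims: "(\<lambda>V. f ` V) ` A \<in> sets (grassmannian_borel (DIM('a) - 1))"
      unfolding im by (rule measurable_sets[OF grassmannian_image_measurable[OF g] A'])
    have em: "emeasure M S = (\<integral>\<^sup>+x. ennreal (gauss 1 x) * indicator S (h x) \<partial>lborel)" if S: "S \<in> sets (grassmannian_borel (DIM('a) - 1))" for S
    proof -
      have "h -` S \<in> sets borel" using measurable_sets[OF hm S] by simp
      then show ?thesis
        unfolding M_def using S hN by (subst emeasure_distr) (simp_all add: Nsp, simp add: N_def emeasure_density indicator_def)
    qed
    have hg: "?g ` h x = h (?g x)" if "x \<noteq> 0" for x
    proof -
      have "?g x \<noteq> 0" using that g by (metis orthogonal_transformation_norm norm_eq_zero)
      moreover have "?g y \<bullet> ?g x = y \<bullet> x" for y using g unfolding orthogonal_transformation_def by blast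
      moreover have "y = ?g (f y)" for y by (simp add: fg)
      ultimately show ?thesis using that unfolding h_def nz_def
        by (auto simp: image_iff) (metis fg)
    qed
    have "emeasure M ((\<lambda>V. f ` V) ` A) = (\<integral>\<^sup>+x. ennreal (gauss 1 x) * indicator ((\<lambda>V. f ` V) ` A) (h x) \<partial>lborel)"
      by (rule em[OF ims])
    also have "\<dots> = (\<integral>\<^sup>+x. ennreal (gauss 1 (?g x)) * indicator A (h (?g x)) \<partial>lborel)"
    proof (rule nn_integral_cong_AE)
      show "AE x in lborel. ennreal (gauss 1 x) * indicator ((\<lambda>V. f ` V) ` A) (h x) = ennreal (gauss 1 (?g x)) * indicator A (h (?g x))"
        using AE_lborel_singleton[of "0::'a"]
      proof eventually_elim
        case (elim x)
        have "gauss 1 (?g x) = gauss 1 x" by (rule gauss_cong_norm) (rule orthogonal_transformation_norm[OF g])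
        moreover have "h x \<in> (\<lambda>V. f ` V) ` A \<longleftrightarrow> h (?g x) \<in> A" unfolding im hg[OF elim, symmetric] using hG by simp
        ultimately show ?case by (simp add: indicator_def)
      qed
    qed
    also have "\<dots> = (\<integral>\<^sup>+x. ennreal (gauss 1 x) * indicator A (h x) \<partial>lborel)"
    proof (rule nn_integral_lborel_orthogonal[OF g])
      have "(\<lambda>x. indicator A (h x) :: ennreal) \<in> borel_measurable borel"
        using measurable_compose[OF hm borel_measurable_indicator[OF A']] .
      then show "(\<lambda>x. ennreal (gauss 1 x) * indicator A (h x)) \<in> borel_measurable borel" by measurable
    qed
    also have "\<dots> = emeasure M A" by (rule em[OF A', symmetric])
    finally show ?thesis .
  qed
  moreover have "prob_space M" unfolding M_def by (rule N.prob_space_distr[OF hN])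
  ultimately show ?thesis
    unfolding invariant_grassmannian_prob_def by (intro exI[of _ M]) (auto simp: M_def)
qed

lemma grassmannian_measure_invariant:
  "invariant_grassmannian_prob (DIM('a::euclidean_space) - 1) (grassmannian_measure (DIM('a) - 1) :: 'a set measure)"
  unfolding grassmannian_measure_def by (rule someI_ex[OF ex_invariant_grassmannian_prob])

section \<open>The final comparison\<close>

lemma ennreal_powr_mono:
  assumes "x \<le> y" "0 \<le> a"
  shows "ennreal_powr x a \<le> ennreal_powr y a"
proof (cases "y = \<infinity>")
  case False
  then have "x \<noteq> \<infinity>" using assms(1) by (auto simp: top_unique)
  then show ?thesis using False assms
    by (auto simp: ennreal_powr_def enn2real_mono less_top intro!: ennreal_leI powr_mono2)
qed (simp add: ennreal_powr_def)

lemma ennreal_powr_ennreal: "0 \<le> x \<Longrightarrow> ennreal_powr (ennreal x) a = ennreal (x powr a)"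
  by (simp add: ennreal_powr_def)

lemma ennreal_powr_measurable [measurable]: "(\<lambda>x. ennreal_powr x a) \<in> borel_measurable borel"
  unfolding ennreal_powr_def by measurable

lemma Lp_norm_le_const:
  assumes N: "prob_space N" and p: "0 < p" and f: "\<And>x. x \<in> space N \<Longrightarrow> f x \<le> ennreal b" and b: "0 \<le> b"
  shows "Lp_norm p N f \<le> ennreal b"
proof (cases "p = \<infinity>")
  case True
  then show ?thesis unfolding Lp_norm_def using f by (auto intro!: Inf_lower AE_I2)
next
  case False
  interpret prob_space N by (rule N)
  define q where "q = enn2real p"
  have q: "0 < q" using p False unfolding q_def by (simp add: enn2real_positive_iff less_top)
  have "(\<integral>\<^sup>+x. ennreal_powr (f x) q \<partial>N) \<le> (\<integral>\<^sup>+x. ennreal (b powr q) \<partial>N)"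
    using f q b by (intro nn_integral_mono) (auto simp: ennreal_powr_ennreal[symmetric] intro!: ennreal_powr_mono)
  also have "\<dots> = ennreal (b powr q)" by (simp add: emeasure_space_1)
  finally have "ennreal_powr (\<integral>\<^sup>+x. ennreal_powr (f x) q \<partial>N) (1 / q) \<le> ennreal_powr (ennreal (b powr q)) (1 / q)"
    using q by (intro ennreal_powr_mono) auto
  also have "\<dots> = ennreal b" using q b by (simp add: ennreal_powr_ennreal powr_powr)
  finally show ?thesis using False by (simp add: Lp_norm_def q_def)
qed

text \<open>The norm dominates the mean of a measurable minorant \<open>g\<close>. For finite
  exponents Young's inequality, in place of Hoelder, says that y^q lies above its tangent line at
  \<open>b\<close>; integrating the tangent line against a probability measure gives the
  bound.\<close>

lemma Lp_norm_ge_mean: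
  assumes N: "prob_space N" and p: "1 < p" and g: "g \<in> borel_measurable N" "\<And>x. x \<in> space N \<Longrightarrow> g x \<le> f x"
    and b: "0 \<le> b" "ennreal b \<le> (\<integral>\<^sup>+x. g x \<partial>N)"
  shows "ennreal b \<le> Lp_norm p N f"
proof -
  interpret prob_space N by (rule N)
  note [measurable] = g(1)
  show ?thesis
  proof (cases "p = \<infinity>")
    case True
    have "ennreal b \<le> c" if c: "AE x in N. f x \<le> c" for c
    proof -
      have "AE x in N. g x \<le> c" using AE_space c by eventually_elim (use g(2) in \<open>blast intro: order_trans\<close>)
      then have "(\<integral>\<^sup>+x. g x \<partial>N) \<le> (\<integral>\<^sup>+x. c \<partial>N)" by (rule nn_integral_mono_AE)
      then show ?thesis using b(2) by (simp add: emeasure_space_1)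
    qed
    then show ?thesis using True by (auto simp: Lp_norm_def intro: Inf_greatest)
  next
    case False
    define q where "q = enn2real p"
    have pq: "p = ennreal q" using False unfolding q_def by (simp add: less_top)
    have q: "1 < q" using p unfolding pq by simp
    show ?thesis
    proof (cases "b = 0")
      case b0: False
      then have bp: "0 < b" using b(1) by simp
      \<comment> \<open>The slope of y^q at y = b.\<close>
      define d where "d = q * b powr (q - 1)"
      have d: "0 < d" using q bp by (simp add: d_def)
      have young: "ennreal d * y \<le> ennreal_powr y q + ennreal ((q - 1) * b powr q)" for y
      proof (cases y)
        case (real x)
        show ?thesis
        proof (cases "x = 0")
          case False
          then have x: "0 < x" using real by simp
          have "(x powr q) powr (1 / q) * (b powr q) powr (1 - 1 / q) \<le> (1 / q) * x powr q + (1 - 1 / q) * b powr q"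
            using q x bp by (intro Youngs_inequality_0) auto
          moreover have "(x powr q) powr (1 / q) = x" using x q by (simp add: powr_powr)
          moreover have "(b powr q) powr (1 - 1 / q) = b powr (q - 1)" using q by (simp add: powr_powr right_diff_distrib)
          ultimately have "q * (x * b powr (q - 1)) \<le> q * ((1 / q) * x powr q + (1 - 1 / q) * b powr q)"
            using q by (intro mult_left_mono) auto
          also have "\<dots> = x powr q + (q - 1) * b powr q" using q by (simp add: field_simps)
          finally have "d * x \<le> x powr q + (q - 1) * b powr q" by (simp add: d_def mult_ac)
          then have "ennreal (d * x) \<le> ennreal (x powr q + (q - 1) * b powr q)" by (rule ennreal_leI)
          then show ?thesis using real q d by (simp add: ennreal_powr_ennreal ennreal_mult)
        qed (use real in simp)
      qed (simp add: ennreal_powr_def)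
      let ?I = "\<integral>\<^sup>+x. ennreal_powr (g x) q \<partial>N"
      have "ennreal (d * b) \<le> (\<integral>\<^sup>+x. ennreal d * g x \<partial>N)"
        using d b by (subst nn_integral_cmult) (auto simp: ennreal_mult' intro: mult_left_mono)
      also have "\<dots> \<le> (\<integral>\<^sup>+x. ennreal_powr (g x) q + ennreal ((q - 1) * b powr q) \<partial>N)"
        by (intro nn_integral_mono young)
      also have "\<dots> = ?I + ennreal ((q - 1) * b powr q)"
        by (subst nn_integral_add) (simp_all add: emeasure_space_1)
      finally have le: "ennreal (d * b) \<le> ?I + ennreal ((q - 1) * b powr q)" .
      have db: "d * b = b powr q + (q - 1) * b powr q"
        using bp by (simp add: d_def powr_diff field_simps)
      have "ennreal (b powr q) \<le> ?I"
      proof (cases ?I)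
        case (real i)
        then have "ennreal (d * b) \<le> ennreal (i + (q - 1) * b powr q)" using le q by simp
        then have "d * b \<le> i + (q - 1) * b powr q" using real q by (subst (asm) ennreal_le_iff) auto
        then show ?thesis using real unfolding db by (simp add: ennreal_leI)
      qed simp
      also have "\<dots> \<le> (\<integral>\<^sup>+x. ennreal_powr (f x) q \<partial>N)"
        using g(2) q by (intro nn_integral_mono ennreal_powr_mono) auto
      finally have "ennreal_powr (ennreal (b powr q)) (1 / q) \<le> ennreal_powr (\<integral>\<^sup>+x. ennreal_powr (f x) q \<partial>N) (1 / q)"
        using q by (intro ennreal_powr_mono) auto
      moreover have "ennreal_powr (ennreal (b powr q)) (1 / q) = ennreal b" using q b by (simp add: ennreal_powr_ennreal powr_powr)
      ultimately show ?thesis using False by (simp add: Lp_norm_def q_def)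
    qed simp
  qed
qed

lemma ex_compact_subset_emeasure_gt:
  fixes E :: "'a::euclidean_space set"
  assumes E: "E \<in> sets borel" and m: "m < emeasure lborel E"
  shows "\<exists>K\<subseteq>E. compact K \<and> m < emeasure lborel K"
proof -
  have "emeasure lborel E = (SUP k. emeasure lborel (E \<inter> ball 0 (real k)))"
  proof -
    have "(\<Union>k. E \<inter> ball 0 (real k)) = E"
    proof (intro equalityI subsetI)
      fix x assume "x \<in> E"
      moreover obtain k where "norm x < real k" using reals_Archimedean2 by blast
      ultimately show "x \<in> (\<Union>k. E \<inter> ball 0 (real k))" by auto
    qed auto
    moreover have "(SUP k. emeasure lborel (E \<inter> ball 0 (real k))) = emeasure lborel (\<Union>k. E \<inter> ball 0 (real k))"
      using E by (intro SUP_emeasure_incseq) (auto simp: incseq_def)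
    ultimately show ?thesis by simp
  qed
  then obtain k where k: "m < emeasure lborel (E \<inter> ball 0 (real k))" using m by (auto simp: less_SUP_iff)
  \<comment> \<open>Inner regularity is applied to a finite measure, hence the restriction to a
    ball.\<close>
  define N where "N = density lborel (indicator (ball (0::'a) (real k)) :: 'a \<Rightarrow> ennreal)"
  have em: "emeasure N S = emeasure lborel (S \<inter> ball 0 (real k))" if "S \<in> sets borel" for S
  proof -
    have "emeasure N S = (\<integral>\<^sup>+x. indicator (ball 0 (real k)) x * indicator S x \<partial>lborel)"
      unfolding N_def using that by (subst emeasure_density) simp_all
    also have "\<dots> = (\<integral>\<^sup>+x. indicator (S \<inter> ball 0 (real k)) x \<partial>lborel)"
      by (intro nn_integral_cong) (auto split: split_indicator)
    finally show ?thesis using that by simp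
  qed
  have "emeasure N E = (SUP K\<in>{K. K \<subseteq> E \<and> compact K}. emeasure N K)"
  proof (rule inner_regular)
    show "emeasure N (space N) \<noteq> \<infinity>" using em[of UNIV] emeasure_lborel_ball_finite[of "0::'a" "real k"] by (simp add: N_def)
  qed (use E in \<open>simp_all add: N_def\<close>)
  then have "m < (SUP K\<in>{K. K \<subseteq> E \<and> compact K}. emeasure N K)" using k em[OF E] by simp
  then obtain K where K: "K \<subseteq> E" "compact K" "m < emeasure N K" by (auto simp: less_SUP_iff)
  have "emeasure N K \<le> emeasure lborel K"
    using K(2) em[of K] by (auto simp: compact_imp_closed intro!: emeasure_mono)
  then show ?thesis using K by (meson order_less_le_trans)
qed

text \<open>A ball of radius \<open>s < r\<close> has strictly less volume than \<open>E\<close>,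
  which leaves room for a compact subset \<open>K\<close> of larger volume, and the projection
  volumes of \<open>K\<close> are the measurable minorant for \<open>Lp_norm_ge_mean\<close>. Since
  \<open>\<beta>\<close> is continuous from the left, letting \<open>s\<close> increase to
  \<open>r\<close> loses nothing. For \<open>B\<close> all projections have measure at most
  \<open>\<beta> r\<close>, hence so does the norm.\<close>

theorem fav_hyperplane_ge_ball:
  fixes E B :: "'a::euclidean_space set" and c :: 'a and r :: real and p :: ennreal
  assumes n: "2 \<le> DIM('a)" and p: "1 < p" and E: "E \<in> sets borel"
    and r: "0 < r" and B: "B = ball c r \<or> B = cball c r"
    and eq: "hausdorff_measure DIM('a) E = hausdorff_measure DIM('a) B"
  shows "fav p (DIM('a) - 1) B \<le> fav p (DIM('a) - 1) E"
proof -
  obtain v :: 'a where "v \<in> Basis" using nonempty_Basis by blast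
  then have v: "norm v = 1" by simp
  define M :: "'a set measure" where "M = grassmannian_measure (DIM('a) - 1)"
  have M: "invariant_grassmannian_prob (DIM('a) - 1) M" unfolding M_def by (rule grassmannian_measure_invariant)
  have prob: "prob_space M" by (rule igp_prob[OF M])
  have cprob: "prob_space (completion M)" by (rule prob_space.prob_space_completion[OF prob])
  have G: "V \<in> grassmannian (DIM('a) - 1)" if "V \<in> space (completion M)" for V using that igp_space[OF M] by simp
  define \<beta> where "\<beta> s = emeasure lborel (slab v \<inter> {x. norm (perp v x) < s})" for s
  have Bc: "B \<subseteq> cball c r" "ball c r \<subseteq> B" "B \<in> sets borel" using B by auto
  have ball_le: "emeasure lborel (ball (0::'a) r) \<le> emeasure lborel E"
  proof -
    have "emeasure lborel (ball (0::'a) r) = emeasure lborel (ball c r)" using r by (simp add: emeasure_ball)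
    also have "\<dots> = hausdorff_measure DIM('a) (ball c r)" by (rule hausdorff_measure_full_bounded[symmetric]) auto
    also have "\<dots> \<le> hausdorff_measure DIM('a) B" by (rule hausdorff_measure_mono[OF Bc(2)])
    also have "\<dots> \<le> emeasure lborel E" unfolding eq[symmetric] by (rule hausdorff_measure_full_le[OF E])
    finally show ?thesis .
  qed
  have proj_B: "hausdorff_measure (DIM('a) - 1) (orth_proj V ` B) \<le> \<beta> r" if "V \<in> space (completion M)" for V
    unfolding \<beta>_def hausdorff_measure_proj_cball[OF n G[OF that] v, of c r, symmetric]
    by (intro hausdorff_measure_mono image_mono Bc(1))
  have \<beta>_fin: "\<beta> s < \<infinity>" if "0 < s" for s
  proof -
    have "slab v \<inter> {x. norm (perp v x) < s} \<subseteq> ball 0 (s + 1)"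
    proof
      fix x assume x: "x \<in> slab v \<inter> {x. norm (perp v x) < s}"
      have "norm x \<le> norm (perp v x) + norm ((x \<bullet> v) *\<^sub>R v)" using norm_triangle_ineq[of "perp v x" "(x \<bullet> v) *\<^sub>R v"] by (simp add: perp_def)
      then show "x \<in> ball 0 (s + 1)" using x v by (simp add: slab_def)
    qed
    then have "\<beta> s \<le> emeasure lborel (ball (0::'a) (s + 1))" unfolding \<beta>_def by (intro emeasure_mono) auto
    also have "\<dots> < \<infinity>" by (rule emeasure_lborel_ball_finite)
    finally show ?thesis .
  qed
  have "fav p (DIM('a) - 1) B \<le> \<beta> r"
  proof -
    have b: "\<beta> r = ennreal (enn2real (\<beta> r))" using \<beta>_fin[OF r] by simp
    have "Lp_norm p (completion M) (\<lambda>V. hausdorff_measure (DIM('a) - 1) (orth_proj V ` B)) \<le> ennreal (enn2real (\<beta> r))"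
    proof (rule Lp_norm_le_const[OF cprob])
      show "0 < p" using p by (rule order_less_trans[rotated]) simp
      show "hausdorff_measure (DIM('a) - 1) (orth_proj V ` B) \<le> ennreal (enn2real (\<beta> r))" if "V \<in> space (completion M)" for V
        using proj_B[OF that] unfolding b[symmetric] .
    qed simp
    then show ?thesis unfolding fav_def M_def[symmetric] b[symmetric] .
  qed
  also have "\<beta> r \<le> fav p (DIM('a) - 1) E"
  proof -
    have ge: "\<beta> s \<le> fav p (DIM('a) - 1) E" if s: "0 < s" "s < r" for s
    proof -
      have "emeasure lborel (ball (0::'a) s) < emeasure lborel (ball (0::'a) r)"
        using s r by (simp add: emeasure_ball ennreal_less_iff power_strict_mono)
      then have "emeasure lborel (ball (0::'a) s) < emeasure lborel E" using ball_le by (rule order_less_le_trans)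
      from ex_compact_subset_emeasure_gt[OF E this] obtain K where K: "K \<subseteq> E" "compact K" "emeasure lborel (ball (0::'a) s) < emeasure lborel K" by blast
      have b: "\<beta> s = ennreal (enn2real (\<beta> s))" using \<beta>_fin[OF s(1)] by simp
      have "ennreal (enn2real (\<beta> s)) \<le> Lp_norm p (completion M) (\<lambda>V. hausdorff_measure (DIM('a) - 1) (orth_proj V ` E))"
      proof (rule Lp_norm_ge_mean[OF cprob p])
        show "(\<lambda>V. proj_vol V K) \<in> borel_measurable (completion M)"
          by (rule measurable_completion[OF igp_proj_vol_measurable[OF n M K(2)]])
        show "proj_vol V K \<le> hausdorff_measure (DIM('a) - 1) (orth_proj V ` E)" if "V \<in> space (completion M)" for V
          unfolding hausdorff_measure_orth_proj[OF n G[OF that] compact_imp_bounded[OF K(2)] cyl_borel[OF G[OF that] K(2)], symmetric]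
          by (intro hausdorff_measure_mono image_mono K(1))
        show "ennreal (enn2real (\<beta> s)) \<le> (\<integral>\<^sup>+V. proj_vol V K \<partial>completion M)"
          unfolding nn_integral_completion b[symmetric] unfolding \<beta>_def
          by (rule mean_proj_vol_ge[OF n M K(2) s(1) less_imp_le[OF K(3)] v])
      qed simp
      then show ?thesis unfolding fav_def M_def[symmetric] b[symmetric] .
    qed
    \<comment> \<open>Radii increasing to \<open>r\<close>; the summand 2 keeps the first one
      positive.\<close>
    define s where "s k = r * (1 - inverse (real k + 2))" for k :: nat
    have s: "0 < s k" "s k < r" for k
    proof -
      have "0 < inverse (real k + 2)" "inverse (real k + 2) < 1" by (simp_all add: inverse_less_1_iff)
      then show "0 < s k" "s k < r" using r by (simp_all add: s_def)
    qed
    have mono: "s j \<le> s k" if "j \<le> k" for j k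
      using r that unfolding s_def by (intro mult_left_mono diff_left_mono le_imp_inverse_le) auto
    let ?S = "\<lambda>k. slab v \<inter> {x. norm (perp v x) < s k}"
    have Un: "(\<Union>k. ?S k) = slab v \<inter> {x. norm (perp v x) < r}"
    proof (intro equalityI subsetI)
      fix x assume x: "x \<in> slab v \<inter> {x. norm (perp v x) < r}"
      have "s \<longlonglongrightarrow> r"
      proof -
        have "(\<lambda>k. inverse (real (Suc (Suc k)))) \<longlonglongrightarrow> 0"
          using LIMSEQ_inverse_real_of_nat by (rule LIMSEQ_Suc)
        then have "(\<lambda>k. r * (1 - inverse (real (Suc (Suc k))))) \<longlonglongrightarrow> r * (1 - 0)" by (intro tendsto_intros)
        moreover have "s = (\<lambda>k. r * (1 - inverse (real (Suc (Suc k)))))" by (simp add: s_def fun_eq_iff add.commute)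
        ultimately show ?thesis by simp
      qed
      then have "\<forall>\<^sub>F k in sequentially. norm (perp v x) < s k" using x by (intro order_tendstoD) auto
      then obtain k where "norm (perp v x) < s k" by (auto dest: eventually_happens)
      then show "x \<in> (\<Union>k. ?S k)" using x by blast
    qed (use s(2) in \<open>auto intro: order_less_trans\<close>)
    have "\<beta> r = (SUP k. \<beta> (s k))"
      unfolding \<beta>_def Un[symmetric]
    proof (rule SUP_emeasure_incseq[symmetric])
      show "incseq ?S" using mono by (force simp: incseq_def)
    qed auto
    also have "\<dots> \<le> fav p (DIM('a) - 1) E" using ge s by (intro SUP_least) auto
    finally show ?thesis .
  qed
  finally show ?thesis .
qed

theorem corollary1p4:
  fixes E B :: "(real ^ 'n) set" and c :: "real ^ 'n" and r :: real and p :: ennreal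
  assumes "CARD('n) \<ge> 2"
    and "1 < p"
    and "E \<in> sets borel"
    and "r > 0" and "B = ball c r \<or> B = cball c r"
    and "hausdorff_measure CARD('n) E = hausdorff_measure CARD('n) B"
  shows "fav p (CARD('n) - 1) E \<ge> fav p (CARD('n) - 1) B"
  using fav_hyperplane_ge_ball[of p E r B c] assms by simp

end
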